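(* There is a randomized (Monte-Carlo) algorithm that, given a graph $G=(V,E)$, a tree decomposition of $G$ of width $t$, and an integer $k$, decides whether $G$ has a path partition of size at most $k$, in time $25^t|V|^{O(1)}$. The algorithm never gives false positives (it never answers YES when no such path partition exists), and when such a path partition exists it answers NO with probability at most $1/2$.
   Context: A path partition of a graph $G$ is a set of pairwise vertex-disjoint paths of $G$ (single-vertex paths allowed) such that every vertex of $G$ belongs to exactly one of the paths; its size is the number of paths. A tree decomposition of $G$ is a tree $\mathcal{T}$ with bags $X_x\subseteq V$ for each node such that every edge lies in some bag and for every vertex the nodes whose bags contain it form a connected subtree; its width is $\max_x|X_x|-1$.
   Formalization: The time bound 25^t|V|^{O(1)} is stated for tree decompositions with polynomially many nodes (at most a|V|^a, for every a, with constants depending on a), since unboundedly many repeated bags could not even be read in that time; the empty graph (width -1) is excluded. *)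

theory Defs
  imports
    "HOL-Probability.Probability"
    "HOL-Library.Log_Nat"
    "Graph_Theory.Graph_Theory"
begin

section \<open>Path partitions and tree decompositions\<close>

text \<open>
  A finite simple undirected graph is a \<^locale>\<open>pair_graph\<close>: finite, loop-free, with a symmetric
  arc relation.  A path is a list of vertices.  A path of at least two vertices can be listed in two
  directions, but the disjointness condition prevents both lists from occurring in one partition,
  so the cardinality of the set is the number of paths.
\<close>

definition path_partition :: "'a pair_pre_digraph \<Rightarrow> 'a list set \<Rightarrow> bool" where
  "path_partition G S \<longleftrightarrow>
     (\<forall>p\<in>S. vpath p (with_proj G)) \<and>
     pairwise (\<lambda>p q. set p \<inter> set q = {}) S \<and>
     (\<forall>v\<in>pverts G. \<exists>!p. p \<in> S \<and> v \<in> set p)"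

text \<open>
  The library predicate \<open>tree\<close> is not usable for symmetric graphs, since there the two arcs of an
  edge already form a directed cycle.  A cycle here has at least three vertices.  The library's
  connectedness includes non-emptiness.
\<close>

definition undirected_tree :: "'a pair_pre_digraph \<Rightarrow> bool" where
  "undirected_tree T \<longleftrightarrow>
     pair_graph T \<and> Digraph_Component.connected (with_proj T) \<and>
     \<not> (\<exists>c. vpath c (with_proj T) \<and> 3 \<le> length c \<and> (last c, hd c) \<in> parcs T)"

definition tree_decomposition ::
  "'a pair_pre_digraph \<Rightarrow> 'b pair_pre_digraph \<Rightarrow> ('b \<Rightarrow> 'a set) \<Rightarrow> bool" where
  "tree_decomposition G T X \<longleftrightarrow>
     undirected_tree T \<and>
     (\<forall>x\<in>pverts T. X x \<subseteq> pverts G) \<and>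
     (\<forall>(u, v)\<in>parcs G. \<exists>x\<in>pverts T. u \<in> X x \<and> v \<in> X x) \<and>
     (\<forall>v\<in>pverts G. Digraph_Component.connected (with_proj T \<restriction> {x \<in> pverts T. v \<in> X x}))"

definition width :: "'b pair_pre_digraph \<Rightarrow> ('b \<Rightarrow> 'a set) \<Rightarrow> int" where
  "width T X = int (Max ((\<lambda>x. card (X x)) ` pverts T)) - 1"


section \<open>Randomized random access machines with logarithmic cost\<close>

text \<open>
  A machine has a register file and a heap, both holding natural numbers.  Programs are structured
  (\<open>Cond\<close> and \<open>While\<close> test whether a register is nonzero) and mention only finitely many registers;
  the heap is accessed by indirect addressing only.  Every instruction is charged one unit plus
  the binary lengths of the operands and heap addresses it handles (logarithmic cost criterion).
  \<open>Flip\<close> draws a fair random bit.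
\<close>

datatype arith_op = Add | Sub | Mul | Div

fun arith :: "arith_op \<Rightarrow> nat \<Rightarrow> nat \<Rightarrow> nat" where
  "arith Add x y = x + y"
| "arith Sub x y = x - y"
| "arith Mul x y = x * y"
| "arith Div x y = x div y"

datatype com =
    Skip
  | Imm nat nat
  | Arith arith_op nat nat nat
  | Load nat nat
  | Store nat nat
  | Flip nat
  | Seq com com
  | Cond nat com com
  | While nat com

type_synonym store = "nat \<Rightarrow> nat"

abbreviation len :: "nat \<Rightarrow> nat" where
  "len x \<equiv> floorlog 2 x"

text \<open>
  One step of a command on registers \<open>R\<close> and heap \<open>H\<close>; the last component of the outcome is the
  cost of the step, which is positive except for the terminal command \<open>Skip\<close>.
\<close>

primrec step :: "com \<Rightarrow> store \<Rightarrow> store \<Rightarrow> (com \<times> store \<times> store \<times> nat) pmf" where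
  "step Skip R H = return_pmf (Skip, R, H, 0)"
| "step (Imm r c) R H = return_pmf (Skip, R(r := c), H, 1 + len c)"
| "step (Arith f r a b) R H =
     return_pmf (Skip, R(r := arith f (R a) (R b)), H, 1 + len (R a) + len (R b))"
| "step (Load r a) R H =
     return_pmf (Skip, R(r := H (R a)), H, 1 + len (R a) + len (H (R a)))"
| "step (Store a r) R H =
     return_pmf (Skip, R, H(R a := R r), 1 + len (R a) + len (R r))"
| "step (Flip r) R H =
     map_pmf (\<lambda>b. (Skip, R(r := of_bool b), H, 1)) (bernoulli_pmf (1/2))"
| "step (Seq c d) R H =
     (if c = Skip then return_pmf (d, R, H, 1)
      else map_pmf (\<lambda>(c', R', H', \<tau>). (Seq c' d, R', H', \<tau>)) (step c R H))"
| "step (Cond r c d) R H = return_pmf (if R r \<noteq> 0 then c else d, R, H, 1 + len (R r))"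
| "step (While r c) R H =
     return_pmf (if R r \<noteq> 0 then Seq c (While r c) else Skip, R, H, 1 + len (R r))"

text \<open>
  \<open>run P xs n\<close> is the distribution, after \<open>n\<close> steps, of the remaining command, the registers, the
  heap and the accumulated cost, when \<open>P\<close> is started with all registers \<open>0\<close> and the input \<open>xs\<close>
  stored in the heap from address \<open>0\<close> on, followed by zeros.
\<close>

primrec run :: "com \<Rightarrow> nat list \<Rightarrow> nat \<Rightarrow> (com \<times> store \<times> store \<times> nat) pmf" where
  "run P xs 0 = return_pmf (P, \<lambda>_. 0, \<lambda>i. if i < length xs then xs ! i else 0, 0)"
| "run P xs (Suc n) =
     bind_pmf (run P xs n) (\<lambda>(c, R, H, \<tau>).
       map_pmf (\<lambda>(c', R', H', \<tau>'). (c', R', H', \<tau> + \<tau>')) (step c R H))"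

text \<open>
  Worst-case running time over all outcomes of the random bits.  As every step of a non-terminated
  command costs at least \<open>1\<close>, a computation of cost at most \<open>B\<close> has terminated after \<open>B\<close> steps.
\<close>

definition runs_in_time :: "com \<Rightarrow> nat list \<Rightarrow> nat \<Rightarrow> bool" where
  "runs_in_time P xs B \<longleftrightarrow> (\<forall>(c, R, H, \<tau>)\<in>set_pmf (run P xs B). c = Skip \<and> \<tau> \<le> B)"

text \<open>
  The answer is read off register \<open>0\<close>; \<open>True\<close> means YES.  Meaningful if \<open>runs_in_time P xs B\<close>, and
  then independent of the choice of \<open>B\<close>.
\<close>

definition answer :: "com \<Rightarrow> nat list \<Rightarrow> nat \<Rightarrow> bool pmf" where
  "answer P xs B = map_pmf (\<lambda>(c, R, H, \<tau>). R 0 \<noteq> 0) (run P xs B)"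


section \<open>Input encoding\<close>

text \<open>
  The integer is unrelated in size to the graph, so it is not stored in a single cell but in binary:
  a sign cell, then the bits of the absolute value, least significant first, one bit \<open>b\<close> per cell
  as \<open>1 + b\<close>.  Being placed last in the input, it is terminated by a \<open>0\<close> cell.
\<close>

definition encode_int :: "int \<Rightarrow> nat list" where
  "encode_int k =
     of_bool (k < 0) # map (\<lambda>i. 1 + of_bool (bit (nat \<bar>k\<bar>) i)) [0..<len (nat \<bar>k\<bar>)]"

definition bit_matrix :: "nat \<Rightarrow> nat \<Rightarrow> (nat \<Rightarrow> nat \<Rightarrow> bool) \<Rightarrow> nat list" where
  "bit_matrix m n A = concat (map (\<lambda>i. map (\<lambda>j. of_bool (A i j)) [0..<n]) [0..<m])"

text \<open>For graphs with vertex set \<open>{..<n}\<close> and decomposition trees with node set \<open>{..<m}\<close>.\<close>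

definition encode_instance ::
  "nat pair_pre_digraph \<Rightarrow> nat pair_pre_digraph \<Rightarrow> (nat \<Rightarrow> nat set) \<Rightarrow> int \<Rightarrow> nat list" where
  "encode_instance G T X k =
     (let n = card (pverts G); m = card (pverts T) in
        [n, m] @
        bit_matrix n n (\<lambda>u v. (u, v) \<in> parcs G) @
        bit_matrix m m (\<lambda>x y. (x, y) \<in> parcs T) @
        bit_matrix m n (\<lambda>x v. v \<in> X x) @
        encode_int k)"

end

theory Submission
  imports Defs "HOL-Library.Z2" "HOL-Computational_Algebra.Polynomial"
begin

text \<open>
  Cut and count without marker vertices.  The number of cuts of the \<open>n\<close> vertices that separate no edge of
  \<open>F\<close> is a power of two, at least \<open>2 ^ (n - |F|)\<close>, with equality exactly if \<open>F\<close> is acyclic.  Hence, in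
  the sum of the products of edge variables over all pairs of such a cut and an edge set of maximum
  degree two with \<open>n - k\<close> edges, every coefficient is divisible by \<open>2 ^ k\<close>, and dividing by \<open>2 ^ k\<close> leaves modulo two
  the sum over the linear forests with \<open>k\<close> components, that is, over the path partitions of size \<open>k\<close>.
  By the Schwartz-Zippel argument, substituting random polynomials of degree less than \<open>n\<close> over GF(2)
  leaves a nonzero sum of this kind nonzero with probability at least one half.

  The machine substitutes for these polynomials their values at a power of two that is so large that
  the coefficients of the total are its digits.  The total is computed along the tree decomposition.
  A vertex of a bag has six states (side of the cut and degree), and joining two tables combines
  states with equal sides and degrees \<open>d\<close>, \<open>d'\<close>: \<open>18\<close> combinations per vertex, and \<open>18 \<le> 25\<close>.
\<close>

section \<open>Terminating randomized computations\<close>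

text \<open>The division by \<open>2 ^ k\<close> forbids computing modulo two: the numbers of cuts
  must be known exactly before the factor is removed, so the tables hold natural numbers and only
  the final digits are reduced. All coefficients are nonnegative, hence bounding their sum excludes
  carries between digits, and one integer can stand for a whole polynomial; under logarithmic cost,
  integers of polynomially many bits are affordable. Each edge variable carries the extra factor
  \<open>(2 ^ D) ^ (n ^ 3)\<close>, so that the number of edges of a set shows in the position of
  its digits. Testing only sets of \<open>n - k\<close> edges loses nothing for partitions into at
  most \<open>k\<close> paths: deleting edges of a linear forest splits paths, so a smaller
  partition refines to one with exactly \<open>k\<close> paths as long as \<open>k < n\<close>. The
  coin flips are drawn before the dynamic program starts, which leaves a deterministic program to be
  verified. A bag has up to \<open>t + 1\<close> vertices, which costs a constant factor 18, and
  since loops over table entries are never nested, the time is linear in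
  \<open>18 ^ (t + 1)\<close>.\<close>

type_synonym config = "com \<times> store \<times> store \<times> nat"

definition config_step :: "config \<Rightarrow> config pmf" where
  "config_step x = (case x of (c, R, H, \<tau>) \<Rightarrow>
     map_pmf (\<lambda>(c', R', H', \<tau>'). (c', R', H', \<tau> + \<tau>')) (step c R H))"

primrec config_steps :: "nat \<Rightarrow> config \<Rightarrow> config pmf" where
  "config_steps 0 x = return_pmf x"
| "config_steps (Suc n) x = bind_pmf (config_step x) (config_steps n)"

text \<open>\<open>run\<close> attaches the next step at the end of a computation, while
  \<open>config_steps\<close> and \<open>halts\<close> unfold it from the first step. Both
  iterations agree by associativity of \<open>bind_pmf\<close>, which makes induction over
  \<open>halts\<close> applicable to \<open>run\<close>.\<close>

lemma config_steps_Suc_right: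
  "bind_pmf (config_steps n x) config_step = config_steps (Suc n) x"
proof (induction n arbitrary: x)
  case 0
  have "config_steps 0 = return_pmf" by (rule ext) simp
  then show ?case by (simp add: bind_return_pmf bind_return_pmf')
next
  case (Suc n)
  have "bind_pmf (config_steps (Suc n) x) config_step
      = bind_pmf (config_step x) (\<lambda>y. bind_pmf (config_steps n y) config_step)"
    by (simp add: bind_assoc_pmf)
  also have "\<dots> = bind_pmf (config_step x) (config_steps (Suc n))"
    by (intro bind_pmf_cong refl Suc.IH)
  finally show ?case by simp
qed

lemma run_conv_config_steps:
  "run P xs n = config_steps n (P, \<lambda>_. 0, \<lambda>i. if i < length xs then xs ! i else 0, 0)"
proof (induction n)
  case (Suc n)
  have "run P xs (Suc n) = bind_pmf (run P xs n) config_step"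
    by (simp add: config_step_def[abs_def])
  then show ?case by (simp only: Suc.IH config_steps_Suc_right)
qed simp

text \<open>
  \<open>halts c R H B \<mu>\<close>: every computation of \<open>c\<close> from registers \<open>R\<close> and heap \<open>H\<close> terminates with cost
  at most \<open>B\<close>, and \<open>\<mu>\<close> is the distribution of the final registers and heap.
\<close>

inductive halts :: "com \<Rightarrow> store \<Rightarrow> store \<Rightarrow> nat \<Rightarrow> (store \<times> store) pmf \<Rightarrow> bool" where
  halts_Skip: "halts Skip R H B (return_pmf (R, H))"
| halts_step: "c \<noteq> Skip \<Longrightarrow>
    (\<And>c' R' H' \<tau>. (c', R', H', \<tau>) \<in> set_pmf (step c R H) \<Longrightarrow>
       \<tau> \<le> B \<and> halts c' R' H' (B - \<tau>) (f (c', R', H', \<tau>))) \<Longrightarrow>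
    \<mu> = bind_pmf (step c R H) f \<Longrightarrow> halts c R H B \<mu>"

lemma halts_mono: "halts c R H B \<mu> \<Longrightarrow> B \<le> B' \<Longrightarrow> halts c R H B' \<mu>"
proof (induction arbitrary: B' rule: halts.induct)
  case (halts_step c R H B f \<mu>)
  show ?case
  proof (rule halts.halts_step[OF halts_step.hyps(1) _ halts_step.hyps(2)])
    fix c' R' H' \<tau> assume "(c', R', H', \<tau>) \<in> set_pmf (step c R H)"
    with halts_step.IH[of c' R' H' \<tau>] halts_step.prems
    show "\<tau> \<le> B' \<and> halts c' R' H' (B' - \<tau>) (f (c', R', H', \<tau>))"
      by (auto intro: diff_le_mono)
  qed
qed (rule halts.halts_Skip)

lemma step_cost_pos:
  "(c', R', H', \<tau>) \<in> set_pmf (step c R H) \<Longrightarrow> c \<noteq> Skip \<Longrightarrow> 1 \<le> \<tau>"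
  by (induction c arbitrary: c' R' H' \<tau>) (auto split: if_splits)

lemma config_steps_Skip:
  "config_steps n (Skip, R, H, \<tau>) = return_pmf (Skip, R, H, \<tau>)"
  by (induction n) (simp_all add: config_step_def bind_return_pmf)

text \<open>Every step before \<open>Skip\<close> costs at least one unit, so a cost bound is also a
  bound on the number of steps, and surplus steps only idle in \<open>Skip\<close>. The accumulated
  cost \<open>\<tau>\<close> is arbitrary because the induction hypothesis is applied in the middle
  of a run.\<close>

lemma halts_config_steps:
  assumes "halts c R H B \<mu>" "B \<le> n"
  shows "map_pmf (\<lambda>(c, R, H, \<tau>). (R, H)) (config_steps n (c, R, H, \<tau>)) = \<mu> \<and>
    (\<forall>(c', R', H', \<tau>')\<in>set_pmf (config_steps n (c, R, H, \<tau>)). c' = Skip \<and> \<tau>' \<le> \<tau> + B)"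
  using assms
proof (induction arbitrary: n \<tau> rule: halts.induct)
  case (halts_Skip R H B)
  show ?case by (simp add: config_steps_Skip)
next
  case (halts_step c R H B f \<mu>)
  \<comment> \<open>Some outcome of the step exists, and it costs at least one unit within the bound
    \<open>B\<close>; hence \<open>B\<close>, and with it \<open>n\<close>, is positive.\<close>
  obtain c0 R0 H0 \<tau>0 where "(c0, R0, H0, \<tau>0) \<in> set_pmf (step c R H)"
    using set_pmf_not_empty[of "step c R H"] by fastforce
  with halts_step.IH step_cost_pos[OF _ halts_step.hyps(1)] halts_step.prems
  obtain n' where n: "n = Suc n'" by (cases n) fastforce+
  have *: "map_pmf (\<lambda>(c, R, H, \<tau>). (R, H)) (config_steps n' (c', R', H', \<tau> + \<tau>')) = f (c', R', H', \<tau>') \<and>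
      (\<forall>(c'', R'', H'', \<tau>'')\<in>set_pmf (config_steps n' (c', R', H', \<tau> + \<tau>')). c'' = Skip \<and> \<tau>'' \<le> \<tau> + B)"
    if m: "(c', R', H', \<tau>') \<in> set_pmf (step c R H)" for c' R' H' \<tau>'
  proof -
    have "\<tau>' \<le> B" and "B - \<tau>' \<le> n'"
      using halts_step.IH[OF m] step_cost_pos[OF m halts_step.hyps(1)] halts_step.prems n by auto
    then show ?thesis
      using halts_step.IH[OF m] by (fastforce simp: add.assoc)
  qed
  have "map_pmf (\<lambda>(c, R, H, \<tau>). (R, H)) (config_steps n (c, R, H, \<tau>))
      = bind_pmf (step c R H) (\<lambda>(c', R', H', \<tau>').
          map_pmf (\<lambda>(c, R, H, \<tau>). (R, H)) (config_steps n' (c', R', H', \<tau> + \<tau>')))"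
    by (simp add: n config_step_def map_bind_pmf bind_map_pmf case_prod_unfold)
  also have "\<dots> = bind_pmf (step c R H) f"
    using * by (intro bind_pmf_cong refl) auto
  finally have "map_pmf (\<lambda>(c, R, H, \<tau>). (R, H)) (config_steps n (c, R, H, \<tau>)) = \<mu>"
    using halts_step.hyps by simp
  moreover have "\<forall>(c', R', H', \<tau>')\<in>set_pmf (config_steps n (c, R, H, \<tau>)). c' = Skip \<and> \<tau>' \<le> \<tau> + B"
    using * by (fastforce simp: n config_step_def)
  ultimately show ?case by blast
qed

lemma halts_runs_in_time:
  assumes "halts P (\<lambda>_. 0) (\<lambda>i. if i < length xs then xs ! i else 0) B \<mu>"
  shows "runs_in_time P xs B" and "answer P xs B = map_pmf (\<lambda>(R, H). R 0 \<noteq> 0) \<mu>"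
proof -
  note * = halts_config_steps[OF assms order_refl, of 0, folded run_conv_config_steps]
  then show "runs_in_time P xs B" by (auto simp: runs_in_time_def)
  have "answer P xs B = map_pmf (\<lambda>(R, H). R 0 \<noteq> 0) (map_pmf (\<lambda>(c, R, H, \<tau>). (R, H)) (run P xs B))"
    by (simp add: answer_def pmf.map_comp o_def case_prod_unfold)
  then show "answer P xs B = map_pmf (\<lambda>(R, H). R 0 \<noteq> 0) \<mu>" using * by simp
qed

text \<open>The additional unit pays for the step in which \<open>Seq Skip d\<close> becomes
  \<open>d\<close>. The second command is considered only on the support of the first distribution,
  so everything known about the final states of the first command can be used.\<close>

lemma halts_Seq:
  assumes "halts c R H B \<mu>"
    and "\<And>R' H'. (R', H') \<in> set_pmf \<mu> \<Longrightarrow> halts d R' H' B' (g (R', H'))"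
  shows "halts (Seq c d) R H (B + 1 + B') (bind_pmf \<mu> g)"
  using assms
proof (induction rule: halts.induct)
  case (halts_Skip R H B)
  show ?case
    by (rule halts_step[where f = "\<lambda>_. g (R, H)"])
       (use halts_Skip in \<open>auto simp: bind_return_pmf intro: halts_mono\<close>)
next
  case (halts_step c R H B f \<mu>)
  \<comment> \<open>An outcome of \<open>Seq c d\<close> is an outcome of \<open>c\<close> with
    \<open>d\<close> appended; \<open>F\<close> strips the appended command again to find the
    distribution that \<open>f\<close> assigns. The default \<open>Skip\<close> is never
    reached.\<close>
  define F where "F = (\<lambda>(c', R', H', \<tau>). bind_pmf (f (case c' of Seq c d \<Rightarrow> c | _ \<Rightarrow> Skip, R', H', \<tau>)) g)"
  show ?case
  proof (rule halts.halts_step[where f = F])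
    show "bind_pmf \<mu> g = bind_pmf (step (Seq c d) R H) F"
      using halts_step.hyps
      by (simp add: bind_assoc_pmf bind_map_pmf F_def case_prod_unfold)
    fix c' R' H' \<tau> assume "(c', R', H', \<tau>) \<in> set_pmf (step (Seq c d) R H)"
    then obtain c'' where c: "c' = Seq c'' d" and m: "(c'', R', H', \<tau>) \<in> set_pmf (step c R H)"
      using halts_step.hyps(1) by auto
    have "(R2, H2) \<in> set_pmf \<mu>" if "(R2, H2) \<in> set_pmf (f (c'', R', H', \<tau>))" for R2 H2
      using that m halts_step.hyps(2) by auto
    then have "\<tau> \<le> B \<and> halts (Seq c'' d) R' H' (B - \<tau> + 1 + B') (bind_pmf (f (c'', R', H', \<tau>)) g)"
      using halts_step.IH[OF m] halts_step.prems by blast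
    moreover from this have "B - \<tau> + 1 + B' = B + 1 + B' - \<tau>" by linarith
    ultimately show "\<tau> \<le> B + 1 + B' \<and> halts c' R' H' (B + 1 + B' - \<tau>) (F (c', R', H', \<tau>))"
      by (simp only: c F_def) simp
  qed simp
qed

lemma halts_return_step:
  assumes "step c R H = return_pmf (c', R', H', \<tau>)" "c \<noteq> Skip" "\<tau> + B \<le> B'" "halts c' R' H' B \<mu>"
  shows "halts c R H B' \<mu>"
proof (rule halts_step[where f = "\<lambda>_. \<mu>"])
  show "\<mu> = bind_pmf (step c R H) (\<lambda>_. \<mu>)" by (simp add: assms bind_return_pmf)
qed (use assms in \<open>auto intro: halts_mono\<close>)

lemma halts_Imm: "1 + len k \<le> B \<Longrightarrow> halts (Imm r k) R H B (return_pmf (R(r := k), H))"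
  by (rule halts_return_step[where B = 0, OF _ _ _ halts_Skip]) auto

lemma halts_Arith:
  "1 + len (R a) + len (R b) \<le> B \<Longrightarrow>
    halts (Arith f r a b) R H B (return_pmf (R(r := arith f (R a) (R b)), H))"
  by (rule halts_return_step[where B = 0, OF _ _ _ halts_Skip]) auto

lemma halts_Load:
  "1 + len (R a) + len (H (R a)) \<le> B \<Longrightarrow>
    halts (Load r a) R H B (return_pmf (R(r := H (R a)), H))"
  by (rule halts_return_step[where B = 0, OF _ _ _ halts_Skip]) auto

lemma halts_Store:
  "1 + len (R a) + len (R r) \<le> B \<Longrightarrow>
    halts (Store a r) R H B (return_pmf (R, H(R a := R r)))"
  by (rule halts_return_step[where B = 0, OF _ _ _ halts_Skip]) auto

text \<open>\<open>compile\<close> never emits \<open>Flip\<close>, so the final distributions of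
  compiled code are point masses, and sequencing reduces to passing on a single state.\<close>

lemma halts_Seq_return:
  assumes "halts c R H B (return_pmf (R', H'))" "halts d R' H' B' \<mu>" "B + 1 + B' \<le> B''"
  shows "halts (Seq c d) R H B'' \<mu>"
  using halts_Seq[OF assms(1), of d B' "\<lambda>_. \<mu>"] assms(2,3)
  by (auto simp: bind_return_pmf intro: halts_mono)

lemma halts_Cond:
  assumes "halts (if R r \<noteq> 0 then c else d) R H B \<mu>" "1 + len (R r) + B \<le> B'"
  shows "halts (Cond r c d) R H B' \<mu>"
  by (rule halts_return_step[OF _ _ assms(2,1)]) auto

lemma halts_While_False:
  assumes "R r = 0" "1 \<le> B"
  shows "halts (While r c) R H B (return_pmf (R, H))"
  by (rule halts_return_step[where B = 0, OF _ _ _ halts_Skip]) (use assms in \<open>auto simp: floorlog_def\<close>)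

lemma halts_While_True:
  assumes "R r \<noteq> 0" "halts (Seq c (While r c)) R H B \<mu>" "1 + len (R r) + B \<le> B'"
  shows "halts (While r c) R H B' \<mu>"
  by (rule halts_return_step[OF _ _ assms(3,2)]) (use assms(1) in auto)


section \<open>A bounded-loop language and its compilation\<close>

datatype exp = Cn nat | Rg nat | Bop arith_op exp exp | Hp exp

primrec eval_exp :: "exp \<Rightarrow> store \<Rightarrow> store \<Rightarrow> nat" where
  "eval_exp (Cn k) R H = k"
| "eval_exp (Rg r) R H = R r"
| "eval_exp (Bop f a b) R H = arith f (eval_exp a R H) (eval_exp b R H)"
| "eval_exp (Hp a) R H = H (eval_exp a R H)"

text \<open>
  Loops evaluate their bound once.  The flag of a loop selects which of two caps its bound has to
  respect: \<open>False\<close> marks the loops over polynomial ranges, \<open>True\<close> the loop over table entries.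
\<close>

datatype prog =
    Nop
  | Asg nat exp
  | Wr exp exp
  | Sq prog prog  (infixr \<open>;;\<close> 60)
  | Ifs exp prog prog
  | For bool nat exp prog

primrec exp_wf :: "nat \<Rightarrow> exp \<Rightarrow> bool" where
  "exp_wf K (Cn k) = True"
| "exp_wf K (Rg r) = (r < K)"
| "exp_wf K (Bop f a b) = (exp_wf K a \<and> exp_wf K b)"
| "exp_wf K (Hp a) = exp_wf K a"

primrec prog_wf :: "nat \<Rightarrow> prog \<Rightarrow> bool" where
  "prog_wf K Nop = True"
| "prog_wf K (Asg r e) = (r < K \<and> exp_wf K e)"
| "prog_wf K (Wr a e) = (exp_wf K a \<and> exp_wf K e)"
| "prog_wf K (c ;; d) = (prog_wf K c \<and> prog_wf K d)"
| "prog_wf K (Ifs e c d) = (exp_wf K e \<and> prog_wf K c \<and> prog_wf K d)"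
| "prog_wf K (For p r e c) = (r < K \<and> exp_wf K e \<and> prog_wf K c)"

text \<open>An upper bound for the bit length of the value, in units of the cell length
  \<open>l\<close>. Lengths add under all four operations, even under addition, because each operand
  is allowed at least one bit.\<close>

primrec exp_size :: "exp \<Rightarrow> nat" where
  "exp_size (Cn k) = k + 1"
| "exp_size (Rg r) = 1"
| "exp_size (Bop f a b) = exp_size a + exp_size b"
| "exp_size (Hp a) = exp_size a"

primrec exp_time :: "exp \<Rightarrow> nat" where
  "exp_time (Cn k) = k + 2"
| "exp_time (Rg r) = 4"
| "exp_time (Bop f a b) = exp_time a + exp_time b + exp_size a + exp_size b + 3"
| "exp_time (Hp a) = exp_time a + exp_size a + 3"

primrec compile_exp :: "exp \<Rightarrow> nat \<Rightarrow> com" where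
  "compile_exp (Cn k) d = Imm d k"
| "compile_exp (Rg r) d = Seq (Imm d 0) (Arith Add d r d)"
| "compile_exp (Bop f a b) d =
     Seq (compile_exp a d) (Seq (compile_exp b (d + 1)) (Arith f d d (d + 1)))"
| "compile_exp (Hp a) d = Seq (compile_exp a d) (Load d d)"

text \<open>Registers from \<open>d\<close> on are free; a loop keeps its remaining count in \<open>d\<close> and its index in \<open>d + 1\<close>.\<close>

primrec compile :: "prog \<Rightarrow> nat \<Rightarrow> com" where
  "compile Nop d = Skip"
| "compile (Asg r e) d = Seq (compile_exp e d) (Seq (Imm r 0) (Arith Add r d r))"
| "compile (Wr a e) d = Seq (compile_exp a d) (Seq (compile_exp e (d + 1)) (Store d (d + 1)))"
| "compile (b ;; c) d = Seq (compile b d) (compile c d)"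
| "compile (Ifs e b c) d = Seq (compile_exp e d) (Cond d (compile b d) (compile c d))"
| "compile (For p r e c) d =
     Seq (compile_exp e d) (Seq (Imm (d + 1) 0) (While d
       (Seq (Imm r 0) (Seq (Arith Add r (d + 1) r) (Seq (compile c (d + 2))
       (Seq (Imm (d + 2) 1) (Seq (Arith Sub d d (d + 2)) (Arith Add (d + 1) (d + 1) (d + 2)))))))))"

primrec prog_time :: "nat \<Rightarrow> nat \<Rightarrow> prog \<Rightarrow> nat" where
  "prog_time W E Nop = 0"
| "prog_time W E (Asg r e) = exp_time e + exp_size e + 4"
| "prog_time W E (Wr a e) = exp_time a + exp_time e + exp_size a + exp_size e + 3"
| "prog_time W E (b ;; c) = prog_time W E b + prog_time W E c + 1"
| "prog_time W E (Ifs e b c) = exp_time e + exp_size e + prog_time W E b + prog_time W E c + 2"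
| "prog_time W E (For p r e c) =
     exp_time e + 4 + (if p then E else W) * (prog_time W E c + 24)"

text \<open>
  The big-step semantics demands that all stored values be below \<open>2 ^ l\<close> and all loop bounds within
  their caps; this is what makes \<open>prog_time\<close> a bound for the running time.
\<close>

inductive exec :: "nat \<Rightarrow> nat \<Rightarrow> nat \<Rightarrow> prog \<Rightarrow> store \<Rightarrow> store \<Rightarrow> store \<Rightarrow> store \<Rightarrow> bool"
  for l W E where
  exec_Nop: "exec l W E Nop R H R H"
| exec_Asg: "eval_exp e R H < 2 ^ l \<Longrightarrow> exec l W E (Asg r e) R H (R(r := eval_exp e R H)) H"
| exec_Wr: "eval_exp e R H < 2 ^ l \<Longrightarrow>
    exec l W E (Wr a e) R H R (H(eval_exp a R H := eval_exp e R H))"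
| exec_Sq: "exec l W E b R H R' H' \<Longrightarrow> exec l W E c R' H' R'' H'' \<Longrightarrow>
    exec l W E (b ;; c) R H R'' H''"
| exec_Ifs: "exec l W E (if eval_exp e R H \<noteq> 0 then b else c) R H R' H' \<Longrightarrow>
    exec l W E (Ifs e b c) R H R' H'"
| exec_For: "n = eval_exp e R H \<Longrightarrow> n \<le> (if p then E else W) \<Longrightarrow>
    RR 0 = R \<Longrightarrow> HH 0 = H \<Longrightarrow> RR n = R' \<Longrightarrow> HH n = H' \<Longrightarrow>
    (\<And>k. k < n \<Longrightarrow> exec l W E c ((RR k)(r := k)) (HH k) (RR (Suc k)) (HH (Suc k))) \<Longrightarrow>
    exec l W E (For p r e c) R H R' H'"

section \<open>Lengths of intermediate values and correctness of the compiled code\<close>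

lemma len_le_iff: "len x \<le> k \<longleftrightarrow> x < 2 ^ k"
  by (cases "x = 0") (simp_all add: floorlog_le_iff)

definition bounded_state :: "nat \<Rightarrow> store \<Rightarrow> store \<Rightarrow> bool" where
  "bounded_state l R H \<longleftrightarrow> (\<forall>r. R r < 2 ^ l) \<and> (\<forall>a. H a < 2 ^ l)"

text \<open>Only stored values are kept below \<open>2 ^ l\<close>; temporaries such as addresses
  may be longer, and this bound charges for them. The sum is the critical case: it stays below the
  product of the two ranges because each range has at least two elements, for which
  \<open>1 \<le> exp_size e\<close> is carried along.\<close>

lemma eval_exp_less:
  assumes "1 \<le> l" "bounded_state l R H"
  shows "1 \<le> exp_size e \<and> eval_exp e R H < 2 ^ (l * exp_size e)"
proof (induction e)
  case (Cn k)
  have "k < 2 ^ (k + 1)" by (rule less_trans[OF less_exp]) simp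
  also have "\<dots> \<le> 2 ^ (l * (k + 1))" using mult_right_mono[OF assms(1), of "k + 1"]
    by (intro power_increasing) auto
  finally show ?case by simp
next
  case (Bop f a b)
  let ?x = "eval_exp a R H" and ?y = "eval_exp b R H" and ?i = "l * exp_size a" and ?j = "l * exp_size b"
  have i: "1 \<le> ?i" and j: "1 \<le> ?j" using Bop assms(1) by auto
  have x: "?x < 2 ^ ?i" and y: "?y < 2 ^ ?j" using Bop by auto
  have sum: "?x + ?y < 2 ^ ?i * 2 ^ ?j"
  proof -
    have "(2::nat) ^ 1 \<le> 2 ^ ?i" "(2::nat) ^ 1 \<le> 2 ^ ?j" by (intro power_increasing; use i j in simp)+
    then obtain p q where pq: "(2::nat) ^ ?i = 2 + p" "(2::nat) ^ ?j = 2 + q"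
      by (metis le_Suc_ex power_one_right)
    have "?x + ?y < (2 + p) * (2 + q)" using x y unfolding pq by (simp add: algebra_simps)
    then show ?thesis by (simp only: pq)
  qed
  have le: "?x < 2 ^ ?i * 2 ^ ?j" using sum by linarith
  have "arith f ?x ?y < 2 ^ ?i * 2 ^ ?j"
  proof (cases f)
    case Mul
    then show ?thesis using x y by (simp add: mult_strict_mono)
  next
    case Div
    then show ?thesis using le by (simp add: le_less_trans[OF div_le_dividend])
  qed (use sum le in auto)
  then show ?case using Bop by (simp add: power_add distrib_left)
next
  case (Hp a)
  have "H (eval_exp a R H) < 2 ^ l" using assms(2) by (simp add: bounded_state_def)
  also have "\<dots> \<le> 2 ^ (l * exp_size a)" using Hp by (intro power_increasing) auto
  finally show ?case using Hp by simp
qed (use assms in \<open>simp add: bounded_state_def\<close>)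

lemma len_eval_exp:
  assumes "1 \<le> l" "bounded_state l R H"
  shows "len (eval_exp e R H) \<le> l * exp_size e"
  using eval_exp_less[OF assms] by (simp add: len_le_iff)

lemma len_0 [simp]: "len 0 = 0" and len_1 [simp]: "len (Suc 0) = 1"
  by (simp_all add: floorlog_def)

text \<open>There is no move instruction: the target is cleared and the source is added to
  it.\<close>

lemma halts_copy:
  assumes "r \<noteq> d" "len (R d) \<le> l"
  shows "halts (Seq (Imm r 0) (Arith Add r d r)) R H (3 + l) (return_pmf (R(r := R d), H))"
proof -
  have "halts (Arith Add r d r) (R(r := 0)) H (1 + l)
      (return_pmf ((R(r := 0))(r := arith Add ((R(r := 0)) d) ((R(r := 0)) r)), H))"
    using assms by (intro halts_Arith) simp
  then have "halts (Arith Add r d r) (R(r := 0)) H (1 + l) (return_pmf (R(r := R d), H))"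
    using assms by simp
  then show ?thesis
    by (intro halts_Seq_return[OF halts_Imm[of 0 1]]) auto
qed

text \<open>\<open>R\<close> is the register file of the source program and \<open>R0\<close> that
  of the machine; they agree only below \<open>K\<close>. The registers from \<open>d\<close> on
  hold temporaries that may exceed \<open>2 ^ l\<close>, which is why boundedness is asked of
  \<open>R\<close> and not of \<open>R0\<close>.\<close>

lemma compile_exp_correct:
  assumes l: "1 \<le> l" "bounded_state l R H"
  shows "exp_wf K e \<Longrightarrow> K \<le> d \<Longrightarrow> \<forall>r<K. R0 r = R r \<Longrightarrow>
    \<exists>R1. halts (compile_exp e d) R0 H (l * exp_time e) (return_pmf (R1, H)) \<and>
      R1 d = eval_exp e R H \<and> (\<forall>r<d. R1 r = R0 r)"
proof (induction e arbitrary: d R0)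
  case (Cn k)
  have "k < 2 ^ (k + 1)" by (rule less_trans[OF less_exp]) simp
  then have "1 + len k \<le> 1 * (k + 2)" using len_le_iff[of k "k + 1"] by simp
  also have "\<dots> \<le> l * (k + 2)" using l(1) by (intro mult_right_mono) auto
  finally have "halts (Imm d k) R0 H (l * (k + 2)) (return_pmf (R0(d := k), H))" by (rule halts_Imm)
  then show ?case
    by (intro exI[of _ "R0(d := k)"] conjI) (simp_all del: fun_upd_apply add: fun_upd_same fun_upd_other)
next
  case (Rg r)
  then have r: "r < d" "R0 r = R r" by auto
  have "len (R r) \<le> l" using l(2) by (simp add: len_le_iff bounded_state_def)
  then have "halts (compile_exp (Rg r) d) R0 H (l * exp_time (Rg r)) (return_pmf (R0(d := R r), H))"
    using halts_mono[OF halts_copy[of d r R0 l H], of "l * 4"] l(1) r by simp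
  then show ?case using r
    by (intro exI[of _ "R0(d := R r)"] conjI) (simp_all del: fun_upd_apply add: fun_upd_same fun_upd_other)
next
  case (Bop f a b)
  obtain R1 where 1: "halts (compile_exp a d) R0 H (l * exp_time a) (return_pmf (R1, H))"
    "R1 d = eval_exp a R H" "\<forall>r<d. R1 r = R0 r" using Bop.IH(1)[of d R0] Bop.prems by auto
  have "\<forall>r<K. R1 r = R r" using 1 Bop.prems by auto
  then obtain R2 where 2: "halts (compile_exp b (d + 1)) R1 H (l * exp_time b) (return_pmf (R2, H))"
    "R2 (d + 1) = eval_exp b R H" "\<forall>r<d + 1. R2 r = R1 r" using Bop.IH(2)[of "d + 1" R1] Bop.prems by auto
  have d: "R2 d = eval_exp a R H" using 1 2 by auto
  have "halts (Arith f d d (d + 1)) R2 H (1 + l * (exp_size a + exp_size b))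
     (return_pmf (R2(d := arith f (R2 d) (R2 (d + 1))), H))"
    using len_eval_exp[OF l, of a] len_eval_exp[OF l, of b] d 2(2)
    by (intro halts_Arith) (simp add: distrib_left)
  from halts_Seq_return[OF 1(1) halts_Seq_return[OF 2(1) this order_refl] order_refl]
  have "halts (compile_exp (Bop f a b) d) R0 H (l * exp_time (Bop f a b))
     (return_pmf (R2(d := arith f (R2 d) (R2 (d + 1))), H))"
    using l(1) by (auto elim!: halts_mono simp: algebra_simps)
  moreover have "(R2(d := arith f (R2 d) (R2 (d + 1)))) d = eval_exp (Bop f a b) R H"
      "\<forall>r<d. (R2(d := arith f (R2 d) (R2 (d + 1)))) r = R0 r"
    using 1 2 d by auto
  ultimately show ?case by (intro exI[of _ "R2(d := arith f (R2 d) (R2 (d + 1)))"] conjI)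
next
  case (Hp a)
  obtain R1 where 1: "halts (compile_exp a d) R0 H (l * exp_time a) (return_pmf (R1, H))"
    "R1 d = eval_exp a R H" "\<forall>r<d. R1 r = R0 r" using Hp.IH[of d R0] Hp.prems by auto
  have "len (H (R1 d)) \<le> l" using l(2) by (simp add: len_le_iff bounded_state_def)
  then have "halts (Load d d) R1 H (1 + l * exp_size a + l) (return_pmf (R1(d := H (R1 d)), H))"
    using len_eval_exp[OF l, of a] 1(2) by (intro halts_Load) simp
  from halts_Seq_return[OF 1(1) this order_refl]
  have "halts (compile_exp (Hp a) d) R0 H (l * exp_time (Hp a)) (return_pmf (R1(d := H (R1 d)), H))"
    using l(1) by (auto elim!: halts_mono simp: algebra_simps)
  moreover have "(R1(d := H (R1 d))) d = eval_exp (Hp a) R H" "\<forall>r<d. (R1(d := H (R1 d))) r = R0 r"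
    using 1 by auto
  ultimately show ?case by (intro exI[of _ "R1(d := H (R1 d))"] conjI)
qed

text \<open>Register \<open>d\<close> counts the remaining rounds down and \<open>d + 1\<close>
  counts the index up. The loop variable \<open>r\<close> is only a copy, refreshed at the beginning
  of each round, so the body may overwrite it. The constant 24 covers the bookkeeping of a round,
  which costs at most \<open>4 * l + 16\<close> apart from the body.\<close>

lemma compile_For_loop:
  fixes d :: nat
  defines "loop r c \<equiv> While d
       (Seq (Imm r 0) (Seq (Arith Add r (d + 1) r) (Seq (compile c (d + 2))
       (Seq (Imm (d + 2) 1) (Seq (Arith Sub d d (d + 2)) (Arith Add (d + 1) (d + 1) (d + 2)))))))"
  assumes K: "r < K" "K \<le> d" and n: "n < 2 ^ l" and l: "1 \<le> l"
    and body: "\<And>k R0. k < n \<Longrightarrow> \<forall>r'<K. R0 r' = ((RR k)(r := k)) r' \<Longrightarrow> bounded_state l (RR k) (HH k) \<Longrightarrow>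
      \<exists>R1. halts (compile c (d + 2)) R0 (HH k) (l * T) (return_pmf (R1, HH (Suc k))) \<and>
        (\<forall>r'<K. R1 r' = RR (Suc k) r') \<and> (\<forall>r'. K \<le> r' \<and> r' < d + 2 \<longrightarrow> R1 r' = R0 r') \<and>
        bounded_state l (RR (Suc k)) (HH (Suc k))"
    and "k \<le> n" "R0 d = n - k" "R0 (d + 1) = k" "\<forall>r'<K. R0 r' = RR k r'" "bounded_state l (RR k) (HH k)"
  shows "\<exists>R1. halts (loop r c) R0 (HH k) (l * ((n - k) * (T + 24) + 1)) (return_pmf (R1, HH n)) \<and>
      (\<forall>r'<K. R1 r' = RR n r') \<and> (\<forall>r'. K \<le> r' \<and> r' < d \<longrightarrow> R1 r' = R0 r') \<and>
      bounded_state l (RR n) (HH n)"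
  using assms(7-)
proof (induction "n - k" arbitrary: k R0)
  case 0
  then have "k = n" by simp
  moreover have "halts (loop r c) R0 (HH n) (l * ((n - k) * (T + 24) + 1)) (return_pmf (R0, HH n))"
    unfolding loop_def by (rule halts_While_False) (use 0 l in auto)
  ultimately show ?case using 0 by auto
next
  case (Suc x)
  then have k: "k < n" by simp
  have lk: "len k \<le> l" "len (n - k) \<le> l" using k n by (simp_all add: len_le_iff)
  define Ra where "Ra = R0(r := k)"
  have "\<forall>r'<K. Ra r' = ((RR k)(r := k)) r'" using Suc.prems by (auto simp: Ra_def)
  from body[OF k this Suc.prems(5)] obtain Rb where b:
    "halts (compile c (d + 2)) Ra (HH k) (l * T) (return_pmf (Rb, HH (Suc k)))"
    "\<forall>r'<K. Rb r' = RR (Suc k) r'" "\<And>r'. K \<le> r' \<Longrightarrow> r' < d + 2 \<Longrightarrow> Rb r' = Ra r'"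
    "bounded_state l (RR (Suc k)) (HH (Suc k))" by blast
  define Rc where "Rc = Rb(d + 2 := 1, d := n - Suc k, d + 1 := Suc k)"
  have bd: "Rb d = n - k" "Rb (d + 1) = k" using b(3) K Suc.prems by (simp_all add: Ra_def)
  have "\<exists>R1. halts (loop r c) Rc (HH (Suc k)) (l * ((n - Suc k) * (T + 24) + 1)) (return_pmf (R1, HH n)) \<and>
      (\<forall>r'<K. R1 r' = RR n r') \<and> (\<forall>r'. K \<le> r' \<and> r' < d \<longrightarrow> R1 r' = Rc r') \<and>
      bounded_state l (RR n) (HH n)"
    by (rule Suc.hyps(1)) (use Suc k K b in \<open>auto simp: Rc_def\<close>)
  then obtain R1 where R1: "halts (loop r c) Rc (HH (Suc k)) (l * ((n - Suc k) * (T + 24) + 1)) (return_pmf (R1, HH n))"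
    "\<forall>r'<K. R1 r' = RR n r'" "\<forall>r'. K \<le> r' \<and> r' < d \<longrightarrow> R1 r' = Rc r'" "bounded_state l (RR n) (HH n)"
    by blast
  have e1: "halts (Imm (d + 2) 1) Rb (HH (Suc k)) 2 (return_pmf (Rb(d + 2 := 1), HH (Suc k)))"
    by (intro halts_Imm) simp
  have e2: "halts (Arith Sub d d (d + 2)) (Rb(d + 2 := 1)) (HH (Suc k)) (l + 2)
     (return_pmf (Rb(d + 2 := 1, d := n - Suc k), HH (Suc k)))"
    using halts_Arith[of "Rb(d + 2 := 1)" d "d + 2" "l + 2" Sub d "HH (Suc k)"] bd lk by simp
  have e3: "halts (Arith Add (d + 1) (d + 1) (d + 2)) (Rb(d + 2 := 1, d := n - Suc k)) (HH (Suc k)) (l + 2)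
     (return_pmf (Rc, HH (Suc k)))"
    using halts_Arith[of "Rb(d + 2 := 1, d := n - Suc k)" "d + 1" "d + 2" "l + 2" Add "d + 1" "HH (Suc k)"] bd lk
    by (simp add: Rc_def)
  have e0: "halts (Arith Add r (d + 1) r) (R0(r := 0)) (HH k) (1 + l) (return_pmf (Ra, HH k))"
    using halts_Arith[of "R0(r := 0)" "d + 1" r "1 + l" Add r "HH k"] lk Suc.prems K by (simp add: Ra_def)
  note tail = halts_Seq_return[OF e1 halts_Seq_return[OF e2 e3 order_refl] order_refl]
  note seq = halts_Seq_return[OF halts_Imm[of 0 1] halts_Seq_return[OF e0
      halts_Seq_return[OF b(1) tail order_refl] order_refl] order_refl]
  note whole = halts_Seq_return[OF seq R1(1) order_refl]
  have "halts (loop r c) R0 (HH k) (l * ((n - k) * (T + 24) + 1)) (return_pmf (R1, HH n))"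
    unfolding loop_def
  proof (rule halts_While_True[OF _ whole[unfolded loop_def]])
    have "1 + len (R0 d) + (1 + 1 + (1 + l + 1 + (l * T + 1 + (2 + 1 + (l + 2 + 1 + (l + 2))))) + 1 + l * ((n - Suc k) * (T + 24) + 1))
       \<le> l * T + 4 * l + 16 + l * ((n - Suc k) * (T + 24) + 1)"
      using lk Suc.prems by simp
    also have "\<dots> \<le> l * (T + 24) + l * ((n - Suc k) * (T + 24) + 1)"
      using l by (simp add: algebra_simps)
    also have "\<dots> = l * ((n - k) * (T + 24) + 1)"
    proof -
      have "n - k = Suc (n - Suc k)" using k by simp
      then show ?thesis by (simp add: distrib_left)
    qed
    finally show "1 + len (R0 d) + (1 + 1 + (1 + l + 1 + (l * T + 1 + (2 + 1 + (l + 2 + 1 + (l + 2))))) + 1 + l * ((n - Suc k) * (T + 24) + 1))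
       \<le> l * ((n - k) * (T + 24) + 1)" .
  qed (use Suc.prems k in auto)
  moreover have "R1 r' = R0 r'" if "K \<le> r'" "r' < d" for r'
    using R1(3) b(3)[of r'] that K by (auto simp: Rc_def Ra_def)
  ultimately show ?case using R1 by blast
qed

text \<open>The registers between \<open>K\<close> and \<open>d\<close> contain the counters of
  enclosing loops, hence the demand that they survive. The caps have to be below
  \<open>2 ^ l\<close> because a loop index is stored in a register of the source program.\<close>

lemma compile_correct:
  assumes l: "1 \<le> l" and caps: "W < 2 ^ l" "E < 2 ^ l"
    and "exec l W E c R H R' H'" "prog_wf K c" "K \<le> d" "\<forall>r<K. R0 r = R r" "bounded_state l R H"
  shows "\<exists>R1. halts (compile c d) R0 H (l * prog_time W E c) (return_pmf (R1, H')) \<and>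
      (\<forall>r<K. R1 r = R' r) \<and> (\<forall>r. K \<le> r \<and> r < d \<longrightarrow> R1 r = R0 r) \<and> bounded_state l R' H'"
  using assms(4-)
proof (induction arbitrary: R0 d rule: exec.induct)
  case (exec_Nop R H)
  then show ?case by (auto intro: halts.halts_Skip)
next
  case (exec_Asg e R H r)
  have b: "bounded_state l R H" using exec_Asg.prems by simp
  obtain R1 where 1: "halts (compile_exp e d) R0 H (l * exp_time e) (return_pmf (R1, H))"
    "R1 d = eval_exp e R H" "\<forall>r<d. R1 r = R0 r"
    using compile_exp_correct[OF l b, of K e d R0] exec_Asg.prems by auto
  have "halts (Seq (Imm r 0) (Arith Add r d r)) R1 H (3 + l * exp_size e) (return_pmf (R1(r := R1 d), H))"
    using exec_Asg 1 len_eval_exp[OF l b, of e] by (intro halts_copy) auto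
  from halts_Seq_return[OF 1(1) this order_refl]
  have "halts (compile (Asg r e) d) R0 H (l * prog_time W E (Asg r e)) (return_pmf (R1(r := R1 d), H))"
    using l by (auto elim!: halts_mono simp: algebra_simps)
  moreover have "\<forall>r'<K. (R1(r := R1 d)) r' = (R(r := eval_exp e R H)) r'"
      "\<forall>r'. K \<le> r' \<and> r' < d \<longrightarrow> (R1(r := R1 d)) r' = R0 r'"
    using 1 exec_Asg.prems by auto
  moreover have "bounded_state l (R(r := eval_exp e R H)) H"
    using exec_Asg.hyps exec_Asg.prems by (simp add: bounded_state_def)
  ultimately show ?case by (intro exI[of _ "R1(r := R1 d)"] conjI)
next
  case (exec_Wr e R H a)
  have b: "bounded_state l R H" using exec_Wr.prems by simp
  obtain R1 where 1: "halts (compile_exp a d) R0 H (l * exp_time a) (return_pmf (R1, H))"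
    "R1 d = eval_exp a R H" "\<forall>r<d. R1 r = R0 r"
    using compile_exp_correct[OF l b, of K a d R0] exec_Wr.prems by auto
  have "\<forall>r<K. R1 r = R r" using 1 exec_Wr by auto
  then obtain R2 where 2: "halts (compile_exp e (d + 1)) R1 H (l * exp_time e) (return_pmf (R2, H))"
    "R2 (d + 1) = eval_exp e R H" "\<forall>r<d + 1. R2 r = R1 r"
    using compile_exp_correct[OF l b, of K e "d + 1" R1] exec_Wr.prems by auto
  have d: "R2 d = eval_exp a R H" using 1 2 by auto
  have "halts (Store d (d + 1)) R2 H (1 + l * exp_size a + l * exp_size e) (return_pmf (R2, H(R2 d := R2 (d + 1))))"
    using len_eval_exp[OF l b, of e] len_eval_exp[OF l b, of a] d 2 by (intro halts_Store) simp
  from halts_Seq_return[OF 1(1) halts_Seq_return[OF 2(1) this order_refl] order_refl]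
  have "halts (compile (Wr a e) d) R0 H (l * prog_time W E (Wr a e)) (return_pmf (R2, H(R2 d := R2 (d + 1))))"
    using l by (auto elim!: halts_mono simp: algebra_simps)
  then have "halts (compile (Wr a e) d) R0 H (l * prog_time W E (Wr a e))
      (return_pmf (R2, H(eval_exp a R H := eval_exp e R H)))"
    unfolding d 2(2) .
  moreover have "\<forall>r<K. R2 r = R r" "\<forall>r. K \<le> r \<and> r < d \<longrightarrow> R2 r = R0 r"
    using 1 2 exec_Wr.prems by auto
  moreover have "bounded_state l R (H(eval_exp a R H := eval_exp e R H))"
    using exec_Wr.hyps exec_Wr.prems by (simp add: bounded_state_def)
  ultimately show ?case by (intro exI[of _ R2] conjI)
next
  case (exec_Sq b R H R' H' c R'' H'')
  obtain R1 where 1: "halts (compile b d) R0 H (l * prog_time W E b) (return_pmf (R1, H'))"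
    "\<forall>r<K. R1 r = R' r" "\<forall>r. K \<le> r \<and> r < d \<longrightarrow> R1 r = R0 r" "bounded_state l R' H'"
    using exec_Sq.IH(1)[of d R0] exec_Sq.prems by auto
  obtain R2 where 2: "halts (compile c d) R1 H' (l * prog_time W E c) (return_pmf (R2, H''))"
    "\<forall>r<K. R2 r = R'' r" "\<forall>r. K \<le> r \<and> r < d \<longrightarrow> R2 r = R1 r" "bounded_state l R'' H''"
    using exec_Sq.IH(2)[of d R1] exec_Sq.prems 1 by auto
  have "halts (compile (b ;; c) d) R0 H (l * prog_time W E (b ;; c)) (return_pmf (R2, H''))"
    using halts_Seq_return[OF 1(1) 2(1) order_refl] l
    by (auto elim!: halts_mono simp: algebra_simps)
  then show ?case using 1 2 by auto
next
  case (exec_Ifs e R H b c R' H')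
  have bd: "bounded_state l R H" using exec_Ifs.prems by simp
  obtain R1 where 1: "halts (compile_exp e d) R0 H (l * exp_time e) (return_pmf (R1, H))"
    "R1 d = eval_exp e R H" "\<forall>r<d. R1 r = R0 r"
    using compile_exp_correct[OF l bd, of K e d R0] exec_Ifs.prems by auto
  let ?c = "if eval_exp e R H \<noteq> 0 then b else c"
  have "prog_wf K ?c" using exec_Ifs.prems by simp
  then obtain R2 where 2: "halts (compile ?c d) R1 H (l * prog_time W E ?c) (return_pmf (R2, H'))"
    "\<forall>r<K. R2 r = R' r" "\<forall>r. K \<le> r \<and> r < d \<longrightarrow> R2 r = R1 r" "bounded_state l R' H'"
    using exec_Ifs.IH[of d R1] exec_Ifs.prems 1 by auto
  have "halts (Cond d (compile b d) (compile c d)) R1 H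
      (1 + l * exp_size e + l * prog_time W E ?c) (return_pmf (R2, H'))"
    by (rule halts_Cond[where B = "l * prog_time W E ?c"])
       (use 1 2 len_eval_exp[OF l bd, of e] in \<open>auto split: if_splits\<close>)
  from halts_Seq_return[OF 1(1) this order_refl]
  have "halts (compile (Ifs e b c) d) R0 H (l * prog_time W E (Ifs e b c)) (return_pmf (R2, H'))"
    using l by (auto elim!: halts_mono simp: algebra_simps)
  then show ?case using 1 2 by auto
next
  case (exec_For n e R H p RR HH R' H' c r)
  have bd: "bounded_state l R H" using exec_For.prems by simp
  obtain R1 where 1: "halts (compile_exp e d) R0 H (l * exp_time e) (return_pmf (R1, H))"
    "R1 d = eval_exp e R H" "\<forall>r<d. R1 r = R0 r"
    using compile_exp_correct[OF l bd, of K e d R0] exec_For.prems by auto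
  define Ra where "Ra = R1(d + 1 := 0)"
  have n: "n < 2 ^ l" using exec_For.hyps(2) caps by (auto split: if_splits)
  have body: "\<exists>R1. halts (compile c (d + 2)) R0 (HH k) (l * prog_time W E c) (return_pmf (R1, HH (Suc k))) \<and>
        (\<forall>r'<K. R1 r' = RR (Suc k) r') \<and> (\<forall>r'. K \<le> r' \<and> r' < d + 2 \<longrightarrow> R1 r' = R0 r') \<and>
        bounded_state l (RR (Suc k)) (HH (Suc k))"
    if "k < n" "\<forall>r'<K. R0 r' = ((RR k)(r := k)) r'" "bounded_state l (RR k) (HH k)" for k R0
  proof (rule exec_For.IH[OF that(1) _ _ that(2)])
    show "bounded_state l ((RR k)(r := k)) (HH k)"
      using that n by (simp add: bounded_state_def)
  qed (use exec_For.prems in auto)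
  let ?loop = "While d
       (Seq (Imm r 0) (Seq (Arith Add r (d + 1) r) (Seq (compile c (d + 2))
       (Seq (Imm (d + 2) 1) (Seq (Arith Sub d d (d + 2)) (Arith Add (d + 1) (d + 1) (d + 2)))))))"
  have "\<exists>R1. halts ?loop Ra (HH 0) (l * ((n - 0) * (prog_time W E c + 24) + 1)) (return_pmf (R1, HH n)) \<and>
      (\<forall>r'<K. R1 r' = RR n r') \<and> (\<forall>r'. K \<le> r' \<and> r' < d \<longrightarrow> R1 r' = Ra r') \<and>
      bounded_state l (RR n) (HH n)"
  proof (rule compile_For_loop[where RR = RR and HH = HH and T = "prog_time W E c", OF _ _ n l body])
    show "Ra d = n - 0" using 1(2) exec_For.hyps(1) by (simp add: Ra_def)
    show "\<forall>r'<K. Ra r' = RR 0 r'"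
      using 1(3) exec_For.prems exec_For.hyps(3) by (simp add: Ra_def)
    show "bounded_state l (RR 0) (HH 0)" using exec_For.prems exec_For.hyps by simp
  qed (use exec_For.prems in \<open>auto simp: Ra_def\<close>)
  then obtain R2 where 2: "halts ?loop Ra H (l * (n * (prog_time W E c + 24) + 1)) (return_pmf (R2, H'))"
    "\<forall>r'<K. R2 r' = R' r'" "\<forall>r'. K \<le> r' \<and> r' < d \<longrightarrow> R2 r' = Ra r'" "bounded_state l R' H'"
    using exec_For.hyps(3-6) by auto
  have i: "halts (Imm (d + 1) 0) R1 H 1 (return_pmf (Ra, H))"
    unfolding Ra_def by (rule halts_Imm) simp
  have "l * exp_time e + 1 + (1 + 1 + l * (n * (prog_time W E c + 24) + 1))
      \<le> l * (exp_time e + 4 + n * (prog_time W E c + 24))"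
    using l by (simp add: algebra_simps)
  also have "\<dots> \<le> l * prog_time W E (For p r e c)"
    using mult_right_mono[OF exec_For.hyps(2), of "prog_time W E c + 24"] by (auto simp del: mult_le_cancel2)
  finally have "halts (compile (For p r e c) d) R0 H (l * prog_time W E (For p r e c)) (return_pmf (R2, H'))"
    using halts_Seq_return[OF 1(1) halts_Seq_return[OF i 2(1) order_refl]] by simp
  moreover have "\<forall>r. K \<le> r \<and> r < d \<longrightarrow> R2 r = R0 r" using 1 2 by (auto simp: Ra_def)
  ultimately show ?case using 2 by blast
qed

subsection \<open>Weakest preconditions\<close>

text \<open>Existence of an execution includes termination and all side conditions of
  \<open>exec\<close>. A valid triple thus certifies not only the result but also the lengths of
  stored values and the loop caps, from which the running time follows.\<close>

definition wp :: "nat \<Rightarrow> nat \<Rightarrow> nat \<Rightarrow> prog \<Rightarrow> store \<Rightarrow> store \<Rightarrow> (store \<Rightarrow> store \<Rightarrow> bool) \<Rightarrow> bool" where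
  "wp l W E c R H Q \<longleftrightarrow> (\<exists>R' H'. exec l W E c R H R' H' \<and> Q R' H')"

inductive_simps exec_Nop_iff: "exec l W E Nop R H R' H'"
inductive_simps exec_Asg_iff: "exec l W E (Asg r e) R H R' H'"
inductive_simps exec_Wr_iff: "exec l W E (Wr a e) R H R' H'"
inductive_simps exec_Sq_iff: "exec l W E (b ;; c) R H R' H'"
inductive_simps exec_Ifs_iff: "exec l W E (Ifs e b c) R H R' H'"

lemma wp_simps [simp]:
  "wp l W E Nop R H Q = Q R H"
  "wp l W E (Asg r e) R H Q = (eval_exp e R H < 2 ^ l \<and> Q (R(r := eval_exp e R H)) H)"
  "wp l W E (Wr a e) R H Q = (eval_exp e R H < 2 ^ l \<and> Q R (H(eval_exp a R H := eval_exp e R H)))"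
  "wp l W E (b ;; c) R H Q = wp l W E b R H (\<lambda>R' H'. wp l W E c R' H' Q)"
  "wp l W E (Ifs e b c) R H Q = (if eval_exp e R H \<noteq> 0 then wp l W E b R H Q else wp l W E c R H Q)"
  unfolding wp_def exec_Nop_iff exec_Asg_iff exec_Wr_iff exec_Sq_iff exec_Ifs_iff
  by (blast, blast, blast, blast, auto)

text \<open>\<open>exec\<close> asks for the whole sequence of intermediate states; it is built by
  recursion with the choice operator from the hypothesis on one round. The invariant describes the
  state before the index is written to the loop register.\<close>

lemma wp_For:
  assumes "I 0 R H" and n: "eval_exp e R H = n" "n \<le> (if p then E else W)"
    and step: "\<And>k R H. k < n \<Longrightarrow> I k R H \<Longrightarrow> wp l W E c (R(r := k)) H (I (Suc k))"
    and post: "\<And>R H. I n R H \<Longrightarrow> Q R H"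
  shows "wp l W E (For p r e c) R H Q"
proof -
  define good where "good k x y \<longleftrightarrow> (k < n \<longrightarrow> I (Suc k) (fst y) (snd y) \<and>
      exec l W E c ((fst x)(r := k)) (snd x) (fst y) (snd y))" for k x y
  define f where "f = rec_nat (R, H) (\<lambda>k x. SOME y. good k x y)"
  have ex: "\<exists>y. good k x y" if "k < n \<Longrightarrow> I k (fst x) (snd x)" for x k
  proof (cases "k < n")
    case True
    then have "wp l W E c ((fst x)(r := k)) (snd x) (I (Suc k))" using step that by blast
    then obtain R' H' where "exec l W E c ((fst x)(r := k)) (snd x) R' H'" "I (Suc k) R' H'"
      unfolding wp_def by blast
    then have "good k x (R', H')" by (simp add: good_def)
    then show ?thesis by blast
  qed (simp add: good_def)
  have f_Suc: "f (Suc k) = (SOME y. good k (f k) y)" for k by (simp add: f_def)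
  have inv: "k \<le> n \<Longrightarrow> I k (fst (f k)) (snd (f k))" for k
  proof (induction k)
    case (Suc k)
    then have "\<exists>y. good k (f k) y" by (intro ex) simp
    then have "good k (f k) (f (Suc k))" unfolding f_Suc by (rule someI_ex)
    then show ?case using Suc.prems by (simp add: good_def)
  qed (use assms(1) in \<open>simp add: f_def\<close>)
  have f: "good k (f k) (f (Suc k))" if "k < n" for k
  proof -
    have "\<exists>y. good k (f k) y" by (intro ex inv) (use that in simp)
    then show ?thesis unfolding f_Suc by (rule someI_ex)
  qed
  have "exec l W E (For p r e c) R H (fst (f n)) (snd (f n))"
  proof (rule exec_For[where RR = "\<lambda>k. fst (f k)" and HH = "\<lambda>k. snd (f k)" and n = n])
    show "exec l W E c ((fst (f k))(r := k)) (snd (f k)) (fst (f (Suc k))) (snd (f (Suc k)))"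
      if "k < n" for k using f[OF that] that by (simp add: good_def)
  qed (use n in \<open>simp_all add: f_def\<close>)
  with inv[of n] post show ?thesis unfolding wp_def by blast
qed

text \<open>The exponent of \<open>E\<close> in the running time. \<open>E\<close> will be
  \<open>18 ^ (t + 1)\<close>, so the time claimed requires depth at most one, whereas loops capped
  by \<open>W\<close> may be nested at will.\<close>

primrec table_loop_depth :: "prog \<Rightarrow> nat" where
  "table_loop_depth Nop = 0"
| "table_loop_depth (Asg r e) = 0"
| "table_loop_depth (Wr a e) = 0"
| "table_loop_depth (b ;; c) = max (table_loop_depth b) (table_loop_depth c)"
| "table_loop_depth (Ifs e b c) = max (table_loop_depth b) (table_loop_depth c)"
| "table_loop_depth (For p r e c) = of_bool p + table_loop_depth c"

lemma monomial_mono: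
  fixes k W E :: nat
  assumes "x \<le> k * W ^ p * E ^ q" "1 \<le> W" "1 \<le> E" "k \<le> k'" "p \<le> p'" "q \<le> q'"
  shows "x \<le> k' * W ^ p' * E ^ q'"
  using assms(1) by (rule order_trans) (intro mult_mono power_increasing; use assms in simp)

text \<open>The numbers \<open>k\<close> and \<open>p\<close> are chosen before \<open>W\<close> and
  \<open>E\<close>: for a fixed program the bound is polynomial in \<open>W\<close>, uniformly over
  all instances.\<close>

lemma prog_time_le:
  "\<exists>k p. \<forall>W\<ge>1. \<forall>E\<ge>1. prog_time W E c \<le> k * W ^ p * E ^ table_loop_depth c"
proof (induction c)
  case Nop
  show ?case by auto
next
  case (Asg r e)
  show ?case by (rule exI[of _ "exp_time e + exp_size e + 4"], rule exI[of _ 0]) simp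
next
  case (Wr a e)
  show ?case by (rule exI[of _ "exp_time a + exp_time e + exp_size a + exp_size e + 3"], rule exI[of _ 0]) simp
next
  case (Sq b c)
  then obtain k p k' p' where
    1: "\<forall>W\<ge>1. \<forall>E\<ge>1. prog_time W E b \<le> k * W ^ p * E ^ table_loop_depth b" and
    2: "\<forall>W\<ge>1. \<forall>E\<ge>1. prog_time W E c \<le> k' * W ^ p' * E ^ table_loop_depth c" by blast
  show ?case
  proof (rule exI[of _ "k + k' + 1"], rule exI[of _ "max p p'"], intro allI impI)
    fix W E :: nat assume W: "1 \<le> W" and E: "1 \<le> E"
    let ?m = "W ^ max p p' * E ^ max (table_loop_depth b) (table_loop_depth c)"
    have "prog_time W E b \<le> k * ?m" "prog_time W E c \<le> k' * ?m"
      unfolding mult.assoc[symmetric]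
      by (rule monomial_mono[OF 1[rule_format, OF W E] W E] monomial_mono[OF 2[rule_format, OF W E] W E]; simp)+
    moreover have "1 \<le> ?m" using W E mult_le_mono[of 1 "W ^ max p p'" 1] by auto
    ultimately show "prog_time W E (b ;; c) \<le> (k + k' + 1) * W ^ max p p' * E ^ table_loop_depth (b ;; c)"
      by (simp only: prog_time.simps table_loop_depth.simps mult.assoc distrib_right; linarith)
  qed
next
  case (Ifs e b c)
  then obtain k p k' p' where
    1: "\<forall>W\<ge>1. \<forall>E\<ge>1. prog_time W E b \<le> k * W ^ p * E ^ table_loop_depth b" and
    2: "\<forall>W\<ge>1. \<forall>E\<ge>1. prog_time W E c \<le> k' * W ^ p' * E ^ table_loop_depth c" by blast
  define T where "T = exp_time e + exp_size e + 2"
  show ?case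
  proof (rule exI[of _ "k + k' + T"], rule exI[of _ "max p p'"], intro allI impI)
    fix W E :: nat assume W: "1 \<le> W" and E: "1 \<le> E"
    let ?m = "W ^ max p p' * E ^ max (table_loop_depth b) (table_loop_depth c)"
    have "prog_time W E b \<le> k * ?m" "prog_time W E c \<le> k' * ?m"
      unfolding mult.assoc[symmetric]
      by (rule monomial_mono[OF 1[rule_format, OF W E] W E] monomial_mono[OF 2[rule_format, OF W E] W E]; simp)+
    moreover have "T * 1 \<le> T * ?m" using W E by (intro mult_left_mono) auto
    ultimately have "prog_time W E b + prog_time W E c + T \<le> (k + k' + T) * ?m"
      by (simp only: distrib_right; linarith)
    then show "prog_time W E (Ifs e b c) \<le> (k + k' + T) * W ^ max p p' * E ^ table_loop_depth (Ifs e b c)"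
      by (simp only: T_def prog_time.simps table_loop_depth.simps mult.assoc; linarith)
  qed
next
  case (For b r e c)
  then obtain k p where
    1: "\<forall>W\<ge>1. \<forall>E\<ge>1. prog_time W E c \<le> k * W ^ p * E ^ table_loop_depth c" by blast
  define T where "T = exp_time e + 4"
  show ?case
  proof (rule exI[of _ "k + T + 24"], rule exI[of _ "Suc p"], intro allI impI)
    fix W E :: nat assume W: "1 \<le> W" and E: "1 \<le> E"
    let ?m = "W ^ p * E ^ table_loop_depth c" and ?M = "W ^ Suc p * E ^ (of_bool b + table_loop_depth c)"
    have m: "1 \<le> ?m" using W E mult_le_mono[of 1 "W ^ p" 1] by auto
    have M: "1 \<le> ?M" using W E mult_le_mono[of 1 "W ^ Suc p" 1] by auto
    have "(if b then E else W) * ?m \<le> ?M" using W E by (cases b) simp_all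
    then have "(k + 24) * ((if b then E else W) * ?m) \<le> (k + 24) * ?M" by (rule mult_le_mono2)
    then have "(if b then E else W) * ((k + 24) * ?m) \<le> (k + 24) * ?M" by (simp only: mult.left_commute)
    moreover have "prog_time W E c + 24 \<le> (k + 24) * ?m"
      using 1[rule_format, OF W E] m by (simp only: distrib_right mult.assoc; linarith)
    then have "(if b then E else W) * (prog_time W E c + 24) \<le> (if b then E else W) * ((k + 24) * ?m)"
      by (rule mult_left_mono) simp
    moreover have "T * 1 \<le> T * ?M" using M by (rule mult_left_mono) simp
    ultimately have "T + (if b then E else W) * (prog_time W E c + 24) \<le> (k + T + 24) * ?M"
      by (simp only: distrib_right; linarith)
    then show "prog_time W E (For b r e c) \<le> (k + T + 24) * W ^ Suc p * E ^ table_loop_depth (For b r e c)"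
      by (simp only: T_def prog_time.simps table_loop_depth.simps mult.assoc; linarith)
  qed
qed

subsection \<open>Filling a heap segment with random bits\<close>

text \<open>The source language is deterministic, so the coin flips are written directly as machine
  code. Register \<open>c\<close> counts the remaining bits, \<open>a\<close> points to the next
  cell, and \<open>b\<close> holds alternately the random bit and the constant one.\<close>

definition random_bits :: "nat \<Rightarrow> nat \<Rightarrow> nat \<Rightarrow> com" where
  "random_bits c a b = While c (Seq (Flip b) (Seq (Store a b) (Seq (Imm b 1)
     (Seq (Arith Sub c c b) (Arith Add a a b)))))"

definition overwrite :: "nat set \<Rightarrow> (nat \<Rightarrow> bool) \<Rightarrow> store \<Rightarrow> store" where
  "overwrite I \<beta> H = (\<lambda>i. if i \<in> I then of_bool (\<beta> i) else H i)"

definition coin_flips :: "nat set \<Rightarrow> (nat \<Rightarrow> bool) pmf" where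
  "coin_flips I = Pi_pmf I False (\<lambda>_. bernoulli_pmf (1 / 2))"

text \<open>Each round splits one independent coordinate off the product distribution. The final
  registers are stated exactly, so that they are the same for all outcomes of the bits; a loop
  without rounds leaves them untouched, whence the case \<open>n = 0\<close>.\<close>

lemma halts_random_bits:
  assumes "c \<noteq> a" "c \<noteq> b" "a \<noteq> b" and "R c = n" "R a = s" "1 \<le> l" "s + n < 2 ^ l"
  shows "halts (random_bits c a b) R H (l * (24 * n + 1))
     (map_pmf (\<lambda>\<beta>. (if n = 0 then R else R(b := 1, c := 0, a := s + n), overwrite {s..<s + n} \<beta> H))
       (coin_flips {s..<s + n}))"
  using assms(4-)
proof (induction n arbitrary: R H s)
  case 0
  have "overwrite {} \<beta> H = H" for \<beta> by (rule ext) (simp add: overwrite_def)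
  moreover have "halts (random_bits c a b) R H (l * (24 * 0 + 1)) (return_pmf (R, H))"
    unfolding random_bits_def by (intro halts_While_False) (use 0 in auto)
  ultimately show ?case by (simp add: coin_flips_def)
next
  case (Suc n)
  define R1 where "R1 = R(b := 1, c := n, a := Suc s)"
  define H1 where "H1 x = H(s := of_bool x)" for x :: bool
  define F where "F = R(b := 1, c := 0, a := s + Suc n)"
  define I where "I = {Suc s..<Suc s + n}"
  define body where "body = Seq (Flip b) (Seq (Store a b) (Seq (Imm b 1) (Seq (Arith Sub c c b) (Arith Add a a b))))"
  have loop: "random_bits c a b = While c body" by (simp add: random_bits_def body_def)
  have F: "(if n = 0 then R1 else R1(b := 1, c := 0, a := Suc s + n)) = F"
    using assms(1-3) by (auto simp: R1_def F_def fun_eq_iff)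
  have ls: "len s \<le> l" "len (Suc n) \<le> l" using Suc.prems by (simp_all add: len_le_iff)
  have ih: "halts (While c body) R1 (H1 x) (l * (24 * n + 1))
      (map_pmf (\<lambda>\<beta>. (F, overwrite I \<beta> (H1 x))) (coin_flips I))" for x
  proof -
    have "R1 c = n" "R1 a = Suc s" using assms(1-3) by (simp_all add: R1_def)
    from Suc.IH[OF this] show ?thesis
      using Suc.prems(3,4) unfolding loop F I_def by simp
  qed
  have flip: "halts (Flip b) R H 1 (map_pmf (\<lambda>x. (R(b := of_bool x), H)) (bernoulli_pmf (1 / 2)))"
  proof (rule halts_step[where f = "\<lambda>(c', R', H', \<tau>). return_pmf (R', H')"])
    show "map_pmf (\<lambda>x. (R(b := of_bool x), H)) (bernoulli_pmf (1 / 2)) =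
        bind_pmf (step (Flip b) R H) (\<lambda>(c', R', H', \<tau>). return_pmf (R', H'))"
      by (simp add: map_pmf_def bind_assoc_pmf bind_return_pmf)
  qed (auto intro: halts_Skip)
  have rest: "halts (Seq (Store a b) (Seq (Imm b 1) (Seq (Arith Sub c c b) (Arith Add a a b))))
      (R(b := of_bool x)) H (3 * l + 13) (return_pmf (R1, H1 x))" for x
  proof -
    let ?R = "R(b := of_bool x)"
    have "halts (Store a b) ?R H (l + 2) (return_pmf (?R, H(?R a := ?R b)))"
      using ls assms(1-3) Suc.prems by (intro halts_Store) simp
    then have 1: "halts (Store a b) ?R H (l + 2) (return_pmf (?R, H1 x))"
      using assms(1-3) Suc.prems by (simp add: H1_def)
    have 2: "halts (Imm b 1) ?R (H1 x) 2 (return_pmf (R(b := 1), H1 x))"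
      using halts_Imm[of 1 2 b ?R "H1 x"] by simp
    have 3: "halts (Arith Sub c c b) (R(b := 1)) (H1 x) (l + 2) (return_pmf (R(b := 1, c := n), H1 x))"
      using halts_Arith[of "R(b := 1)" c b "l + 2" Sub c "H1 x"] ls assms(1-3) Suc.prems by simp
    have 4: "halts (Arith Add a a b) (R(b := 1, c := n)) (H1 x) (l + 2) (return_pmf (R1, H1 x))"
      using halts_Arith[of "R(b := 1, c := n)" a b "l + 2" Add a "H1 x"] ls assms(1-3) Suc.prems
      by (simp add: R1_def)
    show ?thesis
      by (rule halts_mono[OF halts_Seq_return[OF 1 halts_Seq_return[OF 2 halts_Seq_return[OF 3 4 order_refl] order_refl] order_refl]])
         simp
  qed
  have body: "halts body R H (1 + 1 + (3 * l + 13)) (map_pmf (\<lambda>x. (R1, H1 x)) (bernoulli_pmf (1 / 2)))"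
  proof -
    have "halts body R H (1 + 1 + (3 * l + 13))
       (bind_pmf (map_pmf (\<lambda>x. (R(b := of_bool x), H)) (bernoulli_pmf (1 / 2)))
         (\<lambda>(R', H'). return_pmf (R1, H1 (R' b \<noteq> 0))))"
      unfolding body_def by (rule halts_Seq[OF flip]) (use rest in fastforce)
    then show ?thesis by (simp add: map_pmf_def bind_assoc_pmf bind_return_pmf)
  qed
  have "halts (Seq body (While c body)) R H (1 + 1 + (3 * l + 13) + 1 + l * (24 * n + 1))
      (bind_pmf (map_pmf (\<lambda>x. (R1, H1 x)) (bernoulli_pmf (1 / 2)))
        (\<lambda>(R', H'). map_pmf (\<lambda>\<beta>. (F, overwrite I \<beta> H')) (coin_flips I)))"
    by (rule halts_Seq[OF body]) (use ih in fastforce)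
  then have "halts (While c body) R H (l * (24 * Suc n + 1))
      (bind_pmf (map_pmf (\<lambda>x. (R1, H1 x)) (bernoulli_pmf (1 / 2)))
        (\<lambda>(R', H'). map_pmf (\<lambda>\<beta>. (F, overwrite I \<beta> H')) (coin_flips I)))"
  proof (rule halts_While_True[rotated])
    have "1 + len (R c) + (1 + 1 + (3 * l + 13) + 1 + l * (24 * n + 1)) \<le> 4 * l + 17 + l * (24 * n + 1)"
      using ls Suc.prems by simp
    also have "\<dots> \<le> 25 * l + l * (24 * n)" using Suc.prems(3) by (simp add: distrib_left)
    finally show "1 + len (R c) + (1 + 1 + (3 * l + 13) + 1 + l * (24 * n + 1)) \<le> l * (24 * Suc n + 1)"
      by (simp add: algebra_simps)
  qed (use Suc.prems in simp)
  moreover have "bind_pmf (map_pmf (\<lambda>x. (R1, H1 x)) (bernoulli_pmf (1 / 2)))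
        (\<lambda>(R', H'). map_pmf (\<lambda>\<beta>. (F, overwrite I \<beta> H')) (coin_flips I))
      = map_pmf (\<lambda>\<beta>. (F, overwrite {s..<s + Suc n} \<beta> H)) (coin_flips {s..<s + Suc n})"
  proof -
    have s: "{s..<s + Suc n} = insert s I" by (auto simp: I_def)
    have ow: "overwrite (insert s I) (\<beta>(s := x)) H = overwrite I \<beta> (H1 x)" for \<beta> x
      by (rule ext) (auto simp: overwrite_def H1_def I_def)
    show ?thesis
      unfolding s coin_flips_def
      by (subst Pi_pmf_insert')
         (simp add: I_def, simp add: I_def, simp add: map_bind_pmf bind_map_pmf ow map_pmf_def[symmetric] pmf.map_comp o_def)
  qed
  moreover have "(if Suc n = 0 then R else R(b := 1, c := 0, a := s + Suc n)) = F" by (simp add: F_def)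
  ultimately show ?case unfolding loop by (simp only:)
qed

section \<open>Cuts and linear forests\<close>

definition degree_in :: "('a \<times> 'a) set \<Rightarrow> 'a \<Rightarrow> nat" where
  "degree_in F v = card {e \<in> F. fst e = v \<or> snd e = v}"

definition consistent :: "'a set \<Rightarrow> ('a \<times> 'a) set \<Rightarrow> bool" where
  "consistent K F \<longleftrightarrow> (\<forall>(u, v)\<in>F. u \<in> K \<longleftrightarrow> v \<in> K)"

definition cuts :: "'a set \<Rightarrow> ('a \<times> 'a) set \<Rightarrow> 'a set set" where
  "cuts V F = {K. K \<subseteq> V \<and> consistent K F}"

lemma finite_cuts: "finite V \<Longrightarrow> finite (cuts V F)"
  by (rule finite_subset[of _ "Pow V"]) (auto simp: cuts_def)

lemma consistent_insert [simp]:
  "consistent K (insert e F) \<longleftrightarrow> (fst e \<in> K \<longleftrightarrow> snd e \<in> K) \<and> consistent K F"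
  by (simp add: consistent_def case_prod_unfold)

lemma consistentD: "consistent K F \<Longrightarrow> e \<in> F \<Longrightarrow> fst e \<in> K \<longleftrightarrow> snd e \<in> K"
  by (auto simp: consistent_def)

lemma consistentI: "(\<And>e. e \<in> F \<Longrightarrow> fst e \<in> K \<longleftrightarrow> snd e \<in> K) \<Longrightarrow> consistent K F"
  by (fastforce simp: consistent_def)

text \<open>The consistent cuts are closed under symmetric difference, so they form a vector space
  over GF(2) on which a further edge imposes one linear condition. Either this condition holds
  already, or exactly half of the cuts satisfy it.\<close>

lemma cuts_insert:
  assumes "finite V"
  shows "card (cuts V (insert e F)) = card (cuts V F) \<and> cuts V (insert e F) = cuts V F \<or>
    card (cuts V F) = 2 * card (cuts V (insert e F)) \<and> (\<exists>K\<in>cuts V F. (fst e \<in> K) \<noteq> (snd e \<in> K))"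
proof (cases "\<exists>K\<in>cuts V F. (fst e \<in> K) \<noteq> (snd e \<in> K)")
  case False
  then have "cuts V (insert e F) = cuts V F" by (auto simp: cuts_def)
  then show ?thesis by simp
next
  case True
  then obtain K0 where K0: "K0 \<in> cuts V F" "(fst e \<in> K0) \<noteq> (snd e \<in> K0)" by blast
  \<comment> \<open>Symmetric difference with a cut \<open>K0\<close> that separates the ends of
    \<open>e\<close> is an involution exchanging the cuts that separate them with those that do
    not.\<close>
  define flip where "flip K = (K - K0) \<union> (K0 - K)" for K
  define S where "S = cuts V (insert e F)"
  define D where "D = cuts V F - S"
  have S: "S = {K \<in> cuts V F. (fst e \<in> K) = (snd e \<in> K)}"
    by (auto simp: S_def cuts_def)
  have flip_iff: "x \<in> flip K \<longleftrightarrow> (x \<in> K) \<noteq> (x \<in> K0)" for x K by (auto simp: flip_def)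
  have flip_cuts: "flip K \<in> cuts V F" if "K \<in> cuts V F" for K
  proof -
    have "consistent (flip K) F"
      using that K0(1) by (intro consistentI) (auto simp: flip_iff cuts_def dest: consistentD)
    then show ?thesis using that K0(1) by (auto simp: cuts_def flip_def)
  qed
  have flip_flip: "flip (flip K) = K" for K by (auto simp: flip_def)
  have "flip ` S = D"
  proof (intro equalityI subsetI)
    fix K assume "K \<in> flip ` S"
    then obtain K' where "K = flip K'" "K' \<in> S" by blast
    then show "K \<in> D" using K0 flip_cuts[of K'] unfolding D_def S by (simp add: flip_iff)
  next
    fix K assume "K \<in> D"
    then have "flip K \<in> S" using K0 flip_cuts[of K] unfolding D_def S by (simp add: flip_iff)
    then show "K \<in> flip ` S" using flip_flip[of K] by (metis imageI)
  qed
  moreover have "inj_on flip S" using flip_flip by (metis inj_onI)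
  ultimately have "card D = card S" by (metis card_image)
  moreover have "S \<subseteq> cuts V F" by (auto simp: S)
  then have "card (cuts V F) = card S + card D"
    unfolding D_def using finite_cuts[OF assms, of F]
    by (simp add: card_Diff_subset card_mono finite_subset)
  ultimately show ?thesis using True by (simp add: S_def)
qed

lemma cuts_empty: "cuts V {} = Pow V"
  by (auto simp: cuts_def consistent_def)

text \<open>For edges inside \<open>V\<close> the exponent is the number of components: it starts at
  \<open>card V\<close>, and each edge lowers it by at most one.\<close>

lemma card_cuts_power:
  assumes "finite V" "finite F"
  shows "\<exists>r. card (cuts V F) = 2 ^ r \<and> card V \<le> r + card F"
  using assms(2)
proof induction
  case empty
  show ?case using assms(1) by (intro exI[of _ "card V"]) (simp add: cuts_empty card_Pow)
next
  case (insert e F)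
  then obtain r where r: "card (cuts V F) = 2 ^ r" "card V \<le> r + card F" by blast
  from cuts_insert[OF assms(1), of e F] show ?case
  proof
    assume "card (cuts V (insert e F)) = card (cuts V F) \<and> cuts V (insert e F) = cuts V F"
    then show ?thesis using r insert by (intro exI[of _ r]) auto
  next
    assume *: "card (cuts V F) = 2 * card (cuts V (insert e F)) \<and> (\<exists>K\<in>cuts V F. (fst e \<in> K) \<noteq> (snd e \<in> K))"
    then obtain r' where "r = Suc r'" using r by (cases r) auto
    then show ?thesis using r insert * by (intro exI[of _ r']) auto
  qed
qed

lemma card_cuts_mono:
  assumes "finite V" "finite F" "F' \<subseteq> F"
  shows "card (cuts V F') \<le> card (cuts V F) * 2 ^ card (F - F')"
proof -
  have *: "finite D \<Longrightarrow> card (cuts V F') \<le> card (cuts V (D \<union> F')) * 2 ^ card D" for D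
  proof (induction D rule: finite_induct)
    case (insert e D)
    then show ?case using cuts_insert[OF assms(1), of e "D \<union> F'"] by auto
  qed simp
  moreover have "finite (F - F')" "F - F' \<union> F' = F" using assms by auto
  ultimately show ?thesis by metis
qed

text \<open>Equality in the lower bound on the number of cuts: every edge halves it. For edges
  inside \<open>V\<close>, each stored once, this means that \<open>F\<close> has no cycle.
  Acyclicity in this counting form serves both the parity argument and induction over edges.\<close>

definition forest_cuts :: "'a set \<Rightarrow> ('a \<times> 'a) set \<Rightarrow> bool" where
  "forest_cuts V F \<longleftrightarrow> card (cuts V F) * 2 ^ card F = 2 ^ card V"

lemma card_cuts_ge:
  assumes "finite V" "finite F"
  shows "2 ^ card V \<le> card (cuts V F) * 2 ^ card F"
proof -
  obtain r where "card (cuts V F) = 2 ^ r" "card V \<le> r + card F" using card_cuts_power[OF assms] by blast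
  then show ?thesis by (simp add: power_add[symmetric] power_increasing)
qed

text \<open>Removing an edge at most doubles the number of cuts, and the general lower bound applies
  to the smaller set as well; for an extremal \<open>F\<close> the two estimates meet.\<close>

lemma forest_cuts_subset:
  assumes "finite V" "finite F" "F' \<subseteq> F" "forest_cuts V F"
  shows "forest_cuts V F'"
proof -
  have "card F = card F' + card (F - F')"
    using assms by (simp add: card_Diff_subset card_mono finite_subset)
  then have "2 ^ card V = card (cuts V F) * 2 ^ card (F - F') * 2 ^ card F'"
    using assms(4) by (simp add: forest_cuts_def power_add mult_ac)
  then have "card (cuts V F') * 2 ^ card F' \<le> 2 ^ card V"
    using mult_right_mono[OF card_cuts_mono[OF assms(1-3)], of "2 ^ card F'"] by simp
  moreover have "finite F'" using assms finite_subset by blast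
  ultimately show ?thesis using card_cuts_ge[OF assms(1)] by (simp add: forest_cuts_def antisym)
qed

text \<open>
  This replaces the marker sets of the usual cut-and-count argument: a set of edges with a cycle
  contributes an even multiple of \<open>2 ^ (|V| - |F|)\<close>.
\<close>

lemma cuts_parity:
  assumes "finite V" "finite F" "card F + k = card V"
  shows "\<exists>q. card (cuts V F) = 2 ^ k * q \<and> (odd q \<longleftrightarrow> forest_cuts V F)"
proof -
  obtain r where r: "card (cuts V F) = 2 ^ r" "card V \<le> r + card F" using card_cuts_power[OF assms(1,2)] by blast
  then obtain j where j: "r = k + j" using assms(3) by (metis add.commute add_le_cancel_right le_Suc_ex)
  have "forest_cuts V F \<longleftrightarrow> (2::nat) ^ (k + j + card F) = 2 ^ (card F + k)"
    using assms(3) by (simp add: forest_cuts_def r j power_add)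
  also have "\<dots> \<longleftrightarrow> j = 0" by (subst power_inject_exp) auto
  finally show ?thesis using r j by (intro exI[of _ "2 ^ j"]) (auto simp: power_add)
qed

subsection \<open>Path partitions as edge sets\<close>

text \<open>Each undirected edge is kept once, smaller end first, so that cardinalities count
  undirected edges although the graph stores both arcs.\<close>

definition ordered_edge :: "nat \<Rightarrow> nat \<Rightarrow> nat \<times> nat" where
  "ordered_edge u v = (min u v, max u v)"

fun path_edges :: "nat list \<Rightarrow> (nat \<times> nat) set" where
  "path_edges (u # v # p) = insert (ordered_edge u v) (path_edges (v # p))"
| "path_edges _ = {}"

definition edges :: "nat pair_pre_digraph \<Rightarrow> (nat \<times> nat) set" where
  "edges G = {(u, v). (u, v) \<in> parcs G \<and> u < v}"

lemma ordered_edge_commute: "ordered_edge u v = ordered_edge v u"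
  by (simp add: ordered_edge_def min.commute max.commute)

lemma path_edges_append:
  "p \<noteq> [] \<Longrightarrow> q \<noteq> [] \<Longrightarrow>
    path_edges (p @ q) = path_edges p \<union> path_edges q \<union> {ordered_edge (last p) (hd q)}"
proof (induction p rule: path_edges.induct)
  case ("2_2" v)
  then show ?case by (cases q) auto
qed auto

lemma path_edges_rev: "path_edges (rev p) = path_edges p"
proof (induction p rule: path_edges.induct)
  case (1 u v p)
  have "path_edges (rev (u # v # p)) = path_edges (rev (v # p) @ [u])" by simp
  also have "\<dots> = path_edges (rev (v # p)) \<union> {ordered_edge v u}"
    by (subst path_edges_append) simp_all
  finally show ?case using 1 by (simp add: ordered_edge_commute[of v u])
qed auto

lemma finite_path_edges: "finite (path_edges p)"
  by (induction p rule: path_edges.induct) auto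

text \<open>An upper bound suffices: the matching lower bound, for a whole partition at once, comes
  from counting cuts.\<close>

lemma card_path_edges: "card (path_edges p) \<le> length p - 1"
proof (induction p rule: path_edges.induct)
  case (1 u v p)
  then show ?case using card_insert_le_m1[of "length (v # p)" "path_edges (v # p)"]
    by (auto simp: card_insert_if finite_path_edges)
qed auto

lemma path_edges_subset: "(u, v) \<in> path_edges p \<Longrightarrow> u \<in> set p \<and> v \<in> set p"
  by (induction p rule: path_edges.induct) (auto simp: ordered_edge_def min_def max_def split: if_splits)

lemma path_edges_consistent:
  "consistent K (path_edges p) \<Longrightarrow> u \<in> set p \<Longrightarrow> v \<in> set p \<Longrightarrow> u \<in> K \<longleftrightarrow> v \<in> K"
proof -
  assume r: "consistent K (path_edges p)" and uv: "u \<in> set p" "v \<in> set p"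
  have "consistent K (path_edges p) \<Longrightarrow> \<forall>w\<in>set p. w \<in> K \<longleftrightarrow> hd p \<in> K" for p
  proof (induction p rule: path_edges.induct)
    case (1 u v p)
    then have "u \<in> K \<longleftrightarrow> v \<in> K" by (cases "u \<le> v") (simp_all add: ordered_edge_def)
    then show ?case using 1 by simp
  qed simp_all
  from this[OF r] show ?thesis using uv by simp
qed

lemma path_edges_conv:
  "path_edges p = (\<lambda>i. ordered_edge (p ! i) (p ! Suc i)) ` {..<length p - 1}"
proof (induction p rule: path_edges.induct)
  case (1 u v p)
  have "{..<length (u # v # p) - 1} = insert 0 (Suc ` {..<length (v # p) - 1})"
    by (simp add: lessThan_Suc_eq_insert_0)
  then show ?case using 1 by (simp add: image_image)
qed simp_all

lemma degree_path_edges: "distinct p \<Longrightarrow> degree_in (path_edges p) v \<le> 2"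
proof (cases "v \<in> set p")
  case False
  then have none: "{e \<in> path_edges p. fst e = v \<or> snd e = v} = {}" using path_edges_subset by fastforce
  show ?thesis unfolding degree_in_def none by simp
next
  case True
  assume d: "distinct p"
  obtain i where i: "i < length p" "p ! i = v" using True by (auto simp: in_set_conv_nth)
  let ?e = "\<lambda>i. ordered_edge (p ! i) (p ! Suc i)"
  have "{e \<in> path_edges p. fst e = v \<or> snd e = v} \<subseteq> ?e ` {i - 1, i}"
  proof
    fix e assume "e \<in> {e \<in> path_edges p. fst e = v \<or> snd e = v}"
    then obtain j where "j < length p - 1" and e: "e = ?e j" "fst e = v \<or> snd e = v"
      unfolding path_edges_conv by blast
    then have j: "Suc j < length p" by simp
    have "p ! j = p ! i \<or> p ! Suc j = p ! i"
      using i e by (cases "p ! j \<le> p ! Suc j") (auto simp: ordered_edge_def)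
    then have "j = i \<or> Suc j = i" using d i(1) j by (auto simp: nth_eq_iff_index_eq)
    then have "j = i \<or> j = i - 1" by auto
    then show "e \<in> ?e ` {i - 1, i}" using e by blast
  qed
  then have "card {e \<in> path_edges p. fst e = v \<or> snd e = v} \<le> card (?e ` {i - 1, i})"
    by (rule card_mono[rotated]) simp
  also have "\<dots> \<le> card {i - 1, i}" by (rule card_image_le) simp
  also have "\<dots> \<le> 2" by (simp add: card_insert_if)
  finally show ?thesis by (simp add: degree_in_def)
qed

text \<open>A vertex strictly inside a path is joined to its predecessor and to its successor, and
  these two edges differ since the path repeats no vertex.\<close>

lemma path_end_if_degree:
  assumes "distinct p" "u \<in> set p" "finite F" "path_edges p \<subseteq> F" "degree_in F u \<le> 1"
  shows "u = hd p \<or> u = last p"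
proof (rule ccontr)
  assume not_end: "\<not> (u = hd p \<or> u = last p)"
  obtain xs ys where p: "p = xs @ u # ys" using assms(2) by (meson split_list)
  then have ne: "xs \<noteq> []" "ys \<noteq> []" using not_end by auto
  let ?a = "ordered_edge (last xs) u" and ?b = "ordered_edge u (hd ys)"
  have "path_edges ([u] @ ys) = path_edges ys \<union> {?b}"
    by (subst path_edges_append) (use ne in simp_all)
  moreover have "path_edges (xs @ (u # ys)) = path_edges xs \<union> path_edges (u # ys) \<union> {?a}"
    by (subst path_edges_append) (use ne in simp_all)
  ultimately have "?a \<in> F" "?b \<in> F" using assms(4) unfolding p by auto
  then have ab: "{?a, ?b} \<subseteq> {e \<in> F. fst e = u \<or> snd e = u}"
    by (auto simp: ordered_edge_def min_def max_def)
  have "last xs \<in> set xs" "hd ys \<in> set ys" using ne by simp_all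
  then have "last xs \<noteq> hd ys" "last xs \<noteq> u" "hd ys \<noteq> u" using assms(1) unfolding p by auto
  then have "?a \<noteq> ?b" by (auto simp: ordered_edge_def min_def max_def)
  then have "2 = card {?a, ?b}" by simp
  also have "\<dots> \<le> card {e \<in> F. fst e = u \<or> snd e = u}" using ab assms(3) by (intro card_mono) auto
  finally show False using assms(5) by (simp add: degree_in_def)
qed

lemma vpath_iff_path_edges:
  assumes "pair_graph G"
  shows "vpath p (with_proj G) \<longleftrightarrow> p \<noteq> [] \<and> distinct p \<and> set p \<subseteq> pverts G \<and> path_edges p \<subseteq> edges G"
proof -
  interpret pair_graph G by fact
  have sym: "(u, v) \<in> parcs G \<longleftrightarrow> (v, u) \<in> parcs G" for u v using arcs_symmetric by blast
  have ends: "arcs_ends (with_proj G) = parcs G" by (auto simp: arcs_ends_def arc_to_ends_def)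
  have "distinct p \<Longrightarrow> set (vwalk_arcs p) \<subseteq> parcs G \<longleftrightarrow> path_edges p \<subseteq> edges G" for p
  proof (induction p rule: path_edges.induct)
    case (1 u v p)
    have "(u, v) \<in> parcs G \<longleftrightarrow> ordered_edge u v \<in> edges G" using 1 sym[of u v]
      by (auto simp: edges_def ordered_edge_def min_def max_def)
    then show ?case using 1 by simp
  qed auto
  then show ?thesis by (auto simp: vpath_def vwalk_def ends)
qed

text \<open>Disjointness already yields uniqueness, so covering is all that remains of the third
  condition.\<close>

lemma path_partition_iff:
  "path_partition G S \<longleftrightarrow> (\<forall>p\<in>S. vpath p (with_proj G)) \<and>
     pairwise (\<lambda>p q. set p \<inter> set q = {}) S \<and> pverts G \<subseteq> (\<Union>p\<in>S. set p)"
proof -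
  have "(\<forall>v\<in>pverts G. \<exists>!p. p \<in> S \<and> v \<in> set p) \<longleftrightarrow> pverts G \<subseteq> (\<Union>p\<in>S. set p)"
    if d: "pairwise (\<lambda>p q. set p \<inter> set q = {}) S"
  proof
    assume "pverts G \<subseteq> (\<Union>p\<in>S. set p)"
    moreover have "p = q" if "p \<in> S" "v \<in> set p" "q \<in> S" "v \<in> set q" for p q v
      using that d by (auto simp: pairwise_def)
    ultimately show "\<forall>v\<in>pverts G. \<exists>!p. p \<in> S \<and> v \<in> set p" by (metis UN_E subsetD)
  qed blast
  then show ?thesis unfolding path_partition_def by blast
qed

lemma path_partition_disjoint:
  "path_partition G S \<Longrightarrow> p \<in> S \<Longrightarrow> q \<in> S \<Longrightarrow> v \<in> set p \<Longrightarrow> v \<in> set q \<Longrightarrow> p = q"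
  by (auto simp: path_partition_iff pairwise_def)

lemma finite_edges: "pair_graph G \<Longrightarrow> finite (edges G)"
proof -
  assume "pair_graph G"
  then interpret pair_graph G .
  show ?thesis by (rule finite_subset[of _ "parcs G"]) (auto simp: edges_def)
qed

lemma degree_in_mono: "finite F \<Longrightarrow> F' \<subseteq> F \<Longrightarrow> degree_in F' v \<le> degree_in F v"
  unfolding degree_in_def by (rule card_mono) auto

text \<open>Two opposite counts meet. A path has fewer edges than vertices, so
  \<open>card F + card S\<close> is at most the number of vertices. A consistent cut is determined
  by the paths whose heads it contains, so there are at most \<open>2 ^ card S\<close> cuts, and the
  general lower bound on cuts gives the reverse inequality. Equality throughout yields the size and
  the acyclicity of \<open>F\<close>.\<close>

lemma path_partition_forest:
  assumes G: "pair_graph G" and S: "path_partition G S"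
  defines "F \<equiv> \<Union>p\<in>S. path_edges p"
  shows "F \<subseteq> edges G" and "degree_in F v \<le> 2" and "card F + card S = card (pverts G)"
    and "forest_cuts (pverts G) F"
proof -
  let ?V = "pverts G"
  interpret pair_graph G by fact
  have V: "finite ?V" by simp
  have path: "p \<noteq> [] \<and> distinct p \<and> set p \<subseteq> ?V \<and> path_edges p \<subseteq> edges G" if "p \<in> S" for p
    using S that vpath_iff_path_edges[OF G] by (simp add: path_partition_iff)
  show sub: "F \<subseteq> edges G" using path by (auto simp: F_def)
  have fF: "finite F" using sub finite_edges[OF G] finite_subset by blast
  \<comment> \<open>Disjoint nonempty paths have distinct heads, so the finite vertex set makes
    \<open>S\<close> finite.\<close>
  have "inj_on hd S"
  proof (rule inj_onI)
    fix p q assume "p \<in> S" "q \<in> S" "hd p = hd q"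
    then show "p = q" using path_partition_disjoint[OF S, of p q "hd p"] path[of p] path[of q]
        hd_in_set[of p] hd_in_set[of q] by simp
  qed
  moreover have "hd ` S \<subseteq> ?V"
  proof
    fix x assume "x \<in> hd ` S"
    then obtain p where "p \<in> S" "x = hd p" by blast
    then show "x \<in> ?V" using path[of p] hd_in_set[of p] by blast
  qed
  ultimately have fS: "finite S" using V by (metis finite_imageD finite_subset)
  show "degree_in F v \<le> 2"
  proof (cases "\<exists>p\<in>S. v \<in> set p")
    case True
    then obtain p where p: "p \<in> S" "v \<in> set p" by blast
    have sub2: "{e \<in> F. fst e = v \<or> snd e = v} \<subseteq> {e \<in> path_edges p. fst e = v \<or> snd e = v}"
    proof
      fix e assume e: "e \<in> {e \<in> F. fst e = v \<or> snd e = v}"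
      then obtain q where q: "q \<in> S" "e \<in> path_edges q" by (auto simp: F_def)
      then have "v \<in> set q" using e path_edges_subset[of "fst e" "snd e" q] by auto
      then have "q = p" using path_partition_disjoint[OF S] q p by blast
      then show "e \<in> {e \<in> path_edges p. fst e = v \<or> snd e = v}" using e q by simp
    qed
    have "degree_in F v \<le> degree_in (path_edges p) v"
      unfolding degree_in_def by (rule card_mono[OF _ sub2]) (simp add: finite_path_edges)
    also have "\<dots> \<le> 2" using path[OF p(1)] by (intro degree_path_edges) simp
    finally show ?thesis .
  next
    case False
    then have none: "{e \<in> F. fst e = v \<or> snd e = v} = {}"
      using path_edges_subset by (fastforce simp: F_def)
    show ?thesis unfolding degree_in_def none by simp
  qed
  have "?V = (\<Union>p\<in>S. set p)" using S path by (auto simp: path_partition_iff)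
  then have "card ?V = (\<Sum>p\<in>S. card (set p))"
    using S fS by (simp add: card_UN_disjoint path_partition_iff pairwise_def)
  also have "\<dots> = (\<Sum>p\<in>S. length p)" using path by (intro sum.cong refl distinct_card) simp
  also have "\<dots> = (\<Sum>p\<in>S. length p - 1 + 1)"
  proof (intro sum.cong refl)
    fix p assume "p \<in> S"
    then show "length p = length p - 1 + 1" using path[of p] by (cases p) auto
  qed
  also have "\<dots> = (\<Sum>p\<in>S. length p - 1) + card S" by (subst sum.distrib) simp
  finally have cV: "card ?V = (\<Sum>p\<in>S. length p - 1) + card S" .
  have "card F \<le> (\<Sum>p\<in>S. card (path_edges p))" unfolding F_def by (rule card_UN_le[OF fS])
  also have "\<dots> \<le> (\<Sum>p\<in>S. length p - 1)" by (intro sum_mono card_path_edges)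
  finally have cF: "card F + card S \<le> card ?V" using cV by simp
  have "inj_on (\<lambda>K. {p \<in> S. hd p \<in> K}) (cuts ?V F)"
  proof (rule inj_onI)
    fix K L assume K: "K \<in> cuts ?V F" and L: "L \<in> cuts ?V F" and eq: "{p \<in> S. hd p \<in> K} = {p \<in> S. hd p \<in> L}"
    have *: "v \<in> M \<longleftrightarrow> hd p \<in> M" if "M \<in> cuts ?V F" "p \<in> S" "v \<in> set p" for M p v
    proof (rule path_edges_consistent[of _ p])
      show "consistent M (path_edges p)" using that by (auto simp: cuts_def F_def consistent_def)
    qed (use that path in auto)
    have **: "v \<in> K \<longleftrightarrow> v \<in> L" if v: "v \<in> ?V" for v
    proof -
      obtain p where p: "p \<in> S" "v \<in> set p" using S v by (auto simp: path_partition_iff)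
      then show ?thesis using *[OF K p] *[OF L p] eq by blast
    qed
    have "K \<subseteq> ?V" "L \<subseteq> ?V" using K L by (simp_all add: cuts_def)
    with ** show "K = L" by blast
  qed
  then have "card (cuts ?V F) \<le> card (Pow S)" by (rule card_inj_on_le) (auto simp: fS)
  then have "card (cuts ?V F) * 2 ^ card F \<le> 2 ^ (card F + card S)"
    using fS by (simp add: card_Pow power_add)
  moreover from this have "(2::nat) ^ card ?V \<le> 2 ^ (card F + card S)"
    using card_cuts_ge[OF V fF] by linarith
  then have "card ?V \<le> card F + card S" by simp
  then show "card F + card S = card ?V" using cF by simp
  ultimately show "forest_cuts ?V F"
    using card_cuts_ge[OF V fF] by (simp add: forest_cuts_def)
qed

text \<open>Induction over the edges, starting from single-vertex paths. The edge set is extremal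
  with and without the new edge, so the edge halves the number of cuts; some consistent cut
  therefore separates its ends, which lie on different paths. The degree bound makes them ends of
  these paths, and the two paths are concatenated.\<close>

lemma forest_path_partition:
  assumes G: "pair_graph G" and "F \<subseteq> edges G" "\<And>v. degree_in F v \<le> 2" "forest_cuts (pverts G) F"
  shows "\<exists>S. path_partition G S \<and> finite S \<and> card S + card F = card (pverts G) \<and> (\<Union>p\<in>S. path_edges p) = F"
proof -
  let ?V = "pverts G"
  interpret pair_graph G by fact
  have V: "finite ?V" by simp
  have "finite F" using assms(2) finite_edges[OF G] finite_subset by blast
  then show ?thesis using assms(2-)
  proof (induction F rule: finite_induct)
    case empty
    have "path_partition G ((\<lambda>v. [v]) ` ?V)"
      unfolding path_partition_iff by (auto simp: vpath_iff_path_edges[OF G] pairwise_def)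
    moreover have "card ((\<lambda>v. [v]) ` ?V) = card ?V" by (simp add: card_image inj_on_def)
    ultimately show ?case by (intro exI[of _ "(\<lambda>v. [v]) ` ?V"]) auto
  next
    case (insert e F)
    obtain u v where e: "e = (u, v)" by fastforce
    have uv: "u < v" "u \<in> ?V" "v \<in> ?V"
      using insert.prems(1) in_arcsD1 in_arcsD2 by (auto simp: e edges_def)
    have forest: "forest_cuts ?V F"
      using forest_cuts_subset[OF V _ _ insert.prems(3)] insert.hyps by blast
    have "degree_in F w \<le> 2" for w
      using degree_in_mono[of "insert e F" F w] insert.hyps insert.prems(2)[of w]
      by (simp add: subset_insertI)
    then obtain S where S: "path_partition G S" "finite S" "card S + card F = card ?V" "(\<Union>p\<in>S. path_edges p) = F"
      using insert.IH forest insert.prems(1) by auto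
    have path: "p \<noteq> [] \<and> distinct p \<and> set p \<subseteq> ?V \<and> path_edges p \<subseteq> edges G" if "p \<in> S" for p
      using S(1) that vpath_iff_path_edges[OF G] by (simp add: path_partition_iff)
    have "card (cuts ?V F) = 2 * card (cuts ?V (insert e F))"
    proof -
      have "card (cuts ?V F) * 2 ^ card F = (2 * card (cuts ?V (insert e F))) * 2 ^ card F"
        using forest insert.prems(3) insert.hyps by (simp add: forest_cuts_def)
      then show ?thesis by (simp only: mult_cancel2) simp
    qed
    moreover have "card (cuts ?V F) > 0" using forest by (auto simp: forest_cuts_def intro: Nat.gr0I)
    ultimately obtain K where K: "K \<in> cuts ?V F" "(u \<in> K) \<noteq> (v \<in> K)"
      using cuts_insert[OF V, of e F] by (auto simp: e)
    obtain p q where p: "p \<in> S" "u \<in> set p" and q: "q \<in> S" "v \<in> set q"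
      using S(1) uv unfolding path_partition_iff by blast
    have "p \<noteq> q"
    proof
      assume "p = q"
      moreover have "consistent K (path_edges p)" using K(1) S(4) p(1) by (auto simp: cuts_def consistent_def)
      ultimately show False using path_edges_consistent p q K(2) by blast
    qed
    then have disj: "set p \<inter> set q = {}" using path_partition_disjoint[OF S(1)] p q by blast
    have deg1: "degree_in F w \<le> 1" if "w = u \<or> w = v" for w
    proof -
      have "{x \<in> insert e F. fst x = w \<or> snd x = w} = insert e {x \<in> F. fst x = w \<or> snd x = w}"
        using that by (auto simp: e)
      then have "degree_in (insert e F) w = Suc (degree_in F w)"
        using insert.hyps by (simp add: degree_in_def)
      then show ?thesis using insert.prems(2)[of w] by simp
    qed
    have "path_edges p \<subseteq> F" "path_edges q \<subseteq> F" using S(4) p q by auto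
    then have "u = hd p \<or> u = last p" "v = hd q \<or> v = last q"
      using path_end_if_degree[OF _ p(2) insert.hyps(1)] path_end_if_degree[OF _ q(2) insert.hyps(1)]
        path[OF p(1)] path[OF q(1)] deg1 by auto
    \<comment> \<open>Reversing a path keeps its edges, so the first path can be turned to end in
      \<open>u\<close> and the second to begin with \<open>v\<close>.\<close>
    then obtain p' q' where p': "p' = p \<or> p' = rev p" "last p' = u" and q': "q' = q \<or> q' = rev q" "hd q' = v"
      using path[OF p(1)] path[OF q(1)] by (metis hd_rev last_rev)
    define r where "r = p' @ q'"
    have sets: "set p' = set p" "set q' = set q" "path_edges p' = path_edges p" "path_edges q' = path_edges q"
      "p' \<noteq> []" "q' \<noteq> []" "distinct p'" "distinct q'"
      using p' q' path[OF p(1)] path[OF q(1)] by (auto simp: path_edges_rev)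
    have r_edges: "path_edges r = path_edges p \<union> path_edges q \<union> {e}"
      using path_edges_append[OF sets(5,6)] p' q' sets uv
      by (simp add: r_def e ordered_edge_def)
    have r_set: "set r = set p \<union> set q" using sets by (simp add: r_def)
    have "distinct r" "r \<noteq> []" using sets disj by (simp_all add: r_def)
    then have r_path: "vpath r (with_proj G)"
      using path[OF p(1)] path[OF q(1)] r_set r_edges insert.prems(1)
      by (simp add: vpath_iff_path_edges[OF G])
    define S' where "S' = insert r (S - {p, q})"
    have other: "set x \<inter> set r = {}" if "x \<in> S - {p, q}" for x
      using that path_partition_disjoint[OF S(1)] p q r_set by auto
    have "path_partition G S'"
      unfolding path_partition_iff
    proof (intro conjI ballI)
      show "vpath x (with_proj G)" if "x \<in> S'" for x
        using that r_path S(1) by (auto simp: S'_def path_partition_iff)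
      have "pairwise (\<lambda>p q. set p \<inter> set q = {}) (S - {p, q})"
        using S(1) by (auto simp: path_partition_iff pairwise_def)
      then show "pairwise (\<lambda>p q. set p \<inter> set q = {}) S'"
        unfolding S'_def pairwise_insert using other by blast
      show "?V \<subseteq> (\<Union>p\<in>S'. set p)"
      proof
        fix w assume "w \<in> ?V"
        then obtain x where "x \<in> S" "w \<in> set x" using S(1) by (auto simp: path_partition_iff)
        then show "w \<in> (\<Union>p\<in>S'. set p)" using r_set by (cases "x \<in> {p, q}") (auto simp: S'_def)
      qed
    qed
    moreover have "card S' + card (insert e F) = card ?V"
    proof -
      have "r \<notin> S - {p, q}" using other[of r] \<open>r \<noteq> []\<close> by auto
      moreover have "card (S - {p, q}) = card S - 2"
        using \<open>p \<noteq> q\<close> p q S(2) by (simp add: card_Diff_subset)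
      moreover have "2 \<le> card S" using card_mono[OF S(2), of "{p, q}"] \<open>p \<noteq> q\<close> p q by simp
      ultimately show ?thesis using S(2,3) insert.hyps by (simp add: S'_def)
    qed
    moreover have "(\<Union>p\<in>S'. path_edges p) = insert e F"
      using S(4) p q by (auto simp: S'_def r_edges)
    moreover have "finite S'" using S(2) by (simp add: S'_def)
    ultimately show ?case by blast
  qed
qed

section \<open>Search orders of decomposition trees\<close>

text \<open>Reachability inside \<open>A\<close> as a plain reflexive transitive closure. It is
  reflexive also at points outside \<open>A\<close>, hence the membership assumptions in the lemmas
  that use it.\<close>

definition linked :: "('a \<times> 'a) set \<Rightarrow> 'a set \<Rightarrow> 'a \<Rightarrow> 'a \<Rightarrow> bool" where
  "linked r A x y \<longleftrightarrow> (x, y) \<in> (r \<inter> A \<times> A)\<^sup>*"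

lemma linked_mono: "A \<subseteq> A' \<Longrightarrow> linked r A x y \<Longrightarrow> linked r A' x y"
  unfolding linked_def using rtrancl_mono[of "r \<inter> A \<times> A" "r \<inter> A' \<times> A'"] by blast

lemma linked_path:
  assumes "linked r A x y" "y \<in> A"
  shows "\<exists>p. p \<noteq> [] \<and> hd p = x \<and> last p = y \<and> distinct p \<and> set p \<subseteq> A \<and> set (vwalk_arcs p) \<subseteq> r"
  using assms(1) unfolding linked_def
proof (induction rule: converse_rtrancl_induct)
  case base
  show ?case using assms(2) by (intro exI[of _ "[y]"]) simp
next
  case (step x z)
  then obtain p where p: "p \<noteq> []" "hd p = z" "last p = y" "distinct p" "set p \<subseteq> A" "set (vwalk_arcs p) \<subseteq> r"
    by blast
  show ?case
  proof (cases "x \<in> set p")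
    case True
    then obtain xs ys where s: "p = xs @ x # ys" by (meson split_list)
    have "set (vwalk_arcs (x # ys)) \<subseteq> r"
      using p(6) unfolding s
    proof (induction xs rule: vwalk_arcs.induct)
      case (2 u)
      then show ?case by (cases ys) auto
    qed auto
    then show ?thesis using p s by (intro exI[of _ "x # ys"]) auto
  next
    case False
    then show ?thesis using p step by (intro exI[of _ "x # p"]) (cases p; auto)
  qed
qed

text \<open>The walk is cut at its first arrival in \<open>S\<close>; everything before stays in
  \<open>C - S\<close>.\<close>

lemma linked_cross:
  assumes "linked r C x z" "x \<in> C" "x \<notin> S" "z \<in> S"
  shows "\<exists>w z'. linked r (C - S) x w \<and> w \<in> C - S \<and> z' \<in> S \<inter> C \<and> (w, z') \<in> r"
proof -
  have "(linked r (C - S) x z \<and> z \<in> C - S) \<or>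
      (\<exists>w z'. linked r (C - S) x w \<and> w \<in> C - S \<and> z' \<in> S \<inter> C \<and> (w, z') \<in> r)"
    using assms(1) unfolding linked_def
  proof (induction rule: rtrancl_induct)
    case base
    then show ?case using assms by simp
  next
    case (step y z)
    from step.IH show ?case
    proof
      assume y: "(x, y) \<in> (r \<inter> (C - S) \<times> (C - S))\<^sup>* \<and> y \<in> C - S"
      show ?thesis
      proof (cases "z \<in> S")
        case True
        then show ?thesis using y step.hyps by blast
      next
        case False
        then have "(y, z) \<in> r \<inter> (C - S) \<times> (C - S)" using y step.hyps by blast
        then show ?thesis using y by (meson IntD2 SigmaD2 rtrancl.rtrancl_into_rtrancl)
      qed
    qed blast
  qed
  then show ?thesis using assms(4) by blast
qed

text \<open>The library defines connectedness through the symmetric closure of the induced subgraph;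
  as the arcs of \<open>T\<close> are symmetric, this closure adds nothing.\<close>

lemma connected_linked:
  assumes "pair_graph T" "C \<subseteq> pverts T" "Digraph_Component.connected (with_proj T \<restriction> C)"
  shows "C \<noteq> {}" and "x \<in> C \<Longrightarrow> y \<in> C \<Longrightarrow> linked (parcs T) C x y"
proof -
  interpret pair_graph T by fact
  let ?H = "mk_symmetric (with_proj T \<restriction> C)"
  have V: "pverts ?H = C" by (simp add: mk_symmetric_def)
  have sym: "(v, u) \<in> parcs T" if "(u, v) \<in> parcs T" for u v using that arcs_symmetric by blast
  have A: "parcs ?H \<subseteq> parcs T \<inter> C \<times> C"
    using sym by (auto simp: mk_symmetric_def induce_subgraph_def)
  have sc: "strongly_connected (with_proj ?H)" using assms(3) by (simp add: Digraph_Component.connected_def)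
  then show "C \<noteq> {}" using V by (simp add: strongly_connected_def)
  assume "x \<in> C" "y \<in> C"
  then have "x \<rightarrow>\<^sup>*\<^bsub>with_proj ?H\<^esub> y" using sc V by (simp add: strongly_connected_def)
  then have "(x, y) \<in> rtrancl_on C (parcs ?H)" using V by (simp add: reachable_def)
  then have "(x, y) \<in> (parcs ?H)\<^sup>*" by (rule rtrancl_on_rtranclI)
  then show "linked (parcs T) C x y"
    using rtrancl_mono[OF A] unfolding linked_def by blast
qed

text \<open>Otherwise there is a cycle: from \<open>x\<close> through \<open>C - S\<close> to some
  \<open>w\<close>, across to \<open>z'\<close> in both sets, inside \<open>S\<close> to
  \<open>y\<close>, and back along the arc to \<open>x\<close>. The two partial paths are disjoint
  because one avoids \<open>S\<close> and the other stays in it.\<close>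

lemma tree_separator:
  assumes T: "undirected_tree T"
    and S: "S \<subseteq> pverts T" "\<And>s s'. s \<in> S \<Longrightarrow> s' \<in> S \<Longrightarrow> linked (parcs T) S s s'"
    and C: "C \<subseteq> pverts T" "linked (parcs T) C x z"
    and x: "x \<in> C" "x \<notin> S" and y: "y \<in> S" "(y, x) \<in> parcs T" and z: "z \<in> S"
  shows "y \<in> C"
proof (rule ccontr)
  assume "y \<notin> C"
  obtain w z' where w: "linked (parcs T) (C - S) x w" "w \<in> C - S" and z': "z' \<in> S \<inter> C" "(w, z') \<in> parcs T"
    using linked_cross[OF C(2) x z] by blast
  obtain p where p: "p \<noteq> []" "hd p = x" "last p = w" "distinct p" "set p \<subseteq> C - S" "set (vwalk_arcs p) \<subseteq> parcs T"
    using linked_path[OF w] by blast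
  have "linked (parcs T) S z' y" using S(2) z' y by blast
  from linked_path[OF this y(1)] obtain q where
    q: "q \<noteq> []" "hd q = z'" "last q = y" "distinct q" "set q \<subseteq> S" "set (vwalk_arcs q) \<subseteq> parcs T" by blast
  \<comment> \<open>The second path thus has at least two vertices, which provides the three
    vertices demanded of a cycle.\<close>
  have "z' \<noteq> y" using z' \<open>y \<notin> C\<close> by blast
  then have "length q \<ge> 2" using q by (cases q; cases "tl q") auto
  then have len: "3 \<le> length (p @ q)" using p(1) by (cases p) auto
  have arcs: "set (vwalk_arcs (p @ q)) \<subseteq> parcs T"
    using p(1,3,6) q(1,2,6) z'(2)
  proof (induction p rule: vwalk_arcs.induct)
    case (2 u)
    then show ?case by (cases q) auto
  qed auto
  have "arcs_ends (with_proj T) = parcs T" by (auto simp: arcs_ends_def arc_to_ends_def)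
  then have "vpath (p @ q) (with_proj T)"
    using p q arcs S(1) C(1) by (auto simp: vpath_def vwalk_def)
  moreover have "(last (p @ q), hd (p @ q)) \<in> parcs T" using p q y by simp
  ultimately show False using T len by (auto simp: undirected_tree_def)
qed

text \<open>\<open>ord\<close> lists the first \<open>i\<close> visited nodes with node 0 as the
  root, and \<open>par j\<close> is an earlier neighbour of \<open>ord j\<close>. Both are functions
  on indices because the program keeps them as arrays in the heap.\<close>

definition search_order :: "nat pair_pre_digraph \<Rightarrow> nat \<Rightarrow> (nat \<Rightarrow> nat) \<Rightarrow> (nat \<Rightarrow> nat) \<Rightarrow> bool" where
  "search_order T i ord par \<longleftrightarrow> inj_on ord {..<i} \<and> ord ` {..<i} \<subseteq> pverts T \<and> ord 0 = 0 \<and>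
     (\<forall>j. 0 < j \<and> j < i \<longrightarrow> par j \<in> ord ` {..<j} \<and> (par j, ord j) \<in> parcs T)"

lemma search_order_linked:
  assumes "pair_graph T" "search_order T i ord par" "s \<in> ord ` {..<i}" "s' \<in> ord ` {..<i}"
  shows "linked (parcs T) (ord ` {..<i}) s s'"
  using assms(2-)
proof (induction i arbitrary: s s')
  case (Suc i)
  interpret pair_graph T by fact
  have sym: "(v, u) \<in> parcs T" if "(u, v) \<in> parcs T" for u v using that arcs_symmetric by blast
  have so: "search_order T i ord par"
    using Suc.prems(1) by (auto simp: search_order_def lessThan_Suc inj_on_insert)
  have img: "ord ` {..<Suc i} = insert (ord i) (ord ` {..<i})" by (simp add: lessThan_Suc)
  let ?S = "ord ` {..<i}" and ?S' = "ord ` {..<Suc i}"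
  have old: "linked (parcs T) ?S' a b" if "a \<in> ?S" "b \<in> ?S" for a b
    using linked_mono[OF _ Suc.IH[OF so that]] img by blast
  show ?case
  proof (cases "i = 0")
    case True
    then show ?thesis using Suc.prems img by (simp add: linked_def)
  next
    case False
    then have p: "par i \<in> ?S" "(par i, ord i) \<in> parcs T" using Suc.prems(1) by (auto simp: search_order_def)
    have pS: "par i \<in> ?S'" "ord i \<in> ?S'" using p by (auto simp: img)
    have e: "linked (parcs T) ?S' (par i) (ord i)" "linked (parcs T) ?S' (ord i) (par i)"
      unfolding linked_def using p(2) sym[OF p(2)] pS by blast+
    have to: "linked (parcs T) ?S' a (par i) \<and> linked (parcs T) ?S' (par i) a" if "a \<in> ?S'" for a
      using that old p(1) e unfolding img by auto
    then have "linked (parcs T) ?S' s (par i)" "linked (parcs T) ?S' (par i) s'" using Suc.prems by blast+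
    then show ?thesis unfolding linked_def by (rule rtrancl_trans)
  qed
qed simp

lemma tree_connected:
  assumes "undirected_tree T" "x \<in> pverts T" "y \<in> pverts T"
  shows "linked (parcs T) (pverts T) x y"
proof -
  have pg: "pair_graph T" using assms(1) by (simp add: undirected_tree_def)
  interpret pair_graph T by fact
  have "with_proj T \<restriction> pverts T = with_proj T"
    by (auto simp: induce_subgraph_def with_proj_def dest: in_arcsD1 in_arcsD2)
  then show ?thesis
    using connected_linked(2)[OF pg order_refl _ assms(2,3)] assms(1) by (simp add: undirected_tree_def)
qed

lemma search_order_extend:
  assumes T: "undirected_tree T" and so: "search_order T i ord par" and "0 < i" "i < card (pverts T)"
  shows "\<exists>x y. x \<in> pverts T \<and> x \<notin> ord ` {..<i} \<and> y \<in> ord ` {..<i} \<and> (x, y) \<in> parcs T"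
proof -
  have "card (ord ` {..<i}) = i" using so by (simp add: search_order_def card_image)
  then have "ord ` {..<i} \<noteq> pverts T" using assms(4) by auto
  then obtain x where x: "x \<in> pverts T" "x \<notin> ord ` {..<i}" using so by (auto simp: search_order_def)
  have z: "ord 0 \<in> ord ` {..<i}" "ord 0 \<in> pverts T" using so assms(3) by (auto simp: search_order_def)
  show ?thesis using linked_cross[OF tree_connected[OF T x(1) z(2)] x z(1)] by blast
qed

text \<open>The nodes whose bags contain \<open>v\<close> are connected, and so are the nodes
  visited before \<open>ord j\<close>. Both sets contain \<open>ord k\<close>, so the arc between
  \<open>par j\<close> and \<open>ord j\<close> would close a cycle unless the bag of
  \<open>par j\<close> contained \<open>v\<close> as well.\<close>

lemma search_order_running_intersection:
  assumes td: "tree_decomposition G T X" and so: "search_order T i ord par" and "0 < j" "j < i" "k < j"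
  shows "X (ord j) \<inter> X (ord k) \<subseteq> X (par j)"
proof
  fix v assume v: "v \<in> X (ord j) \<inter> X (ord k)"
  have T: "undirected_tree T" and pg: "pair_graph T" using td by (auto simp: tree_decomposition_def undirected_tree_def)
  have so': "search_order T j ord par"
    using so \<open>j < i\<close> by (auto simp: search_order_def intro: inj_on_subset)
  let ?C = "{x \<in> pverts T. v \<in> X x}" and ?S = "ord ` {..<j}"
  have nodes: "ord j \<in> pverts T" "ord k \<in> pverts T" using so assms(3-) by (auto simp: search_order_def)
  have "v \<in> pverts G" using td nodes v by (auto simp: tree_decomposition_def)
  then have "Digraph_Component.connected (with_proj T \<restriction> ?C)" using td by (simp add: tree_decomposition_def)
  then have C: "linked (parcs T) ?C (ord j) (ord k)"
    using connected_linked(2)[OF pg, of ?C "ord j" "ord k"] nodes v by auto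
  have "ord j \<notin> ?S"
  proof
    assume "ord j \<in> ?S"
    then obtain x where "ord j = ord x" "x < j" by auto
    then show False using so \<open>j < i\<close> inj_onD[of ord "{..<i}" j x] by (auto simp: search_order_def)
  qed
  moreover have "par j \<in> ?S" "(par j, ord j) \<in> parcs T" using so assms(3,4) by (auto simp: search_order_def)
  moreover have "?S \<subseteq> pverts T" using so' by (simp add: search_order_def)
  ultimately have "par j \<in> ?C"
    using tree_separator[OF T _ search_order_linked[OF pg so'] _ C, of "par j"] nodes v \<open>k < j\<close> by auto
  then show "v \<in> X (par j)" by simp
qed

section \<open>Random multilinear polynomials\<close>

lemma coin_flips_split:
  assumes "finite J" "I \<subseteq> J"
  shows "coin_flips J = bind_pmf (coin_flips (J - I)) (\<lambda>g. map_pmf (\<lambda>f x. if x \<in> I then f x else g x) (coin_flips I))"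
proof -
  have J: "J = I \<union> (J - I)" using assms(2) by blast
  have fin: "finite I" "finite (J - I)" using assms finite_subset by auto
  have "coin_flips J = coin_flips (I \<union> (J - I))" using J by simp
  also have "\<dots> = map_pmf (\<lambda>(f, g) x. if x \<in> I then f x else g x) (pair_pmf (coin_flips I) (coin_flips (J - I)))"
    unfolding coin_flips_def using fin by (intro Pi_pmf_union) auto
  also have "pair_pmf (coin_flips I) (coin_flips (J - I)) =
      map_pmf (\<lambda>(x, y). (y, x)) (pair_pmf (coin_flips (J - I)) (coin_flips I))"
    by (rule pair_commute_pmf)
  finally show ?thesis
    by (simp add: pair_pmf_def map_pmf_def bind_assoc_pmf bind_return_pmf)
qed

text \<open>Conditioning on the bits outside \<open>I\<close>: a bound valid for each fixed outcome
  \<open>g\<close> of them survives averaging.\<close>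

lemma prob_coin_flips_split_le:
  assumes "finite J" "I \<subseteq> J" "0 \<le> \<delta>"
    and "\<And>g. measure_pmf.prob (coin_flips I) {f. P (\<lambda>x. if x \<in> I then f x else g x)} \<le> \<delta>"
  shows "measure_pmf.prob (coin_flips J) {\<beta>. P \<beta>} \<le> \<delta>"
proof -
  let ?N = "\<lambda>g. map_pmf (\<lambda>f x. if x \<in> I then f x else g x) (coin_flips I)"
  have "emeasure (measure_pmf (coin_flips J)) {\<beta>. P \<beta>} =
      (\<integral>\<^sup>+g. emeasure (measure_pmf (?N g)) {\<beta>. P \<beta>} \<partial>measure_pmf (coin_flips (J - I)))"
    unfolding coin_flips_split[OF assms(1,2)] by (rule emeasure_bind_pmf)
  also have "\<dots> \<le> (\<integral>\<^sup>+g. ennreal \<delta> \<partial>measure_pmf (coin_flips (J - I)))"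
    using assms(4) by (intro nn_integral_mono) (simp add: measure_pmf.emeasure_eq_measure vimage_def ennreal_leI)
  also have "\<dots> = ennreal \<delta>" by (simp add: measure_pmf.emeasure_space_1)
  finally show ?thesis using assms(3) by (simp add: measure_pmf.emeasure_eq_measure ennreal_le_iff)
qed

text \<open>The sum is a multilinear polynomial with coefficients one, formally nonzero because the
  family is nonempty. Write it as \<open>a + q e * b\<close> with \<open>a\<close> and
  \<open>b\<close> independent of the bits of \<open>e\<close>. If \<open>b\<close> does not vanish,
  then for fixed values of the other variables at most one value of \<open>q e\<close> gives zero,
  and it has probability at most \<open>\<delta>\<close>; the vanishing of \<open>b\<close> is
  covered by the induction hypothesis. So \<open>\<delta>\<close> replaces the reciprocal of the
  number of sample points in the usual statement.\<close>

theorem prob_multilinear_zero_le: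
  fixes q :: "'e \<Rightarrow> (nat \<Rightarrow> bool) \<Rightarrow> 'r::idom" and \<delta> :: real
  assumes "finite E" and "finite J" "\<And>e. e \<in> E \<Longrightarrow> I e \<subseteq> J"
    and disj: "\<And>e e'. e \<in> E \<Longrightarrow> e' \<in> E \<Longrightarrow> e \<noteq> e' \<Longrightarrow> I e \<inter> I e' = {}"
    and local: "\<And>e \<beta> \<beta>'. e \<in> E \<Longrightarrow> (\<And>i. i \<in> I e \<Longrightarrow> \<beta> i = \<beta>' i) \<Longrightarrow> q e \<beta> = q e \<beta>'"
    and spread: "\<And>e c. e \<in> E \<Longrightarrow> measure_pmf.prob (coin_flips (I e)) {\<beta>. q e \<beta> = c} \<le> \<delta>"
    and "\<F> \<subseteq> Pow E" "\<F> \<noteq> {}"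
  shows "measure_pmf.prob (coin_flips J) {\<beta>. (\<Sum>F\<in>\<F>. \<Prod>e\<in>F. q e \<beta>) = 0} \<le> card E * \<delta>"
  using assms
proof (induction E arbitrary: \<F> rule: finite_induct)
  case empty
  then have "\<F> = {{}}" by auto
  then show ?case by simp
next
  case (insert e E)
  define A where "A = {F \<in> \<F>. e \<notin> F}"
  define B where "B = (\<lambda>F. F - {e}) ` {F \<in> \<F>. e \<in> F}"
  have fin: "finite \<F>" using insert.prems(6) insert.hyps(1) by (meson finite.insertI finite_Pow_iff finite_subset)
  have "0 \<le> measure_pmf.prob (coin_flips (I e)) {\<beta>. q e \<beta> = 0}" by simp
  also have "\<dots> \<le> \<delta>" by (rule insert.prems(5)) simp
  finally have d0: "0 \<le> \<delta>" .
  have AE: "A \<subseteq> Pow E" and BE: "B \<subseteq> Pow E" using insert.prems(6) by (auto simp: A_def B_def)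
  have IH: "measure_pmf.prob (coin_flips J) {\<beta>. (\<Sum>F\<in>\<G>. \<Prod>e\<in>F. q e \<beta>) = 0} \<le> card E * \<delta>"
    if "\<G> \<subseteq> Pow E" "\<G> \<noteq> {}" for \<G>
  proof (rule insert.IH[OF insert.prems(1) _ _ _ _ that])
    show "I e' \<subseteq> J" if "e' \<in> E" for e' by (rule insert.prems(2)) (use that in simp)
    show "I e' \<inter> I e'' = {}" if "e' \<in> E" "e'' \<in> E" "e' \<noteq> e''" for e' e''
      by (rule insert.prems(3)) (use that in simp_all)
    show "q e' \<beta> = q e' \<beta>'" if "e' \<in> E" "\<And>i. i \<in> I e' \<Longrightarrow> \<beta> i = \<beta>' i" for e' \<beta> \<beta>'
      by (rule insert.prems(4)) (use that in simp_all)
    show "measure_pmf.prob (coin_flips (I e')) {\<beta>. q e' \<beta> = c} \<le> \<delta>" if "e' \<in> E" for e' c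
      by (rule insert.prems(5)) (use that in simp)
  qed
  show ?case
  proof (cases "B = {}")
    case True
    then have "\<F> \<subseteq> Pow E" using insert.prems(6) by (auto simp: B_def)
    from IH[OF this insert.prems(7)] show ?thesis using d0 insert.hyps by (simp add: distrib_right)
  next
    case False
    define a where "a \<beta> = (\<Sum>F\<in>A. \<Prod>e\<in>F. q e \<beta>)" for \<beta>
    define b where "b \<beta> = (\<Sum>F\<in>B. \<Prod>e\<in>F. q e \<beta>)" for \<beta>
    have split: "(\<Sum>F\<in>\<F>. \<Prod>e\<in>F. q e \<beta>) = a \<beta> + q e \<beta> * b \<beta>" for \<beta>
    proof -
      have inj: "inj_on (\<lambda>F. F - {e}) {F \<in> \<F>. e \<in> F}" by (auto simp: inj_on_def)
      have u: "A \<union> {F \<in> \<F>. e \<in> F} = \<F>" by (auto simp: A_def)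
      have "(\<Sum>F\<in>A \<union> {F \<in> \<F>. e \<in> F}. \<Prod>e\<in>F. q e \<beta>) = a \<beta> + (\<Sum>F | F \<in> \<F> \<and> e \<in> F. \<Prod>e\<in>F. q e \<beta>)"
        unfolding a_def by (rule sum.union_disjoint) (use fin in \<open>auto simp: A_def\<close>)
      then have "(\<Sum>F\<in>\<F>. \<Prod>e\<in>F. q e \<beta>) = a \<beta> + (\<Sum>F | F \<in> \<F> \<and> e \<in> F. \<Prod>e\<in>F. q e \<beta>)"
        unfolding u .
      also have "(\<Sum>F | F \<in> \<F> \<and> e \<in> F. \<Prod>e\<in>F. q e \<beta>) = (\<Sum>F | F \<in> \<F> \<and> e \<in> F. q e \<beta> * (\<Prod>e\<in>F - {e}. q e \<beta>))"
      proof (intro sum.cong refl)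
        fix F assume F: "F \<in> {F \<in> \<F>. e \<in> F}"
        then have "finite F" using insert.prems(6) insert.hyps(1) finite_subset by blast
        then show "(\<Prod>e\<in>F. q e \<beta>) = q e \<beta> * (\<Prod>e\<in>F - {e}. q e \<beta>)" using F prod.remove[of F e "\<lambda>e. q e \<beta>"] by simp
      qed
      also have "\<dots> = q e \<beta> * b \<beta>"
        unfolding b_def B_def by (simp add: sum.reindex[OF inj] sum_distrib_left)
      finally show ?thesis .
    qed
    \<comment> \<open>The blocks of bits of different edges are disjoint, so bits outside the block
      of \<open>e\<close> determine \<open>a\<close> and \<open>b\<close>.\<close>
    have same: "a \<beta> = a \<beta>' \<and> b \<beta> = b \<beta>'" if "\<And>x. x \<in> J - I e \<Longrightarrow> \<beta> x = \<beta>' x" for \<beta> \<beta>'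
    proof -
      have qe: "q e' \<beta> = q e' \<beta>'" if "e' \<in> E" for e'
      proof (rule insert.prems(4))
        fix i assume "i \<in> I e'"
        then have "i \<in> J - I e" using that insert.prems(2)[of e'] insert.prems(3)[of e' e] insert.hyps(2) by auto
        then show "\<beta> i = \<beta>' i" using \<open>\<And>x. x \<in> J - I e \<Longrightarrow> \<beta> x = \<beta>' x\<close> by blast
      qed (use that in simp)
      have "(\<Prod>e\<in>F. q e \<beta>) = (\<Prod>e\<in>F. q e \<beta>')" if "F \<subseteq> E" for F
        using that by (intro prod.cong refl qe) auto
      then show ?thesis using AE BE unfolding a_def b_def by (auto intro!: sum.cong)
    qed
    have "measure_pmf.prob (coin_flips J) {\<beta>. b \<beta> \<noteq> 0 \<and> a \<beta> + q e \<beta> * b \<beta> = 0} \<le> \<delta>"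
    proof (rule prob_coin_flips_split_le[OF \<open>finite J\<close> insert.prems(2) d0])
      fix g :: "nat \<Rightarrow> bool"
      let ?c = "\<lambda>f x. if x \<in> I e then f x else g x"
      have ab: "a (?c f) = a g" "b (?c f) = b g" for f using same[of "?c f" g] by auto
      have q: "q e (?c f) = q e f" for f by (rule insert.prems(4)) auto
      show "measure_pmf.prob (coin_flips (I e)) {f. b (?c f) \<noteq> 0 \<and> a (?c f) + q e (?c f) * b (?c f) = 0} \<le> \<delta>"
      proof (cases "\<exists>c. b g \<noteq> 0 \<and> a g + c * b g = 0")
        case True
        then obtain c where c: "b g \<noteq> 0" "a g + c * b g = 0" by blast
        have "q e f = c" if "a g + q e f * b g = 0" for f
        proof -
          have "(q e f - c) * b g = (a g + q e f * b g) - (a g + c * b g)" by (simp add: algebra_simps)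
          then have "(q e f - c) * b g = 0" using that c(2) by simp
          then show ?thesis using c(1) by simp
        qed
        then have "measure_pmf.prob (coin_flips (I e)) {f. b (?c f) \<noteq> 0 \<and> a (?c f) + q e (?c f) * b (?c f) = 0}
           \<le> measure_pmf.prob (coin_flips (I e)) {f. q e f = c}"
          unfolding ab q by (intro measure_pmf.finite_measure_mono) auto
        also have "\<dots> \<le> \<delta>" by (rule insert.prems(5)) simp
        finally show ?thesis .
      next
        case False
        then have "{f. b (?c f) \<noteq> 0 \<and> a (?c f) + q e (?c f) * b (?c f) = 0} = {}" unfolding ab q by auto
        then show ?thesis using d0 by (simp only: measure_empty)
      qed
    qed simp
    moreover have "measure_pmf.prob (coin_flips J) {\<beta>. b \<beta> = 0} \<le> card E * \<delta>"
      unfolding b_def by (rule IH[OF BE False])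
    moreover have "measure_pmf.prob (coin_flips J) {\<beta>. (\<Sum>F\<in>\<F>. \<Prod>e\<in>F. q e \<beta>) = 0} \<le>
        measure_pmf.prob (coin_flips J) ({\<beta>. b \<beta> = 0} \<union> {\<beta>. b \<beta> \<noteq> 0 \<and> a \<beta> + q e \<beta> * b \<beta> = 0})"
      unfolding split by (intro measure_pmf.finite_measure_mono) auto
    moreover have "\<dots> \<le> measure_pmf.prob (coin_flips J) {\<beta>. b \<beta> = 0} +
        measure_pmf.prob (coin_flips J) {\<beta>. b \<beta> \<noteq> 0 \<and> a \<beta> + q e \<beta> * b \<beta> = 0}"
      by (rule measure_Un_le) auto
    ultimately show ?thesis using insert.hyps by (simp add: distrib_right)
  qed
qed

section \<open>Uniformly random polynomials of bounded degree\<close>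

lemma prob_coin_flips_injective_le:
  assumes "finite I" and "\<And>\<beta> \<beta>'. h \<beta> = h \<beta>' \<Longrightarrow> (\<And>i. i \<in> I \<Longrightarrow> \<beta> i = \<beta>' i)"
  shows "measure_pmf.prob (coin_flips I) {\<beta>. h \<beta> = c} \<le> 1 / 2 ^ card I"
proof -
  let ?D = "PiE_dflt I False (\<lambda>_. UNIV :: bool set)"
  have fin: "finite ?D" using assms(1) by (intro finite_PiE_dflt) auto
  have "coin_flips I = pmf_of_set ?D"
    unfolding coin_flips_def bernoulli_pmf_half_conv_pmf_of_set
    using assms(1) by (intro Pi_pmf_of_set) auto
  moreover have ne: "?D \<noteq> {}" by (auto simp: PiE_dflt_def)
  moreover have "card ?D = 2 ^ card I" using assms(1) by (subst card_PiE_dflt) auto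
  ultimately have "measure_pmf.prob (coin_flips I) {\<beta>. h \<beta> = c} = card (?D \<inter> {\<beta>. h \<beta> = c}) / 2 ^ card I"
    using fin by (simp add: measure_pmf_of_set)
  also have "card (?D \<inter> {\<beta>. h \<beta> = c}) \<le> 1"
  proof (rule card_le_Suc0_iff_eq[THEN iffD2, simplified One_nat_def[symmetric]])
    show "finite (?D \<inter> {\<beta>. h \<beta> = c})" using fin by blast
    show "\<forall>\<beta>\<in>?D \<inter> {\<beta>. h \<beta> = c}. \<forall>\<beta>'\<in>?D \<inter> {\<beta>. h \<beta> = c}. \<beta> = \<beta>'"
    proof (intro ballI ext)
      fix \<beta> \<beta>' i assume "\<beta> \<in> ?D \<inter> {\<beta>. h \<beta> = c}" "\<beta>' \<in> ?D \<inter> {\<beta>. h \<beta> = c}"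
      then show "\<beta> i = \<beta>' i" using assms(2)[of \<beta> \<beta>' i] by (cases "i \<in> I") (auto simp: PiE_dflt_def)
    qed
  qed
  finally show ?thesis by (simp add: divide_right_mono)
qed

text \<open>The coefficient ring is left open because the same bits are read twice: over the natural
  numbers for the integers that the machine handles, and over GF(2) for the probabilistic
  argument.\<close>

definition bit_poly :: "nat \<Rightarrow> nat \<Rightarrow> (nat \<Rightarrow> bool) \<Rightarrow> 'a::comm_semiring_1 poly" where
  "bit_poly a n \<beta> = (\<Sum>i<n. monom (of_bool (\<beta> (a + i))) i)"

lemma coeff_bit_poly: "coeff (bit_poly a n \<beta>) i = (if i < n then of_bool (\<beta> (a + i)) else 0)"
  by (simp add: bit_poly_def coeff_sum coeff_monom if_distrib[of of_bool] sum.delta cong: if_cong)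

lemma prob_bit_poly_le:
  "measure_pmf.prob (coin_flips {a..<a + n}) {\<beta>. (bit_poly a n \<beta> :: 'a::comm_semiring_1 poly) = c} \<le> 1 / 2 ^ n"
proof -
  have "\<beta> i = \<beta>' i" if "(bit_poly a n \<beta> :: 'a poly) = bit_poly a n \<beta>'" "i \<in> {a..<a + n}" for \<beta> \<beta>' i
  proof -
    have "coeff (bit_poly a n \<beta> :: 'a poly) (i - a) = coeff (bit_poly a n \<beta>') (i - a)" using that by simp
    then show ?thesis using that(2) by (auto simp: coeff_bit_poly split: if_splits)
  qed
  then have "measure_pmf.prob (coin_flips {a..<a + n}) {\<beta>. (bit_poly a n \<beta> :: 'a poly) = c}
      \<le> 1 / 2 ^ card {a..<a + n}"
    by (intro prob_coin_flips_injective_le) simp_all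
  then show ?thesis by simp
qed

section \<open>Tables over bags\<close>

text \<open>
  A configuration is a cut together with a consistent set of edges of maximum degree at most two.  On
  a vertex it is summarised by three times its side of the cut plus its degree.
\<close>

definition configs :: "(nat \<times> nat) set \<Rightarrow> nat set \<Rightarrow> (nat set \<times> (nat \<times> nat) set) set" where
  "configs A U = {(K, F). K \<subseteq> U \<and> F \<subseteq> A \<and> consistent K F \<and> (\<forall>v. degree_in F v \<le> 2)}"

definition state_of :: "nat set \<times> (nat \<times> nat) set \<Rightarrow> nat \<Rightarrow> nat" where
  "state_of \<kappa> v = 3 * of_bool (v \<in> fst \<kappa>) + degree_in (snd \<kappa>) v"

text \<open>States vanish outside the bag, so that they can be compared as functions and range over
  a finite set.\<close>

definition restr :: "nat set \<Rightarrow> (nat \<Rightarrow> nat) \<Rightarrow> nat \<Rightarrow> nat" where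
  "restr X f = (\<lambda>v. if v \<in> X then f v else 0)"

text \<open>\<open>A\<close> and \<open>U\<close> are the edges and vertices processed so far. The
  entry for \<open>s\<close> collects the partial solutions that look like \<open>s\<close> on the
  boundary \<open>X\<close>; vertices of \<open>U\<close> outside \<open>X\<close> may have any
  state.\<close>

definition table :: "(nat \<times> nat \<Rightarrow> nat) \<Rightarrow> (nat \<times> nat) set \<Rightarrow> nat set \<Rightarrow> nat set \<Rightarrow> (nat \<Rightarrow> nat) \<Rightarrow> nat" where
  "table x A U X s = (\<Sum>\<kappa> | \<kappa> \<in> configs A U \<and> restr X (state_of \<kappa>) = s. \<Prod>e\<in>snd \<kappa>. x e)"

definition digit_fun :: "nat \<Rightarrow> nat set \<Rightarrow> (nat \<Rightarrow> nat) set" where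
  "digit_fun b X = PiE_dflt X 0 (\<lambda>_. {..<b})"

text \<open>A base-18 digit \<open>9 c + 3 d + d'\<close> combines two states with the same side \<open>c\<close> and degrees \<open>d\<close>, \<open>d'\<close>.\<close>

definition left_state :: "(nat \<Rightarrow> nat) \<Rightarrow> nat \<Rightarrow> nat" where
  "left_state \<delta> v = 3 * (\<delta> v div 9) + \<delta> v div 3 mod 3"

definition right_state :: "nat set \<Rightarrow> (nat \<Rightarrow> nat) \<Rightarrow> nat \<Rightarrow> nat" where
  "right_state Y \<delta> v = of_bool (v \<in> Y) * (3 * (\<delta> v div 9) + \<delta> v mod 3)"

definition sum_state :: "(nat \<Rightarrow> nat) \<Rightarrow> nat \<Rightarrow> nat" where
  "sum_state \<delta> v = 3 * (\<delta> v div 9) + \<delta> v div 3 mod 3 + \<delta> v mod 3"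

text \<open>All table operations run over the same base-18 digits, and flags select the meaningful
  ones. A fresh table admits only degree zero, that is, the digits 0 and 9.\<close>

definition init_ok :: "(nat \<Rightarrow> nat) \<Rightarrow> bool" where
  "init_ok \<delta> \<longleftrightarrow> (\<forall>v. \<delta> v div 3 mod 3 + \<delta> v mod 3 = 0)"

text \<open>The second degree in a digit copies the first on \<open>Y\<close> and is zero elsewhere.
  The digit is then determined by its left state, and its right state is the restriction of the left
  state to \<open>Y\<close>.\<close>

definition message_ok :: "nat set \<Rightarrow> (nat \<Rightarrow> nat) \<Rightarrow> bool" where
  "message_ok Y \<delta> \<longleftrightarrow> (\<forall>v. \<delta> v mod 3 = of_bool (v \<in> Y) * (\<delta> v div 3 mod 3))"

text \<open>A vertex outside \<open>Y\<close> does not occur in the message, so its second degree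
  must be zero; otherwise a degree that no edge accounts for would be added.\<close>

definition join_ok :: "nat set \<Rightarrow> (nat \<Rightarrow> nat) \<Rightarrow> bool" where
  "join_ok Y \<delta> \<longleftrightarrow> (\<forall>v. \<delta> v div 3 mod 3 + \<delta> v mod 3 \<le> 2 \<and> \<delta> v mod 3 \<le> 2 * of_bool (v \<in> Y))"

section \<open>Digit functions and the arithmetic of base-18 digits\<close>

lemma digit_fun_iff: "\<delta> \<in> digit_fun b X \<longleftrightarrow> (\<forall>v. (v \<in> X \<longrightarrow> \<delta> v < b) \<and> (v \<notin> X \<longrightarrow> \<delta> v = 0))"
  by (auto simp: digit_fun_def PiE_dflt_def)

lemma finite_digit_fun: "finite X \<Longrightarrow> finite (digit_fun b X)"
  unfolding digit_fun_def by (intro finite_PiE_dflt) auto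

lemma card_digit_fun: "finite X \<Longrightarrow> card (digit_fun b X) = b ^ card X"
  unfolding digit_fun_def by (subst card_PiE_dflt) auto

lemma finite_configs: "finite A \<Longrightarrow> finite U \<Longrightarrow> finite (configs A U)"
  by (rule finite_subset[of _ "Pow U \<times> Pow A"]) (auto simp: configs_def)

lemma restr_state_of:
  assumes "\<kappa> \<in> configs A U"
  shows "restr X (state_of \<kappa>) \<in> digit_fun 6 X"
proof -
  have "state_of \<kappa> v < 6" for v
  proof -
    have "degree_in (snd \<kappa>) v \<le> 2" using assms by (auto simp: configs_def)
    then show ?thesis by (simp add: state_of_def of_bool_def)
  qed
  then show ?thesis by (auto simp: digit_fun_iff restr_def)
qed

lemma mod3_split:
  fixes c c' d d' :: nat
  assumes "3 * c + d = 3 * c' + d'" "d \<le> 2" "d' \<le> 2"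
  shows "c = c'" "d = d'"
  using assms by presburger+

lemma digit18:
  fixes c d d' :: nat
  assumes "c \<le> 1" "d \<le> 2" "d' \<le> 2"
  shows "(9 * c + 3 * d + d') div 9 = c" "(9 * c + 3 * d + d') div 3 mod 3 = d"
    "(9 * c + 3 * d + d') mod 3 = d'" "9 * c + 3 * d + d' < 18"
proof -
  show "9 * c + 3 * d + d' < 18" using assms by linarith
  show "(9 * c + 3 * d + d') div 9 = c" by (rule div_nat_eqI) (use assms in simp_all)
  have "(9 * c + 3 * d + d') div 3 = 3 * c + d" by (rule div_nat_eqI) (use assms in simp_all)
  then show "(9 * c + 3 * d + d') div 3 mod 3 = d" using assms by simp
  have "9 * c + 3 * d + d' = d' + 3 * (3 * c + d)" by simp
  then show "(9 * c + 3 * d + d') mod 3 = d'" using assms by (simp only: mod_mult_self2) simp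
qed

lemma digit18_split:
  fixes g :: nat
  shows "9 * (g div 9) + 3 * (g div 3 mod 3) + g mod 3 = g"
proof -
  have "g div 9 = g div 3 div 3" by (simp add: div_mult2_eq[symmetric])
  then have "9 * (g div 9) + 3 * (g div 3 mod 3) = 3 * (3 * (g div 3 div 3) + g div 3 mod 3)"
    by (simp only: distrib_left mult.assoc[symmetric])
  also have "\<dots> = 3 * (g div 3)" by (simp only: mult_div_mod_eq)
  finally show ?thesis by (simp only: mult_div_mod_eq)
qed

lemma digit18_no_degree:
  fixes g :: nat
  assumes "g < 18" "g div 3 mod 3 + g mod 3 = 0"
  shows "g = 0 \<or> g = 9"
proof -
  have "g = 9 * (g div 9)" using digit18_split[of g] assms(2) by simp
  moreover have "g div 9 < 2" using less_mult_imp_div_less[of g 2 9] assms(1) by simp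
  ultimately show ?thesis by (cases "g div 9 = 0") auto
qed

text \<open>Without edges a configuration is just a subset of the bag, and the digit 9 marks its
  members.\<close>

lemma table_init:
  assumes "finite X" "s \<in> digit_fun 6 X"
  shows "table x {} X X s = card {\<delta> \<in> digit_fun 18 X. init_ok \<delta> \<and> sum_state \<delta> = s}"
proof -
  have deg: "degree_in {} v = 0" for v by (simp add: degree_in_def)
  have "table x {} X X s = card {\<kappa> \<in> configs {} X. restr X (state_of \<kappa>) = s}"
    unfolding table_def by (simp add: configs_def case_prod_unfold cong: conj_cong)
  also have "\<dots> = card {\<delta> \<in> digit_fun 18 X. init_ok \<delta> \<and> sum_state \<delta> = s}"
  proof (rule bij_betw_same_card)
    show "bij_betw (\<lambda>\<kappa> v. 9 * of_bool (v \<in> fst \<kappa>)) {\<kappa> \<in> configs {} X. restr X (state_of \<kappa>) = s}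
       {\<delta> \<in> digit_fun 18 X. init_ok \<delta> \<and> sum_state \<delta> = s}"
    proof (rule bij_betw_byWitness[where f' = "\<lambda>\<delta>. ({v. \<delta> v \<noteq> 0}, {})"])
      show "\<forall>\<kappa>\<in>{\<kappa> \<in> configs {} X. restr X (state_of \<kappa>) = s}.
          ({v. 9 * of_bool (v \<in> fst \<kappa>) \<noteq> (0::nat)}, {}) = \<kappa>"
        by (auto simp: configs_def)
      show "\<forall>\<delta>\<in>{\<delta> \<in> digit_fun 18 X. init_ok \<delta> \<and> sum_state \<delta> = s}.
          (\<lambda>v. 9 * of_bool (v \<in> fst ({v. \<delta> v \<noteq> 0}, {}))) = \<delta>"
      proof (intro ballI ext)
        fix \<delta> v assume d: "\<delta> \<in> {\<delta> \<in> digit_fun 18 X. init_ok \<delta> \<and> sum_state \<delta> = s}"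
        then have "\<delta> v < 18" by (cases "v \<in> X") (auto simp: digit_fun_iff)
        moreover have "\<delta> v div 3 mod 3 + \<delta> v mod 3 = 0" using d by (simp add: init_ok_def)
        ultimately have "\<delta> v = 0 \<or> \<delta> v = 9" by (rule digit18_no_degree)
        then show "9 * of_bool (v \<in> fst ({v. \<delta> v \<noteq> 0}, {})) = \<delta> v" by auto
      qed
      show "(\<lambda>\<kappa> v. 9 * of_bool (v \<in> fst \<kappa>)) ` {\<kappa> \<in> configs {} X. restr X (state_of \<kappa>) = s}
          \<subseteq> {\<delta> \<in> digit_fun 18 X. init_ok \<delta> \<and> sum_state \<delta> = s}"
      proof safe
        fix K F assume *: "(K, F) \<in> configs {} X" "s = restr X (state_of (K, F))"
        then have K: "K \<subseteq> X" "F = {}" by (auto simp: configs_def)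
        show "(\<lambda>v. 9 * of_bool (v \<in> fst (K, F))) \<in> digit_fun 18 X"
          using K by (auto simp: digit_fun_iff)
        show "init_ok (\<lambda>v. 9 * of_bool (v \<in> fst (K, F)))" by (simp add: init_ok_def of_bool_def)
        show "sum_state (\<lambda>v. 9 * of_bool (v \<in> fst (K, F))) = restr X (state_of (K, F))"
          using K by (auto simp: sum_state_def restr_def state_of_def deg fun_eq_iff)
      qed
      show "(\<lambda>\<delta>. ({v. \<delta> v \<noteq> 0}, {})) ` {\<delta> \<in> digit_fun 18 X. init_ok \<delta> \<and> sum_state \<delta> = s}
          \<subseteq> {\<kappa> \<in> configs {} X. restr X (state_of \<kappa>) = s}"
      proof
        fix \<kappa> :: "nat set \<times> (nat \<times> nat) set"
        assume "\<kappa> \<in> (\<lambda>\<delta>. ({v. \<delta> v \<noteq> 0}, {})) ` {\<delta> \<in> digit_fun 18 X. init_ok \<delta> \<and> sum_state \<delta> = s}"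
        then obtain \<delta> where k: "\<kappa> = ({v. \<delta> v \<noteq> 0}, {})" and d: "\<delta> \<in> digit_fun 18 X" "init_ok \<delta>" "sum_state \<delta> = s" by blast
        have *: "\<delta> v = 0 \<or> \<delta> v = 9" for v
        proof -
          have "\<delta> v < 18" using d(1) by (cases "v \<in> X") (auto simp: digit_fun_iff)
          moreover have "\<delta> v div 3 mod 3 + \<delta> v mod 3 = 0" using d(2) by (simp add: init_ok_def)
          ultimately show ?thesis by (rule digit18_no_degree)
        qed
        have "{v. \<delta> v \<noteq> 0} \<subseteq> X"
        proof
          fix v assume "v \<in> {v. \<delta> v \<noteq> 0}"
          then have nz: "\<delta> v \<noteq> 0" by simp
          show "v \<in> X"
          proof (rule ccontr)
            assume "v \<notin> X"
            then have "\<delta> v = 0" using d(1) by (simp add: digit_fun_iff)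
            then show False using nz by simp
          qed
        qed
        then have "\<kappa> \<in> configs {} X" by (auto simp: k configs_def consistent_def deg)
        moreover have "restr X (state_of \<kappa>) v = sum_state \<delta> v" for v
          using *[of v] d(1) by (auto simp: k restr_def state_of_def deg sum_state_def digit_fun_iff)
        ultimately show "\<kappa> \<in> {\<kappa> \<in> configs {} X. restr X (state_of \<kappa>) = s}" using d(3) by auto
      qed
    qed
  qed
  finally show ?thesis .
qed

lemma table_restr:
  assumes "finite A" "finite U" "finite X" "Z \<subseteq> X"
  shows "table x A U Z s = (\<Sum>s' | s' \<in> digit_fun 6 X \<and> restr Z s' = s. table x A U X s')"
proof -
  let ?C = "{\<kappa> \<in> configs A U. restr Z (state_of \<kappa>) = s}"
  let ?S = "{s' \<in> digit_fun 6 X. restr Z s' = s}"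
  have ZX: "restr Z (restr X f) = restr Z f" for f using assms(4) by (intro ext) (auto simp: restr_def)
  have "(\<Sum>\<kappa>\<in>?C. \<Prod>e\<in>snd \<kappa>. x e) = (\<Sum>s'\<in>?S. \<Sum>\<kappa> | \<kappa> \<in> ?C \<and> restr X (state_of \<kappa>) = s'. \<Prod>e\<in>snd \<kappa>. x e)"
  proof (rule sum.group[symmetric])
    show "finite ?C" using finite_configs[OF assms(1,2)] by simp
    show "finite ?S" using finite_digit_fun[OF assms(3)] by simp
    show "(\<lambda>\<kappa>. restr X (state_of \<kappa>)) ` ?C \<subseteq> ?S" using restr_state_of by (auto simp: ZX)
  qed
  also have "\<dots> = (\<Sum>s'\<in>?S. table x A U X s')"
  proof (intro sum.cong refl)
    fix s' assume s': "s' \<in> ?S"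
    have "{\<kappa> \<in> ?C. restr X (state_of \<kappa>) = s'} = {\<kappa> \<in> configs A U. restr X (state_of \<kappa>) = s'}"
      using s' ZX by auto
    then show "(\<Sum>\<kappa> | \<kappa> \<in> ?C \<and> restr X (state_of \<kappa>) = s'. \<Prod>e\<in>snd \<kappa>. x e) = table x A U X s'"
      by (simp add: table_def)
  qed
  finally show ?thesis by (simp add: table_def)
qed

text \<open>Forgetting the vertices outside \<open>Y\<close> is a sum over the states of
  \<open>X\<close> with a given restriction. The admissible digit functions correspond to these
  states by \<open>left_state\<close>; the inverse repeats the degree on \<open>Y\<close>.\<close>

lemma table_message:
  assumes "finite A" "finite U" "finite X"
  shows "(\<Sum>\<delta> | \<delta> \<in> digit_fun 18 X \<and> message_ok Y \<delta> \<and> right_state Y \<delta> = s. table x A U X (left_state \<delta>))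
    = table x A U (X \<inter> Y) s"
  unfolding table_restr[OF assms Int_lower1]
proof (rule sum.reindex_bij_witness[where
      i = "\<lambda>s' v. 9 * (s' v div 3) + 3 * (s' v mod 3) + of_bool (v \<in> Y) * (s' v mod 3)" and j = left_state])
  fix \<delta> assume d: "\<delta> \<in> {\<delta> \<in> digit_fun 18 X. message_ok Y \<delta> \<and> right_state Y \<delta> = s}"
  have lt: "\<delta> v < 18" for v using d by (cases "v \<in> X") (auto simp: digit_fun_iff)
  have m: "\<delta> v mod 3 = of_bool (v \<in> Y) * (\<delta> v div 3 mod 3)" for v using d by (simp add: message_ok_def)
  have parts: "left_state \<delta> v div 3 = \<delta> v div 9" "left_state \<delta> v mod 3 = \<delta> v div 3 mod 3" for v
    by (simp_all add: left_state_def)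
  show "(\<lambda>v. 9 * (left_state \<delta> v div 3) + 3 * (left_state \<delta> v mod 3) + of_bool (v \<in> Y) * (left_state \<delta> v mod 3)) = \<delta>"
    unfolding parts m[symmetric] by (simp add: digit18_split)
  have "left_state \<delta> v < 6" for v
  proof -
    have "\<delta> v div 9 \<le> 1" using lt[of v] by linarith
    moreover have "\<delta> v div 3 mod 3 \<le> 2" by simp
    ultimately show ?thesis unfolding left_state_def by linarith
  qed
  moreover have "left_state \<delta> v = 0" if "v \<notin> X" for v using d that by (simp add: left_state_def digit_fun_iff)
  ultimately have "left_state \<delta> \<in> digit_fun 6 X" by (simp add: digit_fun_iff)
  moreover have "restr (X \<inter> Y) (left_state \<delta>) = right_state Y \<delta>"
  proof
    fix v
    show "restr (X \<inter> Y) (left_state \<delta>) v = right_state Y \<delta> v"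
      using d m[of v] by (auto simp: restr_def left_state_def right_state_def digit_fun_iff)
  qed
  ultimately show "left_state \<delta> \<in> {s' \<in> digit_fun 6 X. restr (X \<inter> Y) s' = s}" using d by simp
next
  fix s' assume s': "s' \<in> {s' \<in> digit_fun 6 X. restr (X \<inter> Y) s' = s}"
  define \<delta> where "\<delta> = (\<lambda>v. 9 * (s' v div 3) + 3 * (s' v mod 3) + of_bool (v \<in> Y) * (s' v mod 3))"
  have lt: "s' v < 6" for v using s' by (cases "v \<in> X") (auto simp: digit_fun_iff)
  have dd: "\<delta> v = 9 * (s' v div 3) + 3 * (s' v mod 3) + of_bool (v \<in> Y) * (s' v mod 3)" for v by (simp add: \<delta>_def)
  have dg: "\<delta> v div 9 = s' v div 3" "\<delta> v div 3 mod 3 = s' v mod 3" "\<delta> v mod 3 = of_bool (v \<in> Y) * (s' v mod 3)" "\<delta> v < 18" for v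
  proof -
    have "s' v div 3 \<le> 1" using less_mult_imp_div_less[of "s' v" 2 3] lt[of v] by simp
    moreover have "s' v mod 3 \<le> 2" by simp
    moreover from this have "of_bool (v \<in> Y) * (s' v mod 3) \<le> 2" by (cases "v \<in> Y") simp_all
    ultimately show "\<delta> v div 9 = s' v div 3" "\<delta> v div 3 mod 3 = s' v mod 3"
      "\<delta> v mod 3 = of_bool (v \<in> Y) * (s' v mod 3)" "\<delta> v < 18"
      unfolding dd by (rule digit18)+
  qed
  show "left_state (\<lambda>v. 9 * (s' v div 3) + 3 * (s' v mod 3) + of_bool (v \<in> Y) * (s' v mod 3)) = s'"
    unfolding \<delta>_def[symmetric] by (rule ext) (simp add: left_state_def dg)
  have "\<delta> \<in> digit_fun 18 X" using s' dg by (auto simp: digit_fun_iff dd)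
  moreover have "message_ok Y \<delta>" by (simp add: message_ok_def dg)
  moreover have "right_state Y \<delta> v = restr (X \<inter> Y) s' v" for v
    using s' by (auto simp: right_state_def restr_def dg digit_fun_iff)
  ultimately show "(\<lambda>v. 9 * (s' v div 3) + 3 * (s' v mod 3) + of_bool (v \<in> Y) * (s' v mod 3))
      \<in> {\<delta> \<in> digit_fun 18 X. message_ok Y \<delta> \<and> right_state Y \<delta> = s}"
    using s' unfolding \<delta>_def[symmetric] by auto
qed simp

lemma degree_in_Un:
  assumes "finite F" "finite F'" "F \<inter> F' = {}"
  shows "degree_in (F \<union> F') v = degree_in F v + degree_in F' v"
proof -
  have "{e \<in> F \<union> F'. fst e = v \<or> snd e = v} = {e \<in> F. fst e = v \<or> snd e = v} \<union> {e \<in> F'. fst e = v \<or> snd e = v}"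
    by blast
  moreover have "{e \<in> F. fst e = v \<or> snd e = v} \<inter> {e \<in> F'. fst e = v \<or> snd e = v} = {}" using assms(3) by blast
  ultimately show ?thesis unfolding degree_in_def using assms(1,2) by (simp add: card_Un_disjoint)
qed

lemma degree_in_outside: "F \<subseteq> U \<times> U \<Longrightarrow> v \<notin> U \<Longrightarrow> degree_in F v = 0"
proof -
  assume "F \<subseteq> U \<times> U" "v \<notin> U"
  then have none: "{e \<in> F. fst e = v \<or> snd e = v} = {}" by auto
  show ?thesis unfolding degree_in_def none by simp
qed

text \<open>A configuration of the union splits uniquely into its parts on \<open>A\<close>,
  \<open>U\<close> and on \<open>A'\<close>, \<open>U'\<close>. Conversely, two parts fit together
  if they agree on the sides of the common vertices, which by
  \<open>U \<inter> U' = X \<inter> Y\<close> are all visible in the states, and if their degrees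
  sum to at most two. The weights multiply since the edge sets are disjoint.\<close>

lemma table_join:
  assumes fin: "finite A" "finite A'" "finite U" "finite U'"
    and A: "A \<subseteq> U \<times> U" and A': "A' \<subseteq> U' \<times> U'" and disj: "A \<inter> A' = {}"
    and X: "X \<subseteq> U" and UU: "U \<inter> U' = X \<inter> Y"
  shows "(\<Sum>\<delta> | \<delta> \<in> digit_fun 18 X \<and> join_ok Y \<delta> \<and> sum_state \<delta> = s.
      table x A U X (left_state \<delta>) * table x A' U' (X \<inter> Y) (right_state Y \<delta>)) = table x (A \<union> A') (U \<union> U') X s"
proof -
  let ?D = "{\<delta> \<in> digit_fun 18 X. join_ok Y \<delta> \<and> sum_state \<delta> = s}"
  let ?L = "\<lambda>\<delta>. {\<kappa> \<in> configs A U. restr X (state_of \<kappa>) = left_state \<delta>}"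
  let ?R = "\<lambda>\<delta>. {\<kappa> \<in> configs A' U'. restr (X \<inter> Y) (state_of \<kappa>) = right_state Y \<delta>}"
  let ?w = "\<lambda>\<kappa> :: nat set \<times> (nat \<times> nat) set. \<Prod>e\<in>snd \<kappa>. x e"
  let ?T = "SIGMA \<delta>:?D. ?L \<delta> \<times> ?R \<delta>"
  have fX: "finite X" using X fin finite_subset by blast
  have fC: "finite (?L \<delta>)" "finite (?R \<delta>)" for \<delta> using finite_configs fin by simp_all
  have "(\<Sum>\<delta>\<in>?D. table x A U X (left_state \<delta>) * table x A' U' (X \<inter> Y) (right_state Y \<delta>))
      = (\<Sum>\<delta>\<in>?D. \<Sum>(\<kappa>, \<kappa>')\<in>?L \<delta> \<times> ?R \<delta>. ?w \<kappa> * ?w \<kappa>')"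
    unfolding table_def by (simp add: sum_product sum.cartesian_product)
  also have "\<dots> = (\<Sum>(\<delta>, \<kappa>, \<kappa>')\<in>?T. ?w \<kappa> * ?w \<kappa>')"
    by (subst sum.Sigma) (use finite_digit_fun[OF fX] fC in auto)
  also have "\<dots> = (\<Sum>\<kappa> | \<kappa> \<in> configs (A \<union> A') (U \<union> U') \<and> restr X (state_of \<kappa>) = s. ?w \<kappa>)"
  proof (rule sum.reindex_bij_witness[where
        j = "\<lambda>(\<delta>, \<kappa>, \<kappa>'). (fst \<kappa> \<union> fst \<kappa>', snd \<kappa> \<union> snd \<kappa>')" and
        i = "\<lambda>(K, F). (\<lambda>v. if v \<in> X then 9 * of_bool (v \<in> K) + 3 * degree_in (F \<inter> A) v + degree_in (F \<inter> A') v else 0,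
               (K \<inter> U, F \<inter> A), (K \<inter> U', F \<inter> A'))"])
    fix t assume t: "t \<in> ?T"
    then obtain \<delta> K F K' F' where t_def: "t = (\<delta>, (K, F), (K', F'))"
      and d: "\<delta> \<in> digit_fun 18 X" "join_ok Y \<delta>" "sum_state \<delta> = s"
      and k: "(K, F) \<in> configs A U" "restr X (state_of (K, F)) = left_state \<delta>"
      and k': "(K', F') \<in> configs A' U'" "restr (X \<inter> Y) (state_of (K', F')) = right_state Y \<delta>"
      by auto
    have KF: "K \<subseteq> U" "F \<subseteq> A" "consistent K F" "degree_in F v \<le> 2"
      and KF': "K' \<subseteq> U'" "F' \<subseteq> A'" "consistent K' F'" "degree_in F' v \<le> 2" for v
      using k(1) k'(1) by (auto simp: configs_def)
    have fF: "finite F" "finite F'" using finite_subset[OF KF(2) fin(1)] finite_subset[OF KF'(2) fin(2)] by simp_all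
    have FF': "F \<inter> F' = {}" using KF(2) KF'(2) disj by blast
    have lt: "\<delta> v < 18" for v using d by (cases "v \<in> X") (auto simp: digit_fun_iff)
    have c: "\<delta> v div 9 = of_bool (v \<in> K)" "\<delta> v div 3 mod 3 = degree_in F v" if "v \<in> X" for v
    proof -
      have "3 * of_bool (v \<in> K) + degree_in F v = 3 * (\<delta> v div 9) + \<delta> v div 3 mod 3"
        using fun_cong[OF k(2), of v] that by (simp add: restr_def state_of_def left_state_def)
      from mod3_split[OF this KF(4)] show "\<delta> v div 9 = of_bool (v \<in> K)" "\<delta> v div 3 mod 3 = degree_in F v" by simp_all
    qed
    have c': "\<delta> v div 9 = of_bool (v \<in> K')" "\<delta> v mod 3 = degree_in F' v" if "v \<in> X" "v \<in> Y" for v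
    proof -
      have "3 * of_bool (v \<in> K') + degree_in F' v = 3 * (\<delta> v div 9) + \<delta> v mod 3"
        using fun_cong[OF k'(2), of v] that by (simp add: restr_def state_of_def right_state_def)
      from mod3_split[OF this KF'(4)] show "\<delta> v div 9 = of_bool (v \<in> K')" "\<delta> v mod 3 = degree_in F' v" by simp_all
    qed
    \<comment> \<open>Outside \<open>Y\<close> the vertex is unknown to the second part and has no
      edges there; \<open>join_ok\<close> demands the matching digit zero.\<close>
    have d2: "\<delta> v mod 3 = degree_in F' v" if "v \<in> X" for v
    proof (cases "v \<in> Y")
      case False
      then have "v \<notin> U'" using that X UU by blast
      then have "degree_in F' v = 0" using degree_in_outside[OF order_trans[OF KF'(2) A']] by simp
      moreover have "\<delta> v mod 3 \<le> 2 * of_bool (v \<in> Y)" using d(2) by (simp add: join_ok_def)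
      then have "\<delta> v mod 3 = 0" using False by simp
      ultimately show ?thesis by simp
    qed (use c' that in simp)
    have agree: "v \<in> K \<longleftrightarrow> v \<in> K'" if "v \<in> U" "v \<in> U'" for v
    proof -
      have v: "v \<in> X" "v \<in> Y" using that UU by blast+
      have "of_bool (v \<in> K) = (of_bool (v \<in> K') :: nat)" using c(1)[OF v(1)] c'(1)[OF v] by (rule trans[OF sym])
      then show ?thesis by (simp only: of_bool_eq_iff)
    qed
    have KU: "(K \<union> K') \<inter> U = K" "(K \<union> K') \<inter> U' = K'" using agree KF(1) KF'(1) by blast+
    have FA: "(F \<union> F') \<inter> A = F" "(F \<union> F') \<inter> A' = F'" using KF(2) KF'(2) disj by blast+
    have dig: "(if v \<in> X then 9 * of_bool (v \<in> K \<union> K') + 3 * degree_in F v + degree_in F' v else 0) = \<delta> v" for v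
    proof (cases "v \<in> X")
      case True
      then have "v \<in> K \<union> K' \<longleftrightarrow> v \<in> K" using KU(1) X by blast
      then show ?thesis using True digit18_split[of "\<delta> v"] c[OF True] d2[OF True] by simp
    qed (use d(1) in \<open>simp add: digit_fun_iff\<close>)
    show "(\<lambda>(K, F). (\<lambda>v. if v \<in> X then 9 * of_bool (v \<in> K) + 3 * degree_in (F \<inter> A) v + degree_in (F \<inter> A') v else 0,
               (K \<inter> U, F \<inter> A), (K \<inter> U', F \<inter> A'))) ((\<lambda>(\<delta>, \<kappa>, \<kappa>'). (fst \<kappa> \<union> fst \<kappa>', snd \<kappa> \<union> snd \<kappa>')) t) = t"
      by (simp only: t_def case_prod_conv fst_conv snd_conv KU FA dig)
    have deg: "degree_in (F \<union> F') v = degree_in F v + degree_in F' v" for v by (rule degree_in_Un[OF fF FF'])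
    have deg2: "degree_in (F \<union> F') v \<le> 2" for v
    proof (cases "v \<in> X")
      case True
      have "\<delta> v div 3 mod 3 + \<delta> v mod 3 \<le> 2" using d(2) by (simp add: join_ok_def)
      then show ?thesis using c(2)[OF True] d2[OF True] deg by simp
    next
      case False
      \<comment> \<open>Vertices off the boundary lie in at most one part, so one of the two degrees
        is zero.\<close>
      then have "v \<notin> U \<or> v \<notin> U'" using UU by blast
      then have "degree_in F v = 0 \<or> degree_in F' v = 0"
        using degree_in_outside[OF order_trans[OF KF(2) A], of v]
          degree_in_outside[OF order_trans[OF KF'(2) A'], of v] by metis
      then show ?thesis using deg[of v] KF(4)[of v] KF'(4)[of v] by auto
    qed
    have cons: "consistent (K \<union> K') (F \<union> F')"
    proof (rule consistentI)
      fix e assume "e \<in> F \<union> F'"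
      then show "fst e \<in> K \<union> K' \<longleftrightarrow> snd e \<in> K \<union> K'"
      proof
        assume e: "e \<in> F"
        then have "fst e \<in> U" "snd e \<in> U" using KF(2) A by auto
        then show ?thesis using KU(1) consistentD[OF KF(3) e] by blast
      next
        assume e: "e \<in> F'"
        then have "fst e \<in> U'" "snd e \<in> U'" using KF'(2) A' by auto
        then show ?thesis using KU(2) consistentD[OF KF'(3) e] by blast
      qed
    qed
    have "(K \<union> K', F \<union> F') \<in> configs (A \<union> A') (U \<union> U')"
      using KF(1,2) KF'(1,2) cons deg2 by (simp add: configs_def) blast
    moreover have "restr X (state_of (K \<union> K', F \<union> F')) v = s v" for v
    proof (cases "v \<in> X")
      case True
      then have "v \<in> K \<union> K' \<longleftrightarrow> v \<in> K" using KU(1) X by blast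
      then show ?thesis using True c[OF True] d2[OF True] d(3)[symmetric] by (simp add: restr_def state_of_def deg sum_state_def)
    next
      case False
      then show ?thesis using d(1) d(3)[symmetric] by (simp add: restr_def sum_state_def digit_fun_iff)
    qed
    ultimately show "(\<lambda>(\<delta>, \<kappa>, \<kappa>'). (fst \<kappa> \<union> fst \<kappa>', snd \<kappa> \<union> snd \<kappa>')) t
        \<in> {\<kappa> \<in> configs (A \<union> A') (U \<union> U'). restr X (state_of \<kappa>) = s}"
      by (auto simp: t_def)
    show "?w ((\<lambda>(\<delta>, \<kappa>, \<kappa>'). (fst \<kappa> \<union> fst \<kappa>', snd \<kappa> \<union> snd \<kappa>')) t) = (\<lambda>(\<delta>, \<kappa>, \<kappa>'). ?w \<kappa> * ?w \<kappa>') t"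
      using fF FF' by (simp add: t_def prod.union_disjoint)
  next
    fix \<kappa> assume "\<kappa> \<in> {\<kappa> \<in> configs (A \<union> A') (U \<union> U'). restr X (state_of \<kappa>) = s}"
    then obtain K F where k: "\<kappa> = (K, F)" "K \<subseteq> U \<union> U'" "F \<subseteq> A \<union> A'" "consistent K F" "\<And>v. degree_in F v \<le> 2"
      and s: "restr X (state_of (K, F)) = s" by (auto simp: configs_def)
    define \<delta> where "\<delta> = (\<lambda>v. if v \<in> X then 9 * of_bool (v \<in> K) + 3 * degree_in (F \<inter> A) v + degree_in (F \<inter> A') v else 0)"
    have FF: "F = (F \<inter> A) \<union> (F \<inter> A')" using k(3) by blast
    have deg: "degree_in F v = degree_in (F \<inter> A) v + degree_in (F \<inter> A') v" for v
      by (subst FF, rule degree_in_Un) (use fin disj in auto)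
    have le: "degree_in (F \<inter> A) v + degree_in (F \<inter> A') v \<le> 2" for v using k(5)[of v] deg[of v] by simp
    have dX: "\<delta> v div 9 = of_bool (v \<in> K)" "\<delta> v div 3 mod 3 = degree_in (F \<inter> A) v"
      "\<delta> v mod 3 = degree_in (F \<inter> A') v" "\<delta> v < 18" if "v \<in> X" for v
      using digit18[of "of_bool (v \<in> K)" "degree_in (F \<inter> A) v" "degree_in (F \<inter> A') v"] le[of v] that
      by (simp_all add: \<delta>_def)
    have d0: "\<delta> v = 0" if "v \<notin> X" for v using that by (simp add: \<delta>_def)
    show "(\<lambda>(\<delta>, \<kappa>, \<kappa>'). (fst \<kappa> \<union> fst \<kappa>', snd \<kappa> \<union> snd \<kappa>'))
        ((\<lambda>(K, F). (\<lambda>v. if v \<in> X then 9 * of_bool (v \<in> K) + 3 * degree_in (F \<inter> A) v + degree_in (F \<inter> A') v else 0,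
               (K \<inter> U, F \<inter> A), (K \<inter> U', F \<inter> A'))) \<kappa>) = \<kappa>"
    proof -
      have "K \<inter> U \<union> K \<inter> U' = K" "F \<inter> A \<union> F \<inter> A' = F" using k(2,3) by blast+
      then show ?thesis by (simp add: k(1))
    qed
    have "\<delta> \<in> digit_fun 18 X" using dX(4) d0 by (simp add: digit_fun_iff)
    moreover have "join_ok Y \<delta>"
      unfolding join_ok_def
    proof (intro allI)
      fix v
      show "\<delta> v div 3 mod 3 + \<delta> v mod 3 \<le> 2 \<and> \<delta> v mod 3 \<le> 2 * of_bool (v \<in> Y)"
      proof (cases "v \<in> X")
        case True
        have "degree_in (F \<inter> A') v = 0" if "v \<notin> Y"
        proof -
          have "v \<notin> U'" using that True X UU by blast
          moreover have "F \<inter> A' \<subseteq> U' \<times> U'" using A' by blast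
          ultimately show ?thesis by (rule degree_in_outside[rotated])
        qed
        then show ?thesis using dX[OF True] le[of v] by (cases "v \<in> Y") auto
      qed (use d0 in simp)
    qed
    moreover have "sum_state \<delta> = s"
    proof
      fix v
      show "sum_state \<delta> v = s v"
        using fun_cong[OF s, of v] dX[of v] d0[of v] deg[of v]
        by (cases "v \<in> X") (simp_all add: sum_state_def restr_def state_of_def)
    qed
    moreover have "(K \<inter> U, F \<inter> A) \<in> configs A U"
    proof -
      have "consistent (K \<inter> U) (F \<inter> A)"
      proof (rule consistentI)
        fix e assume "e \<in> F \<inter> A"
        then show "fst e \<in> K \<inter> U \<longleftrightarrow> snd e \<in> K \<inter> U" using consistentD[OF k(4), of e] A by auto
      qed
      then show ?thesis using add_leD1[OF le] by (simp add: configs_def)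
    qed
    moreover have "(K \<inter> U', F \<inter> A') \<in> configs A' U'"
    proof -
      have "consistent (K \<inter> U') (F \<inter> A')"
      proof (rule consistentI)
        fix e assume "e \<in> F \<inter> A'"
        then show "fst e \<in> K \<inter> U' \<longleftrightarrow> snd e \<in> K \<inter> U'" using consistentD[OF k(4), of e] A' by auto
      qed
      then show ?thesis using add_leD2[OF le] by (simp add: configs_def)
    qed
    moreover have "restr X (state_of (K \<inter> U, F \<inter> A)) = left_state \<delta>"
    proof
      fix v
      show "restr X (state_of (K \<inter> U, F \<inter> A)) v = left_state \<delta> v"
        using dX[of v] d0[of v] X by (cases "v \<in> X") (auto simp: restr_def state_of_def left_state_def)
    qed
    moreover have "restr (X \<inter> Y) (state_of (K \<inter> U', F \<inter> A')) = right_state Y \<delta>"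
    proof
      fix v
      show "restr (X \<inter> Y) (state_of (K \<inter> U', F \<inter> A')) v = right_state Y \<delta> v"
        using dX[of v] d0[of v] UU by (cases "v \<in> X"; cases "v \<in> Y") (auto simp: restr_def state_of_def right_state_def)
    qed
    ultimately show "(\<lambda>(K, F). (\<lambda>v. if v \<in> X then 9 * of_bool (v \<in> K) + 3 * degree_in (F \<inter> A) v + degree_in (F \<inter> A') v else 0,
               (K \<inter> U, F \<inter> A), (K \<inter> U', F \<inter> A'))) \<kappa> \<in> ?T"
      by (simp add: k(1) \<delta>_def[symmetric])
  qed
  finally show ?thesis by (simp add: table_def)
qed

text \<open>The edge is either absent, leaving degree zero on arbitrary sides, or present, forcing
  degree one and equal sides. At most six entries are thus nonzero, few enough for
  \<open>edge_message\<close> to write them one by one.\<close>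

lemma table_edge:
  assumes "u \<noteq> v" "s \<in> digit_fun 6 {u, v}"
  shows "table x {(u, v)} {u, v} {u, v} s =
    (if s u mod 3 = 0 \<and> s v mod 3 = 0 then 1 else if s u = s v \<and> s u mod 3 = 1 then x (u, v) else 0)"
proof -
  let ?e = "(u, v)"
  let ?C = "{\<kappa> \<in> configs {?e} {u, v}. restr {u, v} (state_of \<kappa>) = s}"
  let ?K = "{w \<in> {u, v}. s w div 3 = 1}"
  have deg0: "degree_in {} w = 0" for w by (simp add: degree_in_def)
  have deg1: "degree_in {?e} w = (if w = u \<or> w = v then 1 else 0)" for w
  proof -
    have "{e \<in> {?e}. fst e = w \<or> snd e = w} = (if w = u \<or> w = v then {?e} else {})" by auto
    then show ?thesis by (simp add: degree_in_def)
  qed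
  have lt: "s u < 6" "s v < 6" using assms(2) by (simp_all add: digit_fun_iff)
  have out: "s w = 0" if "w \<noteq> u" "w \<noteq> v" for w using that assms(2) by (simp add: digit_fun_iff)
  have col: "(s w div 3 = 1 \<longleftrightarrow> b) \<and> s w mod 3 = d \<longleftrightarrow> s w = 3 * of_bool b + d"
    if "s w < 6" "d \<le> 1" for w b d
  proof -
    have "s w = 0 \<or> s w = 1 \<or> s w = 2 \<or> s w = 3 \<or> s w = 4 \<or> s w = 5" using that(1) by linarith
    moreover have "d = 0 \<or> d = 1" using that(2) by linarith
    ultimately show ?thesis by (cases b; elim disjE; simp)
  qed
  have K: "K = ?K \<longleftrightarrow> K \<subseteq> {u, v} \<and> (s u div 3 = 1 \<longleftrightarrow> u \<in> K) \<and> (s v div 3 = 1 \<longleftrightarrow> v \<in> K)" for K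
  proof
    assume "K = ?K"
    then have "w \<in> K \<longleftrightarrow> w \<in> {u, v} \<and> s w div 3 = 1" for w by simp
    then show "K \<subseteq> {u, v} \<and> (s u div 3 = 1 \<longleftrightarrow> u \<in> K) \<and> (s v div 3 = 1 \<longleftrightarrow> v \<in> K)" by blast
  next
    assume h: "K \<subseteq> {u, v} \<and> (s u div 3 = 1 \<longleftrightarrow> u \<in> K) \<and> (s v div 3 = 1 \<longleftrightarrow> v \<in> K)"
    show "K = ?K"
    proof (rule set_eqI)
      fix w
      show "w \<in> K \<longleftrightarrow> w \<in> ?K" using h by (cases "w = u"; cases "w = v") auto
    qed
  qed
  have st: "restr {u, v} (state_of (K, F)) = s \<longleftrightarrow>
      s u = 3 * of_bool (u \<in> K) + degree_in F u \<and> s v = 3 * of_bool (v \<in> K) + degree_in F v" for K F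
  proof
    assume h: "restr {u, v} (state_of (K, F)) = s"
    show "s u = 3 * of_bool (u \<in> K) + degree_in F u \<and> s v = 3 * of_bool (v \<in> K) + degree_in F v"
      using fun_cong[OF h, of u] fun_cong[OF h, of v] by (simp add: restr_def state_of_def)
  next
    assume h: "s u = 3 * of_bool (u \<in> K) + degree_in F u \<and> s v = 3 * of_bool (v \<in> K) + degree_in F v"
    show "restr {u, v} (state_of (K, F)) = s"
    proof
      fix w
      show "restr {u, v} (state_of (K, F)) w = s w"
        using h out[of w] by (cases "w = u"; cases "w = v") (simp_all add: restr_def state_of_def)
    qed
  qed
  have C0: "(K, {}) \<in> ?C \<longleftrightarrow> K = ?K \<and> s u mod 3 = 0 \<and> s v mod 3 = 0" for K
  proof -
    have *: "(K, {}) \<in> ?C \<longleftrightarrow> K \<subseteq> {u, v} \<and> s u = 3 * of_bool (u \<in> K) + 0 \<and> s v = 3 * of_bool (v \<in> K) + 0"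
      by (simp add: configs_def st deg0 consistent_def)
    show ?thesis
      unfolding K * col[OF lt(1) le0, symmetric] col[OF lt(2) le0, symmetric] by blast
  qed
  have C1: "(K, {?e}) \<in> ?C \<longleftrightarrow> K = ?K \<and> s u mod 3 = 1 \<and> s v mod 3 = 1 \<and> s u = s v" for K
  proof -
    have "(K, {?e}) \<in> ?C \<longleftrightarrow> K \<subseteq> {u, v} \<and> (u \<in> K \<longleftrightarrow> v \<in> K) \<and>
        s u = 3 * of_bool (u \<in> K) + 1 \<and> s v = 3 * of_bool (v \<in> K) + 1"
      by (simp add: configs_def st deg1 consistent_def conj_assoc)
    also have "\<dots> \<longleftrightarrow> K \<subseteq> {u, v} \<and> s u = s v \<and>
        s u = 3 * of_bool (u \<in> K) + 1 \<and> s v = 3 * of_bool (v \<in> K) + 1"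
      by (cases "u \<in> K"; cases "v \<in> K"; force)
    finally show ?thesis
      unfolding K col[OF lt(1) order_refl, symmetric] col[OF lt(2) order_refl, symmetric] by blast
  qed
  have split: "\<kappa> \<in> ?C \<longleftrightarrow> (\<exists>K. \<kappa> = (K, {}) \<and> (K, {}) \<in> ?C) \<or> (\<exists>K. \<kappa> = (K, {?e}) \<and> (K, {?e}) \<in> ?C)" for \<kappa>
  proof
    assume k: "\<kappa> \<in> ?C"
    obtain K F where kf: "\<kappa> = (K, F)" by (rule prod.exhaust)
    have "F \<subseteq> {?e}" using k by (simp add: kf configs_def)
    then consider "F = {}" | "F = {?e}" by blast
    then show "(\<exists>K. \<kappa> = (K, {}) \<and> (K, {}) \<in> ?C) \<or> (\<exists>K. \<kappa> = (K, {?e}) \<and> (K, {?e}) \<in> ?C)"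
    proof cases
      case 1
      then show ?thesis using k kf by (intro disjI1 exI[of _ K]) simp
    next
      case 2
      then show ?thesis using k kf by (intro disjI2 exI[of _ K]) simp
    qed
  next
    assume "(\<exists>K. \<kappa> = (K, {}) \<and> (K, {}) \<in> ?C) \<or> (\<exists>K. \<kappa> = (K, {?e}) \<and> (K, {?e}) \<in> ?C)"
    then show "\<kappa> \<in> ?C" by (elim disjE exE conjE) (simp_all only:)
  qed
  show ?thesis
  proof (cases "s u mod 3 = 0 \<and> s v mod 3 = 0")
    case True
    have "?C = {(?K, {})}"
      by (rule set_eqI, subst split, unfold C0 C1) (use True in simp)
    then show ?thesis using True unfolding table_def by simp
  next
    case False
    show ?thesis
    proof (cases "s u = s v \<and> s u mod 3 = 1")
      case True
      have "?C = {(?K, {?e})}"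
        by (rule set_eqI, subst split, unfold C0 C1) (use True False in auto)
      moreover have "s u = s v" "s v mod 3 = 1" using True by auto
      ultimately show ?thesis unfolding table_def by simp
    next
      case nt: False
      have "?C = {}"
        by (rule set_eqI, subst split, unfold C0 C1) (use False nt in auto)
      then show ?thesis using nt False unfolding table_def by (simp only: sum.empty) simp
    qed
  qed
qed

lemma table_total: "table x A U {} (\<lambda>_. 0) = (\<Sum>\<kappa>\<in>configs A U. \<Prod>e\<in>snd \<kappa>. x e)"
proof -
  have "restr {} f = (\<lambda>_. 0)" for f by (simp add: restr_def)
  then show ?thesis by (simp add: table_def)
qed

text \<open>Once consistency and the degree bound are dropped, the sum over all subsets of
  \<open>A\<close> factorises.\<close>

lemma table_le:
  assumes "finite A" "finite U"
  shows "table x A U X s \<le> 2 ^ card U * (\<Prod>e\<in>A. 1 + x e)"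
proof -
  have "table x A U X s \<le> (\<Sum>\<kappa>\<in>Pow U \<times> Pow A. \<Prod>e\<in>snd \<kappa>. x e)"
    unfolding table_def using assms by (intro sum_mono2) (auto simp: configs_def)
  also have "\<dots> = (\<Sum>K\<in>Pow U. \<Sum>F\<in>Pow A. \<Prod>e\<in>F. x e)" by (subst sum.cartesian_product) (simp add: case_prod_unfold)
  also have "\<dots> = 2 ^ card U * (\<Sum>F\<in>Pow A. \<Prod>e\<in>F. x e)" using assms by (simp add: card_Pow)
  also have "(\<Sum>F\<in>Pow A. \<Prod>e\<in>F. x e) = (\<Prod>e\<in>A. 1 + x e)"
    using prod_add[OF assms(1), of x "\<lambda>_. 1"] by (simp add: add.commute[of 1])
  finally show ?thesis .
qed

section \<open>Reading the answer off the total\<close>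

lemma poly_digit:
  fixes p :: "nat poly"
  assumes "\<And>i. coeff p i < B"
  shows "poly p B div B ^ i mod B = coeff p i"
  using assms
proof (induction p arbitrary: i)
  case (pCons a p)
  have a: "a < B" using pCons.prems[of 0] by simp
  have "coeff p i < B" for i using pCons.prems[of "Suc i"] by simp
  note IH = pCons.IH[OF this]
  show ?case
  proof (cases i)
    case 0
    then show ?thesis using a by simp
  next
    case (Suc j)
    have "(a + B * poly p B) div B = poly p B" using a by simp
    then show ?thesis using IH[of j] Suc by (simp add: div_mult2_eq)
  qed
qed simp

lemma coeff_le_poly_1:
  fixes p :: "nat poly"
  shows "coeff p i \<le> poly p 1"
proof (induction p arbitrary: i)
  case (pCons a p)
  then show ?case by (cases i) (auto intro: le_trans trans_le_add2)
qed simp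

text \<open>Higher digits only affect bits from position \<open>D\<close> on. Hence the program can
  test a digit by a single division, without isolating it modulo \<open>2 ^ D\<close>.\<close>

lemma odd_div_power_mod:
  fixes y :: nat
  assumes "k < D"
  shows "odd (y div 2 ^ k) \<longleftrightarrow> odd (y mod 2 ^ D div 2 ^ k)"
proof -
  have "odd (y mod 2 ^ D div 2 ^ k) \<longleftrightarrow> bit (take_bit D y) k" by (simp add: bit_iff_odd take_bit_eq_mod)
  also have "\<dots> \<longleftrightarrow> odd (y div 2 ^ k)" using assms unfolding bit_take_bit_iff by (simp add: bit_iff_odd)
  finally show ?thesis by simp
qed

definition linear_edge_sets :: "(nat \<times> nat) set \<Rightarrow> (nat \<times> nat) set set" where
  "linear_edge_sets E = {F. F \<subseteq> E \<and> (\<forall>v. degree_in F v \<le> 2)}"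

lemma sum_configs:
  fixes x :: "nat \<times> nat \<Rightarrow> nat"
  assumes "finite E" "finite V"
  shows "(\<Sum>\<kappa>\<in>configs E V. \<Prod>e\<in>snd \<kappa>. x e) = (\<Sum>F\<in>linear_edge_sets E. card (cuts V F) * (\<Prod>e\<in>F. x e))"
proof -
  have fin: "finite (linear_edge_sets E)"
    by (rule finite_subset[of _ "Pow E"]) (use assms in \<open>auto simp: linear_edge_sets_def\<close>)
  have "(\<Sum>F\<in>linear_edge_sets E. card (cuts V F) * (\<Prod>e\<in>F. x e)) =
      (\<Sum>F\<in>linear_edge_sets E. \<Sum>K\<in>cuts V F. \<Prod>e\<in>F. x e)" by simp
  also have "\<dots> = (\<Sum>(F, K)\<in>(SIGMA F:linear_edge_sets E. cuts V F). \<Prod>e\<in>F. x e)"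
    using fin finite_cuts[OF assms(2)] by (subst sum.Sigma) auto
  also have "\<dots> = (\<Sum>\<kappa>\<in>configs E V. \<Prod>e\<in>snd \<kappa>. x e)"
    by (rule sum.reindex_bij_witness[where i = "\<lambda>\<kappa>. (snd \<kappa>, fst \<kappa>)" and j = "\<lambda>(F, K). (K, F)"])
       (auto simp: configs_def linear_edge_sets_def cuts_def)
  finally show ?thesis by simp
qed

text \<open>This makes the total error \<open>card E / 2 ^ n\<close> at most one half.\<close>

lemma twice_card_pairs_le:
  "2 * card {(u, v). u < v \<and> v < (n::nat)} \<le> 2 ^ n"
proof (induction n)
  case (Suc n)
  have "{(u, v). u < v \<and> v < Suc n} = {(u, v). u < v \<and> v < n} \<union> (\<lambda>u. (u, n)) ` {..<n}" by auto
  moreover have "finite {(u, v). u < v \<and> v < n}"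
    by (rule finite_subset[of _ "{..<n} \<times> {..<n}"]) auto
  ultimately have "card {(u, v). u < v \<and> v < Suc n} \<le> card {(u, v). u < v \<and> v < n} + n"
    using card_Un_le[of "{(u, v). u < v \<and> v < n}" "(\<lambda>u. (u, n)) ` {..<n}"]
      card_image_le[of "{..<n}" "\<lambda>u. (u, n)"] by simp
  moreover have "2 * n \<le> 2 ^ n"
  proof (induction n)
    case (Suc n)
    then show ?case by (cases n) auto
  qed simp
  ultimately show ?case using Suc by simp
qed simp

locale extraction =
  fixes n k :: nat and E :: "(nat \<times> nat) set" and a :: "nat \<times> nat \<Rightarrow> nat"
  assumes k: "1 \<le> k" "k < n" and E: "E \<subseteq> {(u, v). u < v \<and> v < n}"
begin

text \<open>The width of a digit. There are at most \<open>2 ^ n\<close> cuts, and each random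
  polynomial has coefficient sum at most \<open>n\<close>, so all coefficients of the total together
  are at most \<open>2 ^ n * (n + 1) ^ card E\<close>. With \<open>n + 1 \<le> 2 ^ n\<close> and at
  most \<open>n ^ 2\<close> edges this is at most \<open>2 ^ (n + n ^ 3)\<close>.\<close>

definition D :: nat where "D = n ^ 3 + n + 1"

text \<open>The factor in front stands for a monomial of degree \<open>n ^ 3\<close>, which exceeds
  the degree of every product of the random polynomials. A product over \<open>F\<close> therefore
  occupies digits in the block of width \<open>n ^ 3\<close> starting at
  \<open>card F * n ^ 3\<close>, and sets of different size do not interfere.\<close>

definition variable :: "(nat \<Rightarrow> bool) \<Rightarrow> nat \<times> nat \<Rightarrow> nat" where
  "variable \<beta> e = (2 ^ D) ^ (n ^ 3) * (\<Sum>i<n. of_bool (\<beta> (a e + i)) * (2 ^ D) ^ i)"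

definition forests :: "(nat \<times> nat) set set" where
  "forests = {F \<in> linear_edge_sets E. card F = n - k \<and> forest_cuts {..<n} F}"

definition accepts :: "(nat \<Rightarrow> bool) \<Rightarrow> bool" where
  "accepts \<beta> \<longleftrightarrow> (\<exists>j<n ^ 3. odd ((\<Sum>\<kappa>\<in>configs E {..<n}. \<Prod>e\<in>snd \<kappa>. variable \<beta> e) div
     ((2 ^ D) ^ ((n - k) * n ^ 3 + j) * 2 ^ k)))"

lemma finite_E: "finite E"
  by (rule finite_subset[OF E], rule finite_subset[of _ "{..<n} \<times> {..<n}"]) auto

lemma finite_linear: "finite (linear_edge_sets E)"
  by (rule finite_subset[of _ "Pow E"]) (use finite_E in \<open>auto simp: linear_edge_sets_def\<close>)

lemma card_E: "2 * card E \<le> 2 ^ n" "card E \<le> n\<^sup>2"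
proof -
  have fin: "finite {(u, v). u < v \<and> v < n}" by (rule finite_subset[of _ "{..<n} \<times> {..<n}"]) auto
  have "card E \<le> card {(u, v). u < v \<and> v < n}" by (rule card_mono[OF fin E])
  then show "2 * card E \<le> 2 ^ n" using twice_card_pairs_le[of n] by linarith
  have "card E \<le> card ({..<n} \<times> {..<n})" by (rule card_mono) (use E in auto)
  then show "card E \<le> n\<^sup>2" by (simp add: power2_eq_square)
qed

lemma degree_prod_bit_poly:
  fixes r :: "nat \<times> nat \<Rightarrow> 'a::comm_semiring_1 poly"
  assumes "\<And>e. degree (r e) \<le> n - 1" "F \<subseteq> E"
  shows "degree (\<Prod>e\<in>F. r e) < n ^ 3"
proof -
  have fF: "finite F" using assms(2) finite_E finite_subset by blast
  have "degree (\<Prod>e\<in>F. r e) \<le> (\<Sum>e\<in>F. degree (r e))" using degree_prod_sum_le[OF fF] by (simp add: o_def)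
  also have "\<dots> \<le> card F * (n - 1)" using sum_bounded_above[of F "\<lambda>e. degree (r e)" "n - 1"] assms(1) by simp
  also have "\<dots> \<le> n\<^sup>2 * (n - 1)"
    using card_E(2) card_mono[OF finite_E assms(2)] by (intro mult_right_mono) auto
  also have "\<dots> < n\<^sup>2 * n" using k by (intro mult_strict_left_mono) auto
  finally show ?thesis by (simp add: power3_eq_cube power2_eq_square)
qed

lemma degree_bit_poly: "degree (bit_poly b n \<beta> :: 'a::comm_semiring_1 poly) \<le> n - 1"
  by (rule degree_le) (use k in \<open>auto simp: coeff_bit_poly\<close>)

definition total_poly :: "(nat \<Rightarrow> bool) \<Rightarrow> nat poly" where
  "total_poly \<beta> = (\<Sum>F\<in>linear_edge_sets E.
     of_nat (card (cuts {..<n} F)) * (\<Prod>e\<in>F. monom 1 (n ^ 3) * bit_poly (a e) n \<beta>))"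

lemma poly_total_poly:
  "poly (total_poly \<beta>) (2 ^ D) = (\<Sum>\<kappa>\<in>configs E {..<n}. \<Prod>e\<in>snd \<kappa>. variable \<beta> e)"
proof -
  have "poly (monom 1 (n ^ 3) * bit_poly (a e) n \<beta>) (2 ^ D) = variable \<beta> e" for e
    by (simp add: variable_def bit_poly_def poly_sum poly_monom)
  then show ?thesis
    by (simp add: total_poly_def sum_configs[OF finite_E] poly_sum poly_prod)
qed

lemma coeff_total_poly_less: "coeff (total_poly \<beta>) i < 2 ^ D"
proof -
  have var: "poly (monom 1 (n ^ 3) * bit_poly (a e) n \<beta> :: nat poly) 1 \<le> n" for e
  proof -
    have "poly (monom 1 (n ^ 3) * bit_poly (a e) n \<beta> :: nat poly) 1 = (\<Sum>i<n. of_bool (\<beta> (a e + i)))"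
      by (simp add: bit_poly_def poly_sum poly_monom)
    also have "\<dots> \<le> (\<Sum>i<n. 1)" by (intro sum_mono) simp
    finally show ?thesis by simp
  qed
  have "coeff (total_poly \<beta>) i \<le> poly (total_poly \<beta>) 1" by (rule coeff_le_poly_1)
  also have "\<dots> = (\<Sum>F\<in>linear_edge_sets E. card (cuts {..<n} F) *
      (\<Prod>e\<in>F. poly (monom 1 (n ^ 3) * bit_poly (a e) n \<beta>) 1))"
    by (simp add: total_poly_def poly_sum poly_prod)
  also have "\<dots> \<le> (\<Sum>F\<in>linear_edge_sets E. 2 ^ n * n ^ card F)"
  proof (intro sum_mono mult_mono)
    fix F
    have "card (cuts {..<n} F) \<le> card (Pow {..<n})" by (rule card_mono) (auto simp: cuts_def)
    then show "card (cuts {..<n} F) \<le> 2 ^ n" by (simp add: card_Pow)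
    show "(\<Prod>e\<in>F. poly (monom 1 (n ^ 3) * bit_poly (a e) n \<beta>) 1) \<le> n ^ card F"
      using prod_mono[of F "\<lambda>e. poly (monom 1 (n ^ 3) * bit_poly (a e) n \<beta>) 1" "\<lambda>_. n"] var by simp
  qed simp_all
  also have "\<dots> \<le> (\<Sum>F\<in>Pow E. 2 ^ n * n ^ card F)"
    using finite_E by (intro sum_mono2) (auto simp: linear_edge_sets_def)
  also have "\<dots> = 2 ^ n * (\<Sum>F\<in>Pow E. \<Prod>e\<in>F. n)" by (simp add: sum_distrib_left)
  also have "(\<Sum>F\<in>Pow E. \<Prod>e\<in>F. n) = (\<Prod>e\<in>E. n + 1)"
    using prod_add[OF finite_E, of "\<lambda>_. n" "\<lambda>_. 1"] by simp
  also have "2 ^ n * (\<Prod>e\<in>E. n + 1) \<le> 2 ^ n * (2 ^ n) ^ n\<^sup>2"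
  proof (intro mult_left_mono)
    have "n + 1 \<le> 2 ^ n" using Suc_leI[OF less_exp[of n]] by simp
    then have "(n + 1) ^ card E \<le> (2 ^ n) ^ card E" by (rule power_mono) simp
    also have "\<dots> \<le> (2 ^ n) ^ n\<^sup>2" using card_E(2) by (intro power_increasing) auto
    finally show "(\<Prod>e\<in>E. n + 1) \<le> (2 ^ n) ^ n\<^sup>2" by simp
  qed simp
  also have "\<dots> = 2 ^ (n + n * n\<^sup>2)" by (simp add: power_add power_mult)
  also have "\<dots> < 2 ^ D"
    by (rule power_strict_increasing) (simp_all add: D_def power3_eq_cube power2_eq_square)
  finally show ?thesis .
qed

text \<open>Sets with fewer edges end below the block, since their random part has degree less than
  \<open>n ^ 3\<close>; sets with more edges begin above it.\<close>

lemma coeff_total_poly: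
  assumes "j < n ^ 3"
  shows "coeff (total_poly \<beta>) ((n - k) * n ^ 3 + j) =
    (\<Sum>F | F \<in> linear_edge_sets E \<and> card F = n - k. card (cuts {..<n} F) * coeff (\<Prod>e\<in>F. bit_poly (a e) n \<beta>) j)"
proof -
  let ?i = "(n - k) * n ^ 3 + j"
  have summand: "coeff (of_nat c * (\<Prod>e\<in>F. monom 1 (n ^ 3) * bit_poly (a e) n \<beta>)) ?i =
      (if card F = n - k then c * coeff (\<Prod>e\<in>F. bit_poly (a e) n \<beta>) j else 0)"
    if F: "F \<in> linear_edge_sets E" for F c
  proof -
    have "(\<Prod>e\<in>F. monom (1::nat) (n ^ 3)) = monom 1 (card F * n ^ 3)"
      by (simp add: monom_power mult.commute)
    then have eq: "(\<Prod>e\<in>F. monom 1 (n ^ 3) * bit_poly (a e) n \<beta>) =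
        monom (1::nat) (card F * n ^ 3) * (\<Prod>e\<in>F. bit_poly (a e) n \<beta>)"
      by (simp only: prod.distrib)
    have deg: "degree (\<Prod>e\<in>F. bit_poly (a e) n \<beta> :: nat poly) < n ^ 3"
      using F by (intro degree_prod_bit_poly degree_bit_poly) (simp add: linear_edge_sets_def)
    have "coeff (monom (1::nat) (card F * n ^ 3) * (\<Prod>e\<in>F. bit_poly (a e) n \<beta>)) ?i =
        (if card F = n - k then coeff (\<Prod>e\<in>F. bit_poly (a e) n \<beta>) j else 0)"
    proof -
      consider "card F = n - k" | "card F < n - k" | "n - k < card F" by linarith
      then show ?thesis
      proof cases
        case 1
        then show ?thesis by (simp add: coeff_monom_mult)
      next
        case 2
        then have "Suc (card F) * n ^ 3 \<le> (n - k) * n ^ 3" by (intro mult_right_mono) auto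
        then have "n ^ 3 \<le> ?i - card F * n ^ 3" by simp
        then have "coeff (\<Prod>e\<in>F. bit_poly (a e) n \<beta> :: nat poly) (?i - card F * n ^ 3) = 0"
          using deg by (intro coeff_eq_0) linarith
        then show ?thesis using 2 by (simp add: coeff_monom_mult)
      next
        case 3
        then have "Suc (n - k) * n ^ 3 \<le> card F * n ^ 3" by (intro mult_right_mono) auto
        then have "?i < card F * n ^ 3" using assms by simp
        then show ?thesis using 3 by (simp add: coeff_monom_mult)
      qed
    qed
    then show ?thesis unfolding eq by (simp add: of_nat_poly)
  qed
  have "coeff (total_poly \<beta>) ?i = (\<Sum>F\<in>linear_edge_sets E. if card F = n - k
      then card (cuts {..<n} F) * coeff (\<Prod>e\<in>F. bit_poly (a e) n \<beta>) j else 0)"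
    unfolding total_poly_def coeff_sum by (intro sum.cong refl summand)
  also have "\<dots> = (\<Sum>F | F \<in> linear_edge_sets E \<and> card F = n - k. card (cuts {..<n} F) * coeff (\<Prod>e\<in>F. bit_poly (a e) n \<beta>) j)"
    using finite_linear by (simp add: sum.inter_filter)
  finally show ?thesis .
qed

lemma of_nat_coeff_prod_bit_poly:
  assumes "finite F"
  shows "(of_nat (coeff (\<Prod>e\<in>F. bit_poly (a e) n \<beta>) j) :: bit) = coeff (\<Prod>e\<in>F. bit_poly (a e) n \<beta>) j"
  using assms
proof (induction F arbitrary: j rule: finite_induct)
  case empty
  show ?case by (cases j) (simp_all add: coeff_1)
next
  case (insert e F)
  have "(of_nat (coeff (bit_poly (a e) n \<beta>) i) :: bit) = coeff (bit_poly (a e) n \<beta>) i" for i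
    by (simp add: coeff_bit_poly)
  then show ?case using insert by (simp add: coeff_mult)
qed

lemma of_nat_bit_eq_0: "(of_nat m :: bit) = 0 \<longleftrightarrow> even m"
  by (induction m) auto

text \<open>By \<open>cuts_parity\<close> every term of the coefficient contains the factor
  \<open>2 ^ k\<close>, with a cofactor that is odd exactly for forests. Once the factor is divided
  out, reduction modulo two leaves each forest with coefficient one.\<close>

lemma odd_total_iff:
  assumes "j < n ^ 3"
  shows "odd ((\<Sum>\<kappa>\<in>configs E {..<n}. \<Prod>e\<in>snd \<kappa>. variable \<beta> e) div ((2 ^ D) ^ ((n - k) * n ^ 3 + j) * 2 ^ k))
    \<longleftrightarrow> coeff (\<Sum>F\<in>forests. \<Prod>e\<in>F. bit_poly (a e) n \<beta> :: bit poly) j \<noteq> 0"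
proof -
  let ?i = "(n - k) * n ^ 3 + j" and ?S = "{F \<in> linear_edge_sets E. card F = n - k}"
  let ?c = "\<lambda>F. coeff (\<Prod>e\<in>F. bit_poly (a e) n \<beta> :: nat poly) j"
  have kD: "k < D" using k by (simp add: D_def)
  have fS: "finite F" if "F \<in> ?S" for F
    using that finite_E finite_subset by (auto simp: linear_edge_sets_def)
  have "\<exists>q. card (cuts {..<n} F) = 2 ^ k * q \<and> (odd q \<longleftrightarrow> forest_cuts {..<n} F)" if "F \<in> ?S" for F
    using cuts_parity[of "{..<n}" F k] fS[OF that] that k by simp
  then have "\<exists>q. \<forall>F\<in>?S. card (cuts {..<n} F) = 2 ^ k * q F \<and> (odd (q F) \<longleftrightarrow> forest_cuts {..<n} F)"
    by (intro bchoice) blast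
  then obtain q where q: "\<And>F. F \<in> ?S \<Longrightarrow> card (cuts {..<n} F) = 2 ^ k * q F \<and> (odd (q F) \<longleftrightarrow> forest_cuts {..<n} F)"
    by (elim exE) (rule that, erule bspec)
  have "coeff (total_poly \<beta>) ?i = (\<Sum>F\<in>?S. 2 ^ k * (q F * ?c F))"
    unfolding coeff_total_poly[OF assms] using q by (intro sum.cong refl) (simp add: mult.assoc)
  then have coeff: "coeff (total_poly \<beta>) ?i = 2 ^ k * (\<Sum>F\<in>?S. q F * ?c F)" by (simp add: sum_distrib_left)
  have "odd (poly (total_poly \<beta>) (2 ^ D) div ((2 ^ D) ^ ?i * 2 ^ k)) \<longleftrightarrow>
      odd (poly (total_poly \<beta>) (2 ^ D) div (2 ^ D) ^ ?i mod 2 ^ D div 2 ^ k)"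
    unfolding div_mult2_eq by (rule odd_div_power_mod[OF kD])
  also have "\<dots> \<longleftrightarrow> odd (\<Sum>F\<in>?S. q F * ?c F)"
    unfolding poly_digit[OF coeff_total_poly_less] coeff by simp
  also have "\<dots> \<longleftrightarrow> (of_nat (\<Sum>F\<in>?S. q F * ?c F) :: bit) \<noteq> 0" by (simp only: of_nat_bit_eq_0)
  also have "(of_nat (\<Sum>F\<in>?S. q F * ?c F) :: bit) = (\<Sum>F\<in>?S. if forest_cuts {..<n} F
      then coeff (\<Prod>e\<in>F. bit_poly (a e) n \<beta>) j else 0)"
    unfolding of_nat_sum
  proof (intro sum.cong refl)
    fix F assume F: "F \<in> ?S"
    have "(of_nat (q F) :: bit) = (if forest_cuts {..<n} F then 1 else 0)"
      using q[OF F] of_nat_bit_eq_0[of "q F"] by (cases "forest_cuts {..<n} F") auto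
    then show "(of_nat (q F * ?c F) :: bit) = (if forest_cuts {..<n} F then coeff (\<Prod>e\<in>F. bit_poly (a e) n \<beta>) j else 0)"
      unfolding of_nat_mult of_nat_coeff_prod_bit_poly[OF fS[OF F]] by simp
  qed
  also have "\<dots> = (\<Sum>F\<in>forests. coeff (\<Prod>e\<in>F. bit_poly (a e) n \<beta>) j)"
  proof -
    have "forests = {F \<in> ?S. forest_cuts {..<n} F}" by (auto simp: forests_def)
    moreover have "finite ?S" using finite_linear by simp
    ultimately show ?thesis by (simp only: sum.inter_filter)
  qed
  finally show ?thesis by (simp add: poly_total_poly coeff_sum)
qed

lemma accepts_iff: "accepts \<beta> \<longleftrightarrow> (\<Sum>F\<in>forests. \<Prod>e\<in>F. bit_poly (a e) n \<beta> :: bit poly) \<noteq> 0"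
proof -
  let ?p = "\<Sum>F\<in>forests. \<Prod>e\<in>F. bit_poly (a e) n \<beta> :: bit poly"
  have "coeff ?p j = 0" if "n ^ 3 \<le> j" for j
    unfolding coeff_sum
  proof (intro sum.neutral ballI coeff_eq_0)
    fix F assume "F \<in> forests"
    then have "degree (\<Prod>e\<in>F. bit_poly (a e) n \<beta> :: bit poly) < n ^ 3"
      by (intro degree_prod_bit_poly degree_bit_poly) (simp add: forests_def linear_edge_sets_def)
    then show "degree (\<Prod>e\<in>F. bit_poly (a e) n \<beta> :: bit poly) < j" using that by linarith
  qed
  then have "?p \<noteq> 0 \<longleftrightarrow> (\<exists>j<n ^ 3. coeff ?p j \<noteq> 0)"
    unfolding poly_eq_iff by (metis coeff_0 not_le_imp_less)
  then show ?thesis unfolding accepts_def using odd_total_iff by blast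
qed

lemma accepts_imp_forest: "accepts \<beta> \<Longrightarrow> forests \<noteq> {}"
  unfolding accepts_iff by auto

text \<open>The polynomials of distinct edges read disjoint blocks of \<open>n\<close> bits, and
  each of them equals a prescribed polynomial with probability at most
  \<open>1 / 2 ^ n\<close>.\<close>

lemma prob_not_accepts_le:
  assumes ne: "forests \<noteq> {}" and J: "finite J" "\<And>e. e \<in> E \<Longrightarrow> {a e..<a e + n} \<subseteq> J"
    and disj: "\<And>e e'. e \<in> E \<Longrightarrow> e' \<in> E \<Longrightarrow> e \<noteq> e' \<Longrightarrow> {a e..<a e + n} \<inter> {a e'..<a e' + n} = {}"
  shows "measure_pmf.prob (coin_flips J) {\<beta>. \<not> accepts \<beta>} \<le> 1 / 2"
proof -
  have "measure_pmf.prob (coin_flips J) {\<beta>. (\<Sum>F\<in>forests. \<Prod>e\<in>F. bit_poly (a e) n \<beta> :: bit poly) = 0}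
      \<le> card E * (1 / 2 ^ n)"
  proof (rule prob_multilinear_zero_le[OF finite_E J(1) J(2) disj])
    show "(bit_poly (a e) n \<beta> :: bit poly) = bit_poly (a e) n \<beta>'" if "e \<in> E" "\<And>i. i \<in> {a e..<a e + n} \<Longrightarrow> \<beta> i = \<beta>' i" for e \<beta> \<beta>'
      unfolding bit_poly_def by (intro sum.cong refl) (use that in simp)
    show "measure_pmf.prob (coin_flips {a e..<a e + n}) {\<beta>. (bit_poly (a e) n \<beta> :: bit poly) = c} \<le> 1 / 2 ^ n" for e c
      by (rule prob_bit_poly_le)
    show "forests \<subseteq> Pow E" by (auto simp: forests_def linear_edge_sets_def)
  qed (use ne in simp_all)
  also have "\<dots> \<le> 1 / 2"
  proof -
    have "real (2 * card E) \<le> real (2 ^ n)" using card_E(1) by (simp only: of_nat_le_iff)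
    then show ?thesis by (simp add: field_simps)
  qed
  finally show ?thesis unfolding accepts_iff by simp
qed

end

text \<open>A partition into fewer than \<open>k\<close> paths gives a forest with more than
  \<open>n - k\<close> edges, and discarding edges keeps it a linear forest. Hence a single edge
  count decides about all sizes up to \<open>k\<close>.\<close>

lemma forests_iff_path_partition:
  assumes G: "pair_graph G" "pverts G = {..<n}" and k: "1 \<le> k" "k < n"
  shows "(\<exists>S. path_partition G S \<and> card S \<le> k) \<longleftrightarrow>
    (\<exists>F. F \<in> linear_edge_sets (edges G) \<and> card F = n - k \<and> forest_cuts {..<n} F)"
proof
  assume "\<exists>S. path_partition G S \<and> card S \<le> k"
  then obtain S where S: "path_partition G S" "card S \<le> k" by blast
  define F where "F = (\<Union>p\<in>S. path_edges p)"
  note F = path_partition_forest[OF G(1) S(1), folded F_def, unfolded G(2) card_lessThan]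
  have fF: "finite F" using F(1) finite_edges[OF G(1)] finite_subset by blast
  have "n - k \<le> card F" using F(3) S(2) by linarith
  then obtain F' where F': "F' \<subseteq> F" "card F' = n - k" by (meson obtain_subset_with_card_n)
  have "forest_cuts {..<n} F'" by (rule forest_cuts_subset[OF _ fF F'(1) F(4)]) simp
  moreover have "degree_in F' v \<le> 2" for v using degree_in_mono[OF fF F'(1), of v] F(2)[of v] by linarith
  ultimately show "\<exists>F. F \<in> linear_edge_sets (edges G) \<and> card F = n - k \<and> forest_cuts {..<n} F"
    using F' F(1) by (intro exI[of _ F']) (auto simp: linear_edge_sets_def)
next
  assume "\<exists>F. F \<in> linear_edge_sets (edges G) \<and> card F = n - k \<and> forest_cuts {..<n} F"
  then obtain F where F: "F \<subseteq> edges G" "\<And>v. degree_in F v \<le> 2" "card F = n - k" "forest_cuts {..<n} F"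
    by (auto simp: linear_edge_sets_def)
  obtain S where "path_partition G S" "card S + card F = n"
    using forest_path_partition[OF G(1) F(1,2)] F(4) G(2) by auto
  then show "\<exists>S. path_partition G S \<and> card S \<le> k" using F(3) k by (intro exI[of _ S]) simp
qed

section \<open>The program\<close>

abbreviation add_exp (infixl \<open>\<^bold>+\<close> 65) where "a \<^bold>+ b \<equiv> Bop Add a b"
abbreviation sub_exp (infixl \<open>\<^bold>-\<close> 65) where "a \<^bold>- b \<equiv> Bop Sub a b"
abbreviation mul_exp (infixl \<open>\<^bold>*\<close> 70) where "a \<^bold>* b \<equiv> Bop Mul a b"
abbreviation div_exp (infixl \<open>\<^bold>'/\<close> 70) where "a \<^bold>/ b \<equiv> Bop Div a b"

text \<open>
  A state \<open>s\<close> of the vertices is addressed by \<open>\<Sum>v. s v * 6 ^ v\<close>.  As addresses only cost their length,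
  no compact indexing of the vertices of a bag is needed: it suffices to visit few addresses.
\<close>

definition code :: "nat \<Rightarrow> (nat \<Rightarrow> nat) \<Rightarrow> nat" where
  "code n s = (\<Sum>v<n. s v * 6 ^ v)"

text \<open>The rank of \<open>v\<close> in \<open>X\<close> selects the digit of \<open>j\<close>,
  so the indices below \<open>18 ^ card X\<close> enumerate the digit functions of the bag without
  renaming its vertices.\<close>

definition digits :: "nat set \<Rightarrow> nat \<Rightarrow> nat \<Rightarrow> nat" where
  "digits X j v = (if v \<in> X then j div 18 ^ card (X \<inter> {..<v}) mod 18 else 0)"

text \<open>
  Registers: 1 and 2 hold the numbers of vertices and nodes; 12 and 13 point to the masks of a bag \<open>X\<close>
  and of a set \<open>Y\<close>; 18 is the index to be expanded into the digits of the vertices of \<open>X\<close>.  The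
  results are the addresses of the left (20), right (21) and sum (22) states, and the flags
  \<open>init_ok\<close> (23), \<open>message_ok\<close> (24) and \<open>join_ok\<close> (25).
\<close>

definition expand_vertex :: prog where
  "expand_vertex =
     Asg 28 (Rg 19 \<^bold>- Rg 19 \<^bold>/ Cn 18 \<^bold>* Cn 18) ;;
     Asg 19 (Rg 19 \<^bold>/ Cn 18) ;;
     Asg 29 (Rg 28 \<^bold>/ Cn 9) ;;
     Asg 30 (Rg 28 \<^bold>/ Cn 3 \<^bold>- Rg 29 \<^bold>* Cn 3) ;;
     Asg 31 (Rg 28 \<^bold>- Rg 28 \<^bold>/ Cn 3 \<^bold>* Cn 3) ;;
     Asg 32 (Hp (Rg 13 \<^bold>+ Rg 27)) ;;
     Asg 20 (Rg 20 \<^bold>+ (Cn 3 \<^bold>* Rg 29 \<^bold>+ Rg 30) \<^bold>* Rg 26) ;;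
     Asg 21 (Rg 21 \<^bold>+ Rg 32 \<^bold>* (Cn 3 \<^bold>* Rg 29 \<^bold>+ Rg 31) \<^bold>* Rg 26) ;;
     Asg 22 (Rg 22 \<^bold>+ (Cn 3 \<^bold>* Rg 29 \<^bold>+ Rg 30 \<^bold>+ Rg 31) \<^bold>* Rg 26) ;;
     Asg 23 (Rg 23 \<^bold>* (Cn 1 \<^bold>- (Rg 30 \<^bold>+ Rg 31))) ;;
     Asg 24 (Rg 24 \<^bold>* (Cn 1 \<^bold>- ((Rg 31 \<^bold>- Rg 32 \<^bold>* Rg 30) \<^bold>+ (Rg 32 \<^bold>* Rg 30 \<^bold>- Rg 31)))) ;;
     Asg 25 (Rg 25 \<^bold>* ((Cn 1 \<^bold>- (Rg 30 \<^bold>+ Rg 31 \<^bold>- Cn 2)) \<^bold>* (Cn 1 \<^bold>- (Rg 31 \<^bold>- Cn 2 \<^bold>* Rg 32))))"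

definition expand_index :: prog where
  "expand_index =
     Asg 19 (Rg 18) ;; Asg 20 (Cn 0) ;; Asg 21 (Cn 0) ;; Asg 22 (Cn 0) ;;
     Asg 23 (Cn 1) ;; Asg 24 (Cn 1) ;; Asg 25 (Cn 1) ;; Asg 26 (Cn 1) ;;
     For False 27 (Rg 1)
       (Ifs (Hp (Rg 12 \<^bold>+ Rg 27)) expand_vertex Nop ;;
        Asg 26 (Rg 26 \<^bold>* Cn 6))"

text \<open>The number of indices is computed into register 17 by scanning the mask, and the loop
  over them is the only one with flag \<open>True\<close>. Entries are accumulated rather than
  assigned, since several indices may contribute to one address.\<close>

definition fill_table :: "prog \<Rightarrow> prog" where
  "fill_table c =
     Asg 17 (Cn 1) ;;
     For False 27 (Rg 1) (Ifs (Hp (Rg 12 \<^bold>+ Rg 27)) (Asg 17 (Rg 17 \<^bold>* Cn 18)) Nop) ;;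
     For True 18 (Rg 17) (expand_index ;; c)"

text \<open>14, 15 and 16 point to the source tables and to the new table, which is initially zero.\<close>

definition init_entry :: prog where
  "init_entry = Wr (Rg 16 \<^bold>+ Rg 22) (Hp (Rg 16 \<^bold>+ Rg 22) \<^bold>+ Rg 23)"

definition message_entry :: prog where
  "message_entry = Wr (Rg 16 \<^bold>+ Rg 21) (Hp (Rg 16 \<^bold>+ Rg 21) \<^bold>+ Rg 24 \<^bold>* Hp (Rg 14 \<^bold>+ Rg 20))"

definition join_entry :: prog where
  "join_entry = Wr (Rg 16 \<^bold>+ Rg 22)
     (Hp (Rg 16 \<^bold>+ Rg 22) \<^bold>+ Rg 25 \<^bold>* (Hp (Rg 14 \<^bold>+ Rg 20) \<^bold>* Hp (Rg 15 \<^bold>+ Rg 21)))"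

subsection \<open>Codes and digits\<close>

lemma code_Suc: "code (Suc n) s = code n s + s n * 6 ^ n"
  by (simp add: code_def)

lemma code_0: "code 0 s = 0"
  by (simp add: code_def)

lemma code_less: "(\<And>v. s v < 6) \<Longrightarrow> code n s < 6 ^ n"
proof (induction n)
  case (Suc n)
  have "Suc (s n) * 6 ^ n \<le> 6 * 6 ^ n" using Suc.prems[of n] by (intro mult_right_mono) auto
  then show ?case using Suc.IH[OF Suc.prems] by (simp only: code_Suc power_Suc mult_Suc)
qed (simp add: code_0)

text \<open>Before its flag takes effect, a sum state can be as large as 7: side 3 plus two degrees
  of two. Addresses of rejected combinations are therefore bounded by \<open>8 ^ n\<close> rather
  than \<open>6 ^ n\<close>, and tables get segments of at least this length.\<close>

lemma code_less_8: "(\<And>v. s v < 8) \<Longrightarrow> code n s < 8 ^ n"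
proof (induction n)
  case (Suc n)
  have "s n * 6 ^ n \<le> 7 * 8 ^ n" using Suc.prems[of n] by (intro mult_mono power_mono) auto
  then show ?case using Suc.IH[OF Suc.prems] by (simp only: code_Suc power_Suc; linarith)
qed (simp add: code_0)

lemma code_inj:
  assumes "s \<in> digit_fun 6 X" "s' \<in> digit_fun 6 X" "X \<subseteq> {..<n}" "code n s = code n s'"
  shows "s = s'"
proof -
  have lt: "s v < 6" "s' v < 6" for v
    using assms(1,2) by (cases "v \<in> X"; simp add: digit_fun_iff)+
  have "code n s = code n s' \<Longrightarrow> v < n \<Longrightarrow> s v = s' v" for v n
  proof (induction n)
    case (Suc n)
    have *: "s n = code (Suc n) s div 6 ^ n" "code n s = code (Suc n) s mod 6 ^ n"
      and **: "s' n = code (Suc n) s' div 6 ^ n" "code n s' = code (Suc n) s' mod 6 ^ n"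
      using code_less[of s n] code_less[of s' n] lt by (simp_all add: code_Suc)
    show ?case
    proof (cases "v = n")
      case True
      then show ?thesis using * ** Suc.prems by simp
    next
      case False
      then show ?thesis using * ** Suc by simp
    qed
  qed simp
  then have *: "s v = s' v" if "v < n" for v using assms(4) that by blast
  have "s v = s' v" for v
  proof (cases "v < n")
    case False
    then have "v \<notin> X" using assms(3) by auto
    then show ?thesis using assms(1,2) by (simp add: digit_fun_iff)
  qed (use * in simp)
  then show ?thesis by (rule ext)
qed

lemma digits_in: "digits X j \<in> digit_fun 18 X"
  by (simp add: digit_fun_iff digits_def)

lemma digits_inject:
  "j < 18 ^ c \<Longrightarrow> j' < 18 ^ c \<Longrightarrow> (\<And>i. i < c \<Longrightarrow> j div 18 ^ i mod 18 = j' div 18 ^ i mod (18::nat)) \<Longrightarrow> j = j'"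
proof (induction c arbitrary: j j')
  case (Suc c)
  have "j div 18 = j' div 18"
  proof (rule Suc.IH)
    show "j div 18 < 18 ^ c" "j' div 18 < 18 ^ c"
      using Suc.prems by (simp_all add: less_mult_imp_div_less mult.commute)
    show "j div 18 div 18 ^ i mod 18 = j' div 18 div 18 ^ i mod 18" if "i < c" for i
      using Suc.prems(3)[of "Suc i"] that by (simp add: div_mult2_eq)
  qed
  moreover have "j mod 18 = j' mod 18" using Suc.prems(3)[of 0] by simp
  ultimately show ?case by (metis div_mult_mod_eq)
qed simp

lemma bij_digits:
  assumes "finite X"
  shows "bij_betw (digits X) {..<18 ^ card X} (digit_fun 18 X)"
proof -
  define pos where "pos v = card (X \<inter> {..<v})" for v
  have mono: "pos v < pos w" if "v \<in> X" "v < w" for v w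
    unfolding pos_def using that by (intro psubset_card_mono) auto
  have "inj_on pos X"
    by (rule inj_onI) (metis mono less_irrefl linorder_neqE_nat)
  moreover have "pos ` X \<subseteq> {..<card X}"
  proof
    fix i assume "i \<in> pos ` X"
    then obtain v where "v \<in> X" "i = pos v" by blast
    then show "i \<in> {..<card X}" unfolding pos_def using assms by (auto intro!: psubset_card_mono)
  qed
  ultimately have pos: "pos ` X = {..<card X}"
    using assms by (intro card_subset_eq) (simp_all add: card_image)
  have "inj_on (digits X) {..<18 ^ card X}"
  proof (rule inj_onI)
    fix j j' assume j: "j \<in> {..<18 ^ card X}" "j' \<in> {..<18 ^ card X}" and eq: "digits X j = digits X j'"
    show "j = j'"
    proof (rule digits_inject[of _ "card X"])
      fix i assume "i < card X"
      then obtain v where "v \<in> X" "i = pos v" using pos by (metis imageE lessThan_iff)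
      then show "j div 18 ^ i mod 18 = j' div 18 ^ i mod 18"
        using fun_cong[OF eq, of v] by (simp add: digits_def pos_def)
    qed (use j in simp_all)
  qed
  moreover have "digits X ` {..<18 ^ card X} = digit_fun 18 X"
  proof (rule card_subset_eq)
    show "card (digits X ` {..<18 ^ card X}) = card (digit_fun 18 X)"
      using \<open>inj_on (digits X) _\<close> by (simp add: card_image card_digit_fun[OF assms])
  qed (use digits_in finite_digit_fun[OF assms] in auto)
  ultimately show ?thesis by (simp add: bij_betw_def)
qed

lemma left_state_in: "\<delta> \<in> digit_fun 18 X \<Longrightarrow> left_state \<delta> \<in> digit_fun 6 X"
proof -
  assume d: "\<delta> \<in> digit_fun 18 X"
  have "left_state \<delta> v < 6" for v
  proof -
    have "\<delta> v < 18" using d by (cases "v \<in> X") (simp_all add: digit_fun_iff)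
    then have "\<delta> v div 9 \<le> 1" using less_mult_imp_div_less[of "\<delta> v" 2 9] by simp
    moreover have "\<delta> v div 3 mod 3 \<le> 2" by simp
    ultimately show ?thesis unfolding left_state_def by linarith
  qed
  then show ?thesis using d by (simp add: digit_fun_iff left_state_def)
qed

lemma right_state_in: "\<delta> \<in> digit_fun 18 X \<Longrightarrow> right_state Y \<delta> \<in> digit_fun 6 (X \<inter> Y)"
proof -
  assume d: "\<delta> \<in> digit_fun 18 X"
  have "right_state Y \<delta> v < 6" for v
  proof -
    have "\<delta> v < 18" using d by (cases "v \<in> X") (simp_all add: digit_fun_iff)
    then have "\<delta> v div 9 \<le> 1" using less_mult_imp_div_less[of "\<delta> v" 2 9] by simp
    moreover have "\<delta> v mod 3 \<le> 2" by simp
    ultimately have "3 * (\<delta> v div 9) + \<delta> v mod 3 < 6" by linarith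
    then show ?thesis by (cases "v \<in> Y") (simp_all add: right_state_def)
  qed
  moreover have "right_state Y \<delta> v = 0" if "v \<notin> X \<inter> Y" for v
    using d that by (cases "v \<in> X") (auto simp: right_state_def digit_fun_iff)
  ultimately show ?thesis by (simp add: digit_fun_iff)
qed

lemma sum_state_less: "\<delta> \<in> digit_fun 18 X \<Longrightarrow> sum_state \<delta> v < 8"
proof -
  assume d: "\<delta> \<in> digit_fun 18 X"
  have "\<delta> v < 18" using d by (cases "v \<in> X") (simp_all add: digit_fun_iff)
  then have "\<delta> v div 9 \<le> 1" using less_mult_imp_div_less[of "\<delta> v" 2 9] by simp
  moreover have "\<delta> v mod 3 \<le> 2" "\<delta> v div 3 mod 3 \<le> 2" by simp_all
  ultimately show ?thesis unfolding sum_state_def by linarith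
qed

lemma sum_state_in:
  assumes d: "\<delta> \<in> digit_fun 18 X" and ok: "\<And>v. \<delta> v div 3 mod 3 + \<delta> v mod 3 \<le> 2"
  shows "sum_state \<delta> \<in> digit_fun 6 X"
proof -
  have "sum_state \<delta> v < 6" for v
  proof -
    have "\<delta> v < 18" using d by (cases "v \<in> X") (simp_all add: digit_fun_iff)
    then have "\<delta> v div 9 \<le> 1" using less_mult_imp_div_less[of "\<delta> v" 2 9] by simp
    then show ?thesis unfolding sum_state_def using ok[of v] by linarith
  qed
  then show ?thesis using d by (simp add: digit_fun_iff sum_state_def)
qed

subsection \<open>Filling a table\<close>

locale bounds =
  fixes n l W E :: nat
  assumes n: "1 \<le> n" "n \<le> W" and l: "18 ^ n < (2::nat) ^ l"
begin

abbreviation triple where "triple c R H Q \<equiv> wp l W E c R H Q"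

lemma small: "(x::nat) \<le> 18 \<Longrightarrow> x < 2 ^ l"
  using l power_increasing[OF n(1), of "18::nat"] by simp

lemma below: "(x::nat) \<le> 18 ^ n \<Longrightarrow> x < 2 ^ l"
  using l by simp

lemma div3_sub: "g div 3 - g div 9 * 3 = g div 3 mod (3::nat)"
proof -
  have "g div 9 = g div 3 div 3" by (simp add: div_mult2_eq[symmetric])
  then show ?thesis by (simp add: minus_div_mult_eq_mod)
qed

text \<open>The index is consumed from its least significant digit, one digit per vertex of the
  mask, while register 26 runs through the powers of six for all vertices. The flags are products of
  zero-one factors, each a comparison expressed by truncated subtraction from one.\<close>

lemma wp_expand_index:
  assumes R: "R 1 = n" "R 18 = j" "j < 18 ^ n"
    and X: "X = {v. v < n \<and> H (R 12 + v) \<noteq> 0}" and Y: "\<And>v. v < n \<Longrightarrow> H (R 13 + v) = of_bool (v \<in> Y)"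
  defines "\<delta> \<equiv> digits X j"
  assumes post: "\<And>R'. (\<And>r. r < 19 \<or> 32 < r \<Longrightarrow> R' r = R r) \<Longrightarrow>
      R' 20 = code n (left_state \<delta>) \<Longrightarrow> R' 21 = code n (right_state Y \<delta>) \<Longrightarrow> R' 22 = code n (sum_state \<delta>) \<Longrightarrow>
      R' 23 = of_bool (init_ok \<delta>) \<Longrightarrow> R' 24 = of_bool (message_ok Y \<delta>) \<Longrightarrow> R' 25 = of_bool (join_ok Y \<delta>) \<Longrightarrow> Q R' H"
  shows "triple expand_index R H Q"
proof -
  define I where "I v R' H' \<longleftrightarrow> H' = H \<and> (\<forall>r. r < 19 \<or> 32 < r \<longrightarrow> R' r = R r) \<and>
      R' 19 = j div 18 ^ card (X \<inter> {..<v}) \<and> R' 26 = 6 ^ v \<and>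
      R' 20 = code v (left_state \<delta>) \<and> R' 21 = code v (right_state Y \<delta>) \<and> R' 22 = code v (sum_state \<delta>) \<and>
      R' 23 = of_bool (\<forall>w<v. \<delta> w div 3 mod 3 + \<delta> w mod 3 = 0) \<and>
      R' 24 = of_bool (\<forall>w<v. \<delta> w mod 3 = of_bool (w \<in> Y) * (\<delta> w div 3 mod 3)) \<and>
      R' 25 = of_bool (\<forall>w<v. \<delta> w div 3 mod 3 + \<delta> w mod 3 \<le> 2 \<and> \<delta> w mod 3 \<le> 2 * of_bool (w \<in> Y))"
    for v :: nat and R' H' :: store
  have finX: "finite X" by (simp add: X)
  have din: "\<delta> \<in> digit_fun 18 X" unfolding \<delta>_def by (rule digits_in)
  have pow: "6 ^ v \<le> (18::nat) ^ n" "8 ^ v \<le> (18::nat) ^ n" if "v \<le> n" for v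
  proof -
    have "(8::nat) ^ v \<le> 18 ^ v" by (rule power_mono) auto
    also have "\<dots> \<le> 18 ^ n" using that by (intro power_increasing) auto
    finally show "8 ^ v \<le> (18::nat) ^ n" .
    have "(6::nat) ^ v \<le> 18 ^ v" by (rule power_mono) auto
    also have "\<dots> \<le> 18 ^ n" using that by (intro power_increasing) auto
    finally show "6 ^ v \<le> (18::nat) ^ n" .
  qed
  have sl: "left_state \<delta> v < 8" "right_state Y \<delta> v < 8" "sum_state \<delta> v < 8" for v
  proof -
    show "sum_state \<delta> v < 8" by (rule sum_state_less[OF din])
    then show "left_state \<delta> v < 8" by (simp add: sum_state_def left_state_def)
    have "right_state Y \<delta> v < 6" using right_state_in[OF din, of Y] by (cases "v \<in> X \<inter> Y") (auto simp: digit_fun_iff)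
    then show "right_state Y \<delta> v < 8" by simp
  qed
  have codes: "code v (left_state \<delta>) < 2 ^ l" "code v (right_state Y \<delta>) < 2 ^ l" "code v (sum_state \<delta>) < 2 ^ l"
    if "v \<le> n" for v
    using code_less_8[of "left_state \<delta>" v] code_less_8[of "right_state Y \<delta>" v] code_less_8[of "sum_state \<delta>" v]
      sl pow(2)[OF that] l by (meson less_le_trans less_trans)+
  have step: "triple (Ifs (Hp (Rg 12 \<^bold>+ Rg 27)) expand_vertex Nop ;; Asg 26 (Rg 26 \<^bold>* Cn 6)) (R'(27 := v)) H' (I (Suc v))"
    if v: "v < n" and I: "I v R' H'" for v R' H'
  proof -
    have [simp]: "H' = H" and fr: "\<And>r. r < 19 \<or> 32 < r \<Longrightarrow> R' r = R r"
      and r19: "R' 19 = j div 18 ^ card (X \<inter> {..<v})" and r26: "R' 26 = 6 ^ v"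
      using I unfolding I_def by blast+
    have [simp]: "R' 12 = R 12" "R' 13 = R 13" using fr by simp_all
    have six: "6 ^ v * 6 < (2::nat) ^ l" using below[OF pow(1)[of "Suc v"]] v by simp
    have all: "(\<forall>w<Suc v. P w) \<longleftrightarrow> (\<forall>w<v. P w) \<and> P v" for P :: "nat \<Rightarrow> bool" by (auto simp: less_Suc_eq)
    show ?thesis
    proof (cases "v \<in> X")
      case False
      then have h0: "H (R 12 + v) = 0" using v by (simp add: X)
      have d0: "\<delta> v = 0" using False by (simp add: \<delta>_def digits_def)
      have "X \<inter> {..<Suc v} = X \<inter> {..<v}" using False by (auto simp: less_Suc_eq)
      then have "I (Suc v) (R'(27 := v, 26 := R' 26 * 6)) H"
        using I by (simp add: I_def all d0 code_Suc left_state_def right_state_def sum_state_def)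
      then show ?thesis using six by (simp add: h0 r26)
    next
      case True
      then have h1: "H (R 12 + v) \<noteq> 0" by (simp add: X)
      define g where "g = \<delta> v"
      have g: "R' 19 mod 18 = g" using True by (simp add: g_def \<delta>_def digits_def r19)
      have g18: "g < 18" using True din by (simp add: g_def digit_fun_iff)
      have g9: "g div 9 \<le> 1" using less_mult_imp_div_less[of g 2 9] g18 by simp
      have c: "X \<inter> {..<Suc v} = insert v (X \<inter> {..<v})" using True by (auto simp: less_Suc_eq)
      have r19': "R' 19 div 18 = j div 18 ^ card (X \<inter> {..<Suc v})"
        unfolding c r19 using finX by (simp add: div_mult2_eq[symmetric] mult.commute)
      have b19: "R' 19 div 18 < 2 ^ l"
        unfolding r19 using R(3) l by (meson div_le_dividend le_less_trans less_trans)
      define y where "y = (of_bool (v \<in> Y) :: nat)"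
      have hy: "H (R 13 + v) = y" using Y v by (simp add: y_def)
      define d where "d = g div 3 mod 3"
      define d' where "d' = g mod 3"
      have ls: "left_state \<delta> v = 3 * (g div 9) + d" and rs: "right_state Y \<delta> v = y * (3 * (g div 9) + d')"
        and ss: "sum_state \<delta> v = 3 * (g div 9) + d + d'"
        by (simp_all add: left_state_def right_state_def sum_state_def g_def d_def d'_def y_def)
      have cs: "code (Suc v) (left_state \<delta>) = R' 20 + (3 * (g div 9) + d) * 6 ^ v"
        "code (Suc v) (right_state Y \<delta>) = R' 21 + y * (3 * (g div 9) + d') * 6 ^ v"
        "code (Suc v) (sum_state \<delta>) = R' 22 + (3 * (g div 9) + d + d') * 6 ^ v"
        using I by (simp_all only: I_def code_Suc ls rs ss)
      have cb: "R' 20 + (3 * (g div 9) + d) * 6 ^ v < 2 ^ l" "R' 21 + y * (3 * (g div 9) + d') * 6 ^ v < 2 ^ l"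
        "R' 22 + (3 * (g div 9) + d + d') * 6 ^ v < 2 ^ l"
        using codes[of "Suc v"] v unfolding cs by simp_all
      define b1 where "b1 \<longleftrightarrow> d + d' = 0"
      define b2 where "b2 \<longleftrightarrow> d' = y * d"
      define b3 where "b3 \<longleftrightarrow> d + d' \<le> 2 \<and> d' \<le> 2 * y"
      have e1: "1 - (d + d') = of_bool b1" and e2: "1 - ((d' - y * d) + (y * d - d')) = of_bool b2"
        and e3: "(1 - (d + d' - 2)) * (1 - (d' - 2 * y)) = of_bool b3"
        by (auto simp: b1_def b2_def b3_def of_bool_def)
      have f: "R' 23 * (1 - (d + d')) = of_bool (\<forall>w<Suc v. \<delta> w div 3 mod 3 + \<delta> w mod 3 = 0)"
        "R' 24 * (1 - ((d' - y * d) + (y * d - d'))) = of_bool (\<forall>w<Suc v. \<delta> w mod 3 = of_bool (w \<in> Y) * (\<delta> w div 3 mod 3))"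
        "R' 25 * ((1 - (d + d' - 2)) * (1 - (d' - 2 * y))) =
           of_bool (\<forall>w<Suc v. \<delta> w div 3 mod 3 + \<delta> w mod 3 \<le> 2 \<and> \<delta> w mod 3 \<le> 2 * of_bool (w \<in> Y))"
        unfolding e1 e2 e3 unfolding all b1_def b2_def b3_def d_def d'_def g_def y_def
        using I by (simp_all only: I_def of_bool_conj)
      let ?R = "R'(27 := v, 28 := g, 19 := R' 19 div 18, 29 := g div 9, 30 := d, 31 := d', 32 := y,
         20 := R' 20 + (3 * (g div 9) + d) * 6 ^ v, 21 := R' 21 + y * (3 * (g div 9) + d') * 6 ^ v,
         22 := R' 22 + (3 * (g div 9) + d + d') * 6 ^ v, 23 := R' 23 * (1 - (d + d')),
         24 := R' 24 * (1 - ((d' - y * d) + (y * d - d'))),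
         25 := R' 25 * ((1 - (d + d' - 2)) * (1 - (d' - 2 * y))), 26 := 6 ^ v * 6)"
      have "I (Suc v) ?R H"
        unfolding I_def f[symmetric] cs r19'[symmetric] by (simp add: fr)
      moreover have "d \<le> 2" "d' \<le> 2" "y \<le> 1" by (simp_all add: d_def d'_def y_def)
      then have "g < 2 ^ l" "g div 9 < 2 ^ l" "d < 2 ^ l" "d' < 2 ^ l" "y < 2 ^ l"
        using g18 g9 by (auto intro: small)
      moreover have "R' 23 * (1 - (d + d')) < 2 ^ l" "R' 24 * (1 - ((d' - y * d) + (y * d - d'))) < 2 ^ l"
        "R' 25 * ((1 - (d + d' - 2)) * (1 - (d' - 2 * y))) < 2 ^ l"
        unfolding f by (auto intro: small)
      ultimately show ?thesis
        using h1 cb six b19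
        by (simp add: expand_vertex_def g hy r26 div3_sub minus_div_mult_eq_mod d_def[symmetric] d'_def[symmetric])
    qed
  qed
  have "triple (For False 27 (Rg 1)
       (Ifs (Hp (Rg 12 \<^bold>+ Rg 27)) expand_vertex Nop ;; Asg 26 (Rg 26 \<^bold>* Cn 6)))
     (R(19 := j, 20 := 0, 21 := 0, 22 := 0, 23 := 1, 24 := 1, 25 := 1, 26 := 1)) H Q"
  proof (rule wp_For[where I = I and n = n])
    show "I 0 (R(19 := j, 20 := 0, 21 := 0, 22 := 0, 23 := 1, 24 := 1, 25 := 1, 26 := 1)) H"
      by (simp add: I_def code_0)
    show "triple (Ifs (Hp (Rg 12 \<^bold>+ Rg 27)) expand_vertex Nop ;; Asg 26 (Rg 26 \<^bold>* Cn 6)) (R'(27 := v)) H' (I (Suc v))"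
      if "v < n" "I v R' H'" for v R' H' by (rule step[OF that])
    fix R' H' assume I: "I n R' H'"
    \<comment> \<open>Digits beyond \<open>n\<close> are zero and satisfy each condition, so the
      flags computed over the first \<open>n\<close> vertices express the conditions over all of
      them.\<close>
    have out: "\<delta> w = 0" if "n \<le> w" for w using that by (simp add: \<delta>_def digits_def X)
    have ext: "(\<forall>w<n. P (\<delta> w) w) \<longleftrightarrow> (\<forall>w. P (\<delta> w) w)" if "\<And>w. P 0 w" for P :: "nat \<Rightarrow> nat \<Rightarrow> bool"
      using out that by (metis not_le_imp_less)
    have fr: "R' r = R r" if "r < 19 \<or> 32 < r" for r using I that unfolding I_def by blast
    have "Q R' H"
      using I ext[of "\<lambda>d w. d div 3 mod 3 + d mod 3 = 0"] ext[of "\<lambda>d w. d mod 3 = of_bool (w \<in> Y) * (d div 3 mod 3)"]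
        ext[of "\<lambda>d w. d div 3 mod 3 + d mod 3 \<le> 2 \<and> d mod 3 \<le> 2 * of_bool (w \<in> Y)"]
      by (intro post[OF fr]) (simp_all add: I_def init_ok_def message_ok_def join_ok_def)
    then show "Q R' H'" using I by (simp add: I_def)
  qed (use R n in simp_all)
  moreover have "j < 2 ^ l" using R(3) l by simp
  ultimately show ?thesis using R small by (simp add: expand_index_def)
qed

text \<open>The common core of all table operations: index \<open>j\<close> adds
  \<open>val j\<close> at address \<open>idx j\<close> of a segment of zeros. At most
  \<open>18 ^ n\<close> values are added, so \<open>18 ^ n * B < 2 ^ l\<close> keeps partial sums
  storable, and \<open>idx j < 8 ^ n\<close> keeps the heap behind the segment zero for the next
  table.\<close>

lemma wp_fill_table:
  assumes c: "c = Wr (Rg 16 \<^bold>+ Rg ri) (Hp (Rg 16 \<^bold>+ Rg ri) \<^bold>+ e)"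
    and R: "R 1 = n" "R 16 = D" and fresh: "\<And>a. D \<le> a \<Longrightarrow> H a = 0"
    and X: "X = {v. v < n \<and> H (R 12 + v) \<noteq> 0}" "18 ^ card X \<le> E"
    and Y: "\<And>v. v < n \<Longrightarrow> H (R 13 + v) = of_bool (v \<in> Y)"
    and masks: "R 12 + n \<le> D" "R 13 + n \<le> D"
    and entry: "\<And>j R' H' \<delta>. j < 18 ^ card X \<Longrightarrow> \<delta> = digits X j \<Longrightarrow> (\<And>r. r < 17 \<or> 32 < r \<Longrightarrow> R' r = R r) \<Longrightarrow>
      (\<And>a. a < D \<Longrightarrow> H' a = H a) \<Longrightarrow>
      R' 20 = code n (left_state \<delta>) \<Longrightarrow> R' 21 = code n (right_state Y \<delta>) \<Longrightarrow> R' 22 = code n (sum_state \<delta>) \<Longrightarrow>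
      R' 23 = of_bool (init_ok \<delta>) \<Longrightarrow> R' 24 = of_bool (message_ok Y \<delta>) \<Longrightarrow> R' 25 = of_bool (join_ok Y \<delta>) \<Longrightarrow>
      R' ri = idx j \<and> eval_exp e R' H' = val j"
    and small_idx: "\<And>j. j < 18 ^ card X \<Longrightarrow> idx j < 8 ^ n"
    and small_val: "\<And>j. j < 18 ^ card X \<Longrightarrow> val j \<le> B" "18 ^ n * B < 2 ^ l"
    and post: "\<And>R' H'. (\<And>r. r < 17 \<or> 32 < r \<Longrightarrow> R' r = R r) \<Longrightarrow> (\<And>a. a < D \<Longrightarrow> H' a = H a) \<Longrightarrow>
      (\<And>i. H' (D + i) = (\<Sum>j<18 ^ card X. of_bool (idx j = i) * val j)) \<Longrightarrow>
      (\<And>a. D + 8 ^ n \<le> a \<Longrightarrow> H' a = 0) \<Longrightarrow> Q R' H'"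
  shows "triple (fill_table c) R H Q"
proof -
  have finX: "finite X" and Xn: "X \<subseteq> {..<n}" by (auto simp: X)
  have cX: "card X \<le> n" using card_mono[OF _ Xn] by simp
  have pX: "18 ^ card X \<le> (18::nat) ^ n" using cX by (rule power_increasing) simp
  define I where "I v R' H' \<longleftrightarrow> H' = H \<and> (\<forall>r. r < 17 \<or> 32 < r \<longrightarrow> R' r = R r) \<and> R' 17 = 18 ^ card (X \<inter> {..<v})"
    for v :: nat and R' H' :: store
  define J where "J j R' H' \<longleftrightarrow> (\<forall>r. r < 17 \<or> 32 < r \<longrightarrow> R' r = R r) \<and> (\<forall>a<D. H' a = H a) \<and>
      (\<forall>i. H' (D + i) = (\<Sum>j<j. of_bool (idx j = i) * val j))" for j :: nat and R' H' :: store
  have loop: "triple (For True 18 (Rg 17) (expand_index ;; c)) R' H' Q" if I: "I n R' H'" for R' H'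
  proof (rule wp_For[where I = J and n = "18 ^ card X"])
    have XX: "X \<inter> {..<n} = X" using Xn by blast
    show "J 0 R' H'" using I fresh by (simp add: I_def J_def)
    show "eval_exp (Rg 17) R' H' = 18 ^ card X" using I XX by (simp add: I_def)
    show "18 ^ card X \<le> (if True then E else W)" using X(2) by simp
    show "triple (expand_index ;; c) (R'(18 := j)) H' (J (Suc j))" if j: "j < 18 ^ card X" and J: "J j R' H'" for j R' H'
    proof -
      have fr: "R' r = R r" if "r < 17 \<or> 32 < r" for r using J that unfolding J_def by blast
      have low: "H' a = H a" if "a < D" for a using J that unfolding J_def by blast
      have mX: "H' (R 12 + v) = H (R 12 + v)" and mY: "H' (R 13 + v) = H (R 13 + v)" if "v < n" for v
        using low masks that by simp_all
      have "triple expand_index (R'(18 := j)) H' (\<lambda>R'' H''. triple c R'' H'' (J (Suc j)))"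
      proof (rule wp_expand_index[where j = j and X = X and Y = Y])
        show "X = {v. v < n \<and> H' ((R'(18 := j)) 12 + v) \<noteq> 0}" using mX fr by (auto simp: X)
        show "H' ((R'(18 := j)) 13 + v) = of_bool (v \<in> Y)" if "v < n" for v using mY[OF that] Y[OF that] fr by simp
        fix R'' assume fr': "\<And>r. r < 19 \<or> 32 < r \<Longrightarrow> R'' r = (R'(18 := j)) r"
          and d: "R'' 20 = code n (left_state (digits X j))" "R'' 21 = code n (right_state Y (digits X j))"
            "R'' 22 = code n (sum_state (digits X j))" "R'' 23 = of_bool (init_ok (digits X j))"
            "R'' 24 = of_bool (message_ok Y (digits X j))" "R'' 25 = of_bool (join_ok Y (digits X j))"
        have fr'': "R'' r = R r" if "r < 17 \<or> 32 < r" for r using fr'[of r] fr[of r] that by auto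
        have ev: "R'' ri = idx j" "eval_exp e R'' H' = val j" using entry[OF j refl fr'' low d] by blast+
        have "(\<Sum>i<j. of_bool (idx i = idx j) * val i) \<le> (\<Sum>i<j. B)"
        proof (intro sum_mono)
          fix i assume "i \<in> {..<j}"
          then have "val i \<le> B" using j small_val(1)[of i] by simp
          then show "of_bool (idx i = idx j) * val i \<le> B" by (cases "idx i = idx j") simp_all
        qed
        then have "(\<Sum>i<j. of_bool (idx i = idx j) * val i) + val j \<le> Suc j * B"
          using small_val(1)[OF j] by simp
        also have "\<dots> \<le> 18 ^ n * B" by (rule mult_right_mono[OF order_trans[OF Suc_leI[OF j] pX]]) simp
        finally have lt: "H' (D + idx j) + val j < 2 ^ l" using small_val(2) J by (simp add: J_def)
        have r16: "R'' 16 = D" using fr'' R by simp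
        have "J (Suc j) R'' (H'(D + idx j := H' (D + idx j) + val j))"
          using J fr'' by (auto simp: J_def)
        then show "triple c R'' H' (J (Suc j))" using lt ev r16 by (simp add: c)
      next
        show "j < 18 ^ n" by (rule less_le_trans[OF j pX])
      qed (use R fr in simp_all)
      then show ?thesis by simp
    qed
    fix R' H' assume J: "J (18 ^ card X) R' H'"
    show "Q R' H'"
    proof (rule post)
      show "H' (D + i) = (\<Sum>j<18 ^ card X. of_bool (idx j = i) * val j)" for i using J by (simp add: J_def)
      fix a assume a: "D + 8 ^ n \<le> a"
      then obtain i where i: "a = D + i" "8 ^ n \<le> i" by (metis add.assoc add_leD1 le_Suc_ex le_add1)
      have "(\<Sum>j<18 ^ card X. of_bool (idx j = i) * val j) = 0"
      proof (intro sum.neutral ballI)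
        fix j :: nat assume "j \<in> {..<18 ^ card X}"
        then have "idx j \<noteq> i" using small_idx[of j] i(2) by auto
        then show "of_bool (idx j = i) * val j = 0" by simp
      qed
      then show "H' a = 0" using J i by (simp add: J_def)
    next
      show "R' r = R r" if "r < 17 \<or> 32 < r" for r using J that unfolding J_def by blast
      show "H' a = H a" if "a < D" for a using J that unfolding J_def by blast
    qed
  qed
  have "triple (For False 27 (Rg 1) (Ifs (Hp (Rg 12 \<^bold>+ Rg 27)) (Asg 17 (Rg 17 \<^bold>* Cn 18)) Nop))
      (R(17 := 1)) H (\<lambda>R' H'. triple (For True 18 (Rg 17) (expand_index ;; c)) R' H' Q)"
  proof (rule wp_For[where I = I and n = n])
    show "I 0 (R(17 := 1)) H" by (simp add: I_def)
    show "triple (Ifs (Hp (Rg 12 \<^bold>+ Rg 27)) (Asg 17 (Rg 17 \<^bold>* Cn 18)) Nop) (R'(27 := v)) H' (I (Suc v))"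
      if v: "v < n" and I: "I v R' H'" for v R' H'
    proof -
      have H: "H' = H" and fr: "\<And>r. r < 17 \<or> 32 < r \<Longrightarrow> R' r = R r" and r17: "R' 17 = 18 ^ card (X \<inter> {..<v})"
        using I unfolding I_def by blast+
      have r12: "R' 12 = R 12" using fr by simp
      show ?thesis
      proof (cases "v \<in> X")
        case True
        have "X \<inter> {..<Suc v} = insert v (X \<inter> {..<v})" using True by (auto simp: less_Suc_eq)
        then have p: "18 ^ card (X \<inter> {..<v}) * 18 = (18::nat) ^ card (X \<inter> {..<Suc v})" using finX by simp
        have "card (X \<inter> {..<Suc v}) \<le> n" using card_mono[OF finX, of "X \<inter> {..<Suc v}"] cX by simp
        then have "(18::nat) ^ card (X \<inter> {..<Suc v}) \<le> 18 ^ n" by (rule power_increasing) simp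
        then have "(18::nat) ^ card (X \<inter> {..<Suc v}) < 2 ^ l" by (rule below)
        moreover have "I (Suc v) (R'(27 := v, 17 := 18 ^ card (X \<inter> {..<Suc v}))) H" using fr by (simp add: I_def)
        moreover have "H (R 12 + v) \<noteq> 0" using True by (simp add: X(1))
        ultimately show ?thesis by (simp add: H r12 r17 p)
      next
        case False
        then have "X \<inter> {..<Suc v} = X \<inter> {..<v}" by (auto simp: less_Suc_eq)
        then have "I (Suc v) (R'(27 := v)) H" using I by (simp add: I_def)
        moreover have "H (R 12 + v) = 0" using False v by (simp add: X(1))
        ultimately show ?thesis by (simp add: H r12)
      qed
    qed
  qed (use R n loop in simp_all)
  then show ?thesis using small by (simp add: fill_table_def)
qed

text \<open>Rejected digit functions may collide with genuine addresses but contribute zero; on the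
  accepted ones \<open>code\<close> is injective.\<close>

lemma sum_digits:
  assumes "finite X" "Z \<subseteq> {..<n}" "s \<in> digit_fun 6 Z"
    and st: "\<And>\<delta>. \<delta> \<in> digit_fun 18 X \<Longrightarrow> ok \<delta> \<Longrightarrow> st \<delta> \<in> digit_fun 6 Z"
  shows "(\<Sum>j<18 ^ card X. of_bool (code n (st (digits X j)) = code n s) * (of_bool (ok (digits X j)) * h (digits X j))) =
    (\<Sum>\<delta> | \<delta> \<in> digit_fun 18 X \<and> ok \<delta> \<and> st \<delta> = s. (h \<delta> :: nat))"
proof -
  have "(\<Sum>j<18 ^ card X. of_bool (code n (st (digits X j)) = code n s) * (of_bool (ok (digits X j)) * h (digits X j))) =
      (\<Sum>\<delta>\<in>digit_fun 18 X. of_bool (code n (st \<delta>) = code n s) * (of_bool (ok \<delta>) * h \<delta>))"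
    by (rule sum.reindex_bij_betw[OF bij_digits[OF assms(1)]])
  also have "\<dots> = (\<Sum>\<delta>\<in>digit_fun 18 X. if ok \<delta> \<and> st \<delta> = s then h \<delta> else 0)"
  proof (intro sum.cong refl)
    fix \<delta> assume d: "\<delta> \<in> digit_fun 18 X"
    show "of_bool (code n (st \<delta>) = code n s) * (of_bool (ok \<delta>) * h \<delta>) = (if ok \<delta> \<and> st \<delta> = s then h \<delta> else 0)"
    proof (cases "ok \<delta>")
      case True
      have "code n (st \<delta>) = code n s \<longleftrightarrow> st \<delta> = s" using code_inj[OF st[OF d True] assms(3,2)] by auto
      then show ?thesis using True by simp
    qed simp
  qed
  also have "\<dots> = (\<Sum>\<delta> | \<delta> \<in> digit_fun 18 X \<and> ok \<delta> \<and> st \<delta> = s. h \<delta>)"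
    using finite_digit_fun[OF assms(1)] by (simp add: sum.inter_filter)
  finally show ?thesis .
qed

lemma code_small: "s \<in> digit_fun 6 Z \<Longrightarrow> code n s < 8 ^ n"
proof (rule code_less_8)
  fix v assume "s \<in> digit_fun 6 Z"
  then have "s v < 6" by (cases "v \<in> Z") (simp_all add: digit_fun_iff)
  then show "s v < 8" by simp
qed

lemma wp_init_table:
  assumes R: "R 1 = n" "R 16 = D" and fresh: "\<And>a. D \<le> a \<Longrightarrow> H a = 0"
    and X: "X = {v. v < n \<and> H (R 12 + v) \<noteq> 0}" "18 ^ card X \<le> E"
    and Y: "\<And>v. v < n \<Longrightarrow> H (R 13 + v) = of_bool (v \<in> Y)"
    and masks: "R 12 + n \<le> D" "R 13 + n \<le> D"
    and post: "\<And>R' H'. (\<And>r. r < 17 \<or> 32 < r \<Longrightarrow> R' r = R r) \<Longrightarrow> (\<And>a. a < D \<Longrightarrow> H' a = H a) \<Longrightarrow>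
      (\<And>s x. s \<in> digit_fun 6 X \<Longrightarrow> H' (D + code n s) = table x {} X X s) \<Longrightarrow>
      (\<And>a. D + 8 ^ n \<le> a \<Longrightarrow> H' a = 0) \<Longrightarrow> Q R' H'"
  shows "triple (fill_table init_entry) R H Q"
proof (rule wp_fill_table[OF init_entry_def R _ X _ masks,
      where idx = "\<lambda>j. code n (sum_state (digits X j))" and val = "\<lambda>j. of_bool (init_ok (digits X j)) * 1" and B = 1])
  show "H a = 0" if "D \<le> a" for a by (rule fresh[OF that])
  show "H (R 13 + v) = of_bool (v \<in> Y)" if "v < n" for v by (rule Y[OF that])
  have finX: "finite X" and Xn: "X \<subseteq> {..<n}" by (auto simp: X)
  fix R' H' assume *: "\<And>r. r < 17 \<or> 32 < r \<Longrightarrow> R' r = R r" "\<And>a. a < D \<Longrightarrow> H' a = H a"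
    "\<And>i. H' (D + i) = (\<Sum>j<18 ^ card X. of_bool (code n (sum_state (digits X j)) = i) * (of_bool (init_ok (digits X j)) * 1))"
    "\<And>a. D + 8 ^ n \<le> a \<Longrightarrow> H' a = 0"
  show "Q R' H'"
  proof (rule post[OF *(1,2) _ *(4)])
    fix s and x :: "nat \<times> nat \<Rightarrow> nat" assume s: "s \<in> digit_fun 6 X"
    have "H' (D + code n s) = (\<Sum>\<delta> | \<delta> \<in> digit_fun 18 X \<and> init_ok \<delta> \<and> sum_state \<delta> = s. 1)"
      unfolding *(3) using finX Xn s
    proof (rule sum_digits)
      fix \<delta> assume "\<delta> \<in> digit_fun 18 X" "init_ok \<delta>"
      then show "sum_state \<delta> \<in> digit_fun 6 X" by (intro sum_state_in) (simp_all only: init_ok_def)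
    qed
    then show "H' (D + code n s) = table x {} X X s" unfolding table_init[OF finX s] by simp
  qed
qed (use l code_less_8[of _ n] sum_state_less[OF digits_in] in \<open>auto simp: of_bool_def\<close>)

lemma wp_message_table:
  assumes R: "R 1 = n" "R 16 = D" and fresh: "\<And>a. D \<le> a \<Longrightarrow> H a = 0"
    and X: "X = {v. v < n \<and> H (R 12 + v) \<noteq> 0}" "18 ^ card X \<le> E"
    and Y: "\<And>v. v < n \<Longrightarrow> H (R 13 + v) = of_bool (v \<in> Y)"
    and masks: "R 12 + n \<le> D" "R 13 + n \<le> D"
    and src: "R 14 + 8 ^ n \<le> D" "\<And>s. s \<in> digit_fun 6 X \<Longrightarrow> H (R 14 + code n s) = f s"
      "\<And>s. s \<in> digit_fun 6 X \<Longrightarrow> f s \<le> B" "18 ^ n * B < 2 ^ l"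
    and post: "\<And>R' H'. (\<And>r. r < 17 \<or> 32 < r \<Longrightarrow> R' r = R r) \<Longrightarrow> (\<And>a. a < D \<Longrightarrow> H' a = H a) \<Longrightarrow>
      (\<And>s. s \<in> digit_fun 6 (X \<inter> Y) \<Longrightarrow> H' (D + code n s) =
        (\<Sum>\<delta> | \<delta> \<in> digit_fun 18 X \<and> message_ok Y \<delta> \<and> right_state Y \<delta> = s. f (left_state \<delta>))) \<Longrightarrow>
      (\<And>a. D + 8 ^ n \<le> a \<Longrightarrow> H' a = 0) \<Longrightarrow> Q R' H'"
  shows "triple (fill_table message_entry) R H Q"
proof (rule wp_fill_table[OF message_entry_def R _ X _ masks,
      where idx = "\<lambda>j. code n (right_state Y (digits X j))" and
        val = "\<lambda>j. of_bool (message_ok Y (digits X j)) * f (left_state (digits X j))" and B = B])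
  show "H a = 0" if "D \<le> a" for a by (rule fresh[OF that])
  show "H (R 13 + v) = of_bool (v \<in> Y)" if "v < n" for v by (rule Y[OF that])
  have finX: "finite X" and Xn: "X \<subseteq> {..<n}" by (auto simp: X)
  fix R' H' assume *: "\<And>r. r < 17 \<or> 32 < r \<Longrightarrow> R' r = R r" "\<And>a. a < D \<Longrightarrow> H' a = H a"
    "\<And>i. H' (D + i) = (\<Sum>j<18 ^ card X. of_bool (code n (right_state Y (digits X j)) = i) *
       (of_bool (message_ok Y (digits X j)) * f (left_state (digits X j))))"
    "\<And>a. D + 8 ^ n \<le> a \<Longrightarrow> H' a = 0"
  show "Q R' H'"
  proof (rule post[OF *(1,2) _ *(4)])
    fix s assume s: "s \<in> digit_fun 6 (X \<inter> Y)"
    show "H' (D + code n s) = (\<Sum>\<delta> | \<delta> \<in> digit_fun 18 X \<and> message_ok Y \<delta> \<and> right_state Y \<delta> = s. f (left_state \<delta>))"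
      unfolding *(3) by (rule sum_digits[OF finX _ s]) (use Xn right_state_in in auto)
  qed
next
  fix j R' H' \<delta>
  assume d: "\<delta> = digits X j" and low: "\<And>a. a < D \<Longrightarrow> H' a = H a" and fr: "\<And>r. r < 17 \<or> 32 < r \<Longrightarrow> R' r = R r"
    and regs: "R' 20 = code n (left_state \<delta>)" "R' 21 = code n (right_state Y \<delta>)" "R' 24 = of_bool (message_ok Y \<delta>)"
  have in6: "left_state \<delta> \<in> digit_fun 6 X" unfolding d by (rule left_state_in[OF digits_in])
  then have "H' (R 14 + code n (left_state \<delta>)) = f (left_state \<delta>)"
    using low src(1,2) code_small[OF in6] by simp
  then show "R' 21 = code n (right_state Y (digits X j)) \<and> eval_exp (Rg 24 \<^bold>* Hp (Rg 14 \<^bold>+ Rg 20)) R' H' =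
      of_bool (message_ok Y (digits X j)) * f (left_state (digits X j))"
    using regs fr by (simp add: d)
next
  fix j
  show "code n (right_state Y (digits X j)) < 8 ^ n" by (rule code_small[OF right_state_in[OF digits_in]])
  show "of_bool (message_ok Y (digits X j)) * f (left_state (digits X j)) \<le> B"
    using src(3)[OF left_state_in[OF digits_in]] by (simp add: of_bool_def)
qed (fact src(4))

lemma wp_join_table:
  assumes R: "R 1 = n" "R 16 = D" and fresh: "\<And>a. D \<le> a \<Longrightarrow> H a = 0"
    and X: "X = {v. v < n \<and> H (R 12 + v) \<noteq> 0}" "18 ^ card X \<le> E"
    and Y: "\<And>v. v < n \<Longrightarrow> H (R 13 + v) = of_bool (v \<in> Y)"
    and masks: "R 12 + n \<le> D" "R 13 + n \<le> D"
    and src: "R 14 + 8 ^ n \<le> D" "\<And>s. s \<in> digit_fun 6 X \<Longrightarrow> H (R 14 + code n s) = f s"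
      "\<And>s. s \<in> digit_fun 6 X \<Longrightarrow> f s \<le> B"
    and msg: "R 15 + 8 ^ n \<le> D" "\<And>s. s \<in> digit_fun 6 (X \<inter> Y) \<Longrightarrow> H (R 15 + code n s) = g s"
      "\<And>s. s \<in> digit_fun 6 (X \<inter> Y) \<Longrightarrow> g s \<le> B" and big: "18 ^ n * (B * B) < 2 ^ l"
    and post: "\<And>R' H'. (\<And>r. r < 17 \<or> 32 < r \<Longrightarrow> R' r = R r) \<Longrightarrow> (\<And>a. a < D \<Longrightarrow> H' a = H a) \<Longrightarrow>
      (\<And>s. s \<in> digit_fun 6 X \<Longrightarrow> H' (D + code n s) =
        (\<Sum>\<delta> | \<delta> \<in> digit_fun 18 X \<and> join_ok Y \<delta> \<and> sum_state \<delta> = s. f (left_state \<delta>) * g (right_state Y \<delta>))) \<Longrightarrow>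
      (\<And>a. D + 8 ^ n \<le> a \<Longrightarrow> H' a = 0) \<Longrightarrow> Q R' H'"
  shows "triple (fill_table join_entry) R H Q"
proof (rule wp_fill_table[OF join_entry_def R _ X _ masks,
      where idx = "\<lambda>j. code n (sum_state (digits X j))" and
        val = "\<lambda>j. of_bool (join_ok Y (digits X j)) * (f (left_state (digits X j)) * g (right_state Y (digits X j)))" and
        B = "B * B"])
  show "H a = 0" if "D \<le> a" for a by (rule fresh[OF that])
  show "H (R 13 + v) = of_bool (v \<in> Y)" if "v < n" for v by (rule Y[OF that])
  have finX: "finite X" and Xn: "X \<subseteq> {..<n}" by (auto simp: X)
  fix R' H' assume *: "\<And>r. r < 17 \<or> 32 < r \<Longrightarrow> R' r = R r" "\<And>a. a < D \<Longrightarrow> H' a = H a"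
    "\<And>i. H' (D + i) = (\<Sum>j<18 ^ card X. of_bool (code n (sum_state (digits X j)) = i) *
       (of_bool (join_ok Y (digits X j)) * (f (left_state (digits X j)) * g (right_state Y (digits X j)))))"
    "\<And>a. D + 8 ^ n \<le> a \<Longrightarrow> H' a = 0"
  show "Q R' H'"
  proof (rule post[OF *(1,2) _ *(4)])
    fix s assume s: "s \<in> digit_fun 6 X"
    show "H' (D + code n s) = (\<Sum>\<delta> | \<delta> \<in> digit_fun 18 X \<and> join_ok Y \<delta> \<and> sum_state \<delta> = s. f (left_state \<delta>) * g (right_state Y \<delta>))"
      unfolding *(3) using finX Xn s
    proof (rule sum_digits)
      fix \<delta> assume "\<delta> \<in> digit_fun 18 X" "join_ok Y \<delta>"
      then show "sum_state \<delta> \<in> digit_fun 6 X" by (intro sum_state_in) (simp_all add: join_ok_def)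
    qed
  qed
next
  fix j R' H' \<delta>
  assume d: "\<delta> = digits X j" and low: "\<And>a. a < D \<Longrightarrow> H' a = H a" and fr: "\<And>r. r < 17 \<or> 32 < r \<Longrightarrow> R' r = R r"
    and regs: "R' 20 = code n (left_state \<delta>)" "R' 21 = code n (right_state Y \<delta>)" "R' 22 = code n (sum_state \<delta>)"
      "R' 25 = of_bool (join_ok Y \<delta>)"
  have in6: "left_state \<delta> \<in> digit_fun 6 X" "right_state Y \<delta> \<in> digit_fun 6 (X \<inter> Y)"
    unfolding d by (rule left_state_in[OF digits_in] right_state_in[OF digits_in])+
  then have "H' (R 14 + code n (left_state \<delta>)) = f (left_state \<delta>)" "H' (R 15 + code n (right_state Y \<delta>)) = g (right_state Y \<delta>)"
    using low src(1,2) msg(1,2) code_small[OF in6(1)] code_small[OF in6(2)] by simp_all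
  then show "R' 22 = code n (sum_state (digits X j)) \<and> eval_exp (Rg 25 \<^bold>* (Hp (Rg 14 \<^bold>+ Rg 20) \<^bold>* Hp (Rg 15 \<^bold>+ Rg 21))) R' H' =
      of_bool (join_ok Y (digits X j)) * (f (left_state (digits X j)) * g (right_state Y (digits X j)))"
    using regs fr by (simp add: d)
next
  fix j
  show "code n (sum_state (digits X j)) < 8 ^ n" by (rule code_less_8) (rule sum_state_less[OF digits_in])
  have "f (left_state (digits X j)) * g (right_state Y (digits X j)) \<le> B * B"
    using src(3)[OF left_state_in[OF digits_in]] msg(3)[OF right_state_in[OF digits_in]] by (rule mult_le_mono)
  then show "of_bool (join_ok Y (digits X j)) * (f (left_state (digits X j)) * g (right_state Y (digits X j))) \<le> B * B"
    by (simp add: of_bool_def)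
qed (fact big)

end

subsection \<open>Processing the decomposition\<close>

text \<open>
  Heap layout, in segments of length \<open>Q\<close> (register 5): the input, the random bits, the set of visited
  nodes, the search order, the parents, and the pointers to the tables of the nodes; new tables
  are placed at the address in register 10, from which on the heap is zero.
\<close>

definition find_order :: prog where
  "find_order =
     Wr (Rg 5 \<^bold>* Cn 2) (Cn 1) ;;
     For False 44 (Rg 2 \<^bold>- Cn 1)
       (Asg 37 (Cn 0) ;; Asg 38 (Cn 0) ;;
        For False 33 (Rg 2) (For False 34 (Rg 2)
          (Ifs (Hp (Rg 5 \<^bold>* Cn 2 \<^bold>+ Rg 34) \<^bold>* ((Cn 1 \<^bold>- Hp (Rg 5 \<^bold>* Cn 2 \<^bold>+ Rg 33)) \<^bold>* Hp (Rg 3 \<^bold>+ Rg 33 \<^bold>* Rg 2 \<^bold>+ Rg 34)))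
             (Asg 37 (Rg 33) ;; Asg 38 (Rg 34)) Nop)) ;;
        Wr (Rg 5 \<^bold>* Cn 2 \<^bold>+ Rg 37) (Cn 1) ;;
        Wr (Rg 5 \<^bold>* Cn 3 \<^bold>+ (Rg 44 \<^bold>+ Cn 1)) (Rg 37) ;;
        Wr (Rg 5 \<^bold>* Cn 4 \<^bold>+ (Rg 44 \<^bold>+ Cn 1)) (Rg 38))"

definition init_tables :: prog where
  "init_tables =
     Asg 10 (Rg 5 \<^bold>* Cn 6) ;;
     For False 37 (Rg 2)
       (Asg 12 (Rg 4 \<^bold>+ Rg 37 \<^bold>* Rg 1) ;; Asg 13 (Rg 12) ;; Asg 16 (Rg 10) ;;
        fill_table init_entry ;;
        Wr (Rg 5 \<^bold>* Cn 5 \<^bold>+ Rg 37) (Rg 10) ;;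
        Asg 10 (Rg 10 \<^bold>+ Rg 5))"

text \<open>Joins the message in 15 over the set in 13 into the table of node 37.\<close>

definition absorb :: prog where
  "absorb =
     Asg 12 (Rg 4 \<^bold>+ Rg 37 \<^bold>* Rg 1) ;; Asg 14 (Hp (Rg 5 \<^bold>* Cn 5 \<^bold>+ Rg 37)) ;; Asg 16 (Rg 10) ;;
     fill_table join_entry ;;
     Wr (Rg 5 \<^bold>* Cn 5 \<^bold>+ Rg 37) (Rg 10) ;;
     Asg 10 (Rg 10 \<^bold>+ Rg 5)"

text \<open>Computes the message of node 38 to node 37.\<close>

definition send :: prog where
  "send =
     Asg 12 (Rg 4 \<^bold>+ Rg 38 \<^bold>* Rg 1) ;; Asg 13 (Rg 4 \<^bold>+ Rg 37 \<^bold>* Rg 1) ;;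
     Asg 14 (Hp (Rg 5 \<^bold>* Cn 5 \<^bold>+ Rg 38)) ;; Asg 16 (Rg 10) ;;
     fill_table message_entry ;;
     Asg 13 (Rg 12) ;; Asg 15 (Rg 10) ;; Asg 10 (Rg 10 \<^bold>+ Rg 5)"

lemma search_order_Suc:
  assumes "search_order T i ord par" "0 < i" "x \<in> pverts T" "x \<notin> ord ` {..<i}" "y \<in> ord ` {..<i}" "(y, x) \<in> parcs T"
    and ord': "\<And>j. j < i \<Longrightarrow> ord' j = ord j" "ord' i = x" and par': "\<And>j. j < i \<Longrightarrow> par' j = par j" "par' i = y"
  shows "search_order T (Suc i) ord' par'"
proof -
  have img: "ord' ` {..<j} = ord ` {..<j}" if "j \<le> i" for j
    using that ord'(1) by (intro image_cong) auto
  have so: "inj_on ord {..<i}" "ord ` {..<i} \<subseteq> pverts T" "ord 0 = 0"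
    and tree: "\<And>j. 0 < j \<Longrightarrow> j < i \<Longrightarrow> par j \<in> ord ` {..<j} \<and> (par j, ord j) \<in> parcs T"
    using assms(1) by (simp_all add: search_order_def)
  have "inj_on ord' {..<i}" using so(1) ord'(1) by (simp add: inj_on_def)
  then have "inj_on ord' {..<Suc i}"
    unfolding lessThan_Suc inj_on_insert using img[of i] assms(4) ord'(2) by simp
  moreover have "ord' ` {..<Suc i} \<subseteq> pverts T" unfolding lessThan_Suc using img[of i] so(2) ord'(2) assms(3) by simp
  moreover have "ord' 0 = 0" using so(3) ord'(1)[OF assms(2)] by simp
  moreover have "par' j \<in> ord' ` {..<j} \<and> (par' j, ord' j) \<in> parcs T" if "0 < j" "j < Suc i" for j
  proof (cases "j = i")
    case True
    then show ?thesis using img[of i] ord'(2) par'(2) assms(5,6) by simp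
  next
    case False
    then have "j < i" using that by simp
    then show ?thesis using tree[OF that(1)] img[of j] ord'(1)[of j] par'(1)[of j] by simp
  qed
  ultimately show ?thesis by (simp add: search_order_def)
qed

lemma pair_index_less: "u < a \<Longrightarrow> v < b \<Longrightarrow> u * b + v < a * (b::nat)"
proof -
  assume "u < a" "v < b"
  then have "u * b + v < Suc u * b" by simp
  also have "\<dots> \<le> a * b" using \<open>u < a\<close> by (intro mult_right_mono) auto
  finally show ?thesis .
qed

lemma exponent_less_power2:
  assumes "x \<le> 2 ^ e" "e \<le> N ^ 11" "1 < N" "N ^ 12 \<le> l"
  shows "x < (2::nat) ^ l"
proof -
  have "N ^ 11 < N ^ 12" using assms(3) by (intro power_strict_increasing) auto
  then have "(2::nat) ^ e < 2 ^ l" using assms(2,4) by (intro power_strict_increasing) auto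
  then show ?thesis using assms(1) by linarith
qed

text \<open>\<open>N\<close> dominates all parameters. In a segment of \<open>Q\<close> cells the
  factor \<open>N ^ 3\<close> makes room for the matrices of the input and for the random bits, and
  \<open>8 ^ n\<close> for a table. Polynomial loops have at most \<open>N ^ 4\<close> rounds, and
  \<open>N ^ 12\<close> bits suffice for products of two table entries summed over all
  indices.\<close>

locale dp_instance = bounds n l W E for n l W E :: nat +
  fixes m :: nat and G T :: "nat pair_pre_digraph" and X :: "nat \<Rightarrow> nat set" and k :: nat and \<beta> :: "nat \<Rightarrow> bool"
    and N Q :: nat
  assumes G: "pair_graph G" "pverts G = {..<n}" and td: "tree_decomposition G T X"
    and T: "pverts T = {..<m}" and m: "1 \<le> m"
    and bag: "\<And>x. x < m \<Longrightarrow> 18 ^ card (X x) \<le> E"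
    and k: "1 \<le> k" "k < n"
    and N: "N = n + m + 4" and Q: "Q = N ^ 3 * 8 ^ n"
    and W: "N ^ 4 \<le> W" and l_big: "N ^ 12 \<le> l"
begin

abbreviation "OT \<equiv> 2 + n * n"
abbreviation "OX \<equiv> 2 + n * n + m * m"

text \<open>A block is reserved for each of the \<open>n * n\<close> vertex pairs, so the block of
  an edge is found by arithmetic and the edges need no numbering.\<close>

definition bit_address :: "nat \<times> nat \<Rightarrow> nat" where
  "bit_address e = Q + (fst e * n + snd e) * n"

sublocale extraction n k "edges G" bit_address
proof
  show "edges G \<subseteq> {(u, v). u < v \<and> v < n}"
  proof clarify
    fix u v assume "(u, v) \<in> edges G"
    then have "(u, v) \<in> parcs G" "u < v" by (simp_all add: edges_def)
    moreover interpret pair_graph G by (rule G(1))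
    have "v \<in> pverts G" using \<open>(u, v) \<in> parcs G\<close> by (rule in_arcsD2)
    ultimately show "u < v \<and> v < n" using G(2) by simp
  qed
qed (use k in simp_all)

abbreviation "weight \<equiv> variable \<beta>"

definition setting :: "store \<Rightarrow> bool" where
  "setting R \<longleftrightarrow> R 1 = n \<and> R 2 = m \<and> R 3 = OT \<and> R 4 = OX \<and> R 5 = Q \<and> R 6 = k"

definition input :: "store \<Rightarrow> bool" where
  "input H \<longleftrightarrow> (\<forall>u<n. \<forall>v<n. H (2 + u * n + v) = of_bool ((u, v) \<in> parcs G)) \<and>
     (\<forall>x<m. \<forall>y<m. H (OT + x * m + y) = of_bool ((x, y) \<in> parcs T)) \<and>
     (\<forall>x<m. \<forall>v<n. H (OX + x * n + v) = of_bool (v \<in> X x)) \<and>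
     (\<forall>i<n * n * n. H (Q + i) = of_bool (\<beta> (Q + i)))"

section \<open>Estimates for addresses, segments and loop bounds\<close>

lemma N6: "6 \<le> N" "n < N" "m < N" using N n m by auto

lemma big: "(x::nat) \<le> 2 ^ e \<Longrightarrow> e \<le> N ^ 11 \<Longrightarrow> x < 2 ^ l"
  using exponent_less_power2[of x e N l] N6 l_big by simp

lemma N_power_le: "i \<le> j \<Longrightarrow> N ^ i \<le> N ^ j"
  using N6 by (intro power_increasing) auto

lemma N_le_power: "N \<le> 2 ^ N"
  using less_exp[of N] by simp

lemma small_N: "x \<le> N \<Longrightarrow> x < 2 ^ l"
  by (rule big[OF order_trans[OF _ N_le_power]]) (use N_power_le[of 1 11] in auto)

lemma Q_le: "Q \<le> 2 ^ (6 * N)"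
proof -
  have "N ^ 3 \<le> (2 ^ N) ^ 3" using N_le_power by (rule power_mono) simp
  moreover have "(8::nat) ^ n \<le> 2 ^ (3 * N)"
  proof -
    have "(8::nat) ^ n = 2 ^ (3 * n)" by (simp add: power_mult)
    also have "\<dots> \<le> 2 ^ (3 * N)" using N6 by (intro power_increasing) auto
    finally show ?thesis .
  qed
  ultimately have "Q \<le> (2 ^ N) ^ 3 * 2 ^ (3 * N)" unfolding Q by (rule mult_le_mono)
  also have "\<dots> = 2 ^ (6 * N)" by (simp add: power_mult[symmetric] power_add[symmetric] mult.commute)
  finally show ?thesis .
qed

lemma pointer: "x \<le> N ^ 4 * Q \<Longrightarrow> x < 2 ^ l"
proof (rule big[of _ "10 * N"])
  assume "x \<le> N ^ 4 * Q"
  also have "\<dots> \<le> (2 ^ N) ^ 4 * 2 ^ (6 * N)"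
    using N_le_power Q_le by (intro mult_le_mono power_mono) auto
  also have "\<dots> = 2 ^ (10 * N)" by (simp add: power_mult[symmetric] power_add[symmetric] mult.commute)
  finally show "x \<le> 2 ^ (10 * N)" .
  have "10 * N \<le> N * N * N" using N6 mult_le_mono[of 10 "N * N" N N] mult_le_mono[of 6 N 6 N] by (simp add: mult.assoc)
  also have "\<dots> = N ^ 3" by (simp add: power3_eq_cube)
  also have "\<dots> \<le> N ^ 11" by (rule N_power_le) simp
  finally show "10 * N \<le> N ^ 11" .
qed

lemma Q_bounds: "N ^ 3 \<le> Q" "8 ^ n \<le> Q" "n \<le> Q" "m < Q" "N * N \<le> Q" "0 < Q"
proof -
  show 1: "N ^ 3 \<le> Q" unfolding Q by simp
  have "1 * 8 ^ n \<le> N ^ 3 * 8 ^ n" using N6 by (intro mult_le_mono) auto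
  then show "8 ^ n \<le> Q" unfolding Q by simp
  have 2: "N * N \<le> N ^ 3" using N6 by (simp add: power3_eq_cube)
  then show 3: "N * N \<le> Q" using 1 by simp
  have "N \<le> N * N" using N6 by simp
  then show "n \<le> Q" "m < Q" "0 < Q" using 3 N6 by linarith+
qed

lemma addresses: "OX + m * n + n + 2 \<le> Q"
proof -
  have "OX + m * n + n + 2 \<le> N * N" unfolding N by (simp add: algebra_simps)
  then show ?thesis using Q_bounds by simp
qed

lemma row: "x < m \<Longrightarrow> OX + x * n + n \<le> Q"
  using pair_index_less[of x m "n - 1" n] n addresses by simp

lemma tree_arcs: "x < m \<Longrightarrow> y < m \<Longrightarrow> OT + x * m + y < Q"
  using pair_index_less[of x m y m] addresses by simp

lemma graph_arcs: "u < n \<Longrightarrow> v < n \<Longrightarrow> 2 + u * n + v < Q"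
  using pair_index_less[of u n v n] addresses by simp

lemma bits_less: "n * n * n \<le> Q"
proof -
  have "n * n * n \<le> N * N * N" using N6 by (intro mult_le_mono) auto
  then show ?thesis using Q_bounds(1) by (simp add: power3_eq_cube)
qed

lemma loops: "n \<le> W" "m \<le> W" "N ^ 3 \<le> W"
proof -
  have "N \<le> W" using order_trans[OF N_power_le[of 1 4] W] by simp
  then show "n \<le> W" "m \<le> W" using N6 by simp_all
  show "N ^ 3 \<le> W" by (rule order_trans[OF N_power_le W]) simp
qed

lemma X_sub: "x < m \<Longrightarrow> X x \<subseteq> {..<n}"
  using td T G(2) by (auto simp: tree_decomposition_def)

lemma tree: "undirected_tree T" "pair_graph T"
  using td by (auto simp: tree_decomposition_def undirected_tree_def)

lemma tree_sym: "(x, y) \<in> parcs T \<Longrightarrow> (y, x) \<in> parcs T"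
proof -
  interpret pair_graph T by (rule tree(2))
  show "(x, y) \<in> parcs T \<Longrightarrow> (y, x) \<in> parcs T" using arcs_symmetric by blast
qed

definition mergeable where
  "mergeable S x y \<longleftrightarrow> x < m \<and> y < m \<and> x \<notin> S \<and> y \<in> S \<and> (x, y) \<in> parcs T"

text \<open>Loops have no early exit, so all pairs are scanned and the last suitable one remains in
  registers 37 and 38.\<close>

lemma wp_find_pair:
  assumes R: "setting R" and H: "\<And>x y. x < m \<Longrightarrow> y < m \<Longrightarrow> H (OT + x * m + y) = of_bool ((x, y) \<in> parcs T)"
    and vis: "\<And>x. x < m \<Longrightarrow> H (2 * Q + x) = of_bool (x \<in> S)" and ex: "mergeable S x0 y0"
    and post: "\<And>R'. (\<And>r. r \<notin> {33, 34, 37, 38} \<Longrightarrow> R' r = R r) \<Longrightarrow> mergeable S (R' 37) (R' 38) \<Longrightarrow> P R' H"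
  shows "triple (For False 33 (Rg 2) (For False 34 (Rg 2)
          (Ifs (Hp (Rg 5 \<^bold>* Cn 2 \<^bold>+ Rg 34) \<^bold>* ((Cn 1 \<^bold>- Hp (Rg 5 \<^bold>* Cn 2 \<^bold>+ Rg 33)) \<^bold>* Hp (Rg 3 \<^bold>+ Rg 33 \<^bold>* Rg 2 \<^bold>+ Rg 34)))
             (Asg 37 (Rg 33) ;; Asg 38 (Rg 34)) Nop))) R H P"
proof -
  define fr where "fr R' \<longleftrightarrow> (\<forall>r. r \<notin> {33, 34, 37, 38} \<longrightarrow> R' r = R r)" for R' :: store
  define I where "I a R' H' \<longleftrightarrow> H' = H \<and> fr R' \<and> ((\<exists>x<a. \<exists>y. mergeable S x y) \<longrightarrow> mergeable S (R' 37) (R' 38))"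
    for a :: nat and R' H' :: store
  define J where "J a b R' H' \<longleftrightarrow> H' = H \<and> fr R' \<and> R' 33 = a \<and>
      ((\<exists>x<a. \<exists>y. mergeable S x y) \<or> (\<exists>y<b. mergeable S a y) \<longrightarrow> mergeable S (R' 37) (R' 38))"
    for a b :: nat and R' H' :: store
  show ?thesis
  proof (rule wp_For[where I = I and n = m])
    show "I 0 R H" by (simp add: I_def fr_def)
    show "eval_exp (Rg 2) R H = m" using R by (simp add: setting_def)
    show "m \<le> (if False then E else W)" using loops by simp
  next
    fix a R' H' assume a: "a < m" and I: "I a R' H'"
    then have fr': "fr R'" and H': "H' = H" by (simp_all add: I_def)
    have r2: "R' 2 = m" using fr' R by (simp add: fr_def setting_def)
    show "triple (For False 34 (Rg 2)
          (Ifs (Hp (Rg 5 \<^bold>* Cn 2 \<^bold>+ Rg 34) \<^bold>* ((Cn 1 \<^bold>- Hp (Rg 5 \<^bold>* Cn 2 \<^bold>+ Rg 33)) \<^bold>* Hp (Rg 3 \<^bold>+ Rg 33 \<^bold>* Rg 2 \<^bold>+ Rg 34)))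
             (Asg 37 (Rg 33) ;; Asg 38 (Rg 34)) Nop)) (R'(33 := a)) H' (I (Suc a))"
    proof (rule wp_For[where I = "J a" and n = m])
      show "J a 0 (R'(33 := a)) H'" using I by (simp add: I_def J_def fr_def)
      show "eval_exp (Rg 2) (R'(33 := a)) H' = m" using r2 by simp
      show "m \<le> (if False then E else W)" using loops by simp
    next
      fix R'' H'' assume J: "J a m R'' H''"
      have "\<exists>y<m. mergeable S a y" if "mergeable S a y" for y using that unfolding mergeable_def by blast
      then show "I (Suc a) R'' H''" using J unfolding I_def J_def less_Suc_eq by blast
    next
      fix b R'' H'' assume b: "b < m" and J: "J a b R'' H''"
      then have fr'': "fr R''" and H'': "H'' = H" and r33: "R'' 33 = a" by (simp_all add: J_def)
      have regs: "R'' 2 = m" "R'' 3 = OT" "R'' 5 = Q" using fr'' R by (simp_all add: fr_def setting_def)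
      have vb: "H (Q * 2 + b) = of_bool (b \<in> S)" and va: "H (Q * 2 + a) = of_bool (a \<in> S)"
        using vis[OF b] vis[OF a] by (simp_all add: mult.commute)
      have c: "H (Q * 2 + b) * ((1 - H (Q * 2 + a)) * H (OT + a * m + b)) = of_bool (mergeable S a b)"
        unfolding vb va H[OF a b] mergeable_def using a b by simp
      have lt: "a < 2 ^ l" "b < 2 ^ l" using a b N6 by (auto intro: small_N)
      show "triple (Ifs (Hp (Rg 5 \<^bold>* Cn 2 \<^bold>+ Rg 34) \<^bold>* ((Cn 1 \<^bold>- Hp (Rg 5 \<^bold>* Cn 2 \<^bold>+ Rg 33)) \<^bold>* Hp (Rg 3 \<^bold>+ Rg 33 \<^bold>* Rg 2 \<^bold>+ Rg 34)))
             (Asg 37 (Rg 33) ;; Asg 38 (Rg 34)) Nop) (R''(34 := b)) H'' (J a (Suc b))"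
      proof (cases "mergeable S a b")
        case True
        have "J a (Suc b) (R''(34 := b, 37 := a, 38 := b)) H" using J True fr'' r33 by (simp add: J_def fr_def)
        then show ?thesis using c True lt by (simp add: H'' regs r33)
      next
        case False
        have "J a (Suc b) (R''(34 := b)) H" using J False by (auto simp: J_def fr_def less_Suc_eq)
        then show ?thesis using c False by (simp add: H'' regs r33)
      qed
    qed
  next
    fix R' H' assume I: "I m R' H'"
    have "\<exists>x<m. \<exists>y. mergeable S x y" using ex by (auto simp: mergeable_def)
    then have "mergeable S (R' 37) (R' 38)" using I by (simp add: I_def)
    then show "P R' H'" using I post[of R'] by (simp add: I_def fr_def)
  qed
qed

text \<open>A graph search without a queue: each round picks an arc leaving the visited set, which
  exists because the tree is connected. Node 0 already stands at the first position of the order, as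
  that cell is zero.\<close>

lemma wp_find_order:
  assumes R: "setting R" and H: "input H" "\<And>a. 2 * Q \<le> a \<Longrightarrow> H a = 0"
    and post: "\<And>R' H'. (\<And>r. r \<notin> {33, 34, 37, 38, 44} \<Longrightarrow> R' r = R r) \<Longrightarrow> (\<And>a. a < 2 * Q \<Longrightarrow> H' a = H a) \<Longrightarrow>
      search_order T m (\<lambda>i. H' (3 * Q + i)) (\<lambda>i. H' (4 * Q + i)) \<Longrightarrow> (\<And>a. 5 * Q \<le> a \<Longrightarrow> H' a = 0) \<Longrightarrow> P R' H'"
  shows "triple find_order R H P"
proof -
  define I where "I i R' H' \<longleftrightarrow> (\<forall>r. r \<notin> {33, 34, 37, 38, 44} \<longrightarrow> R' r = R r) \<and> (\<forall>a<2 * Q. H' a = H a) \<and>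
      (\<forall>a\<ge>5 * Q. H' a = 0) \<and> search_order T (Suc i) (\<lambda>i. H' (3 * Q + i)) (\<lambda>i. H' (4 * Q + i)) \<and>
      (\<forall>x<m. H' (2 * Q + x) = of_bool (x \<in> (\<lambda>i. H' (3 * Q + i)) ` {..<Suc i}))" for i :: nat and R' H' :: store
  have mQ: "m < Q" using Q_bounds by simp
  have "triple (For False 44 (Rg 2 \<^bold>- Cn 1)
       (Asg 37 (Cn 0) ;; Asg 38 (Cn 0) ;;
        For False 33 (Rg 2) (For False 34 (Rg 2)
          (Ifs (Hp (Rg 5 \<^bold>* Cn 2 \<^bold>+ Rg 34) \<^bold>* ((Cn 1 \<^bold>- Hp (Rg 5 \<^bold>* Cn 2 \<^bold>+ Rg 33)) \<^bold>* Hp (Rg 3 \<^bold>+ Rg 33 \<^bold>* Rg 2 \<^bold>+ Rg 34)))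
             (Asg 37 (Rg 33) ;; Asg 38 (Rg 34)) Nop)) ;;
        Wr (Rg 5 \<^bold>* Cn 2 \<^bold>+ Rg 37) (Cn 1) ;;
        Wr (Rg 5 \<^bold>* Cn 3 \<^bold>+ (Rg 44 \<^bold>+ Cn 1)) (Rg 37) ;;
        Wr (Rg 5 \<^bold>* Cn 4 \<^bold>+ (Rg 44 \<^bold>+ Cn 1)) (Rg 38))) R (H(2 * Q := 1)) P"
  proof (rule wp_For[where I = I and n = "m - 1"])
    have "search_order T (Suc 0) (\<lambda>i. (H(2 * Q := 1)) (3 * Q + i)) (\<lambda>i. (H(2 * Q := 1)) (4 * Q + i))"
      using H(2) T m mQ by (auto simp: search_order_def inj_on_def)
    moreover have "(H(2 * Q := 1)) (2 * Q + x) = of_bool (x \<in> (\<lambda>i. (H(2 * Q := 1)) (3 * Q + i)) ` {..<Suc 0})" for x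
      using H(2) mQ by simp
    ultimately show "I 0 R (H(2 * Q := 1))" using H(2) mQ by (simp add: I_def)
    show "eval_exp (Rg 2 \<^bold>- Cn 1) R (H(2 * Q := 1)) = m - 1" using R by (simp add: setting_def)
    show "m - 1 \<le> (if False then E else W)" using loops by simp
    fix i R' H' assume i: "i < m - 1" and I: "I i R' H'"
    define ord where "ord j = H' (3 * Q + j)" for j
    define par where "par j = H' (4 * Q + j)" for j
    let ?S = "ord ` {..<Suc i}"
    have fr: "R' r = R r" if "r \<notin> {33, 34, 37, 38, 44}" for r using I that unfolding I_def by blast
    have low: "H' a = H a" if "a < 2 * Q" for a using I that unfolding I_def by blast
    have high: "H' a = 0" if "5 * Q \<le> a" for a using I that unfolding I_def by blast
    have so: "search_order T (Suc i) ord par" using I by (simp add: I_def ord_def[abs_def] par_def[abs_def])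
    have vis: "H' (2 * Q + x) = of_bool (x \<in> ?S)" if "x < m" for x using I that by (simp add: I_def ord_def[abs_def])
    have "Suc i < card (pverts T)" using i T by simp
    from search_order_extend[OF tree(1) so _ this] obtain x0 y0 where
      xy: "x0 \<in> pverts T" "x0 \<notin> ?S" "y0 \<in> ?S" "(x0, y0) \<in> parcs T" by blast
    have "y0 \<in> pverts T" using xy(3) so by (auto simp: search_order_def)
    then have ex: "mergeable ?S x0 y0" using xy T by (simp add: mergeable_def)
    have R': "setting (R'(44 := i, 37 := 0, 38 := 0))" using R by (simp add: setting_def fr)
    have arcs: "H' (OT + x * m + y) = of_bool ((x, y) \<in> parcs T)" if "x < m" "y < m" for x y
      using low[of "OT + x * m + y"] tree_arcs[OF that] H(1) that unfolding input_def by simp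
    have "triple (For False 33 (Rg 2) (For False 34 (Rg 2)
          (Ifs (Hp (Rg 5 \<^bold>* Cn 2 \<^bold>+ Rg 34) \<^bold>* ((Cn 1 \<^bold>- Hp (Rg 5 \<^bold>* Cn 2 \<^bold>+ Rg 33)) \<^bold>* Hp (Rg 3 \<^bold>+ Rg 33 \<^bold>* Rg 2 \<^bold>+ Rg 34)))
             (Asg 37 (Rg 33) ;; Asg 38 (Rg 34)) Nop))) (R'(44 := i, 37 := 0, 38 := 0)) H'
        (\<lambda>R'' H''. triple (Wr (Rg 5 \<^bold>* Cn 2 \<^bold>+ Rg 37) (Cn 1) ;;
          Wr (Rg 5 \<^bold>* Cn 3 \<^bold>+ (Rg 44 \<^bold>+ Cn 1)) (Rg 37) ;;
          Wr (Rg 5 \<^bold>* Cn 4 \<^bold>+ (Rg 44 \<^bold>+ Cn 1)) (Rg 38)) R'' H'' (I (Suc i)))"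
    proof (rule wp_find_pair[OF R' arcs vis ex])
      fix R'' assume fr'': "\<And>r. r \<notin> {33, 34, 37, 38} \<Longrightarrow> R'' r = (R'(44 := i, 37 := 0, 38 := 0)) r"
        and mg: "mergeable ?S (R'' 37) (R'' 38)"
      define x y where "x = R'' 37" and "y = R'' 38"
      have xy: "x < m" "y < m" "x \<notin> ?S" "y \<in> ?S" "(y, x) \<in> parcs T"
        using mg tree_sym by (auto simp: mergeable_def x_def y_def)
      define H2 where "H2 = H'(2 * Q + x := 1, 3 * Q + Suc i := x, 4 * Q + Suc i := y)"
      have iQ: "Suc i < Q" using i mQ by simp
      have r44: "R'' 44 = i" and r5: "R'' 5 = Q" using fr''[of 44] fr''[of 5] fr[of 5] R by (simp_all add: setting_def)
      have ord2: "H2 (3 * Q + j) = (if j = Suc i then x else ord j)" if "j \<le> Suc i" for j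
        using that xy(1) mQ iQ by (simp add: H2_def ord_def)
      have par2: "H2 (4 * Q + j) = (if j = Suc i then y else par j)" if "j \<le> Suc i" for j
        using that xy(1) mQ iQ by (simp add: H2_def par_def)
      have so2: "search_order T (Suc (Suc i)) (\<lambda>j. H2 (3 * Q + j)) (\<lambda>j. H2 (4 * Q + j))"
        by (rule search_order_Suc[OF so _ _ xy(3,4,5)]) (use xy(1) T ord2 par2 ord2[of "Suc i"] par2[of "Suc i"] in simp_all)
      have S2: "(\<lambda>j. H2 (3 * Q + j)) ` {..<Suc (Suc i)} = insert x ?S"
        unfolding lessThan_Suc[of "Suc i"] image_insert using ord2 ord2[of "Suc i"] by (simp cong: image_cong_simp)
      have vis2: "H2 (2 * Q + z) = of_bool (z \<in> insert x ?S)" if "z < m" for z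
        using that vis[OF that] mQ by (simp add: H2_def)
      have "I (Suc i) R'' H2"
        unfolding I_def S2
      proof (intro conjI allI impI)
        show "R'' r = R r" if "r \<notin> {33, 34, 37, 38, 44}" for r using fr''[of r] fr[of r] that by auto
        show "H2 a = H a" if "a < 2 * Q" for a using low[OF that] that by (simp add: H2_def)
        show "H2 a = 0" if "5 * Q \<le> a" for a using high[OF that] that xy(1) mQ iQ by (simp add: H2_def)
      qed (use so2 vis2 in simp_all)
      then show "triple (Wr (Rg 5 \<^bold>* Cn 2 \<^bold>+ Rg 37) (Cn 1) ;;
          Wr (Rg 5 \<^bold>* Cn 3 \<^bold>+ (Rg 44 \<^bold>+ Cn 1)) (Rg 37) ;;
          Wr (Rg 5 \<^bold>* Cn 4 \<^bold>+ (Rg 44 \<^bold>+ Cn 1)) (Rg 38)) R'' H' (I (Suc i))"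
        using small_N[of x] small_N[of y] small_N[of 1] xy(1,2) N6
        by (simp add: r44 r5 x_def[symmetric] y_def[symmetric] H2_def mult.commute)
    qed
    then show "triple (Asg 37 (Cn 0) ;; Asg 38 (Cn 0) ;;
        For False 33 (Rg 2) (For False 34 (Rg 2)
          (Ifs (Hp (Rg 5 \<^bold>* Cn 2 \<^bold>+ Rg 34) \<^bold>* ((Cn 1 \<^bold>- Hp (Rg 5 \<^bold>* Cn 2 \<^bold>+ Rg 33)) \<^bold>* Hp (Rg 3 \<^bold>+ Rg 33 \<^bold>* Rg 2 \<^bold>+ Rg 34)))
             (Asg 37 (Rg 33) ;; Asg 38 (Rg 34)) Nop)) ;;
        Wr (Rg 5 \<^bold>* Cn 2 \<^bold>+ Rg 37) (Cn 1) ;;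
        Wr (Rg 5 \<^bold>* Cn 3 \<^bold>+ (Rg 44 \<^bold>+ Cn 1)) (Rg 37) ;;
        Wr (Rg 5 \<^bold>* Cn 4 \<^bold>+ (Rg 44 \<^bold>+ Cn 1)) (Rg 38)) (R'(44 := i)) H' (I (Suc i))" by simp
  next
    fix R' H' assume I: "I (m - 1) R' H'"
    show "P R' H'"
    proof (rule post)
      show "R' r = R r" if "r \<notin> {33, 34, 37, 38, 44}" for r using I that unfolding I_def by blast
      show "H' a = H a" if "a < 2 * Q" for a using I that unfolding I_def by blast
      show "H' a = 0" if "5 * Q \<le> a" for a using I that unfolding I_def by blast
      show "search_order T m (\<lambda>i. H' (3 * Q + i)) (\<lambda>i. H' (4 * Q + i))" using I m by (simp add: I_def)
    qed
  qed
  then show ?thesis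
    using small_N[of 1] N6 R by (simp add: find_order_def setting_def mult.commute)
qed

text \<open>At most \<open>2 ^ n\<close> cuts, times at most \<open>n * n\<close> factors
  \<open>1 + weight e\<close>, each at most \<open>2 ^ (D * (n ^ 3 + n))\<close>. The bound covers
  every partial table, so one cell length serves throughout.\<close>

definition table_bound :: nat where
  "table_bound = 2 ^ (n + n * n * (D * (n ^ 3 + n)))"

lemma weight_le: "weight e < 2 ^ (D * (n ^ 3 + n))"
proof -
  have "(\<Sum>i<j. of_bool (\<beta> (bit_address e + i)) * (2 ^ D) ^ i) < (2 ^ D :: nat) ^ j" for j :: nat
  proof (induction j)
    case (Suc j)
    have "(2::nat) \<le> 2 ^ D" using power_increasing[of 1 D "2::nat"] by (simp add: D_def)
    then have "2 * (2 ^ D :: nat) ^ j \<le> (2 ^ D) * (2 ^ D) ^ j" by (rule mult_right_mono) simp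
    moreover have "of_bool (\<beta> (bit_address e + j)) * (2 ^ D) ^ j \<le> (2 ^ D :: nat) ^ j" by simp
    ultimately show ?case using Suc by (simp only: sum.lessThan_Suc power_Suc; linarith)
  qed simp
  from this[of n] have "weight e < (2 ^ D) ^ (n ^ 3) * (2 ^ D) ^ n"
    unfolding variable_def by (intro mult_strict_left_mono) simp_all
  also have "\<dots> = 2 ^ (D * (n ^ 3 + n))" by (simp add: power_mult[symmetric] power_add[symmetric] distrib_left)
  finally show ?thesis .
qed

lemma table_le_bound:
  assumes "A \<subseteq> edges G" "U \<subseteq> {..<n}"
  shows "table weight A U Z s \<le> table_bound"
proof -
  have fin: "finite A" "finite U" using finite_subset[OF assms(1) finite_E] finite_subset[OF assms(2)] by simp_all
  have "table weight A U Z s \<le> 2 ^ card U * (\<Prod>e\<in>A. 1 + weight e)" by (rule table_le[OF fin])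
  also have "\<dots> \<le> 2 ^ n * (2 ^ (D * (n ^ 3 + n))) ^ (n * n)"
  proof (rule mult_le_mono)
    have "card U \<le> n" using card_mono[OF _ assms(2)] by simp
    then show "(2::nat) ^ card U \<le> 2 ^ n" by (rule power_increasing) simp
    have "(\<Prod>e\<in>A. 1 + weight e) \<le> (\<Prod>e\<in>A. 2 ^ (D * (n ^ 3 + n)))"
      by (rule prod_mono) (use weight_le in \<open>simp add: Suc_leI\<close>)
    also have "\<dots> = (2 ^ (D * (n ^ 3 + n))) ^ card A" by simp
    also have "\<dots> \<le> (2 ^ (D * (n ^ 3 + n))) ^ (n * n)"
    proof (rule power_increasing)
      show "card A \<le> n * n" using card_mono[OF finite_E assms(1)] card_E(2) by (simp add: power2_eq_square)
    qed simp
    finally show "(\<Prod>e\<in>A. 1 + weight e) \<le> (2 ^ (D * (n ^ 3 + n))) ^ (n * n)" .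
  qed
  also have "\<dots> = table_bound"
    unfolding table_bound_def by (simp add: power_mult[symmetric] power_add[symmetric] mult.commute)
  finally show ?thesis .
qed

lemma D_le: "D \<le> N ^ 3" "n ^ 3 + n \<le> N ^ 3"
proof -
  have "(n + 4) * (n + 4) * (n + 4) \<le> N * N * N" using N by (intro mult_le_mono) auto
  moreover have "n * n * n + n + 1 \<le> (n + 4) * (n + 4) * (n + 4)" by (simp add: algebra_simps)
  ultimately show "D \<le> N ^ 3" "n ^ 3 + n \<le> N ^ 3" by (simp_all add: D_def power3_eq_cube)
qed

lemma table_bound_exponent: "n + n * n * (D * (n ^ 3 + n)) \<le> N ^ 9"
proof -
  have "n * n * (D * (n ^ 3 + n)) \<le> N * N * (N ^ 3 * N ^ 3)" using N6 D_le by (intro mult_le_mono) auto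
  also have "\<dots> = N ^ 8" by (simp add: power_numeral_reduce)
  finally have "n + n * n * (D * (n ^ 3 + n)) \<le> N + N ^ 8" using N6 by linarith
  also have "\<dots> \<le> 2 * N ^ 8" using N_power_le[of 1 8] by simp
  also have "\<dots> \<le> N * N ^ 8" using N6 by (intro mult_right_mono) auto
  also have "\<dots> = N ^ 9" by (simp add: power_numeral_reduce)
  finally show ?thesis .
qed

lemma table_bound_big: "18 ^ n * (table_bound * table_bound) < 2 ^ l" "18 ^ n * table_bound < 2 ^ l" "table_bound < 2 ^ l"
proof -
  have e: "table_bound \<le> 2 ^ N ^ 9" unfolding table_bound_def using table_bound_exponent by (intro power_increasing) auto
  have "(18::nat) ^ n \<le> (2 ^ 5) ^ n" by (rule power_mono) simp_all
  also have "\<dots> = 2 ^ (5 * n)" by (simp only: power_mult)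
  finally have "18 ^ n * (table_bound * table_bound) \<le> 2 ^ (5 * n) * (2 ^ N ^ 9 * 2 ^ N ^ 9)"
    using e by (intro mult_le_mono) auto
  also have "\<dots> = 2 ^ (5 * n + (N ^ 9 + N ^ 9))" by (simp only: power_add)
  finally have le: "18 ^ n * (table_bound * table_bound) \<le> 2 ^ (5 * n + (N ^ 9 + N ^ 9))" .
  have "5 * n + (N ^ 9 + N ^ 9) \<le> N * N + (N ^ 9 + N ^ 9)" using N6 mult_le_mono[of 5 N n N] by simp
  also have "\<dots> \<le> 3 * N ^ 9" using N_power_le[of 2 9] by (simp add: power2_eq_square)
  also have "\<dots> \<le> N * N ^ 9" using N6 by (intro mult_right_mono) auto
  also have "\<dots> \<le> N ^ 11" using N_power_le[of 10 11] by (simp add: power_numeral_reduce)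
  finally show 1: "18 ^ n * (table_bound * table_bound) < 2 ^ l" using le by (intro big)
  have "1 \<le> table_bound" by (simp add: table_bound_def)
  then have "table_bound * 1 \<le> table_bound * table_bound" by (rule mult_left_mono) simp
  then have "18 ^ n * table_bound \<le> 18 ^ n * (table_bound * table_bound)" by (simp add: mult_le_mono)
  then show 2: "18 ^ n * table_bound < 2 ^ l" using 1 by linarith
  have "1 * table_bound \<le> 18 ^ n * table_bound" by (rule mult_right_mono) simp_all
  then show "table_bound < 2 ^ l" using 2 by linarith
qed

text \<open>Cell \<open>5 * Q + x\<close> points to the table of node \<open>x\<close>; all tables
  lie below the free pointer \<open>d\<close>, from which on the heap is zero. A table is never
  changed in place: an update writes a new one at \<open>d\<close> and redirects the
  pointer.\<close>

definition tables :: "store \<Rightarrow> nat \<Rightarrow> (nat \<Rightarrow> (nat \<times> nat) set) \<Rightarrow> (nat \<Rightarrow> nat set) \<Rightarrow> nat set \<Rightarrow> bool" where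
  "tables H d AA UU S \<longleftrightarrow> 6 * Q \<le> d \<and> (\<forall>a\<ge>d. H a = 0) \<and>
     (\<forall>x\<in>S. 6 * Q \<le> H (5 * Q + x) \<and> H (5 * Q + x) + Q \<le> d \<and>
       (\<forall>s\<in>digit_fun 6 (X x). H (H (5 * Q + x) + code n s) = table weight (AA x) (UU x) (X x) s))"

lemma code_less_Q: "s \<in> digit_fun 6 Z \<Longrightarrow> code n s < Q"
  using code_small[of s Z] Q_bounds(2) by simp

lemma tables_mono:
  assumes t: "tables H d AA UU S" and S: "S \<subseteq> {..<m}"
    and low: "\<And>a. a < d \<Longrightarrow> H' a = H a" and high: "\<And>a. d + 8 ^ n \<le> a \<Longrightarrow> H' a = 0"
  shows "tables H' (d + Q) AA UU S"
proof -
  have d: "6 * Q \<le> d" using t by (simp add: tables_def)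
  have ptr: "H' (5 * Q + x) = H (5 * Q + x)" if "x \<in> S" for x
    using that S d Q_bounds by (intro low) (auto dest!: subsetD)
  have "H' (H (5 * Q + x) + code n s) = H (H (5 * Q + x) + code n s)" if "x \<in> S" "s \<in> digit_fun 6 (X x)" for x s
  proof -
    have "H (5 * Q + x) + Q \<le> d" using t that by (simp add: tables_def)
    then show ?thesis using code_less_Q[OF that(2)] by (intro low) simp
  qed
  note val = this
  show ?thesis
    unfolding tables_def
  proof (intro conjI ballI allI impI)
    show "6 * Q \<le> d + Q" using d by simp
    show "H' a = 0" if "d + Q \<le> a" for a using that Q_bounds(2) by (intro high) simp
    fix x assume x: "x \<in> S"
    then have b: "6 * Q \<le> H (5 * Q + x)" "H (5 * Q + x) + Q \<le> d" using t by (simp_all add: tables_def)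
    then show "6 * Q \<le> H' (5 * Q + x)" "H' (5 * Q + x) + Q \<le> d + Q" unfolding ptr[OF x] by simp_all
    fix s assume s: "s \<in> digit_fun 6 (X x)"
    then show "H' (H' (5 * Q + x) + code n s) = table weight (AA x) (UU x) (X x) s"
      using t x unfolding ptr[OF x] val[OF x s] by (simp add: tables_def)
  qed
qed

lemma tables_update:
  assumes t: "tables H d AA UU S" and S: "S \<subseteq> {..<m}" and p: "p < m"
    and low: "\<And>a. a < d \<Longrightarrow> H' a = H a" and high: "\<And>a. d + 8 ^ n \<le> a \<Longrightarrow> H' a = 0"
    and new: "\<And>s. s \<in> digit_fun 6 (X p) \<Longrightarrow> H' (d + code n s) = table weight A U (X p) s"
  shows "tables (H'(5 * Q + p := d)) (d + Q) (AA(p := A)) (UU(p := U)) (insert p S)"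
proof -
  have t': "tables H' (d + Q) AA UU S" by (rule tables_mono[OF t S low high])
  have d: "6 * Q \<le> d" using t by (simp add: tables_def)
  have p6: "5 * Q + p < 6 * Q" using p Q_bounds by simp
  let ?H = "H'(5 * Q + p := d)"
  have zero: "?H a = 0" if "d + Q \<le> a" for a using t' that d p6 by (simp add: tables_def)
  have same: "?H a = H' a" if "6 * Q \<le> a" for a using that p6 by simp
  have node: "6 * Q \<le> ?H (5 * Q + x) \<and> ?H (5 * Q + x) + Q \<le> d + Q \<and>
       (\<forall>s\<in>digit_fun 6 (X x). ?H (?H (5 * Q + x) + code n s) = table weight ((AA(p := A)) x) ((UU(p := U)) x) (X x) s)"
    if x: "x \<in> insert p S" for x
  proof (cases "x = p")
    case True
    have "?H (d + code n s) = table weight A U (X p) s" if "s \<in> digit_fun 6 (X p)" for s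
      using new[OF that] same[of "d + code n s"] d by simp
    then show ?thesis using True d by simp
  next
    case False
    then have xS: "x \<in> S" using x by simp
    have ptr: "?H (5 * Q + x) = H' (5 * Q + x)" using False by simp
    have b: "6 * Q \<le> H' (5 * Q + x)" "H' (5 * Q + x) + Q \<le> d + Q"
      and val: "\<And>s. s \<in> digit_fun 6 (X x) \<Longrightarrow> H' (H' (5 * Q + x) + code n s) = table weight (AA x) (UU x) (X x) s"
      using t' xS by (simp_all add: tables_def)
    have "?H (H' (5 * Q + x) + code n s) = H' (H' (5 * Q + x) + code n s)" for s using same b(1) by simp
    then show ?thesis using b val False unfolding ptr by simp
  qed
  show ?thesis
    unfolding tables_def
  proof (intro conjI ballI allI impI)
    show "6 * Q \<le> d + Q" using d by simp
    show "?H a = 0" if "d + Q \<le> a" for a by (rule zero[OF that])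
  qed (use node in blast)+
qed

lemma bag_mask:
  assumes "input H" "x < m"
  shows "X x = {v. v < n \<and> H (OX + x * n + v) \<noteq> 0}" "v < n \<Longrightarrow> H (OX + x * n + v) = of_bool (v \<in> X x)"
proof -
  show *: "H (OX + x * n + v) = of_bool (v \<in> X x)" if "v < n" for v using assms that unfolding input_def by blast
  show "X x = {v. v < n \<and> H (OX + x * n + v) \<noteq> 0}" 
  proof (rule set_eqI)
    fix v
    show "v \<in> X x \<longleftrightarrow> v \<in> {v. v < n \<and> H (OX + x * n + v) \<noteq> 0}"
      using *[of v] X_sub[OF assms(2)] by (cases "v < n") auto
  qed
qed

lemma input_cong:
  assumes "input H" "\<And>a. a < 2 * Q \<Longrightarrow> H' a = H a"
  shows "input H'"
proof -
  have "H' (2 + u * n + v) = H (2 + u * n + v)" if "u < n" "v < n" for u v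
    using graph_arcs[OF that] by (intro assms(2)) simp
  moreover have "H' (OT + x * m + y) = H (OT + x * m + y)" if "x < m" "y < m" for x y
    using tree_arcs[OF that] by (intro assms(2)) simp
  moreover have "H' (OX + x * n + v) = H (OX + x * n + v)" if "x < m" "v < n" for x v
    using row[OF that(1)] that(2) by (intro assms(2)) simp
  moreover have "H' (Q + i) = H (Q + i)" if "i < n * n * n" for i
    using bits_less that by (intro assms(2)) simp
  ultimately show ?thesis using assms(1) unfolding input_def by simp
qed

lemma row_less: "x < m \<Longrightarrow> OX + x * n < 2 ^ l"
proof (rule pointer)
  assume "x < m"
  then have "OX + x * n \<le> 1 * Q" using row[of x] by simp
  also have "\<dots> \<le> N ^ 4 * Q" using N6 by (intro mult_right_mono) auto
  finally show "OX + x * n \<le> N ^ 4 * Q" .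
qed

lemma wp_init_tables:
  assumes R: "setting R" and H: "input H" "\<And>a. 5 * Q \<le> a \<Longrightarrow> H a = 0"
    and post: "\<And>R' H'. (\<And>r. r \<notin> {10, 12, 13, 16, 37} \<union> {17..32} \<Longrightarrow> R' r = R r) \<Longrightarrow> R' 10 = (6 + m) * Q \<Longrightarrow>
      (\<And>a. a < 5 * Q \<Longrightarrow> H' a = H a) \<Longrightarrow> tables H' (R' 10) (\<lambda>_. {}) X {..<m} \<Longrightarrow> P R' H'"
  shows "triple init_tables R H P"
proof -
  define I where "I x R' H' \<longleftrightarrow> (\<forall>r. r \<notin> {10, 12, 13, 16, 37} \<union> {17..32} \<longrightarrow> R' r = R r) \<and> R' 10 = (6 + x) * Q \<and>
      (\<forall>a<5 * Q. H' a = H a) \<and> tables H' (R' 10) (\<lambda>_. {}) X {..<x}" for x :: nat and R' H' :: store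
  have ptr: "(6 + x) * Q < 2 ^ l" if "x \<le> m" for x
  proof (rule pointer, rule mult_right_mono)
    have "6 + x \<le> N + N" using that N6 by simp
    also have "\<dots> \<le> N * N" using N6 by (simp add: mult_2[symmetric] del: mult_2_right)
    also have "\<dots> \<le> N ^ 4" using N_power_le[of 2 4] by (simp add: power2_eq_square)
    finally show "6 + x \<le> N ^ 4" .
  qed simp
  have "triple (For False 37 (Rg 2)
       (Asg 12 (Rg 4 \<^bold>+ Rg 37 \<^bold>* Rg 1) ;; Asg 13 (Rg 12) ;; Asg 16 (Rg 10) ;;
        fill_table init_entry ;;
        Wr (Rg 5 \<^bold>* Cn 5 \<^bold>+ Rg 37) (Rg 10) ;;
        Asg 10 (Rg 10 \<^bold>+ Rg 5))) (R(10 := 6 * Q)) H P"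
  proof (rule wp_For[where I = I and n = m])
    show "I 0 (R(10 := 6 * Q)) H" using H(2) by (simp add: I_def tables_def)
    show "eval_exp (Rg 2) (R(10 := 6 * Q)) H = m" using R by (simp add: setting_def)
    show "m \<le> (if False then E else W)" using loops by simp
  next
    fix x R' H' assume x: "x < m" and I: "I x R' H'"
    have fr: "R' r = R r" if "r \<notin> {10, 12, 13, 16, 37} \<union> {17..32}" for r using I that unfolding I_def by blast
    have low: "H' a = H a" if "a < 5 * Q" for a using I that unfolding I_def by blast
    have r10: "R' 10 = (6 + x) * Q" and t: "tables H' (R' 10) (\<lambda>_. {}) X {..<x}" using I unfolding I_def by blast+
    have inp: "input H'" by (rule input_cong[OF H(1)]) (rule low, simp)
    have regs: "R' 1 = n" "R' 4 = OX" "R' 5 = Q" using R by (simp_all add: setting_def fr)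
    then have r1: "R' (Suc 0) = n" by simp
    define R1 where "R1 = R'(37 := x, 12 := OX + x * n, 13 := OX + x * n, 16 := R' 10)"
    have "triple (fill_table init_entry) R1 H' (\<lambda>R'' H''. triple (Wr (Rg 5 \<^bold>* Cn 5 \<^bold>+ Rg 37) (Rg 10) ;;
        Asg 10 (Rg 10 \<^bold>+ Rg 5)) R'' H'' (I (Suc x)))"
    proof (rule wp_init_table[where D = "R' 10" and X = "X x" and Y = "X x"])
      show "X x = {v. v < n \<and> H' (R1 12 + v) \<noteq> 0}" using bag_mask(1)[OF inp x] by (simp add: R1_def)
      show "H' (R1 13 + v) = of_bool (v \<in> X x)" if "v < n" for v using bag_mask(2)[OF inp x that] by (simp add: R1_def)
      show "H' a = 0" if "R' 10 \<le> a" for a using t that by (simp add: tables_def)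
      have "OX + x * n + n \<le> R' 10" using row[OF x] order_trans[of _ Q "(6 + x) * Q"] by (simp add: r10)
      then show "R1 12 + n \<le> R' 10" "R1 13 + n \<le> R' 10" by (simp_all add: R1_def)
      show "18 ^ card (X x) \<le> E" by (rule bag[OF x])
    next
      fix R'' H'' assume fr'': "\<And>r. r < 17 \<or> 32 < r \<Longrightarrow> R'' r = R1 r" and low'': "\<And>a. a < R' 10 \<Longrightarrow> H'' a = H' a"
        and tab: "\<And>s x'. s \<in> digit_fun 6 (X x) \<Longrightarrow> H'' (R' 10 + code n s) = table x' {} (X x) (X x) s"
        and high'': "\<And>a. R' 10 + 8 ^ n \<le> a \<Longrightarrow> H'' a = 0"
      have r'': "R'' 5 = Q" "R'' 37 = x" "R'' 10 = R' 10" using fr'' regs by (simp_all add: R1_def)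
      have "tables (H''(5 * Q + x := R' 10)) (R' 10 + Q) ((\<lambda>_. {})(x := {})) (X(x := X x)) (insert x {..<x})"
        by (rule tables_update[OF t _ x low'' high'' tab]) (use x in auto)
      then have t2: "tables (H''(5 * Q + x := R' 10)) (R' 10 + Q) (\<lambda>_. {}) X {..<Suc x}"
        by (simp add: lessThan_Suc fun_upd_idem)
      have "I (Suc x) (R''(10 := R' 10 + Q)) (H''(5 * Q + x := R' 10))"
        unfolding I_def
      proof (intro conjI allI impI)
        show "(R''(10 := R' 10 + Q)) r = R r" if "r \<notin> {10, 12, 13, 16, 37} \<union> {17..32}" for r
          using fr''[of r] fr[OF that] that by (auto simp: R1_def)
        show "(H''(5 * Q + x := R' 10)) a = H a" if "a < 5 * Q" for a
          using low''[of a] low[OF that] that less_le_trans[OF that, of "(6 + x) * Q"] r10 by simp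
      qed (use t2 r10 in \<open>simp_all add: algebra_simps\<close>)
      moreover have "(6 + x) * Q + Q < 2 ^ l"
      proof -
        have "(6 + x) * Q + Q = (6 + Suc x) * Q" by (simp add: algebra_simps)
        also have "\<dots> < 2 ^ l" by (rule ptr) (use x in simp)
        finally show ?thesis .
      qed
      ultimately show "triple (Wr (Rg 5 \<^bold>* Cn 5 \<^bold>+ Rg 37) (Rg 10) ;; Asg 10 (Rg 10 \<^bold>+ Rg 5)) R'' H'' (I (Suc x))"
        using ptr[of x] x by (simp add: r'' r10 mult.commute[of Q])
    qed (use regs in \<open>simp_all add: R1_def\<close>)
    then show "triple (Asg 12 (Rg 4 \<^bold>+ Rg 37 \<^bold>* Rg 1) ;; Asg 13 (Rg 12) ;; Asg 16 (Rg 10) ;;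
        fill_table init_entry ;;
        Wr (Rg 5 \<^bold>* Cn 5 \<^bold>+ Rg 37) (Rg 10) ;; Asg 10 (Rg 10 \<^bold>+ Rg 5)) (R'(37 := x)) H' (I (Suc x))"
      using row_less[OF x] ptr[of x] x by (simp add: r1 regs r10 R1_def)
  next
    fix R' H' assume I: "I m R' H'"
    show "P R' H'"
    proof (rule post)
      show "R' r = R r" if "r \<notin> {10, 12, 13, 16, 37} \<union> {17..32}" for r using I that unfolding I_def by blast
      show "H' a = H a" if "a < 5 * Q" for a using I that unfolding I_def by blast
      show "R' 10 = (6 + m) * Q" "tables H' (R' 10) (\<lambda>_. {}) X {..<m}" using I unfolding I_def by blast+
    qed
  qed
  then show ?thesis using ptr[of 0] R by (simp add: init_tables_def setting_def mult.commute)
qed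

text \<open>The assumptions on \<open>A'\<close>, \<open>U'\<close> and \<open>Y\<close> are those
  of \<open>table_join\<close>, so the same code serves for single edges and for the messages of
  child nodes.\<close>

lemma wp_absorb:
  assumes R: "setting R" "R 37 = p" and inp: "input H" and t: "tables H (R 10) AA UU S"
    and S: "S \<subseteq> {..<m}" "p \<in> S"
    and gp: "AA p \<subseteq> edges G" "AA p \<subseteq> UU p \<times> UU p" "X p \<subseteq> UU p" "UU p \<subseteq> {..<n}"
    and gm: "A' \<subseteq> edges G" "A' \<subseteq> U' \<times> U'" "U' \<subseteq> {..<n}" "AA p \<inter> A' = {}" "UU p \<inter> U' = X p \<inter> Y"
    and Y: "\<And>v. v < n \<Longrightarrow> H (R 13 + v) = of_bool (v \<in> Y)" "R 13 + n \<le> R 10"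
    and M: "R 15 + 8 ^ n \<le> R 10" "\<And>s. s \<in> digit_fun 6 (X p \<inter> Y) \<Longrightarrow> H (R 15 + code n s) = table weight A' U' (X p \<inter> Y) s"
    and ptr: "R 10 + Q \<le> N ^ 4 * Q"
    and post: "\<And>R' H'. (\<And>r. r \<notin> {10, 12, 14, 16} \<union> {17..32} \<Longrightarrow> R' r = R r) \<Longrightarrow> R' 10 = R 10 + Q \<Longrightarrow>
      (\<And>a. a < R 10 \<Longrightarrow> a \<noteq> 5 * Q + p \<Longrightarrow> H' a = H a) \<Longrightarrow>
      tables H' (R 10 + Q) (AA(p := AA p \<union> A')) (UU(p := UU p \<union> U')) S \<Longrightarrow> P R' H'"
  shows "triple absorb R H P"
proof -
  have p: "p < m" using S by blast
  have regs: "R 1 = n" "R 4 = OX" "R 5 = Q" using R by (simp_all add: setting_def)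
  then have r1: "R (Suc 0) = n" by simp
  have tp: "6 * Q \<le> R 10" "6 * Q \<le> H (5 * Q + p)" "H (5 * Q + p) + Q \<le> R 10"
    "\<And>s. s \<in> digit_fun 6 (X p) \<Longrightarrow> H (H (5 * Q + p) + code n s) = table weight (AA p) (UU p) (X p) s"
    and zero: "\<And>a. R 10 \<le> a \<Longrightarrow> H a = 0"
    using t S(2) by (simp_all add: tables_def)
  define R1 where "R1 = R(12 := OX + p * n, 14 := H (5 * Q + p), 16 := R 10)"
  have fin: "finite (AA p)" "finite A'" "finite (UU p)" "finite U'"
    using gp gm finite_E finite_subset finite_subset[OF _ finite_lessThan[of n]] by blast+
  have "triple (fill_table join_entry) R1 H (\<lambda>R'' H''. triple (Wr (Rg 5 \<^bold>* Cn 5 \<^bold>+ Rg 37) (Rg 10) ;;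
      Asg 10 (Rg 10 \<^bold>+ Rg 5)) R'' H'' P)"
  proof (rule wp_join_table[where D = "R 10" and X = "X p" and Y = Y and B = table_bound
        and f = "table weight (AA p) (UU p) (X p)" and g = "table weight A' U' (X p \<inter> Y)"])
    show "X p = {v. v < n \<and> H (R1 12 + v) \<noteq> 0}" using bag_mask(1)[OF inp p] by (simp add: R1_def)
    show "H (R1 13 + v) = of_bool (v \<in> Y)" if "v < n" for v using Y(1)[OF that] by (simp add: R1_def)
    show "H a = 0" if "R 10 \<le> a" for a using zero that by simp
    show "R1 12 + n \<le> R 10" "R1 13 + n \<le> R 10" using row[OF p] tp(1) Y(2) by (simp_all add: R1_def)
    show "18 ^ card (X p) \<le> E" by (rule bag[OF p])
    show "R1 14 + 8 ^ n \<le> R 10" using tp(3) Q_bounds(2) by (simp add: R1_def)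
    show "H (R1 14 + code n s) = table weight (AA p) (UU p) (X p) s" if "s \<in> digit_fun 6 (X p)" for s
      using tp(4)[OF that] by (simp add: R1_def)
    show "H (R1 15 + code n s) = table weight A' U' (X p \<inter> Y) s" if "s \<in> digit_fun 6 (X p \<inter> Y)" for s
      using M(2)[OF that] by (simp add: R1_def)
    show "R1 15 + 8 ^ n \<le> R 10" using M(1) by (simp add: R1_def)
    show "table weight (AA p) (UU p) (X p) s \<le> table_bound" for s by (rule table_le_bound[OF gp(1,4)])
    show "table weight A' U' (X p \<inter> Y) s \<le> table_bound" for s by (rule table_le_bound[OF gm(1,3)])
    show "18 ^ n * (table_bound * table_bound) < 2 ^ l" by (rule table_bound_big)
  next
    fix R'' H'' assume fr'': "\<And>r. r < 17 \<or> 32 < r \<Longrightarrow> R'' r = R1 r" and low'': "\<And>a. a < R 10 \<Longrightarrow> H'' a = H a"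
      and tab: "\<And>s. s \<in> digit_fun 6 (X p) \<Longrightarrow> H'' (R 10 + code n s) =
        (\<Sum>\<delta> | \<delta> \<in> digit_fun 18 (X p) \<and> join_ok Y \<delta> \<and> sum_state \<delta> = s.
          table weight (AA p) (UU p) (X p) (left_state \<delta>) * table weight A' U' (X p \<inter> Y) (right_state Y \<delta>))"
      and high'': "\<And>a. R 10 + 8 ^ n \<le> a \<Longrightarrow> H'' a = 0"
    have r'': "R'' 5 = Q" "R'' 37 = p" "R'' 10 = R 10" using fr'' regs R(2) by (simp_all add: R1_def)
    have tab': "H'' (R 10 + code n s) = table weight (AA p \<union> A') (UU p \<union> U') (X p) s" if "s \<in> digit_fun 6 (X p)" for s
      unfolding tab[OF that] by (rule table_join[OF fin gp(2) gm(2,4) gp(3) gm(5)])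
    have "tables (H''(5 * Q + p := R 10)) (R 10 + Q) (AA(p := AA p \<union> A')) (UU(p := UU p \<union> U')) (insert p S)"
      by (rule tables_update[OF t S(1) p low'' high'' tab'])
    then have t2: "tables (H''(5 * Q + p := R 10)) (R 10 + Q) (AA(p := AA p \<union> A')) (UU(p := UU p \<union> U')) S"
      using S(2) by (simp add: insert_absorb)
    have "P (R''(10 := R 10 + Q)) (H''(5 * Q + p := R 10))"
    proof (rule post[OF _ _ _ t2])
      show "(R''(10 := R 10 + Q)) r = R r" if "r \<notin> {10, 12, 14, 16} \<union> {17..32}" for r
        using fr''[of r] that by (auto simp: R1_def)
      show "(H''(5 * Q + p := R 10)) a = H a" if "a < R 10" "a \<noteq> 5 * Q + p" for a using low''[OF that(1)] that by simp
    qed simp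
    then show "triple (Wr (Rg 5 \<^bold>* Cn 5 \<^bold>+ Rg 37) (Rg 10) ;; Asg 10 (Rg 10 \<^bold>+ Rg 5)) R'' H'' P"
      using pointer[OF ptr] by (simp add: r'' mult.commute[of Q])
  qed (use regs in \<open>simp_all add: R1_def\<close>)
  moreover have "H (5 * Q + p) < 2 ^ l" "R 10 < 2 ^ l" using pointer[OF ptr] tp(3) by linarith+
  ultimately show ?thesis
    using row_less[OF p] by (simp add: absorb_def r1 regs R(2) R1_def mult.commute[of Q])
qed

text \<open>The message is computed over the digits of the bag of \<open>c\<close> with the bag of
  \<open>p\<close> as mask, and is later joined over the digits of the bag of \<open>p\<close> with
  the bag of \<open>c\<close> as mask. This exchange is why register 13 ends at the mask of
  \<open>c\<close>.\<close>

lemma wp_send: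
  assumes R: "setting R" "R 37 = p" "R 38 = c" and inp: "input H" and t: "tables H (R 10) AA UU S"
    and S: "S \<subseteq> {..<m}" "c \<in> S" "p < m"
    and gc: "AA c \<subseteq> edges G" "UU c \<subseteq> {..<n}"
    and ptr: "R 10 + Q \<le> N ^ 4 * Q"
    and post: "\<And>R' H'. (\<And>r. r \<notin> {10, 12, 13, 14, 15, 16} \<union> {17..32} \<Longrightarrow> R' r = R r) \<Longrightarrow> R' 10 = R 10 + Q \<Longrightarrow>
      R' 13 = OX + c * n \<Longrightarrow> R' 15 = R 10 \<Longrightarrow> (\<And>a. a < R 10 \<Longrightarrow> H' a = H a) \<Longrightarrow> tables H' (R 10 + Q) AA UU S \<Longrightarrow>
      (\<And>s. s \<in> digit_fun 6 (X c \<inter> X p) \<Longrightarrow> H' (R 10 + code n s) = table weight (AA c) (UU c) (X c \<inter> X p) s) \<Longrightarrow> P R' H'"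
  shows "triple send R H P"
proof -
  have c: "c < m" using S by blast
  have regs: "R 1 = n" "R 4 = OX" "R 5 = Q" using R by (simp_all add: setting_def)
  then have r1: "R (Suc 0) = n" by simp
  have tp: "6 * Q \<le> R 10" "6 * Q \<le> H (5 * Q + c)" "H (5 * Q + c) + Q \<le> R 10"
    "\<And>s. s \<in> digit_fun 6 (X c) \<Longrightarrow> H (H (5 * Q + c) + code n s) = table weight (AA c) (UU c) (X c) s"
    and zero: "\<And>a. R 10 \<le> a \<Longrightarrow> H a = 0"
    using t S(2) by (simp_all add: tables_def)
  define R1 where "R1 = R(12 := OX + c * n, 13 := OX + p * n, 14 := H (5 * Q + c), 16 := R 10)"
  have fin: "finite (AA c)" "finite (UU c)" "finite (X c)"
    using gc finite_E finite_subset[OF _ finite_lessThan[of n]] X_sub[OF c] finite_subset by blast+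
  have "triple (fill_table message_entry) R1 H (\<lambda>R'' H''. triple (Asg 13 (Rg 12) ;; Asg 15 (Rg 10) ;;
      Asg 10 (Rg 10 \<^bold>+ Rg 5)) R'' H'' P)"
  proof (rule wp_message_table[where D = "R 10" and X = "X c" and Y = "X p" and B = table_bound
        and f = "table weight (AA c) (UU c) (X c)"])
    show "X c = {v. v < n \<and> H (R1 12 + v) \<noteq> 0}" using bag_mask(1)[OF inp c] by (simp add: R1_def)
    show "H (R1 13 + v) = of_bool (v \<in> X p)" if "v < n" for v using bag_mask(2)[OF inp S(3) that] by (simp add: R1_def)
    show "H a = 0" if "R 10 \<le> a" for a using zero that by simp
    show "R1 12 + n \<le> R 10" "R1 13 + n \<le> R 10" using row[OF c] row[OF S(3)] tp(1) by (simp_all add: R1_def)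
    show "18 ^ card (X c) \<le> E" by (rule bag[OF c])
    show "R1 14 + 8 ^ n \<le> R 10" using tp(3) Q_bounds(2) by (simp add: R1_def)
    show "H (R1 14 + code n s) = table weight (AA c) (UU c) (X c) s" if "s \<in> digit_fun 6 (X c)" for s
      using tp(4)[OF that] by (simp add: R1_def)
    show "table weight (AA c) (UU c) (X c) s \<le> table_bound" for s by (rule table_le_bound[OF gc])
    show "18 ^ n * table_bound < 2 ^ l" by (rule table_bound_big)
  next
    fix R'' H'' assume fr'': "\<And>r. r < 17 \<or> 32 < r \<Longrightarrow> R'' r = R1 r" and low'': "\<And>a. a < R 10 \<Longrightarrow> H'' a = H a"
      and tab: "\<And>s. s \<in> digit_fun 6 (X c \<inter> X p) \<Longrightarrow> H'' (R 10 + code n s) =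
        (\<Sum>\<delta> | \<delta> \<in> digit_fun 18 (X c) \<and> message_ok (X p) \<delta> \<and> right_state (X p) \<delta> = s.
          table weight (AA c) (UU c) (X c) (left_state \<delta>))"
      and high'': "\<And>a. R 10 + 8 ^ n \<le> a \<Longrightarrow> H'' a = 0"
    have r'': "R'' 5 = Q" "R'' 12 = OX + c * n" "R'' 10 = R 10" using fr'' regs by (simp_all add: R1_def)
    have tab': "H'' (R 10 + code n s) = table weight (AA c) (UU c) (X c \<inter> X p) s" if "s \<in> digit_fun 6 (X c \<inter> X p)" for s
      unfolding tab[OF that] by (rule table_message[OF fin])
    have "P (R''(13 := OX + c * n, 15 := R 10, 10 := R 10 + Q)) H''"
    proof (rule post[OF _ _ _ _ low'' tables_mono[OF t S(1) low'' high''] tab'])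
      show "(R''(13 := OX + c * n, 15 := R 10, 10 := R 10 + Q)) r = R r" if "r \<notin> {10, 12, 13, 14, 15, 16} \<union> {17..32}" for r
        using fr''[of r] that by (auto simp: R1_def)
    qed simp_all
    then show "triple (Asg 13 (Rg 12) ;; Asg 15 (Rg 10) ;; Asg 10 (Rg 10 \<^bold>+ Rg 5)) R'' H'' P"
      using pointer[OF ptr] row_less[OF c] by (simp add: r'')
  qed (use regs in \<open>simp_all add: R1_def\<close>)
  moreover have "H (5 * Q + c) < 2 ^ l" "R 10 < 2 ^ l" using pointer[OF ptr] tp(3) by linarith+
  ultimately show ?thesis
    using row_less[OF c] row_less[OF S(3)] by (simp add: send_def r1 regs R(2,3) R1_def mult.commute[of Q])
qed

end

section \<open>Programs for edge weights, single edges, merging and the final test\<close>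

definition set_radices :: prog where
  "set_radices =
     Asg 8 (Cn 1) ;; For False 44 (Rg 1 \<^bold>* Rg 1 \<^bold>* Rg 1 \<^bold>+ Rg 1 \<^bold>+ Cn 1) (Asg 8 (Rg 8 \<^bold>* Cn 2)) ;;
     Asg 9 (Cn 1) ;; For False 44 (Rg 1 \<^bold>* Rg 1 \<^bold>* Rg 1) (Asg 9 (Rg 9 \<^bold>* Rg 8))"

definition find_bag :: prog where
  "find_bag = For False 38 (Rg 2)
     (Ifs (Hp (Rg 4 \<^bold>+ Rg 38 \<^bold>* Rg 1 \<^bold>+ Rg 33) \<^bold>* Hp (Rg 4 \<^bold>+ Rg 38 \<^bold>* Rg 1 \<^bold>+ Rg 34)) (Asg 37 (Rg 38)) Nop)"

definition edge_weight :: prog where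
  "edge_weight =
     Asg 39 (Cn 0) ;; Asg 40 (Cn 1) ;;
     For False 44 (Rg 1)
       (Asg 39 (Rg 39 \<^bold>+ Hp (Rg 5 \<^bold>+ (Rg 33 \<^bold>* Rg 1 \<^bold>+ Rg 34) \<^bold>* Rg 1 \<^bold>+ Rg 44) \<^bold>* Rg 40) ;;
        Asg 40 (Rg 40 \<^bold>* Rg 8)) ;;
     Asg 39 (Rg 39 \<^bold>* Rg 9)"

text \<open>Registers 35 and 36 hold \<open>6 ^ u\<close> and \<open>6 ^ w\<close>, so the states
  \<open>a\<close> and \<open>b\<close> of the two ends have offset
  \<open>a * 6 ^ u + b * 6 ^ w\<close>. Degree zero gives the states 0 and 3 in any combination;
  degree one on equal sides gives the pairs 1, 1 and 4, 4. The mask of the two ends occupies a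
  segment of its own.\<close>

definition edge_message :: prog where
  "edge_message =
     Wr (Rg 10 \<^bold>+ Rg 33) (Cn 1) ;; Wr (Rg 10 \<^bold>+ Rg 34) (Cn 1) ;; Asg 13 (Rg 10) ;; Asg 10 (Rg 10 \<^bold>+ Rg 5) ;;
     Wr (Rg 10) (Cn 1) ;; Wr (Rg 10 \<^bold>+ Cn 3 \<^bold>* Rg 35) (Cn 1) ;; Wr (Rg 10 \<^bold>+ Cn 3 \<^bold>* Rg 36) (Cn 1) ;;
     Wr (Rg 10 \<^bold>+ (Cn 3 \<^bold>* Rg 35 \<^bold>+ Cn 3 \<^bold>* Rg 36)) (Cn 1) ;;
     Wr (Rg 10 \<^bold>+ (Rg 35 \<^bold>+ Rg 36)) (Rg 39) ;; Wr (Rg 10 \<^bold>+ (Cn 4 \<^bold>* Rg 35 \<^bold>+ Cn 4 \<^bold>* Rg 36)) (Rg 39) ;;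
     Asg 15 (Rg 10) ;; Asg 10 (Rg 10 \<^bold>+ Rg 5)"

definition absorb_edges :: prog where
  "absorb_edges =
     Asg 35 (Cn 1) ;;
     For False 33 (Rg 1)
       (Asg 36 (Cn 1) ;;
        For False 34 (Rg 1)
          (Ifs (Hp (Cn 2 \<^bold>+ Rg 33 \<^bold>* Rg 1 \<^bold>+ Rg 34) \<^bold>* (Rg 34 \<^bold>- Rg 33))
             (find_bag ;; edge_weight ;; edge_message ;; absorb) Nop ;;
           Asg 36 (Rg 36 \<^bold>* Cn 6)) ;;
        Asg 35 (Rg 35 \<^bold>* Cn 6))"

text \<open>Nodes are sent to their parents in reverse search order, so a node has received all its
  children before it is sent on; the root at position 0 remains.\<close>

definition merge_tables :: prog where
  "merge_tables = For False 44 (Rg 2 \<^bold>- Cn 1)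
     (Asg 38 (Hp (Rg 5 \<^bold>* Cn 3 \<^bold>+ (Rg 2 \<^bold>- Cn 1 \<^bold>- Rg 44))) ;;
      Asg 37 (Hp (Rg 5 \<^bold>* Cn 4 \<^bold>+ (Rg 2 \<^bold>- Cn 1 \<^bold>- Rg 44))) ;;
      send ;; absorb)"

text \<open>A message over the empty set sums out all vertices of the root bag. The zero cells at
  the free pointer serve as the mask of the empty set, and the result is placed one segment further
  on.\<close>

definition total_value :: prog where
  "total_value =
     Asg 12 (Rg 4) ;; Asg 14 (Hp (Rg 5 \<^bold>* Cn 5)) ;; Asg 13 (Rg 10) ;; Asg 10 (Rg 10 \<^bold>+ Rg 5) ;; Asg 16 (Rg 10) ;;
     fill_table message_entry ;;
     Asg 47 (Hp (Rg 10))"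

text \<open>Register 48 runs through \<open>(2 ^ D) ^ ((n - k) * n ^ 3 + j) * 2 ^ k\<close>, so that
  a quotient and a parity test realise \<open>accepts\<close>.\<close>

definition test_total :: prog where
  "test_total =
     Asg 48 (Cn 1) ;;
     For False 44 (Rg 1 \<^bold>* Rg 1 \<^bold>* Rg 1 \<^bold>* (Rg 1 \<^bold>- Rg 6)) (Asg 48 (Rg 48 \<^bold>* Rg 8)) ;;
     For False 44 (Rg 6) (Asg 48 (Rg 48 \<^bold>* Cn 2)) ;;
     Asg 0 (Cn 0) ;;
     For False 44 (Rg 1 \<^bold>* Rg 1 \<^bold>* Rg 1)
       (Asg 43 (Rg 47 \<^bold>/ Rg 48) ;;
        Ifs (Rg 43 \<^bold>- Rg 43 \<^bold>/ Cn 2 \<^bold>* Cn 2) (Asg 0 (Cn 1)) Nop ;;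
        Asg 48 (Rg 48 \<^bold>* Rg 8))"

definition decide :: prog where
  "decide = set_radices ;; find_order ;; init_tables ;; absorb_edges ;; merge_tables ;; total_value ;; test_total"

lemma code_pair:
  assumes "u < n" "w < n" "u \<noteq> w" "s \<in> digit_fun b {u, w}"
  shows "code n s = s u * 6 ^ u + s w * 6 ^ w"
proof -
  have "code n s = (\<Sum>v\<in>{u, w}. s v * 6 ^ v)"
    unfolding code_def by (rule sum.mono_neutral_right) (use assms in \<open>auto simp: digit_fun_iff\<close>)
  then show ?thesis using assms(3) by simp
qed

context dp_instance
begin

section \<open>Correctness of the phases of the program\<close>

lemma wp_power:
  assumes i: "i \<noteq> r" and b: "\<And>R'. (\<And>q. q \<noteq> i \<Longrightarrow> q \<noteq> r \<Longrightarrow> R' q = R q) \<Longrightarrow> eval_exp b R' H = c"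
    and count: "eval_exp e R H = N'" "N' \<le> W" and bound: "\<And>j. j \<le> N' \<Longrightarrow> R r * c ^ j < 2 ^ l"
    and post: "\<And>R'. (\<And>q. q \<noteq> i \<Longrightarrow> q \<noteq> r \<Longrightarrow> R' q = R q) \<Longrightarrow> R' r = R r * c ^ N' \<Longrightarrow> P R' H"
  shows "triple (For False i e (Asg r (Rg r \<^bold>* b))) R H P"
proof (rule wp_For[where n = N' and I = "\<lambda>j R' H'. H' = H \<and> (\<forall>q. q \<noteq> i \<longrightarrow> q \<noteq> r \<longrightarrow> R' q = R q) \<and> R' r = R r * c ^ j"])
  fix j R' H' assume j: "j < N'" and I: "H' = H \<and> (\<forall>q. q \<noteq> i \<longrightarrow> q \<noteq> r \<longrightarrow> R' q = R q) \<and> R' r = R r * c ^ j"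
  have "eval_exp b (R'(i := j)) H = c" using I by (intro b) simp
  moreover have "R r * c ^ j * c < 2 ^ l" using bound[of "Suc j"] j by (simp add: mult_ac)
  ultimately show "triple (Asg r (Rg r \<^bold>* b)) (R'(i := j)) H'
      (\<lambda>R' H'. H' = H \<and> (\<forall>q. q \<noteq> i \<longrightarrow> q \<noteq> r \<longrightarrow> R' q = R q) \<and> R' r = R r * c ^ Suc j)"
    using I i by (simp add: mult_ac)
qed (use count post in auto)

lemma cube_le: "n * n * n \<le> N ^ 3" "n * n * n * (n - k) \<le> N ^ 4" "n * n * n + n + 1 \<le> N ^ 3"
proof -
  show 3: "n * n * n + n + 1 \<le> N ^ 3" using D_le(1) by (simp add: D_def power3_eq_cube)
  then show c: "n * n * n \<le> N ^ 3" by linarith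
  have "n * n * n * (n - k) \<le> N ^ 3 * N" using c N6 by (intro mult_le_mono) auto
  then show "n * n * n * (n - k) \<le> N ^ 4" by (simp add: power_numeral_reduce mult_ac)
qed

lemma radix_power_less: "j \<le> N ^ 6 \<Longrightarrow> (2 ^ D) ^ j < (2::nat) ^ l"
proof (rule big)
  assume "j \<le> N ^ 6"
  then have "D * j \<le> N ^ 3 * N ^ 6" using D_le(1) by (intro mult_le_mono) auto
  also have "\<dots> = N ^ 9" by (simp add: power_add[symmetric])
  also have "\<dots> \<le> N ^ 11" by (rule N_power_le) simp
  finally show "D * j \<le> N ^ 11" .
qed (simp add: power_mult)

definition radices :: "store \<Rightarrow> bool" where
  "radices R \<longleftrightarrow> R 8 = 2 ^ D \<and> R 9 = (2 ^ D) ^ (n ^ 3)"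

lemma wp_set_radices:
  assumes R: "setting R"
    and post: "\<And>R'. (\<And>r. r \<notin> {8, 9, 44} \<Longrightarrow> R' r = R r) \<Longrightarrow> radices R' \<Longrightarrow> P R' H"
  shows "triple set_radices R H P"
proof -
  have r1: "R 1 = n" using R by (simp add: setting_def)
  then have r1': "R (Suc 0) = n" by simp
  have Dn: "n * n * n + n + 1 = D" by (simp add: D_def power3_eq_cube)
  have n3: "n * n * n = n ^ 3" by (simp add: power3_eq_cube)
  have "triple (For False 44 (Rg 1 \<^bold>* Rg 1 \<^bold>* Rg 1 \<^bold>+ Rg 1 \<^bold>+ Cn 1) (Asg 8 (Rg 8 \<^bold>* Cn 2))) (R(8 := 1)) H
    (\<lambda>R' H'. triple (Asg 9 (Cn 1) ;; For False 44 (Rg 1 \<^bold>* Rg 1 \<^bold>* Rg 1) (Asg 9 (Rg 9 \<^bold>* Rg 8))) R' H' P)"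
  proof (rule wp_power[where c = 2 and N' = D])
    show "eval_exp (Rg 1 \<^bold>* Rg 1 \<^bold>* Rg 1 \<^bold>+ Rg 1 \<^bold>+ Cn 1) (R(8 := 1)) H = D" using r1' Dn by simp
    show "D \<le> W" using D_le loops by simp
    show "(R(8 := 1)) 8 * 2 ^ j < 2 ^ l" if "j \<le> D" for j
    proof -
      have "j \<le> N ^ 11" using that D_le(1) N_power_le[of 3 11] by linarith
      then show ?thesis using big[of "2 ^ j" j] by simp
    qed
    fix R' assume fr: "\<And>q. q \<noteq> 44 \<Longrightarrow> q \<noteq> 8 \<Longrightarrow> R' q = (R(8 := 1)) q" and "R' 8 = (R(8 := 1)) 8 * 2 ^ D"
    then have r8: "R' 8 = 2 ^ D" by simp
    have f1: "R' 1 = n" using fr[of 1] r1 by simp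
    then have f1': "R' (Suc 0) = n" by simp
    have "triple (For False 44 (Rg 1 \<^bold>* Rg 1 \<^bold>* Rg 1) (Asg 9 (Rg 9 \<^bold>* Rg 8))) (R'(9 := 1)) H P"
    proof (rule wp_power[where c = "2 ^ D" and N' = "n ^ 3"])
      show "eval_exp (Rg 1 \<^bold>* Rg 1 \<^bold>* Rg 1) (R'(9 := 1)) H = n ^ 3" using f1' n3 by simp
      show "n ^ 3 \<le> W" using order_trans[OF cube_le(1) loops(3)] unfolding n3 .
      show "(R'(9 := 1)) 9 * (2 ^ D) ^ j < 2 ^ l" if "j \<le> n ^ 3" for j
      proof -
        have "j \<le> N ^ 6" using that cube_le(1) N_power_le[of 3 6] unfolding n3 by linarith
        then show ?thesis using radix_power_less by simp
      qed
      fix R'' assume fr'': "\<And>q. q \<noteq> 44 \<Longrightarrow> q \<noteq> 9 \<Longrightarrow> R'' q = (R'(9 := 1)) q" and r9: "R'' 9 = (R'(9 := 1)) 9 * (2 ^ D) ^ (n ^ 3)"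
      show "P R'' H"
      proof (rule post)
        show "R'' r = R r" if "r \<notin> {8, 9, 44}" for r using that fr''[of r] fr[of r] by simp
        show "radices R''" using fr''[of 8] r8 r9 by (simp add: radices_def)
      qed
    qed (use r8 in simp_all)
    then show "triple (Asg 9 (Cn 1) ;; For False 44 (Rg 1 \<^bold>* Rg 1 \<^bold>* Rg 1) (Asg 9 (Rg 9 \<^bold>* Rg 8))) R' H P"
      using small[of 1] by simp
  qed simp_all
  then show ?thesis using small[of 1] by (simp add: set_radices_def)
qed

lemma wp_find_bag:
  assumes R: "setting R" "R 33 = u" "R 34 = w" "u < n" "w < n" and H: "input H"
    and ex: "x0 < m" "u \<in> X x0" "w \<in> X x0"
    and post: "\<And>R'. (\<And>r. r \<notin> {37, 38} \<Longrightarrow> R' r = R r) \<Longrightarrow> R' 37 < m \<Longrightarrow> u \<in> X (R' 37) \<Longrightarrow> w \<in> X (R' 37) \<Longrightarrow> P R' H"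
  shows "triple find_bag R H P"
  unfolding find_bag_def
proof (rule wp_For[where n = m and I = "\<lambda>x R' H'. H' = H \<and> (\<forall>r. r \<notin> {37, 38} \<longrightarrow> R' r = R r) \<and>
      ((\<exists>y<x. u \<in> X y \<and> w \<in> X y) \<longrightarrow> R' 37 < m \<and> u \<in> X (R' 37) \<and> w \<in> X (R' 37))"])
  fix x R' H' assume x: "x < m" and I: "H' = H \<and> (\<forall>r. r \<notin> {37, 38} \<longrightarrow> R' r = R r) \<and>
      ((\<exists>y<x. u \<in> X y \<and> w \<in> X y) \<longrightarrow> R' 37 < m \<and> u \<in> X (R' 37) \<and> w \<in> X (R' 37))"
  have regs: "R' (Suc 0) = n" "R' 4 = OX" "R' 33 = u" "R' 34 = w" using I R by (simp_all add: setting_def)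
  have c: "H (OX + x * n + u) * H (OX + x * n + w) = of_bool (u \<in> X x \<and> w \<in> X x)"
    using bag_mask(2)[OF H x R(4)] bag_mask(2)[OF H x R(5)] by simp
  have "x < 2 ^ l" using x N6 by (intro small_N) simp
  then show "triple (Ifs (Hp (Rg 4 \<^bold>+ Rg 38 \<^bold>* Rg 1 \<^bold>+ Rg 33) \<^bold>* Hp (Rg 4 \<^bold>+ Rg 38 \<^bold>* Rg 1 \<^bold>+ Rg 34)) (Asg 37 (Rg 38)) Nop)
      (R'(38 := x)) H' (\<lambda>R' H'. H' = H \<and> (\<forall>r. r \<notin> {37, 38} \<longrightarrow> R' r = R r) \<and>
      ((\<exists>y<Suc x. u \<in> X y \<and> w \<in> X y) \<longrightarrow> R' 37 < m \<and> u \<in> X (R' 37) \<and> w \<in> X (R' 37)))"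
    using I c x by (cases "u \<in> X x \<and> w \<in> X x") (auto simp: regs less_Suc_eq)
next
  fix R' H' assume I: "H' = H \<and> (\<forall>r. r \<notin> {37, 38} \<longrightarrow> R' r = R r) \<and>
      ((\<exists>y<m. u \<in> X y \<and> w \<in> X y) \<longrightarrow> R' 37 < m \<and> u \<in> X (R' 37) \<and> w \<in> X (R' 37))"
  have "R' 37 < m" "u \<in> X (R' 37)" "w \<in> X (R' 37)" "H' = H" using I ex by blast+
  then show "P R' H'" using I post[of R'] by simp
qed (use R loops in \<open>simp_all add: setting_def\<close>)

lemma wp_edge_weight:
  assumes R: "setting R" "radices R" "R 33 = u" "R 34 = w" "u < n" "w < n" and H: "input H"
    and post: "\<And>R'. (\<And>r. r \<notin> {39, 40, 44} \<Longrightarrow> R' r = R r) \<Longrightarrow> R' 39 = weight (u, w) \<Longrightarrow> P R' H"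
  shows "triple edge_weight R H P"
proof -
  define f where "f j = (\<Sum>i<j. of_bool (\<beta> (bit_address (u, w) + i)) * (2 ^ D) ^ i :: nat)" for j
  have f: "f j \<le> (2 ^ D) ^ j" for j
  proof (induction j)
    case (Suc j)
    have "(2::nat) \<le> 2 ^ D" using power_increasing[of 1 D "2::nat"] by (simp add: D_def)
    then have "2 * (2 ^ D :: nat) ^ j \<le> (2 ^ D) * (2 ^ D) ^ j" by (rule mult_right_mono) simp
    moreover have "of_bool (\<beta> (bit_address (u, w) + j)) * (2 ^ D) ^ j \<le> (2 ^ D :: nat) ^ j" by simp
    ultimately show ?case using Suc unfolding f_def by (simp only: sum.lessThan_Suc power_Suc; linarith)
  qed (simp add: f_def)
  have nN: "j \<le> N ^ 6" if "j \<le> n" for j using that N6 N_power_le[of 1 6] by simp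
  have W9: "weight (u, w) < 2 ^ l"
  proof (rule big[OF less_imp_le[OF weight_le]])
    have "D * (n ^ 3 + n) \<le> N ^ 3 * N ^ 3" using D_le by (intro mult_le_mono)
    also have "\<dots> = N ^ 6" by (simp add: power_add[symmetric])
    also have "\<dots> \<le> N ^ 11" by (rule N_power_le) simp
    finally show "D * (n ^ 3 + n) \<le> N ^ 11" .
  qed
  have r1: "R (Suc 0) = n" using R by (simp add: setting_def)
  have "triple (For False 44 (Rg 1)
       (Asg 39 (Rg 39 \<^bold>+ Hp (Rg 5 \<^bold>+ (Rg 33 \<^bold>* Rg 1 \<^bold>+ Rg 34) \<^bold>* Rg 1 \<^bold>+ Rg 44) \<^bold>* Rg 40) ;;
        Asg 40 (Rg 40 \<^bold>* Rg 8))) (R(39 := 0, 40 := 1)) H (\<lambda>R' H'. triple (Asg 39 (Rg 39 \<^bold>* Rg 9)) R' H' P)"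
  proof (rule wp_For[where n = n and I = "\<lambda>j R' H'. H' = H \<and> (\<forall>r. r \<notin> {39, 40, 44} \<longrightarrow> R' r = R r) \<and>
        R' 39 = f j \<and> R' 40 = (2 ^ D) ^ j"])
    fix j R' H' assume j: "j < n" and I: "H' = H \<and> (\<forall>r. r \<notin> {39, 40, 44} \<longrightarrow> R' r = R r) \<and>
        R' 39 = f j \<and> R' 40 = (2 ^ D) ^ j"
    have regs: "R' (Suc 0) = n" "R' 5 = Q" "R' 33 = u" "R' 34 = w" "R' 8 = 2 ^ D" "R' 39 = f j" "R' 40 = (2 ^ D) ^ j"
      using I R by (simp_all add: setting_def radices_def)
    have "(u * n + w) * n + j < n * n * n" using pair_index_less[OF pair_index_less[OF R(5,6)] j] .
    then have h: "H (Q + (u * n + w) * n + j) = of_bool (\<beta> (bit_address (u, w) + j))"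
      using H unfolding input_def by (simp add: bit_address_def add.assoc)
    have fs: "f j + of_bool (\<beta> (bit_address (u, w) + j)) * (2 ^ D) ^ j = f (Suc j)" by (simp add: f_def)
    have ps: "(2 ^ D) ^ j * 2 ^ D = (2 ^ D :: nat) ^ Suc j" by simp
    have lt: "f (Suc j) < 2 ^ l" "(2 ^ D) ^ Suc j < (2::nat) ^ l"
      using f[of "Suc j"] radix_power_less[OF nN[of "Suc j"]] j by simp_all
    show "triple (Asg 39 (Rg 39 \<^bold>+ Hp (Rg 5 \<^bold>+ (Rg 33 \<^bold>* Rg 1 \<^bold>+ Rg 34) \<^bold>* Rg 1 \<^bold>+ Rg 44) \<^bold>* Rg 40) ;;
        Asg 40 (Rg 40 \<^bold>* Rg 8)) (R'(44 := j)) H' (\<lambda>R' H'. H' = H \<and> (\<forall>r. r \<notin> {39, 40, 44} \<longrightarrow> R' r = R r) \<and>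
        R' 39 = f (Suc j) \<and> R' 40 = (2 ^ D) ^ Suc j)"
      using I lt by (simp add: regs h fs ps del: power_Suc)
  next
    fix R' H' assume I: "H' = H \<and> (\<forall>r. r \<notin> {39, 40, 44} \<longrightarrow> R' r = R r) \<and> R' 39 = f n \<and> R' 40 = (2 ^ D) ^ n"
    have "R' 39 * R' 9 = weight (u, w)" using I R(2) by (simp add: variable_def f_def radices_def mult.commute)
    then show "triple (Asg 39 (Rg 39 \<^bold>* Rg 9)) R' H' P" using I W9 post[of "R'(39 := weight (u, w))"] by simp
  qed (use r1 n in \<open>simp_all add: f_def\<close>)
  then show ?thesis using small[of 0] small[of 1] by (simp add: edge_weight_def)
qed

lemma wp_edge_message:
  assumes R: "setting R" "R 33 = u" "R 34 = w" "R 35 = 6 ^ u" "R 36 = 6 ^ w" "R 39 = weight (u, w)" "u < w" "w < n"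
    and t: "tables H (R 10) AA UU S" and S: "S \<subseteq> {..<m}" and ptr: "R 10 + 2 * Q \<le> N ^ 4 * Q"
    and post: "\<And>R' H'. (\<And>r. r \<notin> {10, 13, 15} \<Longrightarrow> R' r = R r) \<Longrightarrow> R' 10 = R 10 + 2 * Q \<Longrightarrow> R' 13 = R 10 \<Longrightarrow>
      R' 15 = R 10 + Q \<Longrightarrow> (\<And>a. a < R 10 \<Longrightarrow> H' a = H a) \<Longrightarrow> tables H' (R 10 + 2 * Q) AA UU S \<Longrightarrow>
      (\<And>v. v < n \<Longrightarrow> H' (R 10 + v) = of_bool (v \<in> {u, w})) \<Longrightarrow>
      (\<And>s. s \<in> digit_fun 6 {u, w} \<Longrightarrow> H' (R 10 + Q + code n s) = table weight {(u, w)} {u, w} {u, w} s) \<Longrightarrow> P R' H'"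
  shows "triple edge_message R H P"
proof -
  have un: "u < n" using R by simp
  define d where "d = R 10"
  define e where "e = R 10 + Q"
  define \<xi> where "\<xi> = weight (u, w)"
  define f where "f a b = a * 6 ^ u + b * (6::nat) ^ w" for a b
  have fcode: "code n s = f (s u) (s w)" if "s \<in> digit_fun 6 {u, w}" for s
    unfolding f_def by (rule code_pair[OF un R(8) _ that]) (use R in simp)
  \<comment> \<open>Injectivity shows that the six writes do not overwrite one another.\<close>
  have finj: "f a b = f a' b' \<longleftrightarrow> a = a' \<and> b = b'" if "a < 6" "b < 6" "a' < 6" "b' < 6" for a b a' b'
  proof
    assume eq: "f a b = f a' b'"
    let ?s = "\<lambda>a b v. if v = u then a else if v = w then b else 0"
    have in6: "?s a b \<in> digit_fun 6 {u, w}" "?s a' b' \<in> digit_fun 6 {u, w}" using that by (simp_all add: digit_fun_iff)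
    have "code n (?s a b) = code n (?s a' b')" unfolding fcode[OF in6(1)] fcode[OF in6(2)] using eq R(7) by simp
    then have "?s a b = ?s a' b'" using code_inj[OF in6] un R(8) by simp
    from fun_cong[OF this, of u] fun_cong[OF this, of w] show "a = a' \<and> b = b'" using R(7) by simp
  qed simp
  have fQ: "f a b < Q" if "a < 6" "b < 6" for a b
  proof -
    have "(\<lambda>v. if v = u then a else if v = w then b else 0) \<in> digit_fun 6 {u, w}" using that by (simp add: digit_fun_iff)
    from code_less_Q[OF this] fcode[OF this] show ?thesis using R(7) by simp
  qed
  define H1 where "H1 = H(d + u := 1, d + w := 1)"
  define H2 where "H2 = H1(e + f 0 0 := 1, e + f 3 0 := 1, e + f 0 3 := 1, e + f 3 3 := 1, e + f 1 1 := \<xi>, e + f 4 4 := \<xi>)"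
  have td: "6 * Q \<le> d" and zero: "\<And>a. d \<le> a \<Longrightarrow> H a = 0" using t by (simp_all add: tables_def d_def)
  have ede: "e = d + Q" by (simp add: e_def d_def)
  have nQ: "n \<le> Q" using Q_bounds by simp
  have low1: "H1 a = H a" if "a < d" for a using that by (simp add: H1_def)
  have low2: "H2 a = H1 a" if "a < e" for a using that by (simp add: H2_def)
  have high2: "H2 a = 0" if "d + 2 * Q \<le> a" for a
  proof -
    have "e + f x y \<noteq> a" if "x < 6" "y < 6" for x y using fQ[OF that] \<open>d + 2 * Q \<le> a\<close> ede by simp
    moreover have "H1 a = 0" using that zero[of a] un R(8) nQ by (simp add: H1_def)
    ultimately show ?thesis unfolding H2_def by (simp add: neq_commute)
  qed
  have "tables H2 (d + 2 * Q) AA UU S"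
  proof -
    have t1: "tables H1 (d + Q) AA UU S"
    proof (rule tables_mono[OF t[folded d_def] S low1])
      show "H1 a = 0" if "d + 8 ^ n \<le> a" for a
      proof -
        have "n < 8 ^ n" using less_le_trans[OF less_exp[of n] power_mono[of 2 8 n]] by simp
        then show ?thesis using that zero[of a] un R(8) by (simp add: H1_def)
      qed
    qed
    have z1: "H1 a = 0" if "e \<le> a" for a using t1 that by (simp add: tables_def ede)
    have "tables H2 (d + Q + Q) AA UU S"
    proof (rule tables_mono[OF t1 S])
      show "H2 a = H1 a" if "a < d + Q" for a using low2 that by (simp add: ede)
      fix a assume a: "d + Q + 8 ^ n \<le> a"
      have "f x y < 8 ^ n" if "x < 6" "y < 6" for x y
      proof -
        have "(\<lambda>v. if v = u then x else if v = w then y else 0) \<in> digit_fun 6 {u, w}" using that by (simp add: digit_fun_iff)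
        from code_small[OF this] fcode[OF this] show ?thesis using R(7) by simp
      qed
      then have "e + f x y \<noteq> a" if "x < 6" "y < 6" for x y using that a ede by fastforce
      then show "H2 a = 0" using z1[of a] a ede unfolding H2_def by (simp add: neq_commute)
    qed
    then show ?thesis by (simp add: mult_2 add.assoc)
  qed
  moreover have "H2 (d + v) = of_bool (v \<in> {u, w})" if "v < n" for v
    using low2[of "d + v"] that nQ ede zero[of "d + v"] by (simp add: H1_def)
  moreover have "H2 (e + code n s) = table weight {(u, w)} {u, w} {u, w} s" if s: "s \<in> digit_fun 6 {u, w}" for s
  proof -
    define a b where "a = s u" and "b = s w"
    have ab: "a < 6" "b < 6" using s by (simp_all add: digit_fun_iff a_def b_def)
    have z: "H1 (e + f a b) = 0" using zero[of "e + f a b"] un R(8) nQ ede by (simp add: H1_def)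
    have "H2 (e + f a b) = (if a = 4 \<and> b = 4 \<or> a = 1 \<and> b = 1 then \<xi> else if (a = 0 \<or> a = 3) \<and> (b = 0 \<or> b = 3) then 1 else 0)"
      unfolding H2_def using ab z by (auto simp: finj)
    also have "\<dots> = (if a mod 3 = 0 \<and> b mod 3 = 0 then 1 else if a = b \<and> a mod 3 = 1 then \<xi> else 0)"
    proof -
      have "a = 0 \<or> a = 1 \<or> a = 2 \<or> a = 3 \<or> a = 4 \<or> a = 5" "b = 0 \<or> b = 1 \<or> b = 2 \<or> b = 3 \<or> b = 4 \<or> b = 5"
        using ab by linarith+
      then show ?thesis by (elim disjE; simp)
    qed
    finally show ?thesis
      unfolding table_edge[OF less_imp_neq[OF R(7)] s] fcode[OF s] a_def b_def \<xi>_def .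
  qed
  ultimately have "P (R(13 := d, 15 := e, 10 := d + 2 * Q)) H2"
    using low1 low2 by (intro post) (simp_all add: d_def e_def)
  then have "P (R(13 := d, 15 := d + Q, 10 := d + Q + Q)) H2" by (simp add: ede mult_2 add.assoc)
  moreover have "d < 2 ^ l" "d + Q < 2 ^ l" "d + Q + Q < 2 ^ l"
    using pointer[OF ptr] by (simp_all add: d_def mult_2 add.assoc)
  moreover have "\<xi> < 2 ^ l"
  proof -
    have "D * (n ^ 3 + n) \<le> N ^ 3 * N ^ 3" using D_le by (intro mult_le_mono)
    also have "\<dots> = N ^ 6" by (simp add: power_add[symmetric])
    also have "\<dots> \<le> N ^ 11" by (rule N_power_le) simp
    finally show ?thesis unfolding \<xi>_def by (intro big[OF less_imp_le[OF weight_le]])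
  qed
  moreover have regs: "R 5 = Q" using R by (simp add: setting_def)
  moreover have fs: "f 0 0 = 0" "f 3 0 = 3 * 6 ^ u" "f 0 3 = 3 * 6 ^ w" "f 3 3 = 3 * 6 ^ u + 3 * 6 ^ w"
      "f 1 1 = 6 ^ u + 6 ^ w" "f 4 4 = 4 * 6 ^ u + 4 * 6 ^ w"
    by (simp_all add: f_def)
  ultimately show ?thesis
    using small[of 1] unfolding edge_message_def H2_def H1_def fs ede
    by (simp add: R(2-6) d_def[symmetric] \<xi>_def[symmetric])
qed

text \<open>Each edge of \<open>F\<close> is credited to exactly one bag that contains both its
  ends; disjointness keeps it from being counted twice after merging.\<close>

definition assigned :: "(nat \<Rightarrow> (nat \<times> nat) set) \<Rightarrow> (nat \<times> nat) set \<Rightarrow> bool" where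
  "assigned AA F \<longleftrightarrow> (\<forall>x<m. AA x \<subseteq> X x \<times> X x) \<and> (\<forall>x<m. \<forall>y<m. x \<noteq> y \<longrightarrow> AA x \<inter> AA y = {}) \<and> (\<Union>x<m. AA x) = F"

abbreviation "kept r \<equiv> r < 10 \<or> (32 < r \<and> r \<notin> {37, 38, 39, 40, 44})"

lemma edge_in_bag: "(u, w) \<in> edges G \<Longrightarrow> \<exists>x<m. u \<in> X x \<and> w \<in> X x"
  using td T unfolding tree_decomposition_def edges_def by fastforce

text \<open>An edge consumes three segments: the mask, the message and the new table of the bag. The
  vertex sets do not grow, because both ends already belong to the bag.\<close>

lemma wp_edge:
  assumes R: "setting R" "radices R" "R 33 = u" "R 34 = w" "R 35 = 6 ^ u" "R 36 = 6 ^ w"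
    and e: "(u, w) \<in> edges G" and H: "input H" and t: "tables H (R 10) AA X {..<m}"
    and AA: "assigned AA F" "F \<subseteq> edges G" "(u, w) \<notin> F" and ptr: "R 10 + 3 * Q \<le> N ^ 4 * Q"
    and post: "\<And>R' H' AA'. (\<And>r. kept r \<Longrightarrow> R' r = R r) \<Longrightarrow> R' 10 = R 10 + 3 * Q \<Longrightarrow> (\<And>a. a < 5 * Q \<Longrightarrow> H' a = H a) \<Longrightarrow>
      tables H' (R' 10) AA' X {..<m} \<Longrightarrow> assigned AA' (insert (u, w) F) \<Longrightarrow> P R' H'"
  shows "triple (find_bag ;; edge_weight ;; edge_message ;; absorb) R H P"
proof -
  have uw: "u < w" "w < n" "u < n" using E e by auto
  obtain x0 where x0: "x0 < m" "u \<in> X x0" "w \<in> X x0" using edge_in_bag[OF e] by blast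
  have d6: "6 * Q \<le> R 10" using t by (simp add: tables_def)
  have "triple find_bag R H (\<lambda>R H. triple edge_weight R H (\<lambda>R H. triple edge_message R H (\<lambda>R H. triple absorb R H P)))"
  proof (rule wp_find_bag[OF R(1,3,4) uw(3,2) H x0])
    fix R1 assume f1: "\<And>r. r \<notin> {37, 38} \<Longrightarrow> R1 r = R r" and p: "R1 37 < m" "u \<in> X (R1 37)" "w \<in> X (R1 37)"
    have s1: "setting R1" "radices R1" using R(1,2) by (simp_all add: setting_def radices_def f1)
    show "triple edge_weight R1 H (\<lambda>R H. triple edge_message R H (\<lambda>R H. triple absorb R H P))"
    proof (rule wp_edge_weight[OF s1 _ _ uw(3,2) H])
      show "R1 33 = u" "R1 34 = w" using R by (simp_all add: f1)
      fix R2 assume f2: "\<And>r. r \<notin> {39, 40, 44} \<Longrightarrow> R2 r = R1 r" and r39: "R2 39 = weight (u, w)"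
      have f2': "R2 r = R r" if "r \<notin> {37, 38, 39, 40, 44}" for r using that f2[of r] f1[of r] by simp
      have s2: "setting R2" using R(1) by (simp add: setting_def f2')
      have t2: "tables H (R2 10) AA X {..<m}" using t f2' by simp
      have ptr2: "R2 10 + 2 * Q \<le> N ^ 4 * Q" using ptr f2' by simp
      show "triple edge_message R2 H (\<lambda>R H. triple absorb R H P)"
      proof (rule wp_edge_message[OF s2 _ _ _ _ r39 uw(1,2) t2 order_refl ptr2])
        show "R2 33 = u" "R2 34 = w" "R2 35 = 6 ^ u" "R2 36 = 6 ^ w" using R by (simp_all add: f2')
        fix R3 H3 assume f3: "\<And>r. r \<notin> {10, 13, 15} \<Longrightarrow> R3 r = R2 r" and r10: "R3 10 = R2 10 + 2 * Q" and r13: "R3 13 = R2 10"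
          and r15: "R3 15 = R2 10 + Q" and low: "\<And>a. a < R2 10 \<Longrightarrow> H3 a = H a" and t3: "tables H3 (R2 10 + 2 * Q) AA X {..<m}"
          and mask: "\<And>v. v < n \<Longrightarrow> H3 (R2 10 + v) = of_bool (v \<in> {u, w})"
          and msg: "\<And>s. s \<in> digit_fun 6 {u, w} \<Longrightarrow> H3 (R2 10 + Q + code n s) = table weight {(u, w)} {u, w} {u, w} s"
        define p where "p = R1 37"
        have p: "p < m" "u \<in> X p" "w \<in> X p" using p by (simp_all add: p_def)
        have r210: "R2 10 = R 10" using f2' by simp
        have s3: "setting R3" using s2 by (simp add: setting_def f3)
        have r37: "R3 37 = p" using f3[of 37] f2[of 37] by (simp add: p_def)
        have inp3: "input H3" by (rule input_cong[OF H]) (use low d6 r210 in simp)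
        have Xp: "X p \<inter> {u, w} = {u, w}" using p by blast
        have AAp: "AA p \<subseteq> F" "AA p \<subseteq> X p \<times> X p" using AA(1) p(1) unfolding assigned_def by blast+
        show "triple absorb R3 H3 P"
        proof (rule wp_absorb[OF s3 r37 inp3 _ order_refl, where AA = AA and UU = X and A' = "{(u, w)}" and U' = "{u, w}" and Y = "{u, w}"])
          show "tables H3 (R3 10) AA X {..<m}" using t3 r10 by simp
          show "AA p \<subseteq> edges G" "AA p \<inter> {(u, w)} = {}" using AAp AA(2,3) by blast+
          show "AA p \<subseteq> X p \<times> X p" by (rule AAp)
          show "X p \<subseteq> {..<n}" by (rule X_sub[OF p(1)])
          show "{(u, w)} \<subseteq> edges G" using e by simp
          show "X p \<inter> {u, w} = X p \<inter> {u, w}" ..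
          show "H3 (R3 13 + v) = of_bool (v \<in> {u, w})" if "v < n" for v unfolding r13 by (rule mask[OF that])
          show "R3 13 + n \<le> R3 10" using r13 r10 Q_bounds(3) by simp
          show "R3 15 + 8 ^ n \<le> R3 10" using r15 r10 Q_bounds(2) by simp
          show "H3 (R3 15 + code n s) = table weight {(u, w)} {u, w} (X p \<inter> {u, w}) s" if "s \<in> digit_fun 6 (X p \<inter> {u, w})" for s
            using msg[of s] that unfolding Xp r15 by simp
          show "R3 10 + Q \<le> N ^ 4 * Q" using ptr r10 r210 by simp
        next
          fix R4 H4 assume f4: "\<And>r. r \<notin> {10, 12, 14, 16} \<union> {17..32} \<Longrightarrow> R4 r = R3 r" and r410: "R4 10 = R3 10 + Q"
            and low4: "\<And>a. a < R3 10 \<Longrightarrow> a \<noteq> 5 * Q + p \<Longrightarrow> H4 a = H3 a"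
            and t4: "tables H4 (R3 10 + Q) (AA(p := AA p \<union> {(u, w)})) (X(p := X p \<union> {u, w})) {..<m}"
          have Xeq: "X(p := X p \<union> {u, w}) = X" using p by (intro ext) auto
          show "P R4 H4"
          proof (rule post[where AA' = "AA(p := AA p \<union> {(u, w)})"])
            show "R4 r = R r" if "kept r" for r using that f4[of r] f3[of r] f2'[of r] by auto
            show "R4 10 = R 10 + 3 * Q" using r410 r10 r210 by simp
            show "H4 a = H a" if "a < 5 * Q" for a using low4[of a] low[of a] that d6 r10 r210 by simp
            show "tables H4 (R4 10) (AA(p := AA p \<union> {(u, w)})) X {..<m}" using t4 r410 unfolding Xeq by simp
            show "assigned (AA(p := AA p \<union> {(u, w)})) (insert (u, w) F)"
              unfolding assigned_def
            proof (intro conjI allI impI)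
              show "(AA(p := AA p \<union> {(u, w)})) x \<subseteq> X x \<times> X x" if "x < m" for x
                using AA(1) that p unfolding assigned_def by (cases "x = p") auto
              have new: "(u, w) \<notin> AA x" if "x < m" for x using AA(1,3) that unfolding assigned_def by blast
              show "(AA(p := AA p \<union> {(u, w)})) x \<inter> (AA(p := AA p \<union> {(u, w)})) y = {}" if "x < m" "y < m" "x \<noteq> y" for x y
              proof -
                have "AA x \<inter> AA y = {}" using AA(1) that unfolding assigned_def by blast
                then show ?thesis using that new[of x] new[of y] by (cases "x = p"; cases "y = p") auto
              qed
              have "(\<Union>x<m. (AA(p := AA p \<union> {(u, w)})) x) = (\<Union>x<m. AA x) \<union> {(u, w)}"
                using p(1) by (auto split: if_splits)
              then show "(\<Union>x<m. (AA(p := AA p \<union> {(u, w)})) x) = insert (u, w) F"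
                using AA(1) unfolding assigned_def by simp
            qed
          qed
        qed (use p uw in auto)
      qed
    qed
  qed
  then show ?thesis by simp
qed

text \<open>The budget of segments: six fixed ones, one initial table per node, three segments per
  vertex pair that is an edge, two per merge for the message and the new table, and a reserve for
  the final sum.\<close>

lemma regions_le: "c \<le> 6 + 3 * m + 3 * (n * n) + 9 \<Longrightarrow> c * Q \<le> N ^ 4 * Q"
proof (rule mult_right_mono)
  assume "c \<le> 6 + 3 * m + 3 * (n * n) + 9"
  also have "\<dots> \<le> 3 * (N * N)" unfolding N by (simp add: algebra_simps)
  also have "\<dots> \<le> (N * N) * (N * N)" using N6 mult_le_mono[of 3 N 1 N] by (intro mult_right_mono) auto
  also have "\<dots> = N ^ 4" by (simp add: power_numeral_reduce)
  finally show "c \<le> N ^ 4" .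
qed simp

lemma six_power_less: "v \<le> n \<Longrightarrow> 6 ^ v < (2::nat) ^ l"
proof -
  assume "v \<le> n"
  then have "(6::nat) ^ v \<le> 18 ^ n" by (intro order_trans[OF power_mono power_increasing]) auto
  then show ?thesis by (rule below)
qed

lemma wp_absorb_edges:
  assumes R: "setting R" "radices R" and H: "input H" and t: "tables H (R 10) (\<lambda>_. {}) X {..<m}" and ptr: "R 10 = (6 + m) * Q"
    and post: "\<And>R' H' AA. (\<And>r. r < 10 \<Longrightarrow> R' r = R r) \<Longrightarrow> R' 10 \<le> (6 + m + 3 * (n * n)) * Q \<Longrightarrow>
      (\<And>a. a < 5 * Q \<Longrightarrow> H' a = H a) \<Longrightarrow> tables H' (R' 10) AA X {..<m} \<Longrightarrow> assigned AA (edges G) \<Longrightarrow> P R' H'"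
  shows "triple absorb_edges R H P"
proof -
  \<comment> \<open>The edges before \<open>(u, w)\<close> in the lexicographic order in which the
    two nested loops visit the pairs.\<close>
  define F where "F u w = {(a, b) \<in> edges G. a < u \<or> a = u \<and> b < w}" for u w
  define I where "I u R' H' \<longleftrightarrow> (\<forall>r<10. R' r = R r) \<and> R' 35 = 6 ^ u \<and> R' 10 \<le> (6 + m + 3 * (u * n)) * Q \<and>
      (\<forall>a<5 * Q. H' a = H a) \<and> (\<exists>AA. tables H' (R' 10) AA X {..<m} \<and> assigned AA (F u 0))" for u :: nat and R' H' :: store
  define J where "J u w R' H' \<longleftrightarrow> (\<forall>r<10. R' r = R r) \<and> R' 33 = u \<and> R' 35 = 6 ^ u \<and> R' 36 = 6 ^ w \<and>
      R' 10 \<le> (6 + m + 3 * (u * n + w)) * Q \<and> (\<forall>a<5 * Q. H' a = H a) \<and>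
      (\<exists>AA. tables H' (R' 10) AA X {..<m} \<and> assigned AA (F u w))" for u w :: nat and R' H' :: store
  let ?body = "Ifs (Hp (Cn 2 \<^bold>+ Rg 33 \<^bold>* Rg 1 \<^bold>+ Rg 34) \<^bold>* (Rg 34 \<^bold>- Rg 33))
             (find_bag ;; edge_weight ;; edge_message ;; absorb) Nop ;; Asg 36 (Rg 36 \<^bold>* Cn 6)"
  have r1: "R (Suc 0) = n" using R by (simp add: setting_def)
  have Fsub: "F u w \<subseteq> edges G" for u w by (auto simp: F_def)
  have inner: "triple ?body (R'(34 := w)) H' (J u (Suc w))" if u: "u < n" and w: "w < n" and J: "J u w R' H'" for u w R' H'
  proof -
    have fr: "R' r = R r" if "r < 10" for r using J that unfolding J_def by blast
    have low: "H' a = H a" if "a < 5 * Q" for a using J that unfolding J_def by blast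
    have rs: "R' 33 = u" "R' 35 = 6 ^ u" "R' 36 = 6 ^ w" "R' 10 \<le> (6 + m + 3 * (u * n + w)) * Q"
      using J unfolding J_def by blast+
    obtain AA where AA: "tables H' (R' 10) AA X {..<m}" "assigned AA (F u w)" using J unfolding J_def by blast
    have inp: "input H'" by (rule input_cong[OF H]) (rule low, simp)
    have f1: "R' (Suc 0) = n" using fr[of "Suc 0"] r1 by simp
    have six: "6 ^ w * 6 < (2::nat) ^ l" using six_power_less[of "Suc w"] w by simp
    have arc: "H' (2 + u * n + w) = of_bool ((u, w) \<in> parcs G)" using inp u w unfolding input_def by blast
    have idx: "u * n + w < n * n" by (rule pair_index_less[OF u w])
    show ?thesis
    proof (cases "(u, w) \<in> edges G")
      case True
      then have c: "H' (2 + u * n + w) * (w - u) \<noteq> 0" using arc by (simp add: edges_def)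
      have s: "setting (R'(34 := w))" "radices (R'(34 := w))" using R by (simp_all add: setting_def radices_def fr)
      have nF: "(u, w) \<notin> F u w" by (simp add: F_def)
      have FS: "insert (u, w) (F u w) = F u (Suc w)" using True by (auto simp: F_def less_Suc_eq)
      have "R' 10 + 3 * Q \<le> (6 + m + 3 * (u * n + w) + 3) * Q" using rs(4) by (simp add: algebra_simps)
      also have "\<dots> \<le> N ^ 4 * Q" using idx by (intro regions_le) simp
      finally have ptr3: "(R'(34 := w)) 10 + 3 * Q \<le> N ^ 4 * Q" by simp
      have "triple (find_bag ;; edge_weight ;; edge_message ;; absorb) (R'(34 := w)) H'
          (\<lambda>R'' H''. triple (Asg 36 (Rg 36 \<^bold>* Cn 6)) R'' H'' (J u (Suc w)))"
      proof (rule wp_edge[OF s _ _ _ _ True inp _ AA(2) Fsub nF ptr3])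
        show "tables H' ((R'(34 := w)) 10) AA X {..<m}" using AA(1) by simp
        fix R2 H2 AA2 assume k2: "\<And>r. kept r \<Longrightarrow> R2 r = (R'(34 := w)) r" and r10: "R2 10 = (R'(34 := w)) 10 + 3 * Q"
          and low2: "\<And>a. a < 5 * Q \<Longrightarrow> H2 a = H' a" and t2: "tables H2 (R2 10) AA2 X {..<m}"
          and a2: "assigned AA2 (insert (u, w) (F u w))"
        have r36: "R2 36 = 6 ^ w" using k2[of 36] rs by simp
        have le: "R2 10 \<le> (6 + m + 3 * (u * n + Suc w)) * Q" using r10 rs(4) by (simp add: algebra_simps)
        have "J u (Suc w) (R2(36 := 6 ^ w * 6)) H2"
          unfolding J_def
        proof (intro conjI allI impI)
          show "(R2(36 := 6 ^ w * 6)) r = R r" if "r < 10" for r using that k2[of r] fr[of r] by simp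
          show "H2 a = H a" if "a < 5 * Q" for a using low2[OF that] low[OF that] by simp
          show "\<exists>AA. tables H2 ((R2(36 := 6 ^ w * 6)) 10) AA X {..<m} \<and> assigned AA (F u (Suc w))"
            using t2 a2 unfolding FS by auto
        qed (use k2[of 33] k2[of 35] rs le in simp_all)
        then show "triple (Asg 36 (Rg 36 \<^bold>* Cn 6)) R2 H2 (J u (Suc w))" using six r36 by simp
      qed (use rs in simp_all)
      then show ?thesis using c by (simp add: f1 rs)
    next
      case False
      then have c: "H' (2 + u * n + w) * (w - u) = 0"
        using arc by (cases "(u, w) \<in> parcs G") (auto simp: edges_def not_less)
      have FS: "F u (Suc w) = F u w" using False by (auto simp: F_def less_Suc_eq)
      have "R' 10 \<le> (6 + m + 3 * (u * n + Suc w)) * Q" using rs(4) by (rule order_trans) (intro mult_right_mono, auto)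
      then have "J u (Suc w) (R'(34 := w, 36 := 6 ^ w * 6)) H'"
        using J unfolding J_def FS by auto
      then show ?thesis using c six by (simp add: f1 rs)
    qed
  qed
  have outer: "triple (Asg 36 (Cn 1) ;; For False 34 (Rg 1) ?body ;; Asg 35 (Rg 35 \<^bold>* Cn 6)) (R'(33 := u)) H' (I (Suc u))"
    if u: "u < n" and I: "I u R' H'" for u R' H'
  proof -
    have fr: "R' r = R r" if "r < 10" for r using I that unfolding I_def by blast
    have f1: "R' (Suc 0) = n" using fr[of "Suc 0"] r1 by simp
    have "triple (For False 34 (Rg 1) ?body) (R'(33 := u, 36 := 1)) H' (\<lambda>R'' H''. triple (Asg 35 (Rg 35 \<^bold>* Cn 6)) R'' H'' (I (Suc u)))"
    proof (rule wp_For[where n = n and I = "J u"])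
      show "J u 0 (R'(33 := u, 36 := 1)) H'" using I unfolding J_def I_def by simp
      show "triple ?body (R'(34 := w)) H' (J u (Suc w))" if "w < n" "J u w R' H'" for w R' H' by (rule inner[OF u that])
      fix R2 H2 assume J: "J u n R2 H2"
      have "F u n = F (Suc u) 0" using E by (auto simp: F_def less_Suc_eq)
      then have "I (Suc u) (R2(35 := 6 ^ u * 6)) H2" using J unfolding J_def I_def by (simp add: add.commute[of n])
      then show "triple (Asg 35 (Rg 35 \<^bold>* Cn 6)) R2 H2 (I (Suc u))"
        using J six_power_less[of "Suc u"] u by (simp add: J_def)
    qed (use f1 n in simp_all)
    then show ?thesis using small[of 1] by simp
  qed
  have "triple (For False 33 (Rg 1) (Asg 36 (Cn 1) ;; For False 34 (Rg 1) ?body ;; Asg 35 (Rg 35 \<^bold>* Cn 6))) (R(35 := 1)) H P"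
  proof (rule wp_For[where n = n and I = I])
    have "assigned (\<lambda>_. {}) (F 0 0)" by (simp add: assigned_def F_def)
    then show "I 0 (R(35 := 1)) H" using t ptr unfolding I_def by auto
    show "triple (Asg 36 (Cn 1) ;; For False 34 (Rg 1) ?body ;; Asg 35 (Rg 35 \<^bold>* Cn 6)) (R'(33 := u)) H' (I (Suc u))"
      if "u < n" "I u R' H'" for u R' H' by (rule outer[OF that])
    fix R2 H2 assume I: "I n R2 H2"
    have "F n 0 = edges G" using E by (auto simp: F_def)
    then obtain AA where "tables H2 (R2 10) AA X {..<m}" "assigned AA (edges G)" using I unfolding I_def by auto
    then show "P R2 H2" using I unfolding I_def by (intro post) auto
  qed (use r1 n in simp_all)
  then show ?thesis using small[of 1] by (simp add: absorb_edges_def)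
qed

text \<open>\<open>S\<close> contains the nodes not yet sent to their parents. Their tables together
  account for all edges and vertices, and two of them share vertices only within both bags, as
  \<open>table_join\<close> requires.\<close>

definition merged :: "(nat \<Rightarrow> (nat \<times> nat) set) \<Rightarrow> (nat \<Rightarrow> nat set) \<Rightarrow> nat set \<Rightarrow> bool" where
  "merged AA UU S \<longleftrightarrow> (\<forall>x\<in>S. AA x \<subseteq> edges G \<and> AA x \<subseteq> UU x \<times> UU x \<and> X x \<subseteq> UU x \<and> UU x \<subseteq> {..<n}) \<and>
     (\<forall>x\<in>S. \<forall>y\<in>S. x \<noteq> y \<longrightarrow> AA x \<inter> AA y = {} \<and> UU x \<inter> UU y \<subseteq> X x \<inter> X y) \<and>
     (\<Union>x\<in>S. AA x) = edges G \<and> (\<Union>x\<in>S. UU x) = {..<n}"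

lemma mergedD:
  assumes "merged AA UU S" "x \<in> S"
  shows "AA x \<subseteq> edges G" "AA x \<subseteq> UU x \<times> UU x" "X x \<subseteq> UU x" "UU x \<subseteq> {..<n}"
proof -
  have "\<forall>x\<in>S. AA x \<subseteq> edges G \<and> AA x \<subseteq> UU x \<times> UU x \<and> X x \<subseteq> UU x \<and> UU x \<subseteq> {..<n}"
    using assms(1) unfolding merged_def by (elim conjE) assumption
  from bspec[OF this assms(2)]
  show "AA x \<subseteq> edges G" "AA x \<subseteq> UU x \<times> UU x" "X x \<subseteq> UU x" "UU x \<subseteq> {..<n}" by simp_all
qed

lemma mergedD2:
  assumes "merged AA UU S" "x \<in> S" "y \<in> S" "x \<noteq> y"
  shows "AA x \<inter> AA y = {}" "UU x \<inter> UU y \<subseteq> X x \<inter> X y"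
proof -
  have "\<forall>x\<in>S. \<forall>y\<in>S. x \<noteq> y \<longrightarrow> AA x \<inter> AA y = {} \<and> UU x \<inter> UU y \<subseteq> X x \<inter> X y"
    using assms(1) unfolding merged_def by (elim conjE) assumption
  from bspec[OF bspec[OF this assms(2)] assms(3)] assms(4)
  show "AA x \<inter> AA y = {}" "UU x \<inter> UU y \<subseteq> X x \<inter> X y" by simp_all
qed

text \<open>A vertex that the absorbed part shares with another node lies in the bags of both and
  hence, by the running intersection property, in the bag of \<open>p\<close>. So enlarging
  \<open>UU p\<close> creates no overlap outside the bags.\<close>

lemma merged_step:
  assumes M: "merged AA UU (insert c S)" and c: "c \<notin> S" and p: "p \<in> S"
    and rip: "\<And>x. x \<in> S \<Longrightarrow> X c \<inter> X x \<subseteq> X p"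
  shows "merged (AA(p := AA p \<union> AA c)) (UU(p := UU p \<union> UU c)) S"
proof -
  note one = mergedD[OF M] and two = mergedD2[OF M]
  have pc: "p \<noteq> c" using c p by blast
  let ?A = "AA(p := AA p \<union> AA c)" and ?U = "UU(p := UU p \<union> UU c)"
  have pair: "?A x \<inter> ?A y = {} \<and> ?U x \<inter> ?U y \<subseteq> X x \<inter> X y" if xy: "x = p" "y \<in> S" "y \<noteq> p" for x y
  proof -
    have yc: "y \<noteq> c" using xy c by blast
    have "AA p \<inter> AA y = {}" "AA c \<inter> AA y = {}" using two(1) xy p yc by auto
    moreover have "UU p \<inter> UU y \<subseteq> X p \<inter> X y" "UU c \<inter> UU y \<subseteq> X c \<inter> X y" using two(2) xy p yc by auto
    moreover have "X c \<inter> X y \<subseteq> X p" by (rule rip[OF xy(2)])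
    ultimately show ?thesis using xy by auto
  qed
  have "?A x \<inter> ?A y = {} \<and> ?U x \<inter> ?U y \<subseteq> X x \<inter> X y" if "x \<in> S" "y \<in> S" "x \<noteq> y" for x y
  proof -
    consider "x = p" | "y = p" | "x \<noteq> p" "y \<noteq> p" by blast
    then show ?thesis
    proof cases
      case 1
      then show ?thesis using pair[of x y] that by simp
    next
      case 2
      then show ?thesis using pair[of y x] that by (simp add: Int_commute)
    next
      case 3
      then show ?thesis using two[of x y] that by simp
    qed
  qed
  moreover have "?A x \<subseteq> edges G \<and> ?A x \<subseteq> ?U x \<times> ?U x \<and> X x \<subseteq> ?U x \<and> ?U x \<subseteq> {..<n}" if "x \<in> S" for x
    using one[of x] one[of c] one[of p] that p by (cases "x = p") auto
  moreover have "(\<Union>x\<in>S. ?A x) = (\<Union>x\<in>insert c S. AA x)" "(\<Union>x\<in>S. ?U x) = (\<Union>x\<in>insert c S. UU x)"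
    using p pc c by (auto split: if_splits)
  ultimately show ?thesis using M unfolding merged_def by simp
qed

lemma tables_subset: "tables H d AA UU S \<Longrightarrow> S' \<subseteq> S \<Longrightarrow> tables H d AA UU S'"
  unfolding tables_def by blast

lemma search_order_cong:
  assumes so: "search_order T i ord par" and "0 < i"
    and eq: "\<And>j. j < i \<Longrightarrow> ord' j = ord j" "\<And>j. j < i \<Longrightarrow> par' j = par j"
  shows "search_order T i ord' par'"
proof -
  have img: "ord' ` {..<j} = ord ` {..<j}" if "j \<le> i" for j using that eq(1) by (intro image_cong) auto
  have "inj_on ord' {..<i} \<longleftrightarrow> inj_on ord {..<i}" using eq(1) by (intro inj_on_cong) auto
  then show ?thesis using so eq \<open>0 < i\<close> by (simp add: search_order_def img)
qed

lemma wp_merge_tables: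
  assumes R: "setting R" and H: "input H" and t: "tables H (R 10) AA X {..<m}" and AA: "assigned AA (edges G)"
    and so: "search_order T m (\<lambda>i. H (3 * Q + i)) (\<lambda>i. H (4 * Q + i))"
    and ptr: "R 10 \<le> (6 + m + 3 * (n * n)) * Q"
    and post: "\<And>R' H' AA UU. (\<And>r. r < 10 \<Longrightarrow> R' r = R r) \<Longrightarrow> R' 10 \<le> (6 + 3 * m + 3 * (n * n)) * Q \<Longrightarrow>
      (\<And>a. a < 5 * Q \<Longrightarrow> H' a = H a) \<Longrightarrow> tables H' (R' 10) AA UU {0} \<Longrightarrow> merged AA UU {0} \<Longrightarrow> P R' H'"
  shows "triple merge_tables R H P"
proof -
  define ord par where "ord i = H (3 * Q + i)" and "par i = H (4 * Q + i)" for i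
  have so: "search_order T m ord par" using so by (simp add: ord_def[abs_def] par_def[abs_def])
  have inj: "inj_on ord {..<m}" and nodes: "ord ` {..<m} \<subseteq> {..<m}" and ord0: "ord 0 = 0"
    and par: "\<And>j. 0 < j \<Longrightarrow> j < m \<Longrightarrow> par j \<in> ord ` {..<j}"
    using so T by (auto simp: search_order_def)
  have all: "ord ` {..<m} = {..<m}" using inj nodes by (intro card_subset_eq) (simp_all add: card_image)
  define I where "I i R' H' \<longleftrightarrow> (\<forall>r<10. R' r = R r) \<and> R' 10 \<le> (6 + m + 3 * (n * n) + 2 * i) * Q \<and>
      (\<forall>a<5 * Q. H' a = H a) \<and> (\<exists>AA UU. tables H' (R' 10) AA UU (ord ` {..<m - i}) \<and> merged AA UU (ord ` {..<m - i}))"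
    for i :: nat and R' H' :: store
  have r2: "R 2 = m" using R by (simp add: setting_def)
  show ?thesis
    unfolding merge_tables_def
  proof (rule wp_For[where n = "m - 1" and I = I])
    have "merged AA X {..<m}"
      unfolding merged_def
    proof (intro conjI ballI impI)
      fix x assume x: "x \<in> {..<m}"
      show "AA x \<subseteq> edges G" "AA x \<subseteq> X x \<times> X x" using AA x unfolding assigned_def by blast+
      show "X x \<subseteq> {..<n}" using X_sub x by simp
      show "AA x \<inter> AA y = {}" if "y \<in> {..<m}" "x \<noteq> y" for y using AA x that unfolding assigned_def by blast
    next
      show "(\<Union>x<m. AA x) = edges G" using AA unfolding assigned_def by blast
      \<comment> \<open>Connectedness of the nodes containing \<open>v\<close> includes that there
        is one, so isolated vertices are covered too.\<close>
      have "v \<in> (\<Union>x<m. X x)" if "v < n" for v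
      proof -
        have "Digraph_Component.connected (with_proj T \<restriction> {x \<in> pverts T. v \<in> X x})"
          using td that G(2) by (simp add: tree_decomposition_def)
        then have "{x \<in> pverts T. v \<in> X x} \<noteq> {}" by (intro connected_linked(1)[OF tree(2)]) auto
        then show ?thesis using T by auto
      qed
      then show "(\<Union>x<m. X x) = {..<n}" using X_sub by fastforce
    qed auto
    then show "I 0 R H" using t ptr all unfolding I_def by auto
    show "eval_exp (Rg 2 \<^bold>- Cn 1) R H = m - 1" using r2 by simp
    show "m - 1 \<le> (if False then E else W)" using loops by simp
  next
    fix R' H' assume I: "I (m - 1) R' H'"
    have S1: "ord ` {..<m - (m - 1)} = {0}" using m ord0 by (simp add: lessThan_Suc)
    obtain AA UU where "tables H' (R' 10) AA UU {0}" "merged AA UU {0}" using I S1 unfolding I_def by auto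
    moreover have "R' 10 \<le> (6 + 3 * m + 3 * (n * n)) * Q"
    proof -
      have "R' 10 \<le> (6 + m + 3 * (n * n) + 2 * (m - 1)) * Q" using I unfolding I_def by blast
      also have "\<dots> \<le> (6 + 3 * m + 3 * (n * n)) * Q" by (intro mult_right_mono) auto
      finally show ?thesis .
    qed
    ultimately show "P R' H'" using I unfolding I_def by (intro post) auto
  next
    fix i R' H' assume i: "i < m - 1" and I: "I i R' H'"
    define j where "j = m - 1 - i"
    have j: "0 < j" "j < m" "m - i = Suc j" "m - Suc i = j" using i by (auto simp: j_def)
    define c p where "c = ord j" and "p = par j"
    let ?S = "ord ` {..<j}"
    have S: "ord ` {..<m - i} = insert c ?S" by (simp add: j lessThan_Suc c_def)
    have fr: "R' r = R r" if "r < 10" for r using I that unfolding I_def by blast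
    have low: "H' a = H a" if "a < 5 * Q" for a using I that unfolding I_def by blast
    have le: "R' 10 \<le> (6 + m + 3 * (n * n) + 2 * i) * Q" using I unfolding I_def by blast
    obtain AA UU where t: "tables H' (R' 10) AA UU (insert c ?S)" and M: "merged AA UU (insert c ?S)"
      using I unfolding I_def S by blast
    have inp: "input H'" by (rule input_cong[OF H]) (rule low, simp)
    have cS: "c \<notin> ?S"
    proof
      assume "c \<in> ?S"
      then obtain x where "ord j = ord x" "x < j" by (auto simp: c_def)
      then show False using inj_onD[OF inj, of j x] j by simp
    qed
    have pS: "p \<in> ?S" using par[OF j(1,2)] by (simp add: p_def)
    have Sm: "insert c ?S \<subseteq> {..<m}"
    proof -
      have "insert c ?S \<subseteq> ord ` {..<m}" using j by (auto simp: c_def)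
      then show ?thesis unfolding all .
    qed
    have cm: "c < m" "p < m" "p \<noteq> c" using Sm pS cS by auto
    have rip: "X c \<inter> X x \<subseteq> X p" if "x \<in> ?S" for x
      using that search_order_running_intersection[OF td so j(1,2)] by (auto simp: c_def p_def)
    have mQ: "m < Q" using Q_bounds by simp
    have hc: "H' (3 * Q + j) = c" "H' (4 * Q + j) = p"
      using low[of "3 * Q + j"] low[of "4 * Q + j"] j mQ by (simp_all add: c_def p_def ord_def par_def)
    note one = mergedD[OF M]
    \<comment> \<open>One inclusion is the overlap condition; the other holds because each vertex
      set contains its bag.\<close>
    have two: "AA p \<inter> AA c = {}" "UU p \<inter> UU c = X p \<inter> X c"
    proof -
      have "AA p \<inter> AA c = {} \<and> UU p \<inter> UU c \<subseteq> X p \<inter> X c" using mergedD2[OF M _ _ cm(3)] pS by simp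
      then show "AA p \<inter> AA c = {}" "UU p \<inter> UU c = X p \<inter> X c" using one(3)[of p] one(3)[of c] pS by auto
    qed
    define R1 where "R1 = R'(44 := i, 38 := c, 37 := p)"
    have regs: "R' 2 = m" "R' 5 = Q" using R by (simp_all add: setting_def fr)
    have s1: "setting R1" using R by (simp add: setting_def R1_def fr)
    have t1: "tables H' (R1 10) AA UU (insert c ?S)" using t by (simp add: R1_def)
    have "R' 10 + 2 * Q \<le> (6 + m + 3 * (n * n) + 2 * i + 2) * Q" using le by (simp add: algebra_simps)
    also have "\<dots> \<le> N ^ 4 * Q" using i by (intro regions_le) simp
    finally have ptr2: "R1 10 + 2 * Q \<le> N ^ 4 * Q" by (simp add: R1_def)
    have "triple send R1 H' (\<lambda>R H. triple absorb R H (I (Suc i)))"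
    proof (rule wp_send[OF s1 _ _ inp t1 Sm _ cm(2)])
      show "R1 37 = p" "R1 38 = c" by (simp_all add: R1_def)
      show "c \<in> insert c ?S" by simp
      show "AA c \<subseteq> edges G" "UU c \<subseteq> {..<n}" by (rule one[OF insertI1])+
      show "R1 10 + Q \<le> N ^ 4 * Q" using ptr2 by simp
      fix R2 H2 assume f2: "\<And>r. r \<notin> {10, 12, 13, 14, 15, 16} \<union> {17..32} \<Longrightarrow> R2 r = R1 r" and r10: "R2 10 = R1 10 + Q"
        and r13: "R2 13 = OX + c * n" and r15: "R2 15 = R1 10" and low2: "\<And>a. a < R1 10 \<Longrightarrow> H2 a = H' a"
        and t2: "tables H2 (R1 10 + Q) AA UU (insert c ?S)"
        and msg: "\<And>s. s \<in> digit_fun 6 (X c \<inter> X p) \<Longrightarrow> H2 (R1 10 + code n s) = table weight (AA c) (UU c) (X c \<inter> X p) s"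
      have d6: "6 * Q \<le> R1 10" using t1 by (simp add: tables_def)
      have inp2: "input H2" by (rule input_cong[OF inp]) (use low2 d6 in simp)
      have s2: "setting R2" using s1 by (simp add: setting_def f2)
      show "triple absorb R2 H2 (I (Suc i))"
      proof (rule wp_absorb[OF s2 _ inp2 _ Sm, where AA = AA and UU = UU and A' = "AA c" and U' = "UU c" and Y = "X c" and p = p])
        show "R2 37 = p" using f2[of 37] by (simp add: R1_def)
        show "tables H2 (R2 10) AA UU (insert c ?S)" using t2 r10 by simp
        show pI: "p \<in> insert c ?S" using pS by simp
        show "AA p \<subseteq> edges G" "AA p \<subseteq> UU p \<times> UU p" "X p \<subseteq> UU p" "UU p \<subseteq> {..<n}" by (rule one[OF pI])+
        show "AA c \<subseteq> edges G" "AA c \<subseteq> UU c \<times> UU c" "UU c \<subseteq> {..<n}" by (rule one[OF insertI1])+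
        show "AA p \<inter> AA c = {}" "UU p \<inter> UU c = X p \<inter> X c" by (rule two)+
        show "H2 (R2 13 + v) = of_bool (v \<in> X c)" if "v < n" for v unfolding r13 by (rule bag_mask(2)[OF inp2 cm(1) that])
        show "R2 13 + n \<le> R2 10" using row[OF cm(1)] r13 r10 d6 by simp
        show "R2 15 + 8 ^ n \<le> R2 10" using r15 r10 Q_bounds(2) by simp
        show "H2 (R2 15 + code n s) = table weight (AA c) (UU c) (X p \<inter> X c) s" if "s \<in> digit_fun 6 (X p \<inter> X c)" for s
          using msg[of s] that r15 by (simp add: Int_commute)
        show "R2 10 + Q \<le> N ^ 4 * Q" using ptr2 r10 by simp
      next
        fix R3 H3 assume f3: "\<And>r. r \<notin> {10, 12, 14, 16} \<union> {17..32} \<Longrightarrow> R3 r = R2 r" and r310: "R3 10 = R2 10 + Q"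
          and low3: "\<And>a. a < R2 10 \<Longrightarrow> a \<noteq> 5 * Q + p \<Longrightarrow> H3 a = H2 a"
          and t3: "tables H3 (R2 10 + Q) (AA(p := AA p \<union> AA c)) (UU(p := UU p \<union> UU c)) (insert c ?S)"
        show "I (Suc i) R3 H3"
          unfolding I_def j(4)
        proof (intro conjI allI impI)
          show "R3 r = R r" if "r < 10" for r using that f3[of r] f2[of r] fr[of r] by (simp add: R1_def)
          show "R3 10 \<le> (6 + m + 3 * (n * n) + 2 * Suc i) * Q" using r310 r10 le by (simp add: R1_def algebra_simps)
          show "H3 a = H a" if "a < 5 * Q" for a using low3[of a] low2[of a] low[OF that] that d6 r10 by simp
          have "tables H3 (R3 10) (AA(p := AA p \<union> AA c)) (UU(p := UU p \<union> UU c)) ?S"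
            using tables_subset[OF t3, of ?S] r310 by auto
          then show "\<exists>AA UU. tables H3 (R3 10) AA UU ?S \<and> merged AA UU ?S"
            using merged_step[OF M cS pS rip] by blast
        qed
      qed
    qed
    moreover have "c < 2 ^ l" "p < 2 ^ l" using cm N6 by (auto intro: small_N)
    ultimately show "triple (Asg 38 (Hp (Rg 5 \<^bold>* Cn 3 \<^bold>+ (Rg 2 \<^bold>- Cn 1 \<^bold>- Rg 44))) ;;
      Asg 37 (Hp (Rg 5 \<^bold>* Cn 4 \<^bold>+ (Rg 2 \<^bold>- Cn 1 \<^bold>- Rg 44))) ;; send ;; absorb) (R'(44 := i)) H' (I (Suc i))"
      using hc unfolding j_def by (simp add: regs R1_def mult.commute[of Q])
  qed
qed

lemma wp_total_value:
  assumes R: "setting R" and H: "input H" and t: "tables H (R 10) AA UU {0}" and M: "merged AA UU {0}"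
    and ptr: "R 10 \<le> (6 + 3 * m + 3 * (n * n)) * Q"
    and post: "\<And>R' H'. (\<And>r. r < 10 \<Longrightarrow> R' r = R r) \<Longrightarrow>
      R' 47 = (\<Sum>\<kappa>\<in>configs (edges G) {..<n}. \<Prod>e\<in>snd \<kappa>. weight e) \<Longrightarrow> P R' H'"
  shows "triple total_value R H P"
proof -
  have AA: "AA 0 = edges G" and UU: "UU 0 = {..<n}" using M unfolding merged_def by auto
  have regs: "R 1 = n" "R 4 = OX" "R 5 = Q" using R by (simp_all add: setting_def)
  have m0: "0 < m" using m by simp
  define d where "d = R 10"
  have tp: "6 * Q \<le> d" "H (5 * Q) + Q \<le> d"
    "\<And>s. s \<in> digit_fun 6 (X 0) \<Longrightarrow> H (H (5 * Q) + code n s) = table weight (edges G) {..<n} (X 0) s"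
    and zero: "\<And>a. d \<le> a \<Longrightarrow> H a = 0"
    using t AA UU by (simp_all add: tables_def d_def)
  define R1 where "R1 = R(12 := OX, 14 := H (5 * Q), 13 := d, 10 := d + Q, 16 := d + Q)"
  have "d + Q \<le> (6 + 3 * m + 3 * (n * n) + 1) * Q" using ptr by (simp add: d_def algebra_simps)
  also have "\<dots> \<le> N ^ 4 * Q" by (rule regions_le) simp
  finally have dQ: "d + Q \<le> N ^ 4 * Q" .
  have fX: "finite (X 0)" using X_sub[OF m0] finite_subset by blast
  have "triple (fill_table message_entry) R1 H (\<lambda>R'' H''. triple (Asg 47 (Hp (Rg 10))) R'' H'' P)"
  proof (rule wp_message_table[where D = "d + Q" and X = "X 0" and Y = "{}" and B = table_bound
        and f = "table weight (edges G) {..<n} (X 0)"])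
    show "X 0 = {v. v < n \<and> H (R1 12 + v) \<noteq> 0}" using bag_mask(1)[OF H m0] by (simp add: R1_def)
    show "H (R1 13 + v) = of_bool (v \<in> {})" if "v < n" for v using zero by (simp add: R1_def)
    show "H a = 0" if "d + Q \<le> a" for a using zero that by simp
    show "R1 12 + n \<le> d + Q" using row[OF m0] tp(1) by (simp add: R1_def)
    show "R1 13 + n \<le> d + Q" using Q_bounds(3) by (simp add: R1_def)
    show "18 ^ card (X 0) \<le> E" by (rule bag[OF m0])
    show "R1 14 + 8 ^ n \<le> d + Q" using tp(2) Q_bounds(2) by (simp add: R1_def)
    show "H (R1 14 + code n s) = table weight (edges G) {..<n} (X 0) s" if "s \<in> digit_fun 6 (X 0)" for s
      using tp(3)[OF that] by (simp add: R1_def)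
    show "table weight (edges G) {..<n} (X 0) s \<le> table_bound" for s by (rule table_le_bound) simp_all
    show "18 ^ n * table_bound < 2 ^ l" by (rule table_bound_big)
  next
    fix R'' H'' assume fr'': "\<And>r. r < 17 \<or> 32 < r \<Longrightarrow> R'' r = R1 r"
      and tab: "\<And>s. s \<in> digit_fun 6 (X 0 \<inter> {}) \<Longrightarrow> H'' (d + Q + code n s) =
        (\<Sum>\<delta> | \<delta> \<in> digit_fun 18 (X 0) \<and> message_ok {} \<delta> \<and> right_state {} \<delta> = s.
          table weight (edges G) {..<n} (X 0) (left_state \<delta>))"
    let ?z = "\<lambda>_::nat. 0::nat"
    have "?z \<in> digit_fun 6 (X 0 \<inter> {})" by (simp add: digit_fun_iff)
    from tab[OF this] have "H'' (d + Q + code n ?z) = table weight (edges G) {..<n} (X 0 \<inter> {}) ?z"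
      unfolding table_message[OF finite_E finite_lessThan fX] .
    moreover have "code n ?z = 0" by (simp add: code_def)
    ultimately have v: "H'' (d + Q) = table weight (edges G) {..<n} {} ?z" by simp
    have b: "H'' (d + Q) < 2 ^ l" unfolding v using table_le_bound[of "edges G" "{..<n}" "{}" ?z] table_bound_big(3) by simp
    have "P (R''(47 := H'' (d + Q))) H''"
      by (rule post) (use fr'' v in \<open>simp_all add: R1_def table_total\<close>)
    moreover have "R'' 10 = d + Q" using fr'' by (simp add: R1_def)
    ultimately show "triple (Asg 47 (Hp (Rg 10))) R'' H'' P" using b by simp
  qed (use regs in \<open>simp_all add: R1_def\<close>)
  moreover have "d + Q < 2 ^ l" "d < 2 ^ l" "H (5 * Q) < 2 ^ l" using pointer[OF dQ] tp(2) by linarith+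
  moreover have "OX < 2 ^ l" using row_less[OF m0] by simp
  ultimately show ?thesis
    by (simp add: total_value_def regs R1_def d_def[symmetric] mult.commute[of Q])
qed

lemma wp_test_total:
  assumes R: "setting R" "radices R" and tot: "R 47 = (\<Sum>\<kappa>\<in>configs (edges G) {..<n}. \<Prod>e\<in>snd \<kappa>. weight e)"
    and post: "\<And>R'. (R' 0 \<noteq> 0 \<longleftrightarrow> accepts \<beta>) \<Longrightarrow> P R' H"
  shows "triple test_total R H P"
proof -
  define x where "x = R 47"
  have n3: "n * n * n = n ^ 3" by (simp add: power3_eq_cube)
  have x_less: "x < 2 ^ l"
    using table_le_bound[of "edges G" "{..<n}" "{}" "\<lambda>_. 0"] table_bound_big(3) by (simp add: x_def tot table_total)
  have pow: "(2 ^ D) ^ i * 2 ^ j < (2::nat) ^ l" if "i \<le> N ^ 5" "j \<le> N" for i j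
  proof (rule big)
    show "(2 ^ D) ^ i * 2 ^ j \<le> (2::nat) ^ (D * i + j)" by (simp add: power_mult power_add)
    have "D * i + j \<le> N ^ 3 * N ^ 5 + N" using that D_le by (intro add_mono mult_le_mono) auto
    also have "\<dots> = N ^ 8 + N" by (simp add: power_add[symmetric])
    also have "\<dots> \<le> 2 * N ^ 8" using N_power_le[of 1 8] by simp
    also have "\<dots> \<le> N * N ^ 8" using N6 by (intro mult_right_mono) auto
    also have "\<dots> = N ^ 9" by (simp add: power_numeral_reduce)
    also have "\<dots> \<le> N ^ 11" by (rule N_power_le) simp
    finally show "D * i + j \<le> N ^ 11" .
  qed
  have idx: "(n - k) * n ^ 3 + j \<le> N ^ 5" if "j \<le> n ^ 3" for j
  proof -
    have "(n - k) * n ^ 3 \<le> N ^ 4" using cube_le(2) unfolding n3 by (simp only: mult.commute)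
    moreover have "j \<le> N ^ 3" using order_trans[OF that] cube_le(1) unfolding n3 .
    ultimately have "(n - k) * n ^ 3 + j \<le> N ^ 4 + N ^ 3" by (rule add_mono)
    also have "\<dots> \<le> 2 * N ^ 4" using N_power_le[of 3 4] by simp
    also have "\<dots> \<le> N * N ^ 4" using N6 by (intro mult_right_mono) auto
    finally show ?thesis by (simp add: power_numeral_reduce)
  qed
  define i0 where "i0 = (n - k) * n ^ 3"
  have i0: "n * n * n * (n - k) = i0" unfolding i0_def n3 by (rule mult.commute)
  have regs: "R (Suc 0) = n" "R 6 = k" "R 8 = 2 ^ D" using R by (simp_all add: setting_def radices_def)
  define I where "I j R' H' \<longleftrightarrow> H' = H \<and> (\<forall>r. r \<notin> {0, 43, 44, 48} \<longrightarrow> R' r = R r) \<and>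
      R' 48 = (2 ^ D) ^ (i0 + j) * 2 ^ k \<and> (R' 0 \<noteq> 0 \<longleftrightarrow> (\<exists>i<j. odd (x div ((2 ^ D) ^ (i0 + i) * 2 ^ k))))"
    for j :: nat and R' H' :: store
  have loop: "triple (For False 44 (Rg 1 \<^bold>* Rg 1 \<^bold>* Rg 1)
       (Asg 43 (Rg 47 \<^bold>/ Rg 48) ;;
        Ifs (Rg 43 \<^bold>- Rg 43 \<^bold>/ Cn 2 \<^bold>* Cn 2) (Asg 0 (Cn 1)) Nop ;;
        Asg 48 (Rg 48 \<^bold>* Rg 8))) R' H P" if I0: "I 0 R' H" for R'
  proof (rule wp_For[where n = "n ^ 3" and I = I])
    show "I 0 R' H" by (rule I0)
    show "eval_exp (Rg 1 \<^bold>* Rg 1 \<^bold>* Rg 1) R' H = n ^ 3" using I0 regs n3 by (simp add: I_def)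
    show "n ^ 3 \<le> (if False then E else W)" using order_trans[OF cube_le(1) loops(3)] unfolding n3 by simp
  next
    fix j R' H' assume j: "j < n ^ 3" and I: "I j R' H'"
    let ?q = "x div ((2 ^ D) ^ (i0 + j) * 2 ^ k)"
    have q: "?q < 2 ^ l" using x_less by (rule le_less_trans[OF div_le_dividend])
    have rs: "R' 47 = x" "R' 8 = 2 ^ D" "R' 48 = (2 ^ D) ^ (i0 + j) * 2 ^ k" "H' = H"
      using I regs by (simp_all add: I_def x_def)
    have nx: "(2 ^ D) ^ (i0 + j) * 2 ^ k * 2 ^ D = ((2 ^ D) ^ (i0 + Suc j) * 2 ^ k :: nat)" by (simp add: mult_ac)
    have b: "(2 ^ D) ^ (i0 + Suc j) * 2 ^ k < (2::nat) ^ l"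
      using idx[of "Suc j"] j k N6 by (intro pow) (simp_all add: i0_def)
    have ifs: "?q - ?q div 2 * 2 \<noteq> 0 \<longleftrightarrow> odd ?q" by (simp add: minus_div_mult_eq_mod odd_iff_mod_2_eq_one)
    show "triple (Asg 43 (Rg 47 \<^bold>/ Rg 48) ;;
        Ifs (Rg 43 \<^bold>- Rg 43 \<^bold>/ Cn 2 \<^bold>* Cn 2) (Asg 0 (Cn 1)) Nop ;;
        Asg 48 (Rg 48 \<^bold>* Rg 8)) (R'(44 := j)) H' (I (Suc j))"
    proof (cases "odd ?q")
      case True
      have "I (Suc j) (R'(44 := j, 43 := ?q, 0 := 1, 48 := (2 ^ D) ^ (i0 + Suc j) * 2 ^ k)) H"
        using I True by (auto simp: I_def)
      then show ?thesis using True ifs q b small[of 1] by (simp add: rs nx del: power_Suc add_Suc_right)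
    next
      case False
      have "I (Suc j) (R'(44 := j, 43 := ?q, 48 := (2 ^ D) ^ (i0 + Suc j) * 2 ^ k)) H"
        using I False by (auto simp: I_def less_Suc_eq)
      then show ?thesis using False ifs q b by (simp add: rs nx del: power_Suc add_Suc_right)
    qed
  next
    fix R' H' assume I: "I (n ^ 3) R' H'"
    have "accepts \<beta> \<longleftrightarrow> (\<exists>i<n ^ 3. odd (x div ((2 ^ D) ^ (i0 + i) * 2 ^ k)))"
      by (simp add: accepts_def x_def tot i0_def)
    then have "R' 0 \<noteq> 0 \<longleftrightarrow> accepts \<beta>" using I by (simp add: I_def)
    then show "P R' H'" using I post[of R'] by (simp add: I_def)
  qed
  have "triple (For False 44 (Rg 1 \<^bold>* Rg 1 \<^bold>* Rg 1 \<^bold>* (Rg 1 \<^bold>- Rg 6)) (Asg 48 (Rg 48 \<^bold>* Rg 8))) (R(48 := 1)) H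
     (\<lambda>R H. triple (For False 44 (Rg 6) (Asg 48 (Rg 48 \<^bold>* Cn 2))) R H (\<lambda>R H. triple (Asg 0 (Cn 0) ;;
     For False 44 (Rg 1 \<^bold>* Rg 1 \<^bold>* Rg 1)
       (Asg 43 (Rg 47 \<^bold>/ Rg 48) ;;
        Ifs (Rg 43 \<^bold>- Rg 43 \<^bold>/ Cn 2 \<^bold>* Cn 2) (Asg 0 (Cn 1)) Nop ;;
        Asg 48 (Rg 48 \<^bold>* Rg 8))) R H P))"
  proof (rule wp_power[where c = "2 ^ D" and N' = i0])
    show "eval_exp (Rg 1 \<^bold>* Rg 1 \<^bold>* Rg 1 \<^bold>* (Rg 1 \<^bold>- Rg 6)) (R(48 := 1)) H = i0" using regs i0 by simp
    show "i0 \<le> W" using cube_le(2) W i0 by simp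
    show "(R(48 := 1)) 48 * (2 ^ D) ^ j < 2 ^ l" if "j \<le> i0" for j
    proof -
      have "j \<le> N ^ 5" using that idx[of 0] by (simp add: i0_def)
      then show ?thesis using pow[of j 0] by simp
    qed
    fix R1 assume f1: "\<And>q. q \<noteq> 44 \<Longrightarrow> q \<noteq> 48 \<Longrightarrow> R1 q = (R(48 := 1)) q" and "R1 48 = (R(48 := 1)) 48 * (2 ^ D) ^ i0"
    then have r1: "R1 48 = (2 ^ D) ^ i0" by simp
    show "triple (For False 44 (Rg 6) (Asg 48 (Rg 48 \<^bold>* Cn 2))) R1 H (\<lambda>R H. triple (Asg 0 (Cn 0) ;;
     For False 44 (Rg 1 \<^bold>* Rg 1 \<^bold>* Rg 1)
       (Asg 43 (Rg 47 \<^bold>/ Rg 48) ;;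
        Ifs (Rg 43 \<^bold>- Rg 43 \<^bold>/ Cn 2 \<^bold>* Cn 2) (Asg 0 (Cn 1)) Nop ;;
        Asg 48 (Rg 48 \<^bold>* Rg 8))) R H P)"
    proof (rule wp_power[where c = 2 and N' = k])
      show "eval_exp (Rg 6) R1 H = k" using f1[of 6] regs by simp
      show "k \<le> W" using k loops by simp
      show "R1 48 * 2 ^ j < 2 ^ l" if "j \<le> k" for j
        unfolding r1 using that k N6 idx[of 0] by (intro pow) (simp_all add: i0_def)
      fix R2 assume f2: "\<And>q. q \<noteq> 44 \<Longrightarrow> q \<noteq> 48 \<Longrightarrow> R2 q = R1 q" and r2: "R2 48 = R1 48 * 2 ^ k"
      have "I 0 (R2(0 := 0)) H" unfolding I_def using r1 r2 f1 f2 by simp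
      then show "triple (Asg 0 (Cn 0) ;; For False 44 (Rg 1 \<^bold>* Rg 1 \<^bold>* Rg 1)
       (Asg 43 (Rg 47 \<^bold>/ Rg 48) ;;
        Ifs (Rg 43 \<^bold>- Rg 43 \<^bold>/ Cn 2 \<^bold>* Cn 2) (Asg 0 (Cn 1)) Nop ;;
        Asg 48 (Rg 48 \<^bold>* Rg 8))) R2 H P" using loop small[of 0] by simp
    qed simp_all
  qed (use regs in simp_all)
  then show ?thesis using small[of 1] by (simp add: test_total_def)
qed

theorem wp_decide:
  assumes R: "setting R" and H: "input H" "\<And>a. 2 * Q \<le> a \<Longrightarrow> H a = 0"
  shows "triple decide R H (\<lambda>R' H'. R' 0 \<noteq> 0 \<longleftrightarrow> accepts \<beta>)"
proof -
  let ?P = "\<lambda>R' H'. R' 0 \<noteq> 0 \<longleftrightarrow> accepts \<beta>"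
  have "triple set_radices R H (\<lambda>R H. triple find_order R H (\<lambda>R H. triple init_tables R H (\<lambda>R H.
      triple absorb_edges R H (\<lambda>R H. triple merge_tables R H (\<lambda>R H. triple total_value R H (\<lambda>R H.
      triple test_total R H ?P))))))"
  proof (rule wp_set_radices[OF R])
    fix R1 assume f1: "\<And>r. r \<notin> {8, 9, 44} \<Longrightarrow> R1 r = R r" and rad1: "radices R1"
    have s1: "setting R1" using R by (simp add: setting_def f1)
    show "triple find_order R1 H (\<lambda>R H. triple init_tables R H (\<lambda>R H.
      triple absorb_edges R H (\<lambda>R H. triple merge_tables R H (\<lambda>R H. triple total_value R H (\<lambda>R H.
      triple test_total R H ?P)))))"
    proof (rule wp_find_order[OF s1 H])
      fix R2 H2 assume f2: "\<And>r. r \<notin> {33, 34, 37, 38, 44} \<Longrightarrow> R2 r = R1 r" and low2: "\<And>a. a < 2 * Q \<Longrightarrow> H2 a = H a"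
        and so: "search_order T m (\<lambda>i. H2 (3 * Q + i)) (\<lambda>i. H2 (4 * Q + i))" and z2: "\<And>a. 5 * Q \<le> a \<Longrightarrow> H2 a = 0"
      have s2: "setting R2" and rad2: "radices R2" using s1 rad1 by (simp_all add: setting_def radices_def f2)
      have inp2: "input H2" by (rule input_cong[OF H(1) low2])
      show "triple init_tables R2 H2 (\<lambda>R H.
        triple absorb_edges R H (\<lambda>R H. triple merge_tables R H (\<lambda>R H. triple total_value R H (\<lambda>R H.
        triple test_total R H ?P))))"
      proof (rule wp_init_tables[OF s2 inp2 z2])
        fix R3 H3 assume f3: "\<And>r. r \<notin> {10, 12, 13, 16, 37} \<union> {17..32} \<Longrightarrow> R3 r = R2 r" and r3: "R3 10 = (6 + m) * Q"
          and low3: "\<And>a. a < 5 * Q \<Longrightarrow> H3 a = H2 a" and t3: "tables H3 (R3 10) (\<lambda>_. {}) X {..<m}"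
        have s3: "setting R3" and rad3: "radices R3" using s2 rad2 by (simp_all add: setting_def radices_def f3)
        have inp3: "input H3" by (rule input_cong[OF inp2]) (rule low3, simp)
        show "triple absorb_edges R3 H3 (\<lambda>R H. triple merge_tables R H (\<lambda>R H. triple total_value R H (\<lambda>R H.
          triple test_total R H ?P)))"
        proof (rule wp_absorb_edges[OF s3 rad3 inp3 t3 r3])
          fix R4 H4 AA assume f4: "\<And>r. r < 10 \<Longrightarrow> R4 r = R3 r" and r4: "R4 10 \<le> (6 + m + 3 * (n * n)) * Q"
            and low4: "\<And>a. a < 5 * Q \<Longrightarrow> H4 a = H3 a" and t4: "tables H4 (R4 10) AA X {..<m}" and AA: "assigned AA (edges G)"
          have s4: "setting R4" and rad4: "radices R4" using s3 rad3 by (simp_all add: setting_def radices_def f4)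
          have inp4: "input H4" by (rule input_cong[OF inp3]) (rule low4, simp)
          have mQ: "m < Q" using Q_bounds by simp
          have so4: "search_order T m (\<lambda>i. H4 (3 * Q + i)) (\<lambda>i. H4 (4 * Q + i))"
          proof -
            have "H4 (3 * Q + i) = H2 (3 * Q + i)" "H4 (4 * Q + i) = H2 (4 * Q + i)" if "i < m" for i
              using that mQ low4[of "3 * Q + i"] low3[of "3 * Q + i"] low4[of "4 * Q + i"] low3[of "4 * Q + i"] by simp_all
            then show ?thesis using m by (intro search_order_cong[OF so]) simp_all
          qed
          show "triple merge_tables R4 H4 (\<lambda>R H. triple total_value R H (\<lambda>R H. triple test_total R H ?P))"
          proof (rule wp_merge_tables[OF s4 inp4 t4 AA so4 r4])
            fix R5 H5 AA UU assume f5: "\<And>r. r < 10 \<Longrightarrow> R5 r = R4 r" and r5: "R5 10 \<le> (6 + 3 * m + 3 * (n * n)) * Q"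
              and low5: "\<And>a. a < 5 * Q \<Longrightarrow> H5 a = H4 a" and t5: "tables H5 (R5 10) AA UU {0}" and M: "merged AA UU {0}"
            have s5: "setting R5" and rad5: "radices R5" using s4 rad4 by (simp_all add: setting_def radices_def f5)
            have inp5: "input H5" by (rule input_cong[OF inp4]) (rule low5, simp)
            show "triple total_value R5 H5 (\<lambda>R H. triple test_total R H ?P)"
            proof (rule wp_total_value[OF s5 inp5 t5 M r5])
              fix R6 H6 assume f6: "\<And>r. r < 10 \<Longrightarrow> R6 r = R5 r"
                and tot: "R6 47 = (\<Sum>\<kappa>\<in>configs (edges G) {..<n}. \<Prod>e\<in>snd \<kappa>. weight e)"
              have "setting R6" "radices R6" using s5 rad5 by (simp_all add: setting_def radices_def f6)
              then show "triple test_total R6 H6 ?P" using tot by (rule wp_test_total[where R = R6])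
            qed
          qed
        qed
      qed
    qed
  qed
  then show ?thesis by (simp add: decide_def)
qed

end

subsection \<open>Reading the input\<close>

definition memory :: "nat list \<Rightarrow> store" where
  "memory xs = (\<lambda>i. if i < length xs then xs ! i else 0)"

lemma memory_append1: "i < length xs \<Longrightarrow> memory (xs @ ys) i = memory xs i"
  by (simp add: memory_def nth_append)

lemma memory_append2: "memory (xs @ ys) (length xs + i) = memory ys i"
  by (simp add: memory_def)

lemma length_bit_matrix [simp]: "length (bit_matrix m n A) = m * n"
  by (induction m) (simp_all add: bit_matrix_def)

lemma memory_bit_matrix: "i < m \<Longrightarrow> j < n \<Longrightarrow> memory (bit_matrix m n A) (i * n + j) = of_bool (A i j)"
proof (induction m)
  case (Suc m)
  let ?row = "map (\<lambda>j. of_bool (A m j)) [0..<n] :: nat list"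
  have split: "bit_matrix (Suc m) n A = bit_matrix m n A @ ?row" by (simp add: bit_matrix_def)
  show ?case
  proof (cases "i = m")
    case True
    then show ?thesis unfolding split using memory_append2[of "bit_matrix m n A" ?row j] Suc.prems
      by (simp add: memory_def)
  next
    case False
    then have "i < m" using Suc.prems by simp
    moreover have "i * n + j < m * n" using \<open>i < m\<close> Suc.prems by (intro pair_index_less)
    ultimately show ?thesis unfolding split using Suc by (simp add: memory_append1)
  qed
qed simp

lemma memory_encode_int:
  "memory (encode_int k) 0 = of_bool (k < 0)"
  "memory (encode_int k) (Suc i) = (if nat \<bar>k\<bar> < 2 ^ i then 0 else 1 + of_bool (bit (nat \<bar>k\<bar>) i))"
  using len_le_iff[of "nat \<bar>k\<bar>" i] by (auto simp: memory_def encode_int_def)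

lemma set_bit_matrix: "set (bit_matrix m n A) \<subseteq> {..1}"
  by (auto simp: bit_matrix_def)

lemma memory_encode_instance:
  fixes G T :: "nat pair_pre_digraph" and X :: "nat \<Rightarrow> nat set" and k :: int
  assumes n: "card (pverts G) = n" and m: "card (pverts T) = m"
  defines "H \<equiv> memory (encode_instance G T X k)" and "KO \<equiv> 2 + n * n + m * m + m * n"
  shows "H 0 = n" "H 1 = m"
    "\<And>u v. u < n \<Longrightarrow> v < n \<Longrightarrow> H (2 + u * n + v) = of_bool ((u, v) \<in> parcs G)"
    "\<And>x y. x < m \<Longrightarrow> y < m \<Longrightarrow> H (2 + n * n + x * m + y) = of_bool ((x, y) \<in> parcs T)"
    "\<And>x v. x < m \<Longrightarrow> v < n \<Longrightarrow> H (2 + n * n + m * m + x * n + v) = of_bool (v \<in> X x)"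
    "H KO = of_bool (k < 0)"
    "\<And>i. H (KO + 1 + i) = (if nat \<bar>k\<bar> < 2 ^ i then 0 else 1 + of_bool (bit (nat \<bar>k\<bar>) i))"
    "\<And>a. H a \<le> n + m + 2"
proof -
  define M1 M2 M3 where "M1 = bit_matrix n n (\<lambda>u v. (u, v) \<in> parcs G)" and "M2 = bit_matrix m m (\<lambda>x y. (x, y) \<in> parcs T)"
    and "M3 = bit_matrix m n (\<lambda>x v. v \<in> X x)"
  have H: "H = memory ([n, m] @ M1 @ M2 @ M3 @ encode_int k)"
    by (simp add: H_def encode_instance_def n m M1_def M2_def M3_def)
  have len: "length M1 = n * n" "length M2 = m * m" "length M3 = m * n" by (simp_all add: M1_def M2_def M3_def)
  have at1: "H (2 + i) = memory (M1 @ M2 @ M3 @ encode_int k) i" for i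
    using memory_append2[of "[n, m]" "M1 @ M2 @ M3 @ encode_int k" i] by (simp add: H)
  have at2: "H (2 + n * n + i) = memory (M2 @ M3 @ encode_int k) i" for i
    using at1[of "n * n + i"] memory_append2[of M1 "M2 @ M3 @ encode_int k" i] by (simp add: len add.assoc)
  have at3: "H (2 + n * n + m * m + i) = memory (M3 @ encode_int k) i" for i
    using at2[of "m * m + i"] memory_append2[of M2 "M3 @ encode_int k" i] by (simp add: len add.assoc)
  have at4: "H (KO + i) = memory (encode_int k) i" for i
    using at3[of "m * n + i"] memory_append2[of M3 "encode_int k" i] by (simp add: len add.assoc KO_def)
  show "H 0 = n" "H 1 = m" by (simp_all add: H memory_def)
  show "H (2 + u * n + v) = of_bool ((u, v) \<in> parcs G)" if "u < n" "v < n" for u v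
    using at1[of "u * n + v"] memory_bit_matrix[OF that] pair_index_less[OF that]
    by (simp add: add.assoc memory_append1 len M1_def)
  show "H (2 + n * n + x * m + y) = of_bool ((x, y) \<in> parcs T)" if "x < m" "y < m" for x y
    using at2[of "x * m + y"] memory_bit_matrix[OF that] pair_index_less[OF that]
    by (simp add: add.assoc memory_append1 len M2_def)
  show "H (2 + n * n + m * m + x * n + v) = of_bool (v \<in> X x)" if "x < m" "v < n" for x v
    using at3[of "x * n + v"] memory_bit_matrix[OF that] pair_index_less[OF that]
    by (simp add: add.assoc memory_append1 len M3_def)
  show "H KO = of_bool (k < 0)" using at4[of 0] by (simp add: memory_encode_int)
  show "H (KO + 1 + i) = (if nat \<bar>k\<bar> < 2 ^ i then 0 else 1 + of_bool (bit (nat \<bar>k\<bar>) i))" for i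
    using at4[of "Suc i"] by (simp add: memory_encode_int)
  show "H a \<le> n + m + 2" for a
  proof -
    have sub: "{..2} \<subseteq> {..n + m + 2}" "{..1} \<subseteq> {..n + m + 2}" by auto
    have "set (encode_int k) \<subseteq> {..2}" by (auto simp: encode_int_def)
    then have "set (encode_int k) \<subseteq> {..n + m + 2}" using sub(1) by (rule order_trans)
    moreover have "set M1 \<subseteq> {..n + m + 2}" "set M2 \<subseteq> {..n + m + 2}" "set M3 \<subseteq> {..n + m + 2}"
      unfolding M1_def M2_def M3_def by (rule order_trans[OF set_bit_matrix sub(2)])+
    ultimately have "set ([n, m] @ M1 @ M2 @ M3 @ encode_int k) \<subseteq> {..n + m + 2}" by simp
    then have "x \<le> n + m + 2" if "x \<in> set ([n, m] @ M1 @ M2 @ M3 @ encode_int k)" for x using that by blast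
    from this[OF nth_mem] show ?thesis
      unfolding H memory_def by (cases "a < length ([n, m] @ M1 @ M2 @ M3 @ encode_int k)") (simp_all only: if_True if_False le0)
  qed
qed

text \<open>Reading \<open>n\<close> bits of the absolute value is enough, since a value of at least
  \<open>2 ^ n\<close> exceeds \<open>n\<close> anyway. Truncated subtraction of one maps the cell
  of a zero bit and the terminating cell alike to zero.\<close>

definition parse :: prog where
  "parse =
     Asg 1 (Hp (Cn 0)) ;; Asg 2 (Hp (Cn 1)) ;; Asg 3 (Cn 2 \<^bold>+ Rg 1 \<^bold>* Rg 1) ;; Asg 4 (Rg 3 \<^bold>+ Rg 2 \<^bold>* Rg 2) ;;
     Asg 49 (Rg 4 \<^bold>+ Rg 2 \<^bold>* Rg 1) ;; Asg 41 (Rg 1 \<^bold>* Rg 1 \<^bold>* Rg 1) ;;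
     Asg 5 ((Rg 1 \<^bold>+ Rg 2 \<^bold>+ Cn 4) \<^bold>* (Rg 1 \<^bold>+ Rg 2 \<^bold>+ Cn 4) \<^bold>* (Rg 1 \<^bold>+ Rg 2 \<^bold>+ Cn 4)) ;;
     For False 44 (Rg 1) (Asg 5 (Rg 5 \<^bold>* Cn 8)) ;;
     Asg 42 (Rg 5) ;; Asg 6 (Cn 0) ;; Asg 40 (Cn 1) ;;
     For False 44 (Rg 1)
       (Asg 6 (Rg 6 \<^bold>+ (Hp (Rg 49 \<^bold>+ Cn 1 \<^bold>+ Rg 44) \<^bold>- Cn 1) \<^bold>* Rg 40) ;; Asg 40 (Rg 40 \<^bold>* Cn 2))"

text \<open>
  Register 49 points to the sign of the integer.  Its absolute value is at least \<open>n\<close> if the cell after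
  the first \<open>n\<close> bits is not the terminating zero or if the number \<open>v\<close> read in register 6 satisfies
  \<open>1 - (n - v) \<noteq> 0\<close>.
\<close>

definition solve :: prog where
  "solve = Ifs (Hp (Rg 49)) Nop
     (Ifs (Hp (Rg 49 \<^bold>+ Cn 1 \<^bold>+ Rg 1) \<^bold>+ (Cn 1 \<^bold>- (Rg 1 \<^bold>- Rg 6))) (Asg 0 (Cn 1)) (Ifs (Rg 6) decide Nop))"

text \<open>Registers below 60 belong to the source programs, and 41 and 42 pass the number and the
  address of the random bits to the generator. The bits are drawn between two compiled programs
  because their place in the heap is known only after \<open>n\<close> and \<open>m\<close> are
  read.\<close>

definition solver :: com where
  "solver = Seq (compile parse 60) (Seq (random_bits 41 42 43) (compile solve 60))"

lemma prog_wf_parse: "prog_wf 60 parse" and prog_wf_solve: "prog_wf 60 solve"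
  by (simp_all add: parse_def solve_def decide_def set_radices_def find_order_def init_tables_def absorb_edges_def
      find_bag_def edge_weight_def edge_message_def absorb_def merge_tables_def send_def total_value_def test_total_def
      fill_table_def expand_index_def expand_vertex_def init_entry_def message_entry_def join_entry_def)

lemma table_loop_depth_parse: "table_loop_depth parse = 0" and table_loop_depth_solve: "table_loop_depth solve = 1"
  by (simp_all add: parse_def solve_def decide_def set_radices_def find_order_def init_tables_def absorb_edges_def
      find_bag_def edge_weight_def edge_message_def absorb_def merge_tables_def send_def total_value_def test_total_def
      fill_table_def expand_index_def expand_vertex_def init_entry_def message_entry_def join_entry_def)

definition parsed :: "nat \<Rightarrow> nat \<Rightarrow> nat \<Rightarrow> nat \<Rightarrow> store \<Rightarrow> bool" where
  "parsed n m Q v R \<longleftrightarrow> R 0 = 0 \<and> R 1 = n \<and> R 2 = m \<and> R 3 = 2 + n * n \<and> R 4 = 2 + n * n + m * m \<and> R 5 = Q \<and> R 6 = v \<and>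
     R 49 = 2 + n * n + m * m + m * n"

lemma segment_bounds:
  fixes n m :: nat
  assumes N: "N = n + m + 4" and Q: "Q = N ^ 3 * 8 ^ n" and l: "N ^ 12 \<le> l" and j: "j \<le> n"
  shows "2 + n * n + m * m + m * n + n + 2 \<le> Q" "n * n * n \<le> Q" "N ^ 3 * 8 ^ j \<le> Q" "2 ^ j \<le> Q" "N \<le> Q" "2 * Q < 2 ^ l"
proof -
  have N4: "4 \<le> N" using N by simp
  have N2: "N * N \<le> N ^ 3" using N4 by (simp add: power3_eq_cube)
  have "N ^ 3 * 1 \<le> N ^ 3 * 8 ^ n" by (intro mult_le_mono) auto
  then have NQ: "N ^ 3 \<le> Q" using Q by simp
  have "2 + n * n + m * m + m * n + n + 2 \<le> N * N" unfolding N by (simp add: algebra_simps)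
  then show "2 + n * n + m * m + m * n + n + 2 \<le> Q" using N2 NQ by linarith
  have "n * n * n \<le> N * N * N" unfolding N by (intro mult_le_mono) auto
  then show "n * n * n \<le> Q" using NQ by (simp add: power3_eq_cube)
  have "(8::nat) ^ j \<le> 8 ^ n" using j by (intro power_increasing) auto
  then show j8: "N ^ 3 * 8 ^ j \<le> Q" unfolding Q by (intro mult_le_mono) auto
  have "(2::nat) ^ j \<le> 8 ^ j" by (intro power_mono) auto
  also have "\<dots> \<le> N ^ 3 * 8 ^ j" using N4 by simp
  finally show "2 ^ j \<le> Q" using j8 by linarith
  have "N * 1 \<le> N * N" using N4 by (intro mult_le_mono) auto
  then show "N \<le> Q" using N2 NQ by linarith
  show "2 * Q < 2 ^ l"
  proof (rule exponent_less_power2[of _ "6 * N + 1" N])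
    have "N ^ 3 \<le> (2 ^ N) ^ 3" using less_exp[of N] by (intro power_mono) auto
    also have "\<dots> = 2 ^ (3 * N)" by (simp add: power_mult[symmetric] mult.commute)
    finally have "N ^ 3 \<le> 2 ^ (3 * N)" .
    moreover have "(2::nat) ^ (3 * n) \<le> 2 ^ (3 * N)" using N by (intro power_increasing) auto
    then have "(8::nat) ^ n \<le> 2 ^ (3 * N)" by (simp add: power_mult)
    ultimately have "Q \<le> 2 ^ (3 * N) * 2 ^ (3 * N)" unfolding Q by (intro mult_le_mono)
    also have "\<dots> = 2 ^ (6 * N)" by (simp add: power_add[symmetric])
    finally show "2 * Q \<le> 2 ^ (6 * N + 1)" by simp
    have "6 * N + 1 \<le> 16 * N" using N4 by simp
    also have "\<dots> \<le> N ^ 2 * N" using power_mono[OF N4, of 2] by (intro mult_right_mono) auto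
    also have "\<dots> = N ^ 3" by (simp add: power_numeral_reduce)
    also have "\<dots> \<le> N ^ 11" using N4 by (intro power_increasing) auto
    finally show "6 * N + 1 \<le> N ^ 11" .
  qed (use N4 l in auto)
qed

lemma (in bounds) wp_parse:
  assumes N: "N = n + m + 4" and Q: "Q = N ^ 3 * 8 ^ n" and l12: "N ^ 12 \<le> l"
    and R: "R 0 = 0" and H: "H 0 = n" "H 1 = m"
    and cells: "\<And>i. i < n \<Longrightarrow> H (2 + n * n + m * m + m * n + 1 + i) - 1 = of_bool (bit K i)"
  shows "triple parse R H (\<lambda>R' H'. H' = H \<and> R' 41 = n * n * n \<and> R' 42 = Q \<and> parsed n m Q (take_bit n K) R')"
    (is "triple parse R H ?P")
proof -
  define KO where "KO = 2 + n * n + m * m + m * n"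
  note sb = segment_bounds[OF N Q l12]
  have le: "x < 2 ^ l" if "x \<le> Q" for x using that sb(6)[of 0] by simp
  define R1 where "R1 = R(1 := n, 2 := m, 3 := 2 + n * n, 4 := 2 + n * n + m * m, 49 := KO, 41 := n * n * n, 5 := N * N * N)"
  have N3: "N * N * N = N ^ 3" by (simp add: power3_eq_cube)
  have *: "triple (For False 44 (Rg 1) (Asg 5 (Rg 5 \<^bold>* Cn 8))) R1 H (\<lambda>R H. triple (Asg 42 (Rg 5) ;; Asg 6 (Cn 0) ;; Asg 40 (Cn 1) ;;
     For False 44 (Rg 1)
       (Asg 6 (Rg 6 \<^bold>+ (Hp (Rg 49 \<^bold>+ Cn 1 \<^bold>+ Rg 44) \<^bold>- Cn 1) \<^bold>* Rg 40) ;; Asg 40 (Rg 40 \<^bold>* Cn 2))) R H ?P)"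
  proof (rule wp_For[where n = n and I = "\<lambda>j R' H'. H' = H \<and> (\<forall>q. q \<noteq> 44 \<longrightarrow> q \<noteq> 5 \<longrightarrow> R' q = R1 q) \<and> R' 5 = N ^ 3 * 8 ^ j"])
    fix j R' H' assume j: "j < n" and I: "H' = H \<and> (\<forall>q. q \<noteq> 44 \<longrightarrow> q \<noteq> 5 \<longrightarrow> R' q = R1 q) \<and> R' 5 = N ^ 3 * 8 ^ j"
    have "N ^ 3 * 8 ^ Suc j < 2 ^ l" using j by (intro le sb(3)) simp
    then show "triple (Asg 5 (Rg 5 \<^bold>* Cn 8)) (R'(44 := j)) H'
        (\<lambda>R' H'. H' = H \<and> (\<forall>q. q \<noteq> 44 \<longrightarrow> q \<noteq> 5 \<longrightarrow> R' q = R1 q) \<and> R' 5 = N ^ 3 * 8 ^ Suc j)"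
      using I by (simp add: mult_ac)
  next
    fix R2 H2 assume I: "H2 = H \<and> (\<forall>q. q \<noteq> 44 \<longrightarrow> q \<noteq> 5 \<longrightarrow> R2 q = R1 q) \<and> R2 5 = N ^ 3 * 8 ^ n"
    then have r2: "R2 q = R1 q" if "q \<noteq> 44" "q \<noteq> 5" for q using that by simp
    have r5: "R2 5 = Q" using I Q by simp
    define R3 where "R3 = R2(42 := Q, 6 := 0, 40 := 1)"
    have "triple (For False 44 (Rg 1)
       (Asg 6 (Rg 6 \<^bold>+ (Hp (Rg 49 \<^bold>+ Cn 1 \<^bold>+ Rg 44) \<^bold>- Cn 1) \<^bold>* Rg 40) ;; Asg 40 (Rg 40 \<^bold>* Cn 2))) R3 H ?P"
    proof (rule wp_For[where n = n and I = "\<lambda>j R' H'. H' = H \<and> (\<forall>q. q \<notin> {6, 40, 44} \<longrightarrow> R' q = R3 q) \<and> R' 6 = take_bit j K \<and> R' 40 = 2 ^ j"])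
      fix j R' H' assume j: "j < n" and I: "H' = H \<and> (\<forall>q. q \<notin> {6, 40, 44} \<longrightarrow> R' q = R3 q) \<and> R' 6 = take_bit j K \<and> R' 40 = 2 ^ j"
      have r49: "R' 49 = KO" using I by (simp add: R3_def r2 R1_def)
      have tb: "take_bit j K + of_bool (bit K j) * 2 ^ j = take_bit (Suc j) K" by (simp add: take_bit_Suc_from_most)
      have "take_bit (Suc j) K < 2 ^ Suc j" by (rule take_bit_nat_less_exp)
      also have "\<dots> \<le> Q" using j by (intro sb(4)) simp
      finally have b1: "take_bit (Suc j) K < 2 ^ l" by (intro le) simp
      have b2: "2 ^ Suc j < (2::nat) ^ l" using j by (intro le sb(4)) simp
      have c: "H (Suc (KO + j)) - Suc 0 = of_bool (bit K j)" using cells[OF j] by (simp add: KO_def)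
      show "triple (Asg 6 (Rg 6 \<^bold>+ (Hp (Rg 49 \<^bold>+ Cn 1 \<^bold>+ Rg 44) \<^bold>- Cn 1) \<^bold>* Rg 40) ;; Asg 40 (Rg 40 \<^bold>* Cn 2)) (R'(44 := j)) H'
        (\<lambda>R' H'. H' = H \<and> (\<forall>q. q \<notin> {6, 40, 44} \<longrightarrow> R' q = R3 q) \<and> R' 6 = take_bit (Suc j) K \<and> R' 40 = 2 ^ Suc j)"
        using I b1 b2 c r49 tb by (simp add: mult.commute)
    next
      fix R4 H4 assume I: "H4 = H \<and> (\<forall>q. q \<notin> {6, 40, 44} \<longrightarrow> R4 q = R3 q) \<and> R4 6 = take_bit n K \<and> R4 40 = 2 ^ n"
      then have r4: "R4 q = R3 q" if "q \<notin> {6, 40, 44}" for q using that by simp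
      show "?P R4 H4" using I R by (simp add: parsed_def r4 R3_def r2 R1_def r5 KO_def)
    qed (use r2[of 1] n in \<open>simp_all add: R3_def R1_def\<close>)
    then show "triple (Asg 42 (Rg 5) ;; Asg 6 (Cn 0) ;; Asg 40 (Cn 1) ;;
     For False 44 (Rg 1)
       (Asg 6 (Rg 6 \<^bold>+ (Hp (Rg 49 \<^bold>+ Cn 1 \<^bold>+ Rg 44) \<^bold>- Cn 1) \<^bold>* Rg 40) ;; Asg 40 (Rg 40 \<^bold>* Cn 2))) R2 H2 ?P"
      using I le[of Q] small[of 1] by (simp add: R3_def r5)
  qed (use n in \<open>simp_all add: R1_def N3\<close>)
  have b: "n < 2 ^ l" "m < 2 ^ l" "2 + n * n < 2 ^ l" "2 + n * n + m * m < 2 ^ l" "KO < 2 ^ l" "n * n * n < 2 ^ l" "N * N * N < 2 ^ l"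
    using sb(1)[of 0] sb(2)[of 0] sb(3)[of 0] sb(5)[of 0] N N3 by (auto intro!: le simp: KO_def)
  have h1: "H (Suc 0) = m" using H(2) by simp
  have nm: "n + m + 4 = N" using N by simp
  from * b show ?thesis
    unfolding parse_def R1_def KO_def by (simp add: H(1) h1 nm fun_upd_twist)
qed

subsection \<open>Correctness\<close>

text \<open>After the coin flips the machine is deterministic, so the distribution of its answer is
  the image of \<open>coin_flips\<close> under \<open>acc\<close>.\<close>

lemma halts_solver:
  assumes l: "1 \<le> l" "W < 2 ^ l" "E < 2 ^ l" and H: "\<And>a. H a < 2 ^ l"
    and parse: "wp l W E parse (\<lambda>_. 0) H (\<lambda>R' H'. H' = H \<and> R' 41 = c \<and> R' 42 = s \<and> parsed n m Q v R')" and sc: "s + c < 2 ^ l"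
    and solve: "\<And>R \<beta>. parsed n m Q v R \<Longrightarrow> wp l W E solve R (overwrite {s..<s + c} \<beta> H) (\<lambda>R' H'. R' 0 \<noteq> 0 \<longleftrightarrow> acc \<beta>)"
  shows "\<exists>\<mu>. halts solver (\<lambda>_. 0) H (l * prog_time W E parse + 1 + (l * (24 * c + 1) + 1 + l * prog_time W E solve)) \<mu> \<and>
    map_pmf (\<lambda>(R, H). R 0 \<noteq> 0) \<mu> = map_pmf acc (coin_flips {s..<s + c})"
proof -
  define J where "J = {s..<s + c}"
  obtain Rp where ex: "exec l W E parse (\<lambda>_. 0) H Rp H" and Rp: "Rp 41 = c" "Rp 42 = s" "parsed n m Q v Rp"
    using parse by (auto simp: wp_def)
  have "bounded_state l (\<lambda>_. 0) H" using H by (simp add: bounded_state_def)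
  from compile_correct[OF l ex prog_wf_parse order_refl _ this, of "\<lambda>_. 0"]
  obtain R1 where h1: "halts (compile parse 60) (\<lambda>_. 0) H (l * prog_time W E parse) (return_pmf (R1, H))"
    and R1: "\<And>r. r < 60 \<Longrightarrow> R1 r = Rp r" and bp: "bounded_state l Rp H" by auto
  define upd where "upd R = (if c = 0 then R else R(43 := 1, 41 := 0, 42 := s + c))" for R :: store
  have h2: "halts (random_bits 41 42 43) R1 H (l * (24 * c + 1))
      (map_pmf (\<lambda>\<beta>. (upd R1, overwrite J \<beta> H)) (coin_flips J))"
    unfolding J_def upd_def by (rule halts_random_bits) (use R1 Rp l sc in simp_all)
  have "\<exists>x. halts (compile solve 60) (upd R1) (overwrite J \<beta> H) (l * prog_time W E solve) (return_pmf x) \<and>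
      (fst x 0 \<noteq> 0 \<longleftrightarrow> acc \<beta>)" for \<beta>
  proof -
    have "parsed n m Q v (upd Rp)" using Rp(3) by (simp add: parsed_def upd_def)
    from solve[OF this, of \<beta>] obtain R' H' where ex: "exec l W E solve (upd Rp) (overwrite J \<beta> H) R' H'"
      and acc: "R' 0 \<noteq> 0 \<longleftrightarrow> acc \<beta>" by (auto simp: wp_def J_def)
    have l1: "1 < (2::nat) ^ l" using l(1) by (intro one_less_power) auto
    have "bounded_state l (upd Rp) (overwrite J \<beta> H)"
      using bp l1 sc by (auto simp: bounded_state_def upd_def overwrite_def)
    moreover have "\<forall>r<60. upd R1 r = upd Rp r" using R1 by (simp add: upd_def)
    ultimately obtain R3 where "halts (compile solve 60) (upd R1) (overwrite J \<beta> H) (l * prog_time W E solve) (return_pmf (R3, H'))"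
      "\<forall>r<60. R3 r = R' r"
      using compile_correct[OF l ex prog_wf_solve order_refl, of "upd R1"] by blast
    then show ?thesis using acc by (intro exI[of _ "(R3, H')"]) simp
  qed
  then obtain f where f: "\<And>\<beta>. halts (compile solve 60) (upd R1) (overwrite J \<beta> H) (l * prog_time W E solve) (return_pmf (f \<beta>))"
    and facc: "\<And>\<beta>. fst (f \<beta>) 0 \<noteq> 0 \<longleftrightarrow> acc \<beta>" by metis
  \<comment> \<open>The sequential rule wants the second distribution as a function of the final
    state, not of the bits. On the support of \<open>coin_flips\<close> all bits outside
    \<open>J\<close> are false, so the heap determines them.\<close>
  define recover where "recover h = (\<lambda>i. i \<in> J \<and> h i \<noteq> 0)" for h :: store
  have rec: "recover (overwrite J \<beta> H) = \<beta>" if "\<beta> \<in> set_pmf (coin_flips J)" for \<beta>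
  proof -
    have "finite J" by (simp add: J_def)
    then have "\<beta> i = False" if "i \<notin> J" for i
      using \<open>\<beta> \<in> _\<close> that unfolding coin_flips_def by (simp add: set_Pi_pmf PiE_dflt_def)
    then show ?thesis by (auto simp: recover_def overwrite_def fun_eq_iff)
  qed
  define \<mu> where "\<mu> = bind_pmf (map_pmf (\<lambda>\<beta>. (upd R1, overwrite J \<beta> H)) (coin_flips J)) (\<lambda>(R, H). return_pmf (f (recover H)))"
  have "halts (Seq (random_bits 41 42 43) (compile solve 60)) R1 H (l * (24 * c + 1) + 1 + l * prog_time W E solve) \<mu>"
    unfolding \<mu>_def by (rule halts_Seq[OF h2]) (use f rec in auto)
  then have "halts solver (\<lambda>_. 0) H (l * prog_time W E parse + 1 + (l * (24 * c + 1) + 1 + l * prog_time W E solve)) \<mu>"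
    unfolding solver_def by (rule halts_Seq_return[OF h1]) simp
  moreover have "\<mu> = map_pmf f (coin_flips J)"
    unfolding \<mu>_def bind_map_pmf by (simp add: map_pmf_def) (intro bind_pmf_cong refl, simp add: rec)
  ultimately show ?thesis
    using facc by (intro exI[of _ \<mu>]) (simp add: pmf.map_comp o_def case_prod_unfold J_def)
qed

lemma (in dp_instance) extraction_edges: "extraction n k (edges G)" and edges_less: "edges G \<subseteq> {(u, v). u < v \<and> v < n}"
  by (rule extraction_axioms) (rule E)

lemma (in dp_instance) bit_blocks:
  shows "e \<in> edges G \<Longrightarrow> {bit_address e..<bit_address e + n} \<subseteq> {Q..<Q + n * n * n}"
    and "e \<in> edges G \<Longrightarrow> e' \<in> edges G \<Longrightarrow> e \<noteq> e' \<Longrightarrow> {bit_address e..<bit_address e + n} \<inter> {bit_address e'..<bit_address e' + n} = {}"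
proof -
  define idx where "idx e = fst e * n + snd e" for e
  have addr: "bit_address e = Q + idx e * n" for e by (simp add: bit_address_def idx_def)
  have lt: "fst e < n" "snd e < n" if "e \<in> edges G" for e using that edges_less by fastforce+
  have next_block: "i * n + n \<le> j * n" if "i < j" for i j :: nat
    using mult_right_mono[of "Suc i" j n] that by simp
  show "{bit_address e..<bit_address e + n} \<subseteq> {Q..<Q + n * n * n}" if "e \<in> edges G"
    using next_block[of "idx e" "n * n"] pair_index_less[of "fst e" n "snd e" n] lt[OF that] by (auto simp: addr idx_def)
  assume e: "e \<in> edges G" "e' \<in> edges G" "e \<noteq> e'"
  have "idx e \<noteq> idx e'"
  proof
    assume eq: "idx e = idx e'"
    have "idx e div n = fst e" "idx e mod n = snd e" "idx e' div n = fst e'" "idx e' mod n = snd e'"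
      using lt[OF e(1)] lt[OF e(2)] by (simp_all add: idx_def)
    then show False using eq e(3) by (simp add: prod_eq_iff)
  qed
  then consider "idx e < idx e'" | "idx e' < idx e" by linarith
  then show "{bit_address e..<bit_address e + n} \<inter> {bit_address e'..<bit_address e' + n} = {}"
    using next_block[of "idx e" "idx e'"] next_block[of "idx e'" "idx e"] by cases (auto simp: addr)
qed

text \<open>The empty cut and the whole vertex set are consistent with all edges of \<open>G\<close>
  and differ, so there are at least two cuts, whereas a partition of size zero would leave only
  one.\<close>

lemma path_partition_nonempty:
  fixes G :: "nat pair_pre_digraph"
  assumes G: "pair_graph G" and S: "path_partition G S" and V: "pverts G \<noteq> {}"
  shows "1 \<le> card S"
proof (rule ccontr)
  let ?V = "pverts G"
  define F where "F = (\<Union>p\<in>S. path_edges p)"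
  interpret pair_graph G by (rule G)
  assume "\<not> 1 \<le> card S"
  then have "card F = card ?V" and "forest_cuts ?V F" using path_partition_forest[OF G S] by (simp_all add: F_def)
  then have c: "card (cuts ?V F) = 1" by (simp add: forest_cuts_def)
  have "F \<subseteq> edges G" using path_partition_forest(1)[OF G S] by (simp add: F_def)
  then have "{} \<in> cuts ?V F" "?V \<in> cuts ?V F"
    using in_arcsD1 in_arcsD2 by (auto simp: cuts_def consistent_def edges_def)
  then have "card {{}, ?V} \<le> card (cuts ?V F)" using c by (intro card_mono) (auto intro: card_ge_0_finite)
  then show False using c V by simp
qed

lemma path_partition_singletons:
  fixes G :: "nat pair_pre_digraph"
  assumes G: "pair_graph G"
  shows "\<exists>S. path_partition G S \<and> card S = card (pverts G)"
proof -
  interpret pair_graph G by (rule G)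
  have "forest_cuts (pverts G) {}" by (simp add: forest_cuts_def cuts_empty card_Pow)
  then show ?thesis using forest_path_partition[OF G, of "{}"] by (force simp: degree_in_def)
qed

text \<open>For \<open>k \<le> 0\<close> the answer is no, since a nonempty graph needs a path; for
  \<open>k\<close> at least \<open>n\<close> it is yes, by single-vertex paths; only the range
  between needs random bits. As the width is a natural number \<open>t\<close>, some bag has
  \<open>t + 1\<close> vertices, which gives \<open>1 \<le> n\<close>.\<close>

lemma solver_correct:
  fixes G T :: "nat pair_pre_digraph" and X :: "nat \<Rightarrow> nat set" and k :: int
  assumes G: "pair_graph G" "pverts G = {..<n}" and td: "tree_decomposition G T X" and T: "pverts T = {..<m}"
    and w: "width T X = int t" and N: "N = n + m + 4"
  defines "yes \<equiv> \<exists>S. path_partition G S \<and> int (card S) \<le> k"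
  shows "1 \<le> n" and "\<exists>\<mu>. halts solver (\<lambda>_. 0) (memory (encode_instance G T X k))
      (N ^ 12 * prog_time (N ^ 4) (18 ^ Suc t) parse + 1 +
       (N ^ 12 * (24 * (n * n * n) + 1) + 1 + N ^ 12 * prog_time (N ^ 4) (18 ^ Suc t) solve)) \<mu> \<and>
      (\<not> yes \<longrightarrow> True \<notin> set_pmf (map_pmf (\<lambda>(R, H). R 0 \<noteq> 0) \<mu>)) \<and>
      (yes \<longrightarrow> measure_pmf.prob (map_pmf (\<lambda>(R, H). R 0 \<noteq> 0) \<mu>) {False} \<le> 1 / 2)"
proof -
  have tree: "pair_graph T" "Digraph_Component.connected (with_proj T)"
    using td by (auto simp: tree_decomposition_def undirected_tree_def)
  have ne: "pverts T \<noteq> {}" using tree(2) by (auto simp: connected_def strongly_connected_def)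
  then have m: "1 \<le> m" using T by (cases m) auto
  have Max: "Max ((\<lambda>x. card (X x)) ` pverts T) = Suc t" using w by (simp add: width_def)
  have bag: "card (X x) \<le> Suc t" if "x < m" for x
    unfolding Max[symmetric] using that T by (intro Max_ge) auto
  have tn: "Suc t \<le> n"
  proof -
    have "Max ((\<lambda>x. card (X x)) ` pverts T) \<in> (\<lambda>x. card (X x)) ` pverts T" using ne T by (intro Max_in) auto
    then obtain x where x: "x \<in> pverts T" "card (X x) = Suc t" unfolding Max by auto
    then have "X x \<subseteq> {..<n}" using td G(2) by (auto simp: tree_decomposition_def)
    then show ?thesis using card_mono[of "{..<n}" "X x"] x by simp
  qed
  then show n: "1 \<le> n" by simp
  define Q l W E where "Q = N ^ 3 * 8 ^ n" and "l = N ^ 12" and "W = N ^ 4" and "E = (18::nat) ^ Suc t"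
  note sb = segment_bounds[OF N Q_def, of l]
  have l12: "N ^ 12 \<le> l" by (simp add: l_def)
  have N6: "6 \<le> N" using N n m by simp
  have l1: "1 \<le> l" using N6 by (simp add: l_def)
  have Q_less: "2 * Q < 2 ^ l" using sb(6)[OF l12, of 0] by simp
  have bnd: "bounds n l W"
  proof
    show "1 \<le> n" by (rule n)
    have "N ^ 1 \<le> N ^ 4" using N6 by (intro power_increasing) auto
    then show "n \<le> W" using N by (simp add: W_def)
    show "18 ^ n < (2::nat) ^ l"
    proof (rule exponent_less_power2[of _ "5 * n" N])
      have "(18::nat) ^ n \<le> 32 ^ n" by (intro power_mono) auto
      then show "(18::nat) ^ n \<le> 2 ^ (5 * n)" by (simp add: power_mult)
      have "5 * n \<le> N * N" using N6 N by (intro mult_le_mono) auto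
      also have "\<dots> = N ^ 2" by (simp add: power2_eq_square)
      also have "\<dots> \<le> N ^ 11" using N6 by (intro power_increasing) auto
      finally show "5 * n \<le> N ^ 11" .
    qed (use N6 l12 in auto)
  qed
  have W_less: "W < 2 ^ l"
  proof -
    have "N ^ 4 \<le> N ^ 12" using N6 by (intro power_increasing) auto
    then have "W \<le> l" unfolding W_def l_def .
    then have "(2::nat) ^ W \<le> 2 ^ l" by (intro power_increasing) simp_all
    then show ?thesis using less_exp[of W] by linarith
  qed
  have E_less: "E < 2 ^ l"
  proof (rule bounds.below[OF bnd])
    show "E \<le> 18 ^ n" unfolding E_def using tn by (intro power_increasing) auto
  qed
  define H where "H = memory (encode_instance G T X k)"
  define KO where "KO = 2 + n * n + m * m + m * n"
  define K where "K = nat \<bar>k\<bar>"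
  have cards: "card (pverts G) = n" "card (pverts T) = m" using G T by simp_all
  note mem = memory_encode_instance[OF cards, where X = X and k = k, folded H_def KO_def K_def]
  have H_less: "H a < 2 ^ l" for a using mem(8)[of a] N sb(5)[OF l12, of 0] Q_less by simp
  have KOQ: "KO + n + 2 \<le> Q" using sb(1)[OF l12, of 0] by (simp add: KO_def)
  have n3: "n * n * n \<le> Q" using sb(2)[OF l12, of 0] by simp
  have parse: "wp l W E parse (\<lambda>_. 0) H (\<lambda>R' H'. H' = H \<and> R' 41 = n * n * n \<and> R' 42 = Q \<and> parsed n m Q (take_bit n K) R')"
  proof (rule bounds.wp_parse[OF bnd N Q_def l12])
    show "H (2 + n * n + m * m + m * n + 1 + i) - 1 = of_bool (bit K i)" if "i < n" for i
    proof -
      have "\<not> bit K i" if "K < 2 ^ i" using that by (simp add: bit_iff_odd)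
      then show ?thesis using mem(7)[of i] by (simp add: KO_def)
    qed
  qed (use mem(1,2) in simp_all)
  define J where "J = {Q..<Q + n * n * n}"
  define acc where "acc \<beta> \<longleftrightarrow> 0 \<le> k \<and> (n \<le> K \<or> 1 \<le> K \<and> extraction.accepts n K (edges G) (dp_instance.bit_address n Q) \<beta>)" for \<beta>
  have inst: "dp_instance n l W E m G T X K N Q" if "1 \<le> K" "K < n"
  proof (rule dp_instance.intro[OF bnd dp_instance_axioms.intro])
    show "18 ^ card (X x) \<le> E" if "x < m" for x
      unfolding E_def using bag[OF that] by (intro power_increasing) auto
  qed (rule G td T m that N Q_def l12 eq_imp_le[OF W_def[symmetric]])+
  have solve: "wp l W E solve R (overwrite J \<beta> H) (\<lambda>R' H'. R' 0 \<noteq> 0 \<longleftrightarrow> acc \<beta>)" if R: "parsed n m Q (take_bit n K) R" for R \<beta>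
  proof -
    define H' where "H' = overwrite J \<beta> H"
    have low: "H' a = H a" if "a < Q" for a using that by (simp add: H'_def overwrite_def J_def)
    have r: "R 0 = 0" "R (Suc 0) = n" "R 6 = take_bit n K" "R 49 = KO" using R by (simp_all add: parsed_def KO_def)
    have sign: "H' KO = of_bool (k < 0)" using low[of KO] KOQ mem(6) by simp
    have last: "H' (Suc (KO + n)) = (if K < 2 ^ n then 0 else 1 + of_bool (bit K n))"
      using low[of "Suc (KO + n)"] KOQ mem(7)[of n] by simp
    have small_K: "take_bit n K = K" if "K < 2 ^ n" using that by (simp add: take_bit_nat_eq_self)
    have n2: "n < 2 ^ n" by (rule less_exp)
    have large_K: "n \<le> K" if "\<not> K < 2 ^ n" using that n2 by linarith
    have large: "H' (Suc (KO + n)) + (Suc 0 - (n - take_bit n K)) \<noteq> 0 \<longleftrightarrow> n \<le> K"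
      using last small_K large_K by (cases "K < 2 ^ n") auto
    have one: "1 < (2::nat) ^ l" using bounds.small[OF bnd, of 1] by simp
    consider "k < 0" | "0 \<le> k" "n \<le> K" | "0 \<le> k" "K < n" "K = 0" | "0 \<le> k" "K < n" "1 \<le> K" by linarith
    then have "wp l W E solve R H' (\<lambda>R' H'. R' 0 \<noteq> 0 \<longleftrightarrow> acc \<beta>)"
    proof cases
      case 1
      then show ?thesis using sign by (simp add: solve_def r acc_def)
    next
      case 2
      then show ?thesis using sign large one by (simp add: solve_def r acc_def)
    next
      case 3
      then show ?thesis using sign large by (simp add: solve_def r acc_def)
    next
      case 4
      have K2: "K < 2 ^ n" using 4(2) n2 by linarith
      note I = inst[OF 4(3,2)]
      have "dp_instance.setting n m K Q R"
        using R small_K[OF K2] by (simp add: dp_instance.setting_def[OF I] parsed_def)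
      moreover have "dp_instance.input n m G T X \<beta> Q H'"
        unfolding dp_instance.input_def[OF I]
      proof (intro conjI allI impI)
        show "H' (2 + u * n + v) = of_bool ((u, v) \<in> parcs G)" if "u < n" "v < n" for u v
          using mem(3)[OF that] pair_index_less[OF that] KOQ by (subst low) (simp_all add: KO_def)
        show "H' (2 + n * n + x * m + y) = of_bool ((x, y) \<in> parcs T)" if "x < m" "y < m" for x y
          using mem(4)[OF that] pair_index_less[OF that] KOQ by (subst low) (simp_all add: KO_def)
        show "H' (2 + n * n + m * m + x * n + v) = of_bool (v \<in> X x)" if "x < m" "v < n" for x v
          using mem(5)[OF that] pair_index_less[OF that] KOQ by (subst low) (simp_all add: KO_def)
        show "H' (Q + i) = of_bool (\<beta> (Q + i))" if "i < n * n * n" for i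
          using that by (simp add: H'_def overwrite_def J_def)
      qed
      \<comment> \<open>Because of \<open>K < 2 ^ n\<close>, the binary digits of the integer end
        inside the first segment, so everything behind the random bits is zero. An arbitrarily long
        integer would spoil the working area; such integers have been answered before.\<close>
      moreover have "H' a = 0" if "2 * Q \<le> a" for a
      proof -
        have "H' a = H a" using that n3 by (simp add: H'_def overwrite_def J_def)
        moreover have "KO + 1 \<le> a" using that KOQ by simp
        then obtain i where a: "a = KO + 1 + i" using le_Suc_ex by blast
        moreover have "n \<le> i" using a that KOQ by simp
        then have "K < 2 ^ i" by (intro less_le_trans[OF K2 power_increasing]) auto
        ultimately show ?thesis using mem(7)[of i] a by simp
      qed
      ultimately have "wp l W E decide R H' (\<lambda>R' H'. R' 0 \<noteq> 0 \<longleftrightarrow> extraction.accepts n K (edges G) (dp_instance.bit_address n Q) \<beta>)"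
        by (rule dp_instance.wp_decide[OF I])
      then show ?thesis using 4 sign large small_K[OF K2] by (simp add: solve_def r acc_def)
    qed
    then show ?thesis by (simp add: H'_def)
  qed
  have sc: "Q + n * n * n < 2 ^ l" using n3 Q_less by simp
  obtain \<mu> where hl: "halts solver (\<lambda>_. 0) H (l * prog_time W E parse + 1 + (l * (24 * (n * n * n) + 1) + 1 + l * prog_time W E solve)) \<mu>"
    and ans: "map_pmf (\<lambda>(R, H). R 0 \<noteq> 0) \<mu> = map_pmf acc (coin_flips J)"
    using halts_solver[OF l1 W_less E_less H_less parse sc, where acc = acc] solve unfolding J_def by blast
  have pos: "1 \<le> card S" if "path_partition G S" for S
  proof (rule path_partition_nonempty[OF G(1) that])
    show "pverts G \<noteq> {}" unfolding G(2) lessThan_empty_iff using n by simp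
  qed
  have "(\<not> yes \<longrightarrow> True \<notin> set_pmf (map_pmf acc (coin_flips J))) \<and>
      (yes \<longrightarrow> measure_pmf.prob (map_pmf acc (coin_flips J)) {False} \<le> 1 / 2)"
  proof -
    consider "k \<le> 0" | "0 < k" "n \<le> K" | "0 < k" "K < n" by linarith
    then show ?thesis
    proof cases
      case 1
      then have "\<not> acc \<beta>" for \<beta> using n by (auto simp: acc_def K_def)
      moreover have "\<not> yes"
      proof
        assume yes
        then obtain S where "path_partition G S" "int (card S) \<le> k" unfolding yes_def by blast
        with pos[of S] 1 show False by linarith
      qed
      ultimately show ?thesis by auto
    next
      case 2
      then have "acc = (\<lambda>_. True)" by (auto simp: acc_def fun_eq_iff)
      moreover have yes
      proof -
        obtain S where "path_partition G S" "card S = n" using path_partition_singletons[OF G(1)] unfolding cards by blast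
        moreover have "int n \<le> k" using 2 unfolding K_def by linarith
        ultimately show ?thesis unfolding yes_def by blast
      qed
      ultimately show ?thesis by simp
    next
      case 3
      then have K: "1 \<le> K" "K < n" by (simp_all add: K_def)
      note I = inst[OF K]
      let ?a = "dp_instance.bit_address n Q"
      interpret ex: extraction n K "edges G" ?a by (rule dp_instance.extraction_edges[OF I])
      have acc: "acc = ex.accepts" using 3 K by (auto simp: acc_def fun_eq_iff)
      have "int c \<le> k \<longleftrightarrow> c \<le> K" for c using 3(1) unfolding K_def by linarith
      then have "yes \<longleftrightarrow> (\<exists>S. path_partition G S \<and> card S \<le> K)" unfolding yes_def by simp
      also have "\<dots> \<longleftrightarrow> ex.forests \<noteq> {}"
        unfolding forests_iff_path_partition[OF G K] by (auto simp: ex.forests_def)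
      finally have yes: "yes \<longleftrightarrow> ex.forests \<noteq> {}" .
      have "True \<notin> set_pmf (map_pmf acc (coin_flips J))" if "\<not> yes"
        using that ex.accepts_imp_forest unfolding yes acc by auto
      moreover have "measure_pmf.prob (map_pmf acc (coin_flips J)) {False} \<le> 1 / 2" if yes
      proof -
        have "measure_pmf.prob (coin_flips J) {\<beta>. \<not> ex.accepts \<beta>} \<le> 1 / 2"
          by (rule ex.prob_not_accepts_le) (use that yes dp_instance.bit_blocks[OF I] in \<open>auto simp: J_def\<close>)
        then show ?thesis by (simp add: acc vimage_def)
      qed
      ultimately show ?thesis by blast
    qed
  qed
  then show "\<exists>\<mu>. halts solver (\<lambda>_. 0) (memory (encode_instance G T X k))
      (N ^ 12 * prog_time (N ^ 4) (18 ^ Suc t) parse + 1 +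
       (N ^ 12 * (24 * (n * n * n) + 1) + 1 + N ^ 12 * prog_time (N ^ 4) (18 ^ Suc t) solve)) \<mu> \<and>
      (\<not> yes \<longrightarrow> True \<notin> set_pmf (map_pmf (\<lambda>(R, H). R 0 \<noteq> 0) \<mu>)) \<and>
      (yes \<longrightarrow> measure_pmf.prob (map_pmf (\<lambda>(R, H). R 0 \<noteq> 0) \<mu>) {False} \<le> 1 / 2)"
    using hl unfolding ans[symmetric] H_def l_def W_def E_def by (intro exI[of _ \<mu>] conjI) blast+
qed

text \<open>\<open>parse\<close> contains no table loop and \<open>solve\<close> has depth one, so
  \<open>18 ^ Suc t\<close> enters linearly; one factor 18 goes into the constant and
  \<open>18 ^ t\<close> is at most \<open>25 ^ t\<close>. The 27 collects the coin flips and the two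
  sequencing steps.\<close>

lemma solver_time:
  "\<exists>\<kappa> q. \<forall>n m t N. N = n + m + 4 \<longrightarrow>
     N ^ 12 * prog_time (N ^ 4) (18 ^ Suc t) parse + 1 +
       (N ^ 12 * (24 * (n * n * n) + 1) + 1 + N ^ 12 * prog_time (N ^ 4) (18 ^ Suc t) solve) \<le> \<kappa> * N ^ q * 25 ^ t"
proof -
  obtain k1 p1 where 1: "\<forall>W\<ge>1. \<forall>E\<ge>1. prog_time W E parse \<le> k1 * W ^ p1 * E ^ 0"
    using prog_time_le[of parse] unfolding table_loop_depth_parse by blast
  obtain k2 p2 where 2: "\<forall>W\<ge>1. \<forall>E\<ge>1. prog_time W E solve \<le> k2 * W ^ p2 * E ^ 1"
    using prog_time_le[of solve] unfolding table_loop_depth_solve by blast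
  define q where "q = 15 + 4 * p1 + 4 * p2"
  have "N ^ 12 * prog_time (N ^ 4) (18 ^ Suc t) parse + 1 +
       (N ^ 12 * (24 * (n * n * n) + 1) + 1 + N ^ 12 * prog_time (N ^ 4) (18 ^ Suc t) solve) \<le> (k1 + 18 * k2 + 27) * N ^ q * 25 ^ t"
    if N: "N = n + m + 4" for n m t N
  proof -
    define M where "M = N ^ q * 25 ^ t"
    have N1: "1 \<le> N" using N by simp
    have M: "N ^ i * y \<le> M" if "i \<le> q" "y \<le> 25 ^ t" for i y
      unfolding M_def using that N1 by (intro mult_le_mono power_increasing) auto
    have W1: "1 \<le> N ^ 4" using N1 by simp
    have "prog_time (N ^ 4) (18 ^ Suc t) parse \<le> k1 * (N ^ 4) ^ p1"
      using 1[rule_format, OF W1, of "18 ^ Suc t"] by simp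
    then have "N ^ 12 * prog_time (N ^ 4) (18 ^ Suc t) parse \<le> N ^ 12 * (k1 * (N ^ 4) ^ p1)" by (rule mult_le_mono2)
    also have "\<dots> = k1 * (N ^ (12 + 4 * p1) * 1)" by (simp add: power_add power_mult)
    also have "\<dots> \<le> k1 * M" by (intro mult_le_mono2 M) (simp_all add: q_def)
    finally have a: "N ^ 12 * prog_time (N ^ 4) (18 ^ Suc t) parse \<le> k1 * M" .
    have "prog_time (N ^ 4) (18 ^ Suc t) solve \<le> k2 * (N ^ 4) ^ p2 * 18 ^ Suc t"
      using 2[rule_format, OF W1, of "18 ^ Suc t"] by simp
    then have "N ^ 12 * prog_time (N ^ 4) (18 ^ Suc t) solve \<le> N ^ 12 * (k2 * (N ^ 4) ^ p2 * 18 ^ Suc t)" by (rule mult_le_mono2)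
    also have "\<dots> = 18 * k2 * (N ^ (12 + 4 * p2) * 18 ^ t)" by (simp add: power_add power_mult)
    also have "\<dots> \<le> 18 * k2 * M" by (intro mult_le_mono2 M power_mono) (simp_all add: q_def)
    finally have b: "N ^ 12 * prog_time (N ^ 4) (18 ^ Suc t) solve \<le> 18 * k2 * M" .
    have "n * n * n \<le> N * N * N" unfolding N by (intro mult_le_mono) auto
    then have "24 * (n * n * n) + 1 \<le> 25 * N ^ 3" using one_le_power[OF N1, of 3] unfolding power3_eq_cube by linarith
    then have "N ^ 12 * (24 * (n * n * n) + 1) \<le> N ^ 12 * (25 * N ^ 3)" by (rule mult_le_mono2)
    also have "\<dots> = 25 * (N ^ 15 * 1)" by (simp add: power_add[symmetric])
    also have "\<dots> \<le> 25 * M" by (intro mult_le_mono2 M) (simp_all add: q_def)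
    finally have c: "N ^ 12 * (24 * (n * n * n) + 1) \<le> 25 * M" .
    have "1 \<le> M" using M[of 0 1] by simp
    with a b c have "N ^ 12 * prog_time (N ^ 4) (18 ^ Suc t) parse + 1 +
       (N ^ 12 * (24 * (n * n * n) + 1) + 1 + N ^ 12 * prog_time (N ^ 4) (18 ^ Suc t) solve)
       \<le> k1 * M + 18 * k2 * M + 27 * M" by linarith
    also have "\<dots> = (k1 + 18 * k2 + 27) * N ^ q * 25 ^ t" by (simp add: M_def algebra_simps)
    finally show ?thesis .
  qed
  then show ?thesis by blast
qed

text \<open>The input contains the matrices of the decomposition, so a time polynomial in the number
  of vertices presupposes polynomially many nodes. The number \<open>a\<close> describes this
  polynomial, and the same program serves for every \<open>a\<close>.\<close>

theorem theorem3:
  shows "\<exists>P :: com. \<forall>a :: nat. \<exists>C d :: nat.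
    \<forall>(G :: nat pair_pre_digraph) (T :: nat pair_pre_digraph) (X :: nat \<Rightarrow> nat set) (t :: nat) (k :: int).
      pair_graph G \<and> pverts G = {..<card (pverts G)} \<and>
      tree_decomposition G T X \<and> pverts T = {..<card (pverts T)} \<and>
      width T X = int t \<and>
      card (pverts T) \<le> a * card (pverts G) ^ a
      \<longrightarrow>
      (let xs = encode_instance G T X k;
           B = C * 25 ^ t * card (pverts G) ^ d;
           yes = (\<exists>S. path_partition G S \<and> int (card S) \<le> k)
       in runs_in_time P xs B \<and>
          (\<not> yes \<longrightarrow> True \<notin> set_pmf (answer P xs B)) \<and>
          (yes \<longrightarrow> measure_pmf.prob (answer P xs B) {False} \<le> 1 / 2))"
proof -
  obtain \<kappa> q where time: "\<forall>n m t N. N = n + m + 4 \<longrightarrow>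
     N ^ 12 * prog_time (N ^ 4) (18 ^ Suc t) parse + 1 +
       (N ^ 12 * (24 * (n * n * n) + 1) + 1 + N ^ 12 * prog_time (N ^ 4) (18 ^ Suc t) solve) \<le> \<kappa> * N ^ q * 25 ^ t"
    using solver_time by blast
  show ?thesis
  proof (intro exI[of _ solver] allI)
    fix a :: nat
    show "\<exists>C d. \<forall>(G :: nat pair_pre_digraph) (T :: nat pair_pre_digraph) (X :: nat \<Rightarrow> nat set) (t :: nat) (k :: int).
      pair_graph G \<and> pverts G = {..<card (pverts G)} \<and>
      tree_decomposition G T X \<and> pverts T = {..<card (pverts T)} \<and>
      width T X = int t \<and> card (pverts T) \<le> a * card (pverts G) ^ a \<longrightarrow>
      (let xs = encode_instance G T X k;
           B = C * 25 ^ t * card (pverts G) ^ d;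
           yes = (\<exists>S. path_partition G S \<and> int (card S) \<le> k)
       in runs_in_time solver xs B \<and>
          (\<not> yes \<longrightarrow> True \<notin> set_pmf (answer solver xs B)) \<and>
          (yes \<longrightarrow> measure_pmf.prob (answer solver xs B) {False} \<le> 1 / 2))"
    \<comment> \<open>Both witnesses come from \<open>n + m + 4 \<le> (a + 5) * n ^ (a + 1)\<close>,
      which holds for \<open>m \<le> a * n ^ a\<close> and \<open>1 \<le> n\<close>, raised to the
      power \<open>q\<close>.\<close>
    proof (rule exI[of _ "\<kappa> * (a + 5) ^ q"], rule exI[of _ "(a + 1) * q"], intro allI impI, elim conjE)
      fix G T :: "nat pair_pre_digraph" and X :: "nat \<Rightarrow> nat set" and t :: nat and k :: int
      define n m where "n = card (pverts G)" and "m = card (pverts T)"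
      assume G: "pair_graph G" "pverts G = {..<card (pverts G)}" and td: "tree_decomposition G T X"
        and T: "pverts T = {..<card (pverts T)}" and w: "width T X = int t" and a: "card (pverts T) \<le> a * card (pverts G) ^ a"
      note inst = G(1) G(2)[folded n_def] td T[folded m_def] w refl
      note n1 = solver_correct(1)[OF inst] and sc = solver_correct(2)[OF inst, where k = k]
      let ?xs = "encode_instance G T X k" and ?B = "\<kappa> * (a + 5) ^ q * 25 ^ t * n ^ ((a + 1) * q)"
      let ?yes = "\<exists>S. path_partition G S \<and> int (card S) \<le> k"
      obtain \<mu> where h: "halts solver (\<lambda>_. 0) (memory ?xs) ((n + m + 4) ^ 12 * prog_time ((n + m + 4) ^ 4) (18 ^ Suc t) parse + 1 +
          ((n + m + 4) ^ 12 * (24 * (n * n * n) + 1) + 1 + (n + m + 4) ^ 12 * prog_time ((n + m + 4) ^ 4) (18 ^ Suc t) solve)) \<mu>"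
        and no: "\<not> ?yes \<longrightarrow> True \<notin> set_pmf (map_pmf (\<lambda>(R, H). R 0 \<noteq> 0) \<mu>)"
        and yes: "?yes \<longrightarrow> measure_pmf.prob (map_pmf (\<lambda>(R, H). R 0 \<noteq> 0) \<mu>) {False} \<le> 1 / 2"
        using sc by (elim exE conjE)
      have "n + m + 4 \<le> (a + 5) * n ^ (a + 1)"
      proof -
        have "n \<le> n ^ (a + 1)" using power_increasing[of 1 "a + 1" n] n1 by simp
        moreover have "a * n ^ a \<le> a * n ^ (a + 1)" using n1 by (intro mult_le_mono2 power_increasing) auto
        moreover have "1 \<le> n ^ (a + 1)" using n1 by (rule one_le_power)
        ultimately have "n + m + 4 \<le> n ^ (a + 1) + a * n ^ (a + 1) + 4 * n ^ (a + 1)"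
          using a unfolding n_def[symmetric] m_def[symmetric] by linarith
        then show ?thesis by (simp add: algebra_simps)
      qed
      then have "(n + m + 4) ^ q \<le> ((a + 5) * n ^ (a + 1)) ^ q" by (intro power_mono) auto
      then have "\<kappa> * (n + m + 4) ^ q * 25 ^ t \<le> \<kappa> * ((a + 5) * n ^ (a + 1)) ^ q * 25 ^ t" by (intro mult_le_mono) auto
      also have "\<dots> = ?B" by (simp only: power_mult_distrib power_mult[symmetric] mult_ac)
      finally have "\<kappa> * (n + m + 4) ^ q * 25 ^ t \<le> ?B" .
      from halts_mono[OF h order_trans[OF time[rule_format, OF refl] this]]
      have "halts solver (\<lambda>_. 0) (\<lambda>i. if i < length ?xs then ?xs ! i else 0) ?B \<mu>" unfolding memory_def .
      note run = halts_runs_in_time[OF this]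
      show "let xs = encode_instance G T X k; B = \<kappa> * (a + 5) ^ q * 25 ^ t * card (pverts G) ^ ((a + 1) * q);
           yes = (\<exists>S. path_partition G S \<and> int (card S) \<le> k)
       in runs_in_time solver xs B \<and> (\<not> yes \<longrightarrow> True \<notin> set_pmf (answer solver xs B)) \<and>
          (yes \<longrightarrow> measure_pmf.prob (answer solver xs B) {False} \<le> 1 / 2)"
        unfolding Let_def n_def[symmetric] run(2) using run(1) no yes by blast
    qed
  qed
qed

end
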